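(* Let $X$ be a proper, irreducible, non-singular algebraic curve over a perfect field $\Bbbk$ which is algebraically closed in the function field of $X$. For every closed point $x\in X$ let $S_x,T_x\in \mathrm{Gl}(K_x)$ be such that $S:=\prod_x S_x$ and $T:=\prod_x T_x$ belong to $\mathrm{Gl}^0(\mathbb{A}_X)$, and assume $ST=TS$. Then $\langle S_x,T_x\rangle=1$ for almost all $x\in X$ (all but finitely many), and $$\langle S,T\rangle=\prod_{x\in X}(-1)^{w_x(S)w_x(T)}\langle S_x,T_x\rangle ,$$ where $w_x(S)$ and $w_x(T)$ denote the winding numbers of $S_x$ and $T_x$ with respect to $(K_x,A_x)$.
   Context: For a closed point $x\in X$: $A_x=\widehat{\mathcal{O}}_{X,x}$, $K_x=\mathrm{Frac}(A_x)$; $\mathbb{A}_X=\prod'_{x}K_x$ is the restricted product with respect to the $A_x$, and $\mathbb{A}_X^+=\prod_x A_x$. All are regarded as $\Bbbk$-vector spaces. Central extension attached to a pair $(V,V^+)$ ($V$ a $\Bbbk$-vector space, $V^+\subset V$ a subspace; used for $(\mathbb{A}_X,\mathbb{A}_X^+)$ and for each $(K_x,A_x)$): subspaces $A,B\subset V$ are commensurable, $A\sim B$, if $\dim_\Bbbk (A+B)/(A\cap B)<\infty$. For $A,B\sim V^+$ let $(A|B)$ be the line $\mathrm{Hom}_\Bbbk(\wedge^{\mathrm{top}}(B/M),\wedge^{\mathrm{top}}(A/M))$, where $M\subseteq A\cap B$ is any subspace with $M\sim V^+$; for $M'\subseteq M$ the two lines are identified by sending $\varphi$ to the map $m\wedge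 b\mapsto m\wedge\varphi(b)$, $m\in\wedge^{\mathrm{top}}(M/M')$, so $(A|B)$ is canonically independent of $M$. Composition gives $(A|B)\times(B|C)\to(A|C)$. Let $\mathrm{Gl}(V)$ be the group of $\Bbbk$-linear automorphisms $S$ of $V$ with $S(V^+)\sim V^+$ and $S^{-1}(V^+)\sim V^+$. Each such $S$ induces $S_*:(A|B)\to(SA|SB)$ by transport of structure. The winding number of $S$ is $w(S)=\dim_\Bbbk V^+/(V^+\cap S(V^+))-\dim_\Bbbk S(V^+)/(V^+\cap S(V^+))$, and $\mathrm{Gl}^0(V)=\{S: w(S)=0\}$. The group $\widetilde{\mathrm{Gl}(V)}$ consists of pairs $(\sigma,S)$ with $S\in\mathrm{Gl}(V)$ and $0\ne\sigma\in(V^+|S(V^+))$, with law $(\sigma,S)(\tau,T)=(\sigma\circ S_*\tau,\,ST)$; it is a central extension of $\mathrm{Gl}(V)$ by $\Bbbk^*$. For commuting $S,T\in\mathrm{Gl}(V)$ the commutator is $\langle S,T\rangle=\tilde S\tilde T\tilde S^{-1}\tilde T^{-1}\in\Bbbk^*$, for any preimages $\tilde S,\tilde T$ of $S,T$. In the claim, $\langle S,T\rangle$ is computed for $(\mathbb{A}_X,\mathbb{A}_X^+)$ and $\langle S_x,T_x\rangle$ for $(K_x,A_x)$. *)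

theory Defs
  imports
    "HOL-Algebra.Algebra"
    "HOL-Analysis.Abstract_Topology"
    "Jordan_Normal_Form.Missing_VectorSpace"
begin

section \<open>Rings and fields\<close>

text \<open>Perfect: characteristic \<open>0\<close>, or characteristic \<open>p > 0\<close> with surjective Frobenius.\<close>
definition perfect_field :: "'k ring \<Rightarrow> bool" where
  "perfect_field K \<longleftrightarrow> field K \<and>
     (\<forall>p::nat. Factorial_Ring.prime p \<and> [p] \<cdot>\<^bsub>K\<^esub> \<one>\<^bsub>K\<^esub> = \<zero>\<^bsub>K\<^esub> \<longrightarrow>
        (\<forall>a\<in>carrier K. \<exists>b\<in>carrier K. b [^]\<^bsub>K\<^esub> p = a))"

definition local_ring :: "'a ring \<Rightarrow> bool" where
  "local_ring R \<longleftrightarrow> cring R \<and> (\<exists>!m. maximalideal m R)"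

definition max_ideal :: "'a ring \<Rightarrow> 'a set" where
  "max_ideal R = (THE m. maximalideal m R)"

text \<open>The longest strictly increasing chains \<open>Z\<^sub>0 \<subset> \<dots> \<subset> Z\<^sub>n\<close> in \<open>C\<close> have length \<open>n\<close>.
  With \<open>C\<close> the prime ideals of a ring, or the irreducible closed subsets of a space, this says
  that the Krull dimension is \<open>n\<close>.\<close>
definition chain_dim :: "'s set set \<Rightarrow> nat \<Rightarrow> bool" where
  "chain_dim C n \<longleftrightarrow>
     (\<exists>Z. (\<forall>i\<le>n. Z i \<in> C) \<and> (\<forall>i<n. Z i \<subset> Z (Suc i))) \<and>
     \<not> (\<exists>Z. (\<forall>i\<le>Suc n. Z i \<in> C) \<and> (\<forall>i<Suc n. Z i \<subset> Z (Suc i)))"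

definition regular_local_ring :: "'a ring \<Rightarrow> bool" where
  "regular_local_ring R \<longleftrightarrow> local_ring R \<and> noetherian_ring R \<and>
     (\<exists>n. chain_dim {P. primeideal P R} n \<and>
        (\<exists>G\<subseteq>carrier R. finite G \<and> card G \<le> n \<and> Idl\<^bsub>R\<^esub> G = max_ideal R))"

text \<open>\<open>h\<close> exhibits \<open>R'\<close> as the localization \<open>R\<^sub>f\<close>.\<close>
definition is_localization_away :: "'a ring \<Rightarrow> 'a \<Rightarrow> 'b ring \<Rightarrow> ('a \<Rightarrow> 'b) \<Rightarrow> bool" where
  "is_localization_away R f R' h \<longleftrightarrow> h \<in> ring_hom R R' \<and> h f \<in> Units R' \<and>
     (\<forall>y\<in>carrier R'. \<exists>a\<in>carrier R. \<exists>n::nat. y \<otimes>\<^bsub>R'\<^esub> h f [^]\<^bsub>R'\<^esub> n = h a) \<and>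
     (\<forall>a\<in>carrier R. h a = \<zero>\<^bsub>R'\<^esub> \<longrightarrow> (\<exists>n::nat. f [^]\<^bsub>R\<^esub> n \<otimes>\<^bsub>R\<^esub> a = \<zero>\<^bsub>R\<^esub>))"

text \<open>The topological space \<open>Spec R\<close>.\<close>
definition zariski :: "'a ring \<Rightarrow> 'a set topology" where
  "zariski R = topology_generated_by {{P. primeideal P R \<and> f \<notin> P} |f. f \<in> carrier R}"

text \<open>The completion \<open>lim R/m\<^sup>n\<close> of a local ring. Compatibility of a sequence of cosets with
  the projections \<open>R/m\<^sup>n\<^sup>+\<^sup>1 \<rightarrow> R/m\<^sup>n\<close> is inclusion of cosets. The powers of \<open>m\<close> are
  taken in the multiplicative monoid of ideals, \<^const>\<open>ideals_set\<close>.\<close>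
definition max_power :: "'a ring \<Rightarrow> nat \<Rightarrow> 'a set" where
  "max_power R n = max_ideal R [^]\<^bsub>ideals_set R\<^esub> n"

definition completion :: "'a ring \<Rightarrow> (nat \<Rightarrow> 'a set) ring" where
  "completion R =
    \<lparr>carrier = {a. \<forall>n. a n \<in> carrier (R Quot max_power R n) \<and> a (Suc n) \<subseteq> a n},
     monoid.mult = \<lambda>a b n. a n \<otimes>\<^bsub>R Quot max_power R n\<^esub> b n,
     one = \<lambda>n. \<one>\<^bsub>R Quot max_power R n\<^esub>,
     ring.zero = \<lambda>n. \<zero>\<^bsub>R Quot max_power R n\<^esub>,
     add = \<lambda>a b n. a n \<oplus>\<^bsub>R Quot max_power R n\<^esub> b n\<rparr>"

definition to_completion :: "'a ring \<Rightarrow> 'a \<Rightarrow> nat \<Rightarrow> 'a set" where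
  "to_completion R a = (\<lambda>n. max_power R n +>\<^bsub>R\<^esub> a)"

text \<open>The total ring of fractions; for an integral domain, the non-zero-divisors are the
  non-zero elements and this is the field of fractions. It is used below for the completions of
  regular local rings, which are integral domains.\<close>
definition regular_elems :: "'a ring \<Rightarrow> 'a set" where
  "regular_elems R = {s \<in> carrier R. \<forall>a\<in>carrier R. a \<otimes>\<^bsub>R\<^esub> s = \<zero>\<^bsub>R\<^esub> \<longrightarrow> a = \<zero>\<^bsub>R\<^esub>}"

definition fraction :: "'a ring \<Rightarrow> 'a \<Rightarrow> 'a \<Rightarrow> ('a \<times> 'a) set" where
  "fraction R a s =
     {(b, t). b \<in> carrier R \<and> t \<in> regular_elems R \<and> a \<otimes>\<^bsub>R\<^esub> t = b \<otimes>\<^bsub>R\<^esub> s}"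

definition Frac :: "'a ring \<Rightarrow> ('a \<times> 'a) set ring" where
  "Frac R =
    \<lparr>carrier = {fraction R a s |a s. a \<in> carrier R \<and> s \<in> regular_elems R},
     monoid.mult = \<lambda>x y. the_elem {fraction R (a \<otimes>\<^bsub>R\<^esub> b) (s \<otimes>\<^bsub>R\<^esub> t) |a s b t. (a, s) \<in> x \<and> (b, t) \<in> y},
     one = fraction R \<one>\<^bsub>R\<^esub> \<one>\<^bsub>R\<^esub>,
     ring.zero = fraction R \<zero>\<^bsub>R\<^esub> \<one>\<^bsub>R\<^esub>,
     add = \<lambda>x y. the_elem {fraction R (a \<otimes>\<^bsub>R\<^esub> t \<oplus>\<^bsub>R\<^esub> b \<otimes>\<^bsub>R\<^esub> s) (s \<otimes>\<^bsub>R\<^esub> t) |a s b t.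
                             (a, s) \<in> x \<and> (b, t) \<in> y}\<rparr>"


section \<open>Schemes over a field\<close>

text \<open>A space \<open>spc\<close> with a presheaf of rings and a ring homomorphism \<open>str\<close> from the base
  field to the global sections; for schemes, \<open>str\<close> amounts to a morphism to \<open>Spec K\<close>.\<close>
record ('k, 'p, 'a) rspace =
  spc :: "'p topology"
  sect :: "'p set \<Rightarrow> 'a ring"
  restr :: "'p set \<Rightarrow> 'p set \<Rightarrow> 'a \<Rightarrow> 'a"
  str :: "'k \<Rightarrow> 'a"

abbreviation pts :: "('k, 'p, 'a) rspace \<Rightarrow> 'p set" where
  "pts C \<equiv> topspace (spc C)"

definition str_on :: "('k, 'p, 'a) rspace \<Rightarrow> 'p set \<Rightarrow> 'k \<Rightarrow> 'a" where
  "str_on C U c = restr C (pts C) U (str C c)"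

definition germ :: "('k, 'p, 'a) rspace \<Rightarrow> 'p \<Rightarrow> 'p set \<Rightarrow> 'a \<Rightarrow> ('p set \<times> 'a) set" where
  "germ C x U s = {(V, t). openin (spc C) V \<and> x \<in> V \<and> t \<in> carrier (sect C V) \<and>
     (\<exists>W. openin (spc C) W \<and> x \<in> W \<and> W \<subseteq> U \<inter> V \<and> restr C U W s = restr C V W t)}"

definition stalk :: "('k, 'p, 'a) rspace \<Rightarrow> 'p \<Rightarrow> ('p set \<times> 'a) set ring" where
  "stalk C x =
    \<lparr>carrier = {germ C x U s |U s. openin (spc C) U \<and> x \<in> U \<and> s \<in> carrier (sect C U)},
     monoid.mult = \<lambda>g h. the_elem {germ C x (U \<inter> V)
        (restr C U (U \<inter> V) s \<otimes>\<^bsub>sect C (U \<inter> V)\<^esub> restr C V (U \<inter> V) t) |U s V t. (U, s) \<in> g \<and> (V, t) \<in> h},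
     one = germ C x (pts C) \<one>\<^bsub>sect C (pts C)\<^esub>,
     ring.zero = germ C x (pts C) \<zero>\<^bsub>sect C (pts C)\<^esub>,
     add = \<lambda>g h. the_elem {germ C x (U \<inter> V)
        (restr C U (U \<inter> V) s \<oplus>\<^bsub>sect C (U \<inter> V)\<^esub> restr C V (U \<inter> V) t) |U s V t. (U, s) \<in> g \<and> (V, t) \<in> h}\<rparr>"

text \<open>\<open>(U, O\<^sub>U) \<cong> Spec O(U)\<close>: a homeomorphism under which the restriction maps from \<open>O(U)\<close> to
  the sections over the basic open sets \<open>D(f)\<close> are the localizations \<open>O(U) \<rightarrow> O(U)\<^sub>f\<close>,
  that is, the structure sheaves agree on a basis.\<close>
definition affine_open :: "('k, 'p, 'a) rspace \<Rightarrow> 'p set \<Rightarrow> bool" where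
  "affine_open C U \<longleftrightarrow> openin (spc C) U \<and>
     (\<exists>\<phi>. homeomorphic_map (subtopology (spc C) U) (zariski (sect C U)) \<phi> \<and>
        (\<forall>f\<in>carrier (sect C U).
           is_localization_away (sect C U) f (sect C {x \<in> U. f \<notin> \<phi> x}) (restr C U {x \<in> U. f \<notin> \<phi> x})))"

locale ringed_space_over =
  fixes K :: "'k ring" and C :: "('k, 'p, 'a) rspace"
  assumes sect_cring: "openin (spc C) U \<Longrightarrow> cring (sect C U)"
    and restr_hom: "openin (spc C) U \<Longrightarrow> openin (spc C) V \<Longrightarrow> V \<subseteq> U \<Longrightarrow>
      restr C U V \<in> ring_hom (sect C U) (sect C V)"
    and restr_id: "openin (spc C) U \<Longrightarrow> s \<in> carrier (sect C U) \<Longrightarrow> restr C U U s = s"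
    and restr_restr: "openin (spc C) U \<Longrightarrow> openin (spc C) V \<Longrightarrow> openin (spc C) W \<Longrightarrow>
      W \<subseteq> V \<Longrightarrow> V \<subseteq> U \<Longrightarrow> s \<in> carrier (sect C U) \<Longrightarrow>
      restr C V W (restr C U V s) = restr C U W s"
    and locality: "(\<And>V. V \<in> \<U> \<Longrightarrow> openin (spc C) V) \<Longrightarrow>
      s \<in> carrier (sect C (\<Union>\<U>)) \<Longrightarrow> t \<in> carrier (sect C (\<Union>\<U>)) \<Longrightarrow>
      (\<And>V. V \<in> \<U> \<Longrightarrow> restr C (\<Union>\<U>) V s = restr C (\<Union>\<U>) V t) \<Longrightarrow> s = t"
    and gluing: "(\<And>V. V \<in> \<U> \<Longrightarrow> openin (spc C) V) \<Longrightarrow>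
      (\<And>V. V \<in> \<U> \<Longrightarrow> \<sigma> V \<in> carrier (sect C V)) \<Longrightarrow>
      (\<And>V W. V \<in> \<U> \<Longrightarrow> W \<in> \<U> \<Longrightarrow> restr C V (V \<inter> W) (\<sigma> V) = restr C W (V \<inter> W) (\<sigma> W)) \<Longrightarrow>
      \<exists>s\<in>carrier (sect C (\<Union>\<U>)). \<forall>V\<in>\<U>. restr C (\<Union>\<U>) V s = \<sigma> V"
    and str_hom: "str C \<in> ring_hom K (sect C (pts C))"

locale scheme_over = ringed_space_over +
  assumes stalk_local: "x \<in> pts C \<Longrightarrow> local_ring (stalk C x)"
    and affine_cover: "x \<in> pts C \<Longrightarrow> \<exists>U. affine_open C U \<and> x \<in> U"

abbreviation preimg :: "('k, 'p, 'a) rspace \<Rightarrow> ('p \<Rightarrow> 'q) \<Rightarrow> 'q set \<Rightarrow> 'p set" where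
  "preimg C f V \<equiv> {x \<in> pts C. f x \<in> V}"

text \<open>\<open>(f, h)\<close> is a morphism \<open>C \<rightarrow> Y\<close> of locally ringed spaces over \<open>K\<close>, where \<open>h V\<close> maps
  \<open>O\<^sub>Y(V)\<close> to \<open>O\<^sub>C(f\<^sup>-\<^sup>1 V)\<close>.\<close>
definition morphism_over ::
  "'k ring \<Rightarrow> ('k, 'p, 'a) rspace \<Rightarrow> ('k, 'q, 'b) rspace \<Rightarrow> ('p \<Rightarrow> 'q) \<Rightarrow> ('q set \<Rightarrow> 'b \<Rightarrow> 'a) \<Rightarrow> bool"
where
  "morphism_over K C Y f h \<longleftrightarrow> continuous_map (spc C) (spc Y) f \<and>
     (\<forall>V. openin (spc Y) V \<longrightarrow> h V \<in> ring_hom (sect Y V) (sect C (preimg C f V))) \<and>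
     (\<forall>V V' t. openin (spc Y) V \<and> openin (spc Y) V' \<and> V' \<subseteq> V \<and> t \<in> carrier (sect Y V) \<longrightarrow>
        h V' (restr Y V V' t) = restr C (preimg C f V) (preimg C f V') (h V t)) \<and>
     (\<forall>c\<in>carrier K. h (pts Y) (str Y c) = str C c) \<and>
     (\<forall>x\<in>pts C. \<forall>V t. openin (spc Y) V \<and> f x \<in> V \<and> t \<in> carrier (sect Y V) \<and>
        germ C x (preimg C f V) (h V t) \<in> Units (stalk C x) \<longrightarrow> germ Y (f x) V t \<in> Units (stalk Y (f x)))"

definition closed_immersion ::
  "('k, 'p, 'a) rspace \<Rightarrow> ('k, 'q, 'b) rspace \<Rightarrow> ('p \<Rightarrow> 'q) \<Rightarrow> ('q set \<Rightarrow> 'b \<Rightarrow> 'a) \<Rightarrow> bool"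
where
  "closed_immersion C Y f h \<longleftrightarrow>
     embedding_map (spc C) (spc Y) f \<and> closedin (spc Y) (f ` pts C) \<and>
     (\<forall>x\<in>pts C. \<forall>g\<in>carrier (stalk C x). \<exists>V t. openin (spc Y) V \<and> f x \<in> V \<and>
        t \<in> carrier (sect Y V) \<and> g = germ C x (preimg C f V) (h V t))"

text \<open>For commutative algebras \<open>A\<close>, \<open>B\<close> over the field \<open>K\<close> (with structure map \<open>i\<close> of \<open>A\<close>),
  the map \<open>A \<otimes>\<^sub>K B \<rightarrow> C\<close> induced by \<open>\<alpha>\<close> and \<open>\<beta>\<close> is bijective. For injectivity, recall that
  every element of \<open>A \<otimes>\<^sub>K B\<close> is of the form \<open>\<Sum> a\<^sub>i \<otimes> b\<^sub>i\<close> with linearly independent \<open>a\<^sub>i\<close>, and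
  is zero iff all \<open>b\<^sub>i\<close> are.\<close>
definition is_tensor_product ::
  "'k ring \<Rightarrow> ('k \<Rightarrow> 'a) \<Rightarrow> 'a ring \<Rightarrow> 'b ring \<Rightarrow> 'c ring \<Rightarrow> ('a \<Rightarrow> 'c) \<Rightarrow> ('b \<Rightarrow> 'c) \<Rightarrow> bool"
where
  "is_tensor_product K i A B C \<alpha> \<beta> \<longleftrightarrow>
     (\<forall>y\<in>carrier C. \<exists>n::nat. \<exists>a\<in>{..<n} \<rightarrow> carrier A. \<exists>b\<in>{..<n} \<rightarrow> carrier B.
        y = (\<Oplus>\<^bsub>C\<^esub>j\<in>{..<n}. \<alpha> (a j) \<otimes>\<^bsub>C\<^esub> \<beta> (b j))) \<and>
     (\<forall>n::nat. \<forall>a\<in>{..<n} \<rightarrow> carrier A. \<forall>b\<in>{..<n} \<rightarrow> carrier B.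
        (\<forall>c\<in>{..<n} \<rightarrow> carrier K. (\<Oplus>\<^bsub>A\<^esub>j\<in>{..<n}. i (c j) \<otimes>\<^bsub>A\<^esub> a j) = \<zero>\<^bsub>A\<^esub> \<longrightarrow> (\<forall>j<n. c j = \<zero>\<^bsub>K\<^esub>)) \<and>
        (\<Oplus>\<^bsub>C\<^esub>j\<in>{..<n}. \<alpha> (a j) \<otimes>\<^bsub>C\<^esub> \<beta> (b j)) = \<zero>\<^bsub>C\<^esub> \<longrightarrow> (\<forall>j<n. b j = \<zero>\<^bsub>B\<^esub>))"

text \<open>\<open>P\<close> with the projections \<open>(p, p')\<close>, \<open>(q, q')\<close> is the fibre product of \<open>C\<close> and \<open>Y\<close> over
  \<open>Spec K\<close>: it is covered by the affine pieces \<open>Spec (O(U) \<otimes>\<^sub>K O(V))\<close>.\<close>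
definition fibre_product_over where
  "fibre_product_over K C Y P p p' q q' \<longleftrightarrow> scheme_over K P \<and>
     morphism_over K P C p p' \<and> morphism_over K P Y q q' \<and>
     (\<forall>U V. affine_open C U \<and> affine_open Y V \<longrightarrow>
        (let W = preimg P p U \<inter> preimg P q V in
           affine_open P W \<and>
           is_tensor_product K (str_on C U) (sect C U) (sect Y V) (sect P W)
             (\<lambda>a. restr P (preimg P p U) W (p' U a)) (\<lambda>b. restr P (preimg P q V) W (q' V b))))"

definition finite_type_over :: "'k ring \<Rightarrow> ('k, 'p, 'a) rspace \<Rightarrow> bool" where
  "finite_type_over K C \<longleftrightarrow> (\<exists>\<U>. finite \<U> \<and> \<Union>\<U> = pts C \<and>
     (\<forall>U\<in>\<U>. affine_open C U \<and> (\<exists>G\<subseteq>carrier (sect C U). finite G \<and>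
        generate_ring (sect C U) (str_on C U ` carrier K \<union> G) = carrier (sect C U))))"

text \<open>The test objects in the next two definitions have points and sections in
  \<open>nat \<Rightarrow> 'a\<close>. If \<open>C\<close> is a nonempty scheme of finite type over \<open>K\<close>, then \<open>K\<close> embeds into \<open>'a\<close>, so
  this type is large enough to contain a copy of every scheme of finite type over \<open>K\<close>, in
  particular of \<open>C \<times> C\<close>, of the affine spaces \<open>\<bbbA>\<^sup>n\<close> and of \<open>C \<times> \<bbbA>\<^sup>n\<close>; base change to the
  affine spaces suffices to test universal closedness.\<close>
definition separated_over :: "'k ring \<Rightarrow> ('k, 'p, 'a) rspace \<Rightarrow> bool" where
  "separated_over K C \<longleftrightarrow>
     (\<forall>(P :: ('k, nat \<Rightarrow> 'a, nat \<Rightarrow> 'a) rspace) p p' q q' d d'.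
        fibre_product_over K C C P p p' q q' \<and> morphism_over K C P d d' \<and>
        (\<forall>x\<in>pts C. p (d x) = x \<and> q (d x) = x) \<and>
        (\<forall>U s. openin (spc C) U \<and> s \<in> carrier (sect C U) \<longrightarrow>
           d' (preimg P p U) (p' U s) = s \<and> d' (preimg P q U) (q' U s) = s) \<longrightarrow>
        closed_immersion C P d d')"

definition universally_closed_over :: "'k ring \<Rightarrow> ('k, 'p, 'a) rspace \<Rightarrow> bool" where
  "universally_closed_over K C \<longleftrightarrow>
     (\<forall>(Y :: ('k, nat \<Rightarrow> 'a, nat \<Rightarrow> 'a) rspace) (P :: ('k, nat \<Rightarrow> 'a, nat \<Rightarrow> 'a) rspace) p p' q q'.
        scheme_over K Y \<and> fibre_product_over K C Y P p p' q q' \<longrightarrow> closed_map (spc P) (spc Y) q)"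

definition proper_over :: "'k ring \<Rightarrow> ('k, 'p, 'a) rspace \<Rightarrow> bool" where
  "proper_over K C \<longleftrightarrow> finite_type_over K C \<and> separated_over K C \<and> universally_closed_over K C"

definition irreducible_in :: "'p topology \<Rightarrow> 'p set \<Rightarrow> bool" where
  "irreducible_in T Z \<longleftrightarrow> Z \<subseteq> topspace T \<and> Z \<noteq> {} \<and>
     (\<forall>C D. closedin T C \<and> closedin T D \<and> Z \<subseteq> C \<union> D \<longrightarrow> Z \<subseteq> C \<or> Z \<subseteq> D)"

definition closed_points :: "('k, 'p, 'a) rspace \<Rightarrow> 'p set" where
  "closed_points C = {x \<in> pts C. closedin (spc C) {x}}"

definition generic_point :: "('k, 'p, 'a) rspace \<Rightarrow> 'p" where
  "generic_point C = (THE x. x \<in> pts C \<and> spc C closure_of {x} = pts C)"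

definition function_field :: "('k, 'p, 'a) rspace \<Rightarrow> ('p set \<times> 'a) set ring" where
  "function_field C = stalk C (generic_point C)"

definition str_germ :: "('k, 'p, 'a) rspace \<Rightarrow> 'p \<Rightarrow> 'k \<Rightarrow> ('p set \<times> 'a) set" where
  "str_germ C x c = germ C x (pts C) (str C c)"

definition alg_closed_in_function_field :: "'k ring \<Rightarrow> ('k, 'p, 'a) rspace \<Rightarrow> bool" where
  "alg_closed_in_function_field K C \<longleftrightarrow>
     (let F = function_field C; k = str_germ C (generic_point C) ` carrier K in
        \<forall>f\<in>carrier F. (ring.algebraic F over k) f \<longrightarrow> f \<in> k)"

text \<open>A proper, irreducible, non-singular algebraic curve over \<open>K\<close>.\<close>
definition proper_nonsingular_curve :: "'k ring \<Rightarrow> ('k, 'p, 'a) rspace \<Rightarrow> bool" where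
  "proper_nonsingular_curve K C \<longleftrightarrow> scheme_over K C \<and> proper_over K C \<and>
     irreducible_in (spc C) (pts C) \<and>
     chain_dim {Z. closedin (spc C) Z \<and> irreducible_in (spc C) Z} 1 \<and>
     (\<forall>x\<in>pts C. regular_local_ring (stalk C x))"


section \<open>The completions at closed points and the adeles\<close>

type_synonym ('p, 'a) complete_stalk_elem = "nat \<Rightarrow> ('p set \<times> 'a) set set"
type_synonym ('p, 'a) local_field_elem =
  "(('p, 'a) complete_stalk_elem \<times> ('p, 'a) complete_stalk_elem) set"

type_synonym ('p, 'a) local_maps = "'p \<Rightarrow> ('p, 'a) local_field_elem \<Rightarrow> ('p, 'a) local_field_elem"

definition complete_stalk :: "('k, 'p, 'a) rspace \<Rightarrow> 'p \<Rightarrow> ('p, 'a) complete_stalk_elem ring" where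
  "complete_stalk C x = completion (stalk C x)"

text \<open>\<open>K\<^sub>x\<close> as a vector space over the base field, and \<open>A\<^sub>x\<close> as a subset of it.\<close>
definition local_field :: "('k, 'p, 'a) rspace \<Rightarrow> 'p \<Rightarrow> ('k, ('p, 'a) local_field_elem) module" where
  "local_field C x = (let A = complete_stalk C x; L = Frac A in
    \<lparr>carrier = carrier L, monoid.mult = monoid.mult L, one = one L, ring.zero = ring.zero L, add = add L,
     smult = \<lambda>c f. fraction A (to_completion (stalk C x) (str_germ C x c)) \<one>\<^bsub>A\<^esub> \<otimes>\<^bsub>L\<^esub> f\<rparr>)"

definition local_ints :: "('k, 'p, 'a) rspace \<Rightarrow> 'p \<Rightarrow> ('p, 'a) local_field_elem set" where
  "local_ints C x = (let A = complete_stalk C x in (\<lambda>a. fraction A a \<one>\<^bsub>A\<^esub>) ` carrier A)"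

definition restricted_product ::
  "'i set \<Rightarrow> ('i \<Rightarrow> ('k, 'v) module) \<Rightarrow> ('i \<Rightarrow> 'v set) \<Rightarrow> ('k, 'i \<Rightarrow> 'v) module"
where
  "restricted_product I V A =
    \<lparr>carrier = {f \<in> (\<Pi>\<^sub>E i\<in>I. carrier (V i)). finite {i \<in> I. f i \<notin> A i}},
     monoid.mult = \<lambda>f g. \<lambda>i\<in>I. f i \<otimes>\<^bsub>V i\<^esub> g i,
     one = \<lambda>i\<in>I. \<one>\<^bsub>V i\<^esub>,
     ring.zero = \<lambda>i\<in>I. \<zero>\<^bsub>V i\<^esub>,
     add = \<lambda>f g. \<lambda>i\<in>I. f i \<oplus>\<^bsub>V i\<^esub> g i,
     smult = \<lambda>c f. \<lambda>i\<in>I. c \<odot>\<^bsub>V i\<^esub> f i\<rparr>"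

definition adeles :: "('k, 'p, 'a) rspace \<Rightarrow> ('k, 'p \<Rightarrow> ('p, 'a) local_field_elem) module" where
  "adeles C = restricted_product (closed_points C) (local_field C) (local_ints C)"

definition integral_adeles :: "('k, 'p, 'a) rspace \<Rightarrow> ('p \<Rightarrow> ('p, 'a) local_field_elem) set" where
  "integral_adeles C = (\<Pi>\<^sub>E x\<in>closed_points C. local_ints C x)"

text \<open>The map \<open>\<Prod>\<^sub>x S\<^sub>x\<close> on adeles, made extensional as required by \<^const>\<open>Bij\<close> below.\<close>
definition adelic_prod ::
  "('k, 'p, 'a) rspace \<Rightarrow> ('p, 'a) local_maps \<Rightarrow>
    ('p \<Rightarrow> ('p, 'a) local_field_elem) \<Rightarrow> ('p \<Rightarrow> ('p, 'a) local_field_elem)"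
where
  "adelic_prod C S = (\<lambda>f\<in>carrier (adeles C). \<lambda>x\<in>closed_points C. S x (f x))"


section \<open>Quotients and exterior powers\<close>

text \<open>The fields \<open>mult\<close> and \<open>one\<close> of a module record are irrelevant.\<close>
definition quot_mod :: "('k, 'v) module \<Rightarrow> 'v set \<Rightarrow> ('k, 'v set) module" where
  "quot_mod V N =
    \<lparr>carrier = a_rcosets\<^bsub>V\<^esub> N, monoid.mult = \<lambda>_ _. N, one = N, ring.zero = N,
     add = \<lambda>Y Z. Y <+>\<^bsub>V\<^esub> Z,
     smult = \<lambda>c Y. N <+>\<^bsub>V\<^esub> ((\<lambda>y. c \<odot>\<^bsub>V\<^esub> y) ` Y)\<rparr>"

text \<open>The quotient \<open>B/M\<close> of subspaces \<open>M \<subseteq> B\<close> of \<open>V\<close>, and its dimension.\<close>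
definition subquot :: "('k, 'v) module \<Rightarrow> 'v set \<Rightarrow> 'v set \<Rightarrow> ('k, 'v set) module" where
  "subquot V B M = quot_mod (V\<lparr>carrier := B\<rparr>) M"

definition qdim :: "'k ring \<Rightarrow> ('k, 'v) module \<Rightarrow> 'v set \<Rightarrow> 'v set \<Rightarrow> nat" where
  "qdim K V B M = vectorspace.dim K (subquot V B M)"

definition tuples :: "('k, 'w) module \<Rightarrow> nat \<Rightarrow> 'w list set" where
  "tuples W n = {ws. length ws = n \<and> set ws \<subseteq> carrier W}"

text \<open>The \<open>n\<close>-th exterior power of \<open>W\<close>: the free vector space on the \<open>n\<close>-tuples of vectors,
  modulo the relations making \<open>(w\<^sub>1, \<dots>, w\<^sub>n) \<mapsto> w\<^sub>1 \<and> \<dots> \<and> w\<^sub>n\<close> multilinear and alternating.\<close>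
definition free_on :: "'k ring \<Rightarrow> 'x set \<Rightarrow> ('k, 'x \<Rightarrow> 'k) module" where
  "free_on K I = (ring.func_space K I)\<lparr>carrier := {f \<in> I \<rightarrow>\<^sub>E carrier K. finite {x \<in> I. f x \<noteq> \<zero>\<^bsub>K\<^esub>}}\<rparr>"

definition free_gen :: "'k ring \<Rightarrow> 'x set \<Rightarrow> 'x \<Rightarrow> 'x \<Rightarrow> 'k" where
  "free_gen K I x = (\<lambda>y\<in>I. if y = x then \<one>\<^bsub>K\<^esub> else \<zero>\<^bsub>K\<^esub>)"

definition ext_relations :: "'k ring \<Rightarrow> ('k, 'w) module \<Rightarrow> nat \<Rightarrow> ('w list \<Rightarrow> 'k) set" where
  "ext_relations K W n =
    (let F = free_on K (tuples W n); e = free_gen K (tuples W n) in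
      {e (us @ (v \<oplus>\<^bsub>W\<^esub> w) # zs) \<ominus>\<^bsub>F\<^esub> (e (us @ v # zs) \<oplus>\<^bsub>F\<^esub> e (us @ w # zs)) |us v w zs.
         us @ v # zs \<in> tuples W n \<and> w \<in> carrier W} \<union>
      {e (us @ (c \<odot>\<^bsub>W\<^esub> v) # zs) \<ominus>\<^bsub>F\<^esub> c \<odot>\<^bsub>F\<^esub> e (us @ v # zs) |us c v zs.
         us @ v # zs \<in> tuples W n \<and> c \<in> carrier K} \<union>
      {e (us @ v # vs @ v # zs) |us v vs zs. us @ v # vs @ v # zs \<in> tuples W n})"

definition ext_null :: "'k ring \<Rightarrow> ('k, 'w) module \<Rightarrow> nat \<Rightarrow> ('w list \<Rightarrow> 'k) set" where
  "ext_null K W n = LinearCombinations.module.span K (free_on K (tuples W n)) (ext_relations K W n)"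

definition ext_power :: "'k ring \<Rightarrow> ('k, 'w) module \<Rightarrow> nat \<Rightarrow> ('k, ('w list \<Rightarrow> 'k) set) module" where
  "ext_power K W n = quot_mod (free_on K (tuples W n)) (ext_null K W n)"

definition wedge :: "'k ring \<Rightarrow> ('k, 'w) module \<Rightarrow> 'w list \<Rightarrow> ('w list \<Rightarrow> 'k) set" where
  "wedge K W ws = (let n = length ws in
     ext_null K W n +>\<^bsub>free_on K (tuples W n)\<^esub> free_gen K (tuples W n) ws)"

type_synonym ('k, 'v) det_elem = "('v set list \<Rightarrow> 'k) set"

text \<open>The line \<open>\<and>\<^sup>t\<^sup>o\<^sup>p(B/M)\<close>, and its element \<open>b\<^sub>1 \<and> \<dots> \<and> b\<^sub>n\<close> for \<open>b\<^sub>1, \<dots>, b\<^sub>n \<in> B\<close>, \<open>n = dim B/M\<close>.\<close>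
definition det_line ::
  "'k ring \<Rightarrow> ('k, 'v) module \<Rightarrow> 'v set \<Rightarrow> 'v set \<Rightarrow> ('k, ('k, 'v) det_elem) module" where
  "det_line K V B M = ext_power K (subquot V B M) (qdim K V B M)"

definition det_wedge ::
  "'k ring \<Rightarrow> ('k, 'v) module \<Rightarrow> 'v set \<Rightarrow> 'v set \<Rightarrow> 'v list \<Rightarrow> ('k, 'v) det_elem" where
  "det_wedge K V B M bs = wedge K (subquot V B M) (map (\<lambda>b. M +>\<^bsub>V\<^esub> b) bs)"

definition frames :: "'k ring \<Rightarrow> ('k, 'v) module \<Rightarrow> 'v set \<Rightarrow> 'v set \<Rightarrow> 'v list set" where
  "frames K V B M = {bs. length bs = qdim K V B M \<and> set bs \<subseteq> B}"


section \<open>The central extension attached to a pair \<open>(V, V\<^sup>+)\<close>\<close>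

definition commensurable :: "'k ring \<Rightarrow> ('k, 'v) module \<Rightarrow> 'v set \<Rightarrow> 'v set \<Rightarrow> bool" where
  "commensurable K V A B \<longleftrightarrow> vectorspace.fin_dim K (subquot V (A <+>\<^bsub>V\<^esub> B) (A \<inter> B))"

text \<open>The subspaces \<open>M \<subseteq> A \<inter> B\<close> with \<open>M \<sim> V\<^sup>+\<close>.\<close>
definition minorants ::
  "'k ring \<Rightarrow> ('k, 'v) module \<Rightarrow> 'v set \<Rightarrow> 'v set \<Rightarrow> 'v set \<Rightarrow> 'v set set" where
  "minorants K V Vp A B =
     {M. VectorSpace.subspace K M V \<and> M \<subseteq> A \<inter> B \<and> commensurable K V M Vp}"

text \<open>An element of \<open>(A|B)\<close> is a family of linear maps
  \<open>\<phi>\<^sub>M : \<and>\<^sup>t\<^sup>o\<^sup>p(B/M) \<rightarrow> \<and>\<^sup>t\<^sup>o\<^sup>p(A/M)\<close>, one for each admissible \<open>M\<close>, corresponding to each other under the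
  canonical identifications \<open>\<phi>\<^sub>M\<^sub>' (m \<and> b) = m \<and> \<phi>\<^sub>M(b)\<close> for \<open>M' \<subseteq> M\<close>. These are stated for
  decomposable \<open>m = m\<^sub>1 \<and> \<dots> \<and> m\<^sub>r\<close>, \<open>b = b\<^sub>1 \<and> \<dots> \<and> b\<^sub>s\<close>, writing
  \<open>\<phi>\<^sub>M(b) = c \<cdot> a\<^sub>1 \<and> \<dots> \<and> a\<^sub>t\<close>: every element of a top exterior power has this form.\<close>
type_synonym ('k, 'v) line_elem = "'v set \<Rightarrow> ('k, 'v) det_elem \<Rightarrow> ('k, 'v) det_elem"

definition rel_line ::
  "'k ring \<Rightarrow> ('k, 'v) module \<Rightarrow> 'v set \<Rightarrow> 'v set \<Rightarrow> 'v set \<Rightarrow> ('k, 'v) line_elem set" where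
  "rel_line K V Vp A B =
    {\<phi> \<in> (\<Pi>\<^sub>E M\<in>minorants K V Vp A B.
            module_hom K (det_line K V B M) (det_line K V A M) \<inter> extensional (carrier (det_line K V B M))).
     \<forall>M\<in>minorants K V Vp A B. \<forall>M'\<in>minorants K V Vp A B. M' \<subseteq> M \<longrightarrow>
       (\<forall>ms\<in>frames K V M M'. \<forall>bs\<in>frames K V B M. \<forall>as\<in>frames K V A M. \<forall>c\<in>carrier K.
          \<phi> M (det_wedge K V B M bs) = c \<odot>\<^bsub>det_line K V A M\<^esub> det_wedge K V A M as \<longrightarrow>
          \<phi> M' (det_wedge K V B M' (ms @ bs)) = c \<odot>\<^bsub>det_line K V A M'\<^esub> det_wedge K V A M' (ms @ as))}"

definition line_zero ::
  "'k ring \<Rightarrow> ('k, 'v) module \<Rightarrow> 'v set \<Rightarrow> 'v set \<Rightarrow> 'v set \<Rightarrow> ('k, 'v) line_elem" where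
  "line_zero K V Vp A B =
     (\<lambda>M\<in>minorants K V Vp A B. \<lambda>\<xi>\<in>carrier (det_line K V B M). \<zero>\<^bsub>det_line K V A M\<^esub>)"

text \<open>The scalar \<open>c\<close> as an element of \<open>(A|A) = K\<close>.\<close>
definition line_scalar ::
  "'k ring \<Rightarrow> ('k, 'v) module \<Rightarrow> 'v set \<Rightarrow> 'v set \<Rightarrow> 'k \<Rightarrow> ('k, 'v) line_elem" where
  "line_scalar K V Vp A c =
     (\<lambda>M\<in>minorants K V Vp A A. \<lambda>\<xi>\<in>carrier (det_line K V A M). c \<odot>\<^bsub>det_line K V A M\<^esub> \<xi>)"

text \<open>Composition \<open>(A|B) \<times> (B|C) \<rightarrow> (A|C)\<close>, computed with any \<open>M \<subseteq> A \<inter> B \<inter> C\<close>.\<close>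
definition line_comp ::
  "'k ring \<Rightarrow> ('k, 'v) module \<Rightarrow> 'v set \<Rightarrow> 'v set \<Rightarrow> 'v set \<Rightarrow> 'v set \<Rightarrow>
    ('k, 'v) line_elem \<Rightarrow> ('k, 'v) line_elem \<Rightarrow> ('k, 'v) line_elem" where
  "line_comp K V Vp A B C \<phi> \<psi> =
     (THE \<chi>. \<chi> \<in> rel_line K V Vp A C \<and>
        (\<forall>M \<in> minorants K V Vp A B \<inter> minorants K V Vp B C.
           \<chi> M = compose (carrier (det_line K V C M)) (\<phi> M) (\<psi> M)))"

text \<open>Transport of structure \<open>S\<^sub>* : (A|B) \<rightarrow> (SA|SB)\<close>: if \<open>\<phi>\<^sub>M\<close> sends \<open>b\<^sub>1 \<and> \<dots> \<and> b\<^sub>s\<close> to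
  \<open>c \<cdot> a\<^sub>1 \<and> \<dots> \<and> a\<^sub>t\<close>, then \<open>(S\<^sub>* \<phi>)\<^sub>S\<^sub>M\<close> sends \<open>S b\<^sub>1 \<and> \<dots> \<and> S b\<^sub>s\<close> to \<open>c \<cdot> S a\<^sub>1 \<and> \<dots> \<and> S a\<^sub>t\<close>.\<close>
definition line_push ::
  "'k ring \<Rightarrow> ('k, 'v) module \<Rightarrow> 'v set \<Rightarrow> ('v \<Rightarrow> 'v) \<Rightarrow> 'v set \<Rightarrow> 'v set \<Rightarrow>
    ('k, 'v) line_elem \<Rightarrow> ('k, 'v) line_elem" where
  "line_push K V Vp S A B \<phi> =
     (THE \<psi>. \<psi> \<in> rel_line K V Vp (S ` A) (S ` B) \<and>
        (\<forall>M \<in> minorants K V Vp A B. \<forall>bs\<in>frames K V B M. \<forall>as\<in>frames K V A M. \<forall>c\<in>carrier K.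
           \<phi> M (det_wedge K V B M bs) = c \<odot>\<^bsub>det_line K V A M\<^esub> det_wedge K V A M as \<longrightarrow>
           \<psi> (S ` M) (det_wedge K V (S ` B) (S ` M) (map S bs)) =
             c \<odot>\<^bsub>det_line K V (S ` A) (S ` M)\<^esub> det_wedge K V (S ` A) (S ` M) (map S as)))"

text \<open>The group \<open>Gl(V)\<close>, a subgroup of \<^const>\<open>BijGroup\<close>; in particular its elements are
  extensional functions.\<close>
definition Gl :: "'k ring \<Rightarrow> ('k, 'v) module \<Rightarrow> 'v set \<Rightarrow> ('v \<Rightarrow> 'v) monoid" where
  "Gl K V Vp = (BijGroup (carrier V))
     \<lparr>carrier := {S \<in> Bij (carrier V). S \<in> module_hom K V V \<and>
        commensurable K V (S ` Vp) Vp \<and> commensurable K V (inv_into (carrier V) S ` Vp) Vp}\<rparr>"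

definition winding :: "'k ring \<Rightarrow> ('k, 'v) module \<Rightarrow> 'v set \<Rightarrow> ('v \<Rightarrow> 'v) \<Rightarrow> int" where
  "winding K V Vp S = int (qdim K V Vp (Vp \<inter> S ` Vp)) - int (qdim K V (S ` Vp) (Vp \<inter> S ` Vp))"

definition Gl0 :: "'k ring \<Rightarrow> ('k, 'v) module \<Rightarrow> 'v set \<Rightarrow> ('v \<Rightarrow> 'v) set" where
  "Gl0 K V Vp = {S \<in> carrier (Gl K V Vp). winding K V Vp S = 0}"

definition Gl_ext :: "'k ring \<Rightarrow> ('k, 'v) module \<Rightarrow> 'v set \<Rightarrow> (('k, 'v) line_elem \<times> ('v \<Rightarrow> 'v)) monoid" where
  "Gl_ext K V Vp =
    \<lparr>carrier = {(\<sigma>, S). S \<in> carrier (Gl K V Vp) \<and> \<sigma> \<in> rel_line K V Vp Vp (S ` Vp) \<and>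
                        \<sigma> \<noteq> line_zero K V Vp Vp (S ` Vp)},
     monoid.mult = \<lambda>(\<sigma>, S) (\<tau>, T).
       (line_comp K V Vp Vp (S ` Vp) (S ` T ` Vp) \<sigma> (line_push K V Vp S Vp (T ` Vp) \<tau>),
        S \<otimes>\<^bsub>Gl K V Vp\<^esub> T),
     one = (line_scalar K V Vp Vp \<one>\<^bsub>K\<^esub>, \<one>\<^bsub>Gl K V Vp\<^esub>)\<rparr>"

text \<open>The commutator \<open>\<langle>S, T\<rangle>\<close> of commuting \<open>S\<close>, \<open>T\<close>, where \<open>c \<in> K\<^sup>*\<close> is identified with
  \<open>(c, 1)\<close> in the central extension.\<close>
definition commutator_symbol :: "'k ring \<Rightarrow> ('k, 'v) module \<Rightarrow> 'v set \<Rightarrow> ('v \<Rightarrow> 'v) \<Rightarrow> ('v \<Rightarrow> 'v) \<Rightarrow> 'k" where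
  "commutator_symbol K V Vp S T =
     (THE c. c \<in> carrier K - {\<zero>\<^bsub>K\<^esub>} \<and>
        (\<forall>a\<in>carrier (Gl_ext K V Vp). \<forall>b\<in>carrier (Gl_ext K V Vp). snd a = S \<and> snd b = T \<longrightarrow>
           a \<otimes>\<^bsub>Gl_ext K V Vp\<^esub> b \<otimes>\<^bsub>Gl_ext K V Vp\<^esub> inv\<^bsub>Gl_ext K V Vp\<^esub> a \<otimes>\<^bsub>Gl_ext K V Vp\<^esub> inv\<^bsub>Gl_ext K V Vp\<^esub> b =
             (line_scalar K V Vp Vp c, \<one>\<^bsub>Gl K V Vp\<^esub>)))"


section \<open>Local data of a family of automorphisms of the local fields\<close>

definition local_winding :: "'k ring \<Rightarrow> ('k, 'p, 'a) rspace \<Rightarrow> ('p, 'a) local_maps \<Rightarrow> 'p \<Rightarrow> int" where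
  "local_winding K C S x = winding K (local_field C x) (local_ints C x) (S x)"

definition local_symbol ::
  "'k ring \<Rightarrow> ('k, 'p, 'a) rspace \<Rightarrow> ('p, 'a) local_maps \<Rightarrow> ('p, 'a) local_maps \<Rightarrow> 'p \<Rightarrow> 'k" where
  "local_symbol K C S T x = commutator_symbol K (local_field C x) (local_ints C x) (S x) (T x)"

definition local_factor ::
  "'k ring \<Rightarrow> ('k, 'p, 'a) rspace \<Rightarrow> ('p, 'a) local_maps \<Rightarrow> ('p, 'a) local_maps \<Rightarrow> 'p \<Rightarrow> 'k" where
  "local_factor K C S T x =
     (\<ominus>\<^bsub>K\<^esub> \<one>\<^bsub>K\<^esub>) [^]\<^bsub>K\<^esub> (local_winding K C S x * local_winding K C T x) \<otimes>\<^bsub>K\<^esub> local_symbol K C S T x"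

end

theory Submission imports Defs
begin

text \<open>
Call a subspace of \<open>V\<close> that is commensurable with the given subspace \<open>P\<close> a lattice. For
lattices \<open>M \<subseteq> A \<inter> B\<close>, a basis of \<open>A\<close> modulo \<open>M\<close> and a basis of \<open>B\<close> modulo \<open>M\<close> turn an element of
the line \<open>(A|B)\<close> into a scalar, and the element is determined by this one scalar. Composition of
lines becomes multiplication of scalars (\<open>val_comp\<close>), and transport along \<open>S\<close> leaves the scalar
unchanged if the bases are transported as well (\<open>val_push\<close>). The symbol \<open>\<langle>S, T\<rangle>\<close> is therefore a
ratio of products of such scalars, read off on one lattice \<open>M\<close> which is small enough for all the
lines involved (\<open>comm_ratio\<close>, \<open>comm_frames\<close>).

Suppose that \<open>V = V1 \<oplus> V2\<close>, \<open>P = P1 \<oplus> P2\<close>, and that \<open>S\<close>, \<open>T\<close> are sums of automorphisms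
\<open>S1\<close>, \<open>T1\<close> and \<open>S2\<close>, \<open>T2\<close> of the summands. Elements of the lines of \<open>V1\<close> and \<open>V2\<close> have a product in
the line of \<open>V\<close>. With respect to concatenated bases its scalar is the product of the two scalars, up
to a sign: blocks of vectors of \<open>V1\<close> and of \<open>V2\<close> have to be moved past each other. A basis of \<open>A1/M1\<close>,
\<open>B1/M1\<close>, \<open>A2/M2\<close> of length \<open>a1\<close>, \<open>b1\<close>, \<open>a2\<close> gives the sign \<open>(-1)^(a2 (a1 + b1))\<close> (\<open>line_product\<close>).
Four such signs enter the commutator. Differences of lengths are winding numbers, so that together
the signs amount to \<open>(-1)^(w(S1) w(T2) + w(S2) w(T1))\<close>. Since \<open>w(S) = w(S1) + w(S2)\<close> and likewise for
\<open>T\<close>, this is the cross term of \<open>(-1)^(w(S) w(T))\<close>. Hence the signed symbol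
\<open>(-1)^(w(S) w(T)) \<langle>S, T\<rangle>\<close> is multiplicative in direct sums (\<open>signed_symbol_direct_sum\<close>). It is \<open>1\<close>
if \<open>S P = P = T P\<close>, for then every line in sight is \<open>(P|P) = K\<close> (\<open>signed_symbol_stable\<close>).

An automorphism \<open>S\<close> of the adeles that acts componentwise satisfies \<open>S_x A_x = A_x\<close> for almost all
\<open>x\<close>, because \<open>S\<close> and its inverse send integral adeles to adeles (\<open>prodmap_bad_finite\<close>). Splitting off
the finitely many exceptional points one by one, and using triviality on what is left,
expresses the signed symbol of the adeles as the product of the signed symbols at these points
(\<open>signed_symbol_prodmap\<close>). Both global winding numbers vanish, so that the signed symbol of \<open>S\<close> and \<open>T\<close>
on the adeles is \<open>\<langle>S, T\<rangle>\<close> itself.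
\<close>

section \<open>Alternating forms on subquotients\<close>

locale kspace = vectorspace K V for K :: "'k ring" (structure) and V :: "('k, 'v) module"

text \<open>The subspace \<open>M + K b\<^sub>1 + \<dots> + K b\<^sub>n\<close>, and linear independence of \<open>b\<^sub>1, \<dots>, b\<^sub>n\<close> modulo \<open>M\<close>.
Quotients \<open>B/M\<close> are avoided as far as possible: statements about them are statements about lists of
vectors of \<open>V\<close> modulo \<open>M\<close>.\<close>

fun spn :: "'k ring => ('k, 'v) module => 'v set => 'v list => 'v set" where
 "spn K V M [] = M"
| "spn K V M (b # bs) = {x \<oplus>\<^bsub>V\<^esub> c \<odot>\<^bsub>V\<^esub> b |x c. x \<in> spn K V M bs \<and> c \<in> carrier K}"

fun indep_mod :: "'k ring => ('k, 'v) module => 'v set => 'v list => bool" where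
 "indep_mod K V M [] \<longleftrightarrow> True"
| "indep_mod K V M (b # bs) \<longleftrightarrow> b \<notin> spn K V M bs \<and> indep_mod K V M bs"

text \<open>Alternating \<open>n\<close>-forms on \<open>B/M\<close>, as functions of vectors of \<open>B\<close>: multilinear, zero on lists
with a repetition, and zero as soon as one entry lies in \<open>M\<close>. They are dual to the exterior power of
\<open>B/M\<close>, and so detect its elements.\<close>

definition alt_form :: "'k ring => ('k, 'v) module => 'v set => 'v set => nat => ('v list => 'k) => bool" where
 "alt_form K V B M n D \<longleftrightarrow>
   (\<forall>bs. length bs = n --> set bs \<subseteq> B --> D bs \<in> carrier K) \<and>
   (\<forall>us c v w ws. Suc (length us + length ws) = n --> set us \<subseteq> B --> set ws \<subseteq> B --> v \<in> B --> w \<in> B -->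
    c \<in> carrier K -->
    D (us @ (w \<oplus>\<^bsub>V\<^esub> c \<odot>\<^bsub>V\<^esub> v) # ws) = D (us @ w # ws) \<oplus>\<^bsub>K\<^esub> c \<otimes>\<^bsub>K\<^esub> D (us @ v # ws)) \<and>
   (\<forall>us v ys ws. Suc (Suc (length us + length ys + length ws)) = n --> set us \<subseteq> B --> set ys \<subseteq> B -->
    set ws \<subseteq> B --> v \<in> B --> D (us @ v # ys @ v # ws) = \<zero>\<^bsub>K\<^esub>) \<and>
   (\<forall>us m ws. Suc (length us + length ws) = n --> set us \<subseteq> B --> set ws \<subseteq> B --> m \<in> M -->
    D (us @ m # ws) = \<zero>\<^bsub>K\<^esub>)"

text \<open>The wedge product of a linear form \<open>l\<close> with an alternating form, as a Laplace expansion with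
alternating signs.\<close>

fun wedge_form :: "'k ring => ('v => 'k) => ('v list => 'k) => 'v list => 'k" where
 "wedge_form K l om [] = \<zero>\<^bsub>K\<^esub>"
| "wedge_form K l om (b # bs) = l b \<otimes>\<^bsub>K\<^esub> om bs \<ominus>\<^bsub>K\<^esub> wedge_form K l (\<lambda>xs. om (b # xs)) bs"

lemma front_to_middle:
 assumes swap: "!!us v w ws. P (us @ v # w # ws) ==> P (us @ w # v # ws)"
 shows "P (pre @ e # us @ ys) ==> P (pre @ us @ e # ys)"
proof (induction us arbitrary: pre)
 case (Cons u us)
 have "P ((pre @ [u]) @ e # us @ ys)" using swap[of pre e u "us @ ys"] Cons.prems by simp
 from Cons.IH[OF this] show ?case by simp
qed simp

text \<open>Adjacent transpositions generate the symmetric group. The prefix \<open>pre\<close> is there for the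
induction on the list.\<close>

lemma swap_invariant_permute:
 assumes swap: "!!us v w ws. P (us @ v # w # ws) ==> P (us @ w # v # ws)"
 shows "mset ws = mset es ==> P (pre @ es) ==> P (pre @ ws)"
proof (induction es arbitrary: pre ws)
 case (Cons e es)
 then have "e \<in> set ws" by (metis list.set_intros(1) mset_eq_setD)
 then obtain us ys where ws: "ws = us @ e # ys" by (meson split_list)
 with Cons.prems(1) have "mset (us @ ys) = mset es" by simp
 from Cons.IH[OF this, of "pre @ [e]"] Cons.prems(2) have "P (pre @ e # us @ ys)" by simp
 then show ?case unfolding ws using front_to_middle[where P = P, OF swap] by simp
qed simp

context kspace
begin

abbreviation sub :: "'v set => bool" where "sub N \<equiv> submodule K N V"
abbreviation spanm :: "'v set => 'v list => 'v set" where "spanm \<equiv> spn K V"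
abbreviation indepm :: "'v set => 'v list => bool" where "indepm \<equiv> indep_mod K V"
abbreviation altf where "altf \<equiv> alt_form K V"
abbreviation fr where "fr \<equiv> frames K V"
abbreviation dl where "dl \<equiv> det_line K V"
abbreviation dw where "dw \<equiv> det_wedge K V"

lemma invK: "c \<in> carrier K ==> c \<noteq> \<zero> ==> inv c \<in> carrier K \<and> c \<otimes> inv c = \<one> \<and> inv c \<otimes> c = \<one> \<and> inv c \<noteq> \<zero>"
 by (metis R.Units_inv_closed R.Units_l_inv R.Units_r_inv R.r_null field_Units insertE insert_Diff zero_not_one R.zero_closed)

lemma sub_iff: "sub N \<longleftrightarrow> N \<subseteq> carrier V \<and> \<zero>\<^bsub>V\<^esub> \<in> N \<and> (\<forall>v\<in>N. \<forall>w\<in>N. v \<oplus>\<^bsub>V\<^esub> w \<in> N) \<and>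
  (\<forall>c\<in>carrier K. \<forall>v\<in>N. c \<odot>\<^bsub>V\<^esub> v \<in> N)"
 unfolding submodule_def using module_axioms by auto

lemma subD:
 assumes "sub N"
 shows "x \<in> N ==> x \<in> carrier V" "\<zero>\<^bsub>V\<^esub> \<in> N" "v \<in> N ==> w \<in> N ==> v \<oplus>\<^bsub>V\<^esub> w \<in> N"
  "c \<in> carrier K ==> v \<in> N ==> c \<odot>\<^bsub>V\<^esub> v \<in> N" "v \<in> N ==> \<ominus>\<^bsub>V\<^esub> v \<in> N"
  "v \<in> N ==> w \<in> N ==> v \<ominus>\<^bsub>V\<^esub> w \<in> N"
proof -
 show *: "x \<in> N ==> x \<in> carrier V" for x using assms by (auto simp: sub_iff)
 show "\<zero>\<^bsub>V\<^esub> \<in> N" "v \<in> N ==> w \<in> N ==> v \<oplus>\<^bsub>V\<^esub> w \<in> N"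
  "c \<in> carrier K ==> v \<in> N ==> c \<odot>\<^bsub>V\<^esub> v \<in> N" using assms by (auto simp: sub_iff)
 show neg: "v \<in> N ==> \<ominus>\<^bsub>V\<^esub> v \<in> N" for v
 proof -
  assume v: "v \<in> N"
  have "(\<ominus> \<one>) \<odot>\<^bsub>V\<^esub> v \<in> N" using assms v by (auto simp: sub_iff)
  then show ?thesis using v * by (simp add: smult_minus_1)
 qed
 show "v \<in> N ==> w \<in> N ==> v \<ominus>\<^bsub>V\<^esub> w \<in> N"
  using neg assms by (auto simp: sub_iff a_minus_def)
qed

lemma sub_Int: "sub M ==> sub N ==> sub (M \<inter> N)"
 by (auto simp: sub_iff)

lemma sub_smult_cancel:
 assumes "sub N" "c \<in> carrier K" "c \<noteq> \<zero>" "y \<in> carrier V" "c \<odot>\<^bsub>V\<^esub> y \<in> N" shows "y \<in> N"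
proof -
 have "inv c \<odot>\<^bsub>V\<^esub> (c \<odot>\<^bsub>V\<^esub> y) = y" using assms invK[of c]
  by (metis smult_assoc1 smult_one)
 then show ?thesis using subD(4)[OF assms(1), of "inv c" "c \<odot>\<^bsub>V\<^esub> y"] assms invK[of c] by simp
qed

lemma spn_sub: "sub M ==> set bs \<subseteq> carrier V ==> sub (spanm M bs)"
proof (induction bs)
 case (Cons b bs)
 then have s: "sub (spanm M bs)" and b: "b \<in> carrier V" by auto
 note d = subD[OF s]
 show ?case unfolding sub_iff
 proof (intro conjI ballI)
  show "spanm M (b # bs) \<subseteq> carrier V" using d(1) b by auto
  show "\<zero>\<^bsub>V\<^esub> \<in> spanm M (b # bs)"
   using d(2) b by (auto intro!: exI[of _ "\<zero>\<^bsub>V\<^esub>"] exI[of _ "\<zero>"])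
 next
  fix v w assume "v \<in> spanm M (b # bs)" "w \<in> spanm M (b # bs)"
  then obtain x c y e where v: "v = x \<oplus>\<^bsub>V\<^esub> c \<odot>\<^bsub>V\<^esub> b" "x \<in> spanm M bs" "c \<in> carrier K"
   and w: "w = y \<oplus>\<^bsub>V\<^esub> e \<odot>\<^bsub>V\<^esub> b" "y \<in> spanm M bs" "e \<in> carrier K" by auto
  have "v \<oplus>\<^bsub>V\<^esub> w = (x \<oplus>\<^bsub>V\<^esub> y) \<oplus>\<^bsub>V\<^esub> (c \<oplus> e) \<odot>\<^bsub>V\<^esub> b"
   using v w b d(1) by (simp add: smult_l_distr M.a_ac)
  then show "v \<oplus>\<^bsub>V\<^esub> w \<in> spanm M (b # bs)" using d(3) v w by auto
 next
  fix a v assume a: "a \<in> carrier K" and "v \<in> spanm M (b # bs)"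
  then obtain x c where v: "v = x \<oplus>\<^bsub>V\<^esub> c \<odot>\<^bsub>V\<^esub> b" "x \<in> spanm M bs" "c \<in> carrier K" by auto
  have "a \<odot>\<^bsub>V\<^esub> v = a \<odot>\<^bsub>V\<^esub> x \<oplus>\<^bsub>V\<^esub> (a \<otimes> c) \<odot>\<^bsub>V\<^esub> b"
   using v b a d(1) by (simp add: smult_r_distr smult_assoc1)
  then show "a \<odot>\<^bsub>V\<^esub> v \<in> spanm M (b # bs)" using d(4) v a by auto
 qed
qed simp

lemma spn_Cons_mono: "sub M ==> set (b # bs) \<subseteq> carrier V ==> spanm M bs \<subseteq> spanm M (b # bs)"
proof
 fix x assume a: "sub M" "set (b # bs) \<subseteq> carrier V" "x \<in> spanm M bs"
 then have "x = x \<oplus>\<^bsub>V\<^esub> \<zero> \<odot>\<^bsub>V\<^esub> b" using subD(1)[OF spn_sub[of M bs]] by simp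
 then show "x \<in> spanm M (b # bs)" using a(3) by auto
qed

lemma spn_base: "sub M ==> set bs \<subseteq> carrier V ==> M \<subseteq> spanm M bs"
proof (induction bs)
 case (Cons b bs) then show ?case using spn_Cons_mono[of M b bs] by auto
qed simp

lemma spn_gen: "sub M ==> set bs \<subseteq> carrier V ==> set bs \<subseteq> spanm M bs"
proof (induction bs)
 case (Cons b bs)
 have "\<zero>\<^bsub>V\<^esub> \<in> spanm M bs" using subD(2)[OF spn_sub[of M bs]] Cons.prems by auto
 moreover have "b = \<zero>\<^bsub>V\<^esub> \<oplus>\<^bsub>V\<^esub> \<one> \<odot>\<^bsub>V\<^esub> b" using Cons.prems by simp
 ultimately have "b \<in> spanm M (b # bs)" unfolding spn.simps by blast
 then show ?case using Cons spn_Cons_mono[of M b bs] by auto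
qed simp

lemma spn_least: "sub N ==> M \<subseteq> N ==> set bs \<subseteq> N ==> spanm M bs \<subseteq> N"
 by (induction bs) (auto intro!: subD(3,4))

lemma spn_append: "spanm M (as @ bs) = spanm (spanm M bs) as"
 by (induction as) auto

text \<open>Dropping the vectors that depend on later ones leaves a basis.\<close>

lemma spn_extract_basis:
 assumes "sub M" "set bs \<subseteq> carrier V"
 shows "\<exists>es. set es \<subseteq> set bs \<and> indepm M es \<and> spanm M es = spanm M bs"
 using assms(2)
proof (induction bs)
 case (Cons b bs)
 then obtain es where es: "set es \<subseteq> set bs" "indepm M es" "spanm M es = spanm M bs" by auto
 show ?case
 proof (cases "b \<in> spanm M es")
  case True
  have "spanm M (b # bs) \<subseteq> spanm M bs"
   using True es Cons.prems assms(1)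
   by (intro spn_least spn_sub spn_base) (auto dest: spn_gen)
  then have "spanm M es = spanm M (b # bs)" using es spn_Cons_mono[OF assms(1) Cons.prems] by auto
  with es show ?thesis by auto
 next
  case False
  then show ?thesis using es by (intro exI[of _ "b # es"]) auto
 qed
qed auto

text \<open>The principle behind uniqueness of the determinant: a multilinear alternating property of
\<open>n\<close> vectors of the span of \<open>es\<close> modulo \<open>M\<close>, with \<open>n\<close> at least the length of \<open>es\<close>, only has to be checked
on \<open>es\<close> itself. Expanding every entry in \<open>es\<close>, each term has a repetition, an entry from \<open>M\<close>, or is a
permutation of \<open>es\<close>.\<close>

lemma multilinear_expand:
 assumes M: "sub M" and es: "set es \<subseteq> carrier V" and B: "B = spanm M es"
  and lin: "!!us c v w ws. [|Suc (length us + length ws) = n; set us \<subseteq> B; set ws \<subseteq> B; v \<in> B; w \<in> B;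
    c \<in> carrier K; P (us @ v # ws); P (us @ w # ws)|] ==> P (us @ (w \<oplus>\<^bsub>V\<^esub> c \<odot>\<^bsub>V\<^esub> v) # ws)"
  and rep: "!!us v ys ws. [|Suc (Suc (length us + length ys + length ws)) = n; set us \<subseteq> B; set ys \<subseteq> B;
    set ws \<subseteq> B; v \<in> B|] ==> P (us @ v # ys @ v # ws)"
  and kill: "!!us m ws. [|Suc (length us + length ws) = n; set us \<subseteq> B; set ws \<subseteq> B; m \<in> M|] ==> P (us @ m # ws)"
  and swap: "!!us v w ws. [|Suc (Suc (length us + length ws)) = n; set us \<subseteq> B; set ws \<subseteq> B; v \<in> B; w \<in> B;
    P (us @ v # w # ws)|] ==> P (us @ w # v # ws)"
  and base: "length es = n ==> P es" and len: "length es \<le> n"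
  and bs: "length bs = n" "set bs \<subseteq> B"
 shows "P bs"
proof -
 have esB: "set es \<subseteq> B" using spn_gen[OF M es] B by simp
 define Q where "Q ws \<longleftrightarrow> (length ws = n --> set ws \<subseteq> B --> P ws)" for ws
 have swapQ: "Q (us @ v # w # ws) ==> Q (us @ w # v # ws)" for us v w ws
  using swap[of us ws v w] unfolding Q_def by auto
 have entries: "P ks" if ks: "set ks \<subseteq> set es" "length ks = n" for ks
 proof (cases "distinct ks")
  case False
  then obtain us v ys ws where "ks = us @ v # ys @ v # ws" using not_distinct_decomp[of ks] by auto
  then show ?thesis using rep[of us ys ws v] ks esB by auto
 next
  case True
  then have c: "card (set ks) = n" using ks(2) distinct_card by metis
  have "card (set ks) \<le> card (set es)" using ks(1) by (simp add: card_mono)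
  then have le: "card (set es) = n" "length es = n" using c len card_length[of es] by auto
  then have "set ks = set es" using ks(1) c by (simp add: card_subset_eq)
  moreover have "distinct es" using le by (simp add: card_distinct)
  ultimately have m: "mset ks = mset es" using True by (simp add: set_eq_iff_mset_eq_distinct)
  have "Q es" using base le by (simp add: Q_def)
  then have "Q ks" using swap_invariant_permute[where P = Q and pre = "[]", OF swapQ m] by simp
  then show ?thesis using ks esB unfolding Q_def by auto
 qed
 have "set us \<subseteq> B --> set ks \<subseteq> set es --> length us + length ks = n --> P (us @ ks)" for us ks
 proof (induction us arbitrary: ks rule: rev_induct)
  case Nil then show ?case using entries by simp
 next
  case (snoc u us)
  show ?case
  proof (intro impI)
   assume a: "set (us @ [u]) \<subseteq> B" "set ks \<subseteq> set es" "length (us @ [u]) + length ks = n"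
   have len': "Suc (length us + length ks) = n" using a(3) by simp
   have ksB: "set ks \<subseteq> B" using a(2) esB by auto
   have "set es' \<subseteq> set es ==> v \<in> spanm M es' ==> P (us @ v # ks)" for es' v
   proof (induction es' arbitrary: v)
    case Nil then show ?case using kill[OF len'] a ksB by auto
   next
    case (Cons e es')
    then obtain x c where v: "v = x \<oplus>\<^bsub>V\<^esub> c \<odot>\<^bsub>V\<^esub> e" "x \<in> spanm M es'" "c \<in> carrier K" by auto
    have "P (us @ e # ks)" using snoc.IH[of "e # ks"] Cons.prems(1) a by auto
    moreover have "P (us @ x # ks)" using Cons v by auto
    moreover have "x \<in> B"
    proof -
     have "spanm M es' \<subseteq> B"
      using Cons.prems es M esB by (intro spn_least) (auto simp: B intro: spn_sub dest: spn_base)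
     then show ?thesis using v by auto
    qed
    ultimately show ?case unfolding v(1)
     using v a ksB Cons.prems esB by (intro lin[OF len']) auto
   qed
   from this[of es u] show "P ((us @ [u]) @ ks)" using a B by simp
  qed
 qed
 from this[of bs "[]"] show ?thesis using bs by simp
qed

lemma altD:
 assumes "altf B M n D"
 shows "[|length bs = n; set bs \<subseteq> B|] ==> D bs \<in> carrier K"
  "[|Suc (length us + length ws) = n; set us \<subseteq> B; set ws \<subseteq> B; v \<in> B; w \<in> B; c \<in> carrier K|] ==>
   D (us @ (w \<oplus>\<^bsub>V\<^esub> c \<odot>\<^bsub>V\<^esub> v) # ws) = D (us @ w # ws) \<oplus> c \<otimes> D (us @ v # ws)"
  "[|Suc (Suc (length us + length ys + length ws)) = n; set us \<subseteq> B; set ys \<subseteq> B; set ws \<subseteq> B; v \<in> B|] ==>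
   D (us @ v # ys @ v # ws) = \<zero>"
  "[|Suc (length us + length ws) = n; set us \<subseteq> B; set ws \<subseteq> B; m \<in> M|] ==> D (us @ m # ws) = \<zero>"
 using assms unfolding alt_form_def by blast+

lemma altI:
 assumes "!!bs. [|length bs = n; set bs \<subseteq> B|] ==> D bs \<in> carrier K"
  "!!us c v w ws. [|Suc (length us + length ws) = n; set us \<subseteq> B; set ws \<subseteq> B; v \<in> B; w \<in> B; c \<in> carrier K|] ==>
   D (us @ (w \<oplus>\<^bsub>V\<^esub> c \<odot>\<^bsub>V\<^esub> v) # ws) = D (us @ w # ws) \<oplus> c \<otimes> D (us @ v # ws)"
  "!!us v ys ws. [|Suc (Suc (length us + length ys + length ws)) = n; set us \<subseteq> B; set ys \<subseteq> B; set ws \<subseteq> B; v \<in> B|] ==>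
   D (us @ v # ys @ v # ws) = \<zero>"
  "!!us m ws. [|Suc (length us + length ws) = n; set us \<subseteq> B; set ws \<subseteq> B; m \<in> M|] ==> D (us @ m # ws) = \<zero>"
 shows "altf B M n D"
 using assms unfolding alt_form_def by blast

text \<open>Expand \<open>D(v + w, v + w) = 0\<close>.\<close>

lemma alt_swap:
 assumes D: "altf B M n D" and B: "sub B"
  and *: "Suc (Suc (length us + length ws)) = n" "set us \<subseteq> B" "set ws \<subseteq> B" "v \<in> B" "w \<in> B"
 shows "D (us @ w # v # ws) = \<ominus> D (us @ v # w # ws)"
proof -
 note d = altD[OF D]
 have vw: "v \<oplus>\<^bsub>V\<^esub> w \<in> B" using * subD[OF B] by auto
 have e: "v \<oplus>\<^bsub>V\<^esub> w = v \<oplus>\<^bsub>V\<^esub> \<one> \<odot>\<^bsub>V\<^esub> w" using * subD[OF B] by auto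
 have c: "D (us @ x # y # ws) \<in> carrier K" if "x \<in> B" "y \<in> B" for x y using that * by (intro d(1)) auto
 have z: "D (us @ x # x # ws) = \<zero>" if "x \<in> B" for x using d(3)[of us "[]" ws x] that * by auto
 have "\<zero> = D (us @ (v \<oplus>\<^bsub>V\<^esub> w) # (v \<oplus>\<^bsub>V\<^esub> w) # ws)" using z[OF vw] by simp
 also have "\<dots> = D (us @ v # (v \<oplus>\<^bsub>V\<^esub> w) # ws) \<oplus> D (us @ w # (v \<oplus>\<^bsub>V\<^esub> w) # ws)"
  apply (subst (1) e, subst d(2)) using * vw c by auto
 also have "D (us @ v # (v \<oplus>\<^bsub>V\<^esub> w) # ws) = D (us @ v # w # ws)"
  using d(2)[of "us @ [v]" ws w v \<one>] z[of v] c[of v w] * e by simp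
 also have "D (us @ w # (v \<oplus>\<^bsub>V\<^esub> w) # ws) = D (us @ w # v # ws)"
  using d(2)[of "us @ [w]" ws w v \<one>] z[of w] c[of w v] * e by simp
 finally have "D (us @ v # w # ws) \<oplus> D (us @ w # v # ws) = \<zero>" by simp
 then show ?thesis using c[of v w] c[of w v] * by (metis R.add.inv_unique' R.a_comm R.minus_equality)
qed

lemma wedge_form_closed:
 assumes "!!b. b \<in> B ==> l b \<in> carrier K"
 shows "[|!!xs. Suc (length xs) = length ws ==> set xs \<subseteq> B ==> om xs \<in> carrier K; set ws \<subseteq> B|] ==>
  wedge_form K l om ws \<in> carrier K"
proof (induction ws arbitrary: om)
 case (Cons b bs)
 have "wedge_form K l (\<lambda>xs. om (b # xs)) bs \<in> carrier K" using Cons by (intro Cons.IH) auto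
 moreover have "om bs \<in> carrier K" using Cons by auto
 ultimately show ?case using Cons.prems assms by auto
qed simp

lemma wedge_form_lin:
 assumes l: "!!b. b \<in> B ==> l b \<in> carrier K" and c: "c \<in> carrier K"
 shows "[|!!xs. Suc (length xs) = length ws ==> set xs \<subseteq> B ==> om1 xs \<in> carrier K \<and> om2 xs \<in> carrier K \<and>
    om xs = om2 xs \<oplus> c \<otimes> om1 xs; set ws \<subseteq> B|] ==>
  wedge_form K l om ws = wedge_form K l om2 ws \<oplus> c \<otimes> wedge_form K l om1 ws"
proof (induction ws arbitrary: om om1 om2)
 case (Cons b bs)
 have 1: "wedge_form K l (\<lambda>xs. om (b # xs)) bs =
   wedge_form K l (\<lambda>xs. om2 (b # xs)) bs \<oplus> c \<otimes> wedge_form K l (\<lambda>xs. om1 (b # xs)) bs"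
  using Cons by (intro Cons.IH) auto
 have 2: "wedge_form K l (\<lambda>xs. om1 (b # xs)) bs \<in> carrier K" "wedge_form K l (\<lambda>xs. om2 (b # xs)) bs \<in> carrier K"
  using Cons.prems l by (auto intro!: wedge_form_closed[where B = B])
 have 3: "om bs = om2 bs \<oplus> c \<otimes> om1 bs" "om1 bs \<in> carrier K" "om2 bs \<in> carrier K" "l b \<in> carrier K"
  using Cons.prems l by auto
 show ?case using 2 3(2-4) c
  by (simp add: 1 3(1) a_minus_def R.minus_add R.r_distr R.l_distr R.r_minus R.l_minus R.a_ac R.m_ac)
qed (use c in simp)

lemma wedge_form_zero:
 assumes l: "!!b. b \<in> B ==> l b \<in> carrier K"
 shows "[|!!xs. Suc (length xs) = length ws ==> set xs \<subseteq> B ==> om xs = \<zero>; set ws \<subseteq> B|] ==> wedge_form K l om ws = \<zero>"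
proof (induction ws arbitrary: om)
 case (Cons b bs)
 have "wedge_form K l (\<lambda>xs. om (b # xs)) bs = \<zero>" using Cons by (intro Cons.IH) auto
 then show ?case using Cons.prems l by auto
qed simp

lemma wedge_form_zero':
 shows "[|!!xs. Suc (length xs) = length ws ==> set xs \<subseteq> B ==> om xs \<in> carrier K; set ws \<subseteq> B;
  !!b. b \<in> set ws ==> l b = \<zero>|] ==> wedge_form K l om ws = \<zero>"
proof (induction ws arbitrary: om)
 case (Cons b bs)
 have "wedge_form K l (\<lambda>xs. om (b # xs)) bs = \<zero>" using Cons by (intro Cons.IH) auto
 then show ?case using Cons.prems by auto
qed simp

lemma alt_Cons:
 assumes "altf B M (Suc n) D" "b \<in> B" shows "altf B M n (\<lambda>xs. D (b # xs))"
proof -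
 note d = altD[OF assms(1)]
 show ?thesis
 proof (rule altI)
  show "D (b # us @ (w \<oplus>\<^bsub>V\<^esub> c \<odot>\<^bsub>V\<^esub> v) # ws) = D (b # us @ w # ws) \<oplus> c \<otimes> D (b # us @ v # ws)"
   if "Suc (length us + length ws) = n" "set us \<subseteq> B" "set ws \<subseteq> B" "v \<in> B" "w \<in> B" "c \<in> carrier K" for us c v w ws
   using d(2)[of "b # us" ws v w c] that assms(2) by auto
  show "D (b # us @ v # ys @ v # ws) = \<zero>"
   if "Suc (Suc (length us + length ys + length ws)) = n" "set us \<subseteq> B" "set ys \<subseteq> B" "set ws \<subseteq> B" "v \<in> B" for us v ys ws
   using d(3)[of "b # us" ys ws v] that assms(2) by auto
  show "D (b # us @ m # ws) = \<zero>" if "Suc (length us + length ws) = n" "set us \<subseteq> B" "set ws \<subseteq> B" "m \<in> M" for us m ws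
   using d(4)[of "b # us" ws m] that assms(2) by auto
 qed (use d(1) assms(2) in auto)
qed

lemma wedge_form_repeat:
 assumes l: "!!b. b \<in> B ==> l b \<in> carrier K" and B: "sub B"
 shows "[|altf B M n om; Suc (length ys + length ws) = n; set ys \<subseteq> B; set ws \<subseteq> B; v \<in> B|] ==>
  wedge_form K l (\<lambda>xs. om (v # xs)) (ys @ v # ws) = l v \<otimes> om (ys @ v # ws)"
proof (induction ys arbitrary: om n)
 case Nil
 have "wedge_form K l (\<lambda>xs. om (v # v # xs)) ws = \<zero>"
  using Nil l altD(3)[OF Nil(1), of "[]" "[]" _ v] by (intro wedge_form_zero[where B = B]) auto
 then show ?case using Nil l altD(1)[OF Nil(1), of "v # ws"] by (simp add: a_minus_def)
next
 case (Cons x ys)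
 then obtain m where n: "n = Suc m" by (cases n) auto
 have x: "x \<in> B" and xv: "set (x # ys) \<subseteq> B" using Cons.prems by auto
 have om: "altf B M (Suc m) om" using Cons.prems n by simp
 have IH: "wedge_form K l (\<lambda>xs. om (x # v # xs)) (ys @ v # ws) = l v \<otimes> om (x # ys @ v # ws)"
  using Cons.IH[OF alt_Cons[OF om x]] Cons.prems n by simp
 have z: "om (v # ys @ v # ws) = \<zero>" using altD(3)[OF Cons.prems(1), of "[]" ys ws v] Cons.prems by auto
 have "wedge_form K l (\<lambda>xs. om (v # x # xs)) (ys @ v # ws) =
   wedge_form K l (\<lambda>_. \<zero>) (ys @ v # ws) \<oplus> (\<ominus> \<one>) \<otimes> wedge_form K l (\<lambda>xs. om (x # v # xs)) (ys @ v # ws)"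
 proof (rule wedge_form_lin[where B = B and l = l, OF l])
  fix xs :: "'v list" assume xs: "Suc (length xs) = length (ys @ v # ws)" "set xs \<subseteq> B"
  have c: "om (x # v # xs) \<in> carrier K" using xs Cons.prems by (intro altD(1)[OF Cons.prems(1)]) auto
  moreover have "om (v # x # xs) = \<ominus> om (x # v # xs)"
   using alt_swap[OF Cons.prems(1) B, of "[]" xs x v] xs Cons.prems by auto
  ultimately show "om (x # v # xs) \<in> carrier K \<and> \<zero> \<in> carrier K \<and> om (v # x # xs) = \<zero> \<oplus> \<ominus> \<one> \<otimes> om (x # v # xs)"
   by (simp add: R.l_minus)
 qed (use Cons.prems in auto)
 also have "wedge_form K l (\<lambda>_. \<zero>) (ys @ v # ws) = \<zero>"
  using Cons.prems l by (intro wedge_form_zero[where B = B]) auto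
 finally show ?case using z IH l x Cons.prems altD(1)[OF Cons.prems(1), of "x # ys @ v # ws"]
  by (simp add: a_minus_def R.l_minus)
qed

text \<open>Alternation is the delicate point: if the repeated entries are not affected by \<open>l\<close> the
terms vanish individually, and the two remaining terms cancel by \<open>wedge_form_repeat\<close>.\<close>

lemma alt_wedge_form:
 assumes l: "!!b. b \<in> B ==> l b \<in> carrier K" and B: "sub B" and MB: "M \<subseteq> B"
  and lin: "!!v w c. v \<in> B ==> w \<in> B ==> c \<in> carrier K ==> l (w \<oplus>\<^bsub>V\<^esub> c \<odot>\<^bsub>V\<^esub> v) = l w \<oplus> c \<otimes> l v"
  and lM: "!!m. m \<in> M ==> l m = \<zero>"
 shows "altf B M n om ==> altf B M (Suc n) (wedge_form K l om)"
proof (induction n arbitrary: om)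
 case (0 om)
 note d = altD[OF 0]
 have om: "om [] \<in> carrier K" using d(1)[of "[]"] by simp
 show ?case
 proof (rule altI)
  show "wedge_form K l om bs \<in> carrier K" if "length bs = Suc 0" "set bs \<subseteq> B" for bs
   using that om l by (cases bs) auto
 qed (use om l lin lM B MB in \<open>auto simp: a_minus_def R.l_distr R.m_assoc subD\<close>)
next
 case (Suc n om)
 note d = altD[OF Suc.prems]
 note IH = Suc.IH[OF alt_Cons[OF Suc.prems]]
 show ?case
 proof (rule altI)
  fix bs assume "length bs = Suc (Suc n)" "set bs \<subseteq> B"
  then show "wedge_form K l om bs \<in> carrier K"
   by (intro wedge_form_closed[where B = B] l d(1)) auto
 next
  fix us c v w ws
  assume a: "Suc (length us + length ws) = Suc (Suc n)" "set us \<subseteq> B" "set ws \<subseteq> B" "v \<in> B" "w \<in> B" "c \<in> carrier K"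
  show "wedge_form K l om (us @ (w \<oplus>\<^bsub>V\<^esub> c \<odot>\<^bsub>V\<^esub> v) # ws) =
   wedge_form K l om (us @ w # ws) \<oplus> c \<otimes> wedge_form K l om (us @ v # ws)"
  proof (cases us)
   case Nil
   have 1: "wedge_form K l (\<lambda>xs. om ((w \<oplus>\<^bsub>V\<^esub> c \<odot>\<^bsub>V\<^esub> v) # xs)) ws =
    wedge_form K l (\<lambda>xs. om (w # xs)) ws \<oplus> c \<otimes> wedge_form K l (\<lambda>xs. om (v # xs)) ws"
   proof (rule wedge_form_lin[where B = B and l = l, OF l])
    fix xs :: "'v list" assume "Suc (length xs) = length ws" "set xs \<subseteq> B"
    then show "om (v # xs) \<in> carrier K \<and> om (w # xs) \<in> carrier K \<and>
     om ((w \<oplus>\<^bsub>V\<^esub> c \<odot>\<^bsub>V\<^esub> v) # xs) = om (w # xs) \<oplus> c \<otimes> om (v # xs)"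
     using d(1)[of "v # xs"] d(1)[of "w # xs"] d(2)[of "[]" xs v w c] a Nil by auto
   qed (use a in auto)
   have 2: "wedge_form K l (\<lambda>xs. om (w # xs)) ws \<in> carrier K" "wedge_form K l (\<lambda>xs. om (v # xs)) ws \<in> carrier K"
    using a Nil by (auto intro!: wedge_form_closed[where B = B] l d(1))
   have 3: "om ws \<in> carrier K" "l v \<in> carrier K" "l w \<in> carrier K" using a Nil d(1) l by auto
   show ?thesis using 2 3 a(6) lin[OF a(4,5,6)]
    by (simp add: Nil 1 a_minus_def R.minus_add R.r_distr R.l_distr R.r_minus R.l_minus R.a_ac R.m_ac)
  next
   case (Cons u us')
   have u: "u \<in> B" using a Cons by simp
   have "wedge_form K l (\<lambda>xs. om (u # xs)) (us' @ (w \<oplus>\<^bsub>V\<^esub> c \<odot>\<^bsub>V\<^esub> v) # ws) =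
    wedge_form K l (\<lambda>xs. om (u # xs)) (us' @ w # ws) \<oplus> c \<otimes> wedge_form K l (\<lambda>xs. om (u # xs)) (us' @ v # ws)"
    using altD(2)[OF IH[OF u], of us' ws v w c] a Cons by auto
   moreover have "om (us' @ (w \<oplus>\<^bsub>V\<^esub> c \<odot>\<^bsub>V\<^esub> v) # ws) = om (us' @ w # ws) \<oplus> c \<otimes> om (us' @ v # ws)"
    using d(2)[of us' ws v w c] a Cons by auto
   moreover have "om (us' @ x # ws) \<in> carrier K" "wedge_form K l (\<lambda>xs. om (u # xs)) (us' @ x # ws) \<in> carrier K" if "x \<in> B" for x
    using d(1)[of "us' @ x # ws"] altD(1)[OF IH[OF u], of "us' @ x # ws"] a that Cons by auto
   moreover note l[OF u]
   ultimately show ?thesis using a(4-6)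
    by (simp add: Cons a_minus_def R.minus_add R.r_distr R.l_distr R.r_minus R.l_minus R.a_ac R.m_ac)
  qed
 next
  fix us v ys ws
  assume a: "Suc (Suc (length us + length ys + length ws)) = Suc (Suc n)" "set us \<subseteq> B" "set ys \<subseteq> B" "set ws \<subseteq> B" "v \<in> B"
  show "wedge_form K l om (us @ v # ys @ v # ws) = \<zero>"
  proof (cases us)
   case Nil
   have "l v \<otimes> om (ys @ v # ws) \<in> carrier K" using a Nil l[of v] d(1)[of "ys @ v # ws"] by auto
   then show ?thesis using wedge_form_repeat[where l = l and ys = ys and ws = ws and v = v, OF l B Suc.prems] a Nil by (simp add: a_minus_def R.r_neg)
  next
   case (Cons u us')
   have u: "u \<in> B" using a Cons by simp
   show ?thesis using altD(3)[OF IH[OF u], of us' ys ws v] d(3)[of us' ys ws v] a l[OF u] Cons by auto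
  qed
 next
  fix us m ws
  assume a: "Suc (length us + length ws) = Suc (Suc n)" "set us \<subseteq> B" "set ws \<subseteq> B" "m \<in> M"
  show "wedge_form K l om (us @ m # ws) = \<zero>"
  proof (cases us)
   case Nil
   have "wedge_form K l (\<lambda>xs. om (m # xs)) ws = \<zero>"
    using d(4)[of "[]" _ m] a Nil by (intro wedge_form_zero[where B = B] l) auto
   then show ?thesis using a Nil lM d(1)[of ws] by auto
  next
   case (Cons u us')
   have u: "u \<in> B" using a Cons by simp
   show ?thesis using altD(4)[OF IH[OF u], of us' ws m] d(4)[of us' ws m] a l[OF u] Cons by auto
  qed
 qed
qed

end

text \<open>The quotient \<open>B/M\<close> is finite-dimensional; \<open>basis_mod\<close> says that \<open>es\<close> is a basis of it.\<close>

definition fin_gen_mod :: "'k ring => ('k, 'v) module => 'v set => 'v set => bool" where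
 "fin_gen_mod K V B M \<longleftrightarrow> (\<exists>bs. set bs \<subseteq> carrier V \<and> spn K V M bs = B)"

definition basis_mod :: "'k ring => ('k, 'v) module => 'v set => 'v set => 'v list => bool" where
 "basis_mod K V B M es \<longleftrightarrow> set es \<subseteq> carrier V \<and> indep_mod K V M es \<and> spn K V M es = B"

context kspace
begin

abbreviation fgen where "fgen \<equiv> fin_gen_mod K V"
abbreviation mbasis where "mbasis \<equiv> basis_mod K V"

lemma add_eq_minus:
 assumes "a \<in> carrier V" "b \<in> carrier V" "p \<in> carrier V" "q \<in> carrier V" "a \<oplus>\<^bsub>V\<^esub> p = b \<oplus>\<^bsub>V\<^esub> q"
 shows "p \<ominus>\<^bsub>V\<^esub> q = b \<ominus>\<^bsub>V\<^esub> a"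
proof -
 have "p = \<ominus>\<^bsub>V\<^esub> a \<oplus>\<^bsub>V\<^esub> (b \<oplus>\<^bsub>V\<^esub> q)" using assms by (metis M.r_neg1)
 also have "\<dots> = (b \<ominus>\<^bsub>V\<^esub> a) \<oplus>\<^bsub>V\<^esub> q" using assms(1-4) by (simp add: a_minus_def M.a_ac)
 finally show ?thesis using assms(1-4) by (simp add: a_minus_def M.a_assoc M.r_neg)
qed

text \<open>Existence of determinants. By induction on the basis: wedge the volume form of the smaller span
with the linear form that reads off the coefficient of the new basis vector.\<close>

lemma volume_form_exists:
 assumes M: "sub M"
 shows "set es \<subseteq> carrier V ==> indepm M es ==> \<exists>D. altf (spanm M es) M (length es) D \<and> D es = \<one>"
proof (induction es)
 case Nil
 show ?case by (rule exI[of _ "\<lambda>_. \<one>"]) (auto intro!: altI)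
next
 case (Cons e es)
 define N where "N = spanm M es"
 define B where "B = spanm M (e # es)"
 from Cons obtain D where D: "altf N M (length es) D" "D es = \<one>" by (auto simp: N_def)
 have e: "e \<in> carrier V" "e \<notin> N" and esc: "set es \<subseteq> carrier V" using Cons.prems by (auto simp: N_def)
 have N: "sub N" and B: "sub B" and NB: "N \<subseteq> B" and MN: "M \<subseteq> N" and esN: "set es \<subseteq> N" and eB: "e \<in> B"
  using M Cons.prems spn_sub[OF M esc] spn_sub[OF M Cons.prems(1)] spn_Cons_mono[OF M Cons.prems(1)]
   spn_base[OF M esc] spn_gen[OF M esc] spn_gen[OF M Cons.prems(1)]
  by (auto simp: N_def B_def simp del: spn.simps)
 note dN = subD[OF N] note dB = subD[OF B]
 have B_split: "\<exists>x\<in>N. \<exists>c\<in>carrier K. b = x \<oplus>\<^bsub>V\<^esub> c \<odot>\<^bsub>V\<^esub> e" if "b \<in> B" for b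
  using that by (auto simp: B_def N_def)
 have uniq: "c = c' \<and> x = x'" if "x \<oplus>\<^bsub>V\<^esub> c \<odot>\<^bsub>V\<^esub> e = x' \<oplus>\<^bsub>V\<^esub> c' \<odot>\<^bsub>V\<^esub> e" "x \<in> N" "x' \<in> N" "c \<in> carrier K" "c' \<in> carrier K" for x x' c c'
 proof -
  have xc: "x \<in> carrier V" "x' \<in> carrier V" using that dN by auto
  have "(c \<ominus> c') \<odot>\<^bsub>V\<^esub> e = c \<odot>\<^bsub>V\<^esub> e \<ominus>\<^bsub>V\<^esub> c' \<odot>\<^bsub>V\<^esub> e"
   using that e by (simp add: a_minus_def smult_l_distr smult_l_minus)
  also have "\<dots> = x' \<ominus>\<^bsub>V\<^esub> x"
   using that(1) that(4,5) xc e(1) by (intro add_eq_minus) auto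
  also have "\<dots> \<in> N" using that dN by auto
  finally have "(c \<ominus> c') \<odot>\<^bsub>V\<^esub> e \<in> N" .
  then have "c \<ominus> c' = \<zero>" using sub_smult_cancel[OF N _ _ e(1), of "c \<ominus> c'"] e(2) that(4,5) by auto
  then have "c = c'" using R.r_right_minus_eq that(4,5) by blast
  then show ?thesis using that(1) xc that(4) e(1) by simp
 qed
 define l where "l b = (THE c. c \<in> carrier K \<and> (\<exists>x\<in>N. b = x \<oplus>\<^bsub>V\<^esub> c \<odot>\<^bsub>V\<^esub> e))" for b
 define p where "p b = (THE x. x \<in> N \<and> (\<exists>c\<in>carrier K. b = x \<oplus>\<^bsub>V\<^esub> c \<odot>\<^bsub>V\<^esub> e))" for b
 have l_eq: "l (x \<oplus>\<^bsub>V\<^esub> c \<odot>\<^bsub>V\<^esub> e) = c" if "x \<in> N" "c \<in> carrier K" for x c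
  unfolding l_def
 proof (rule the_equality)
  show "c \<in> carrier K \<and> (\<exists>y\<in>N. x \<oplus>\<^bsub>V\<^esub> c \<odot>\<^bsub>V\<^esub> e = y \<oplus>\<^bsub>V\<^esub> c \<odot>\<^bsub>V\<^esub> e)" using that by auto
  fix d assume "d \<in> carrier K \<and> (\<exists>y\<in>N. x \<oplus>\<^bsub>V\<^esub> c \<odot>\<^bsub>V\<^esub> e = y \<oplus>\<^bsub>V\<^esub> d \<odot>\<^bsub>V\<^esub> e)"
  then obtain y where "y \<in> N" "d \<in> carrier K" "x \<oplus>\<^bsub>V\<^esub> c \<odot>\<^bsub>V\<^esub> e = y \<oplus>\<^bsub>V\<^esub> d \<odot>\<^bsub>V\<^esub> e" by auto
  then show "d = c" using uniq[of x c y d] that by simp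
 qed
 have p_eq: "p (x \<oplus>\<^bsub>V\<^esub> c \<odot>\<^bsub>V\<^esub> e) = x" if "x \<in> N" "c \<in> carrier K" for x c
  unfolding p_def
 proof (rule the_equality)
  show "x \<in> N \<and> (\<exists>d\<in>carrier K. x \<oplus>\<^bsub>V\<^esub> c \<odot>\<^bsub>V\<^esub> e = x \<oplus>\<^bsub>V\<^esub> d \<odot>\<^bsub>V\<^esub> e)" using that by auto
  fix y assume "y \<in> N \<and> (\<exists>d\<in>carrier K. x \<oplus>\<^bsub>V\<^esub> c \<odot>\<^bsub>V\<^esub> e = y \<oplus>\<^bsub>V\<^esub> d \<odot>\<^bsub>V\<^esub> e)"
  then obtain d where "y \<in> N" "d \<in> carrier K" "x \<oplus>\<^bsub>V\<^esub> c \<odot>\<^bsub>V\<^esub> e = y \<oplus>\<^bsub>V\<^esub> d \<odot>\<^bsub>V\<^esub> e" by auto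
  then show "y = x" using uniq[of x c y d] that by simp
 qed
 have lN: "l x = \<zero>" and pN: "p x = x" if "x \<in> N" for x
  using l_eq[OF that, of \<zero>] p_eq[OF that, of \<zero>] dN(1)[OF that] e by auto
 have le: "l e = \<one>" using l_eq[OF dN(2), of \<one>] e by simp
 have lc: "l b \<in> carrier K" and pc: "p b \<in> N" if "b \<in> B" for b
  using B_split[OF that] l_eq p_eq by auto
 have lin: "l (w \<oplus>\<^bsub>V\<^esub> c \<odot>\<^bsub>V\<^esub> v) = l w \<oplus> c \<otimes> l v \<and> p (w \<oplus>\<^bsub>V\<^esub> c \<odot>\<^bsub>V\<^esub> v) = p w \<oplus>\<^bsub>V\<^esub> c \<odot>\<^bsub>V\<^esub> p v"
  if "v \<in> B" "w \<in> B" and c: "c \<in> carrier K" for v w c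
 proof -
  from B_split[OF that(1)] B_split[OF that(2)] obtain x a y b where
   xy: "x \<in> N" "a \<in> carrier K" "v = x \<oplus>\<^bsub>V\<^esub> a \<odot>\<^bsub>V\<^esub> e" "y \<in> N" "b \<in> carrier K" "w = y \<oplus>\<^bsub>V\<^esub> b \<odot>\<^bsub>V\<^esub> e" by auto
  have xyc: "x \<in> carrier V" "y \<in> carrier V" using xy dN by auto
  have "w \<oplus>\<^bsub>V\<^esub> c \<odot>\<^bsub>V\<^esub> v = (y \<oplus>\<^bsub>V\<^esub> c \<odot>\<^bsub>V\<^esub> x) \<oplus>\<^bsub>V\<^esub> (b \<oplus> c \<otimes> a) \<odot>\<^bsub>V\<^esub> e"
   using xy xyc c e(1) by (simp add: smult_l_distr smult_r_distr smult_assoc1 M.a_ac)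
  moreover have "y \<oplus>\<^bsub>V\<^esub> c \<odot>\<^bsub>V\<^esub> x \<in> N" using xy c dN by auto
  moreover have "b \<oplus> c \<otimes> a \<in> carrier K" using xy c by simp
  ultimately have "l (w \<oplus>\<^bsub>V\<^esub> c \<odot>\<^bsub>V\<^esub> v) = b \<oplus> c \<otimes> a" "p (w \<oplus>\<^bsub>V\<^esub> c \<odot>\<^bsub>V\<^esub> v) = y \<oplus>\<^bsub>V\<^esub> c \<odot>\<^bsub>V\<^esub> x"
   using l_eq p_eq by metis+
  moreover have "l v = a" "p v = x" "l w = b" "p w = y" unfolding xy(3,6) using l_eq p_eq xy by blast+
  ultimately show ?thesis by simp
 qed
 define om where "om bs = D (map p bs)" for bs
 note d = altD[OF D(1)]
 have pset: "set (map p us) \<subseteq> N" if "set us \<subseteq> B" for us using that pc by auto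
 have om: "altf B M (length es) om"
 proof (rule altI)
  fix bs assume "length bs = length es" "set bs \<subseteq> B"
  then show "om bs \<in> carrier K" unfolding om_def using pset[of bs] by (intro d(1)) simp_all
 next
  fix us c v w ws assume a: "Suc (length us + length ws) = length es" "set us \<subseteq> B" "set ws \<subseteq> B" "v \<in> B" "w \<in> B" "c \<in> carrier K"
  then show "om (us @ (w \<oplus>\<^bsub>V\<^esub> c \<odot>\<^bsub>V\<^esub> v) # ws) = om (us @ w # ws) \<oplus> c \<otimes> om (us @ v # ws)"
   using d(2)[of "map p us" "map p ws" "p v" "p w" c] pset[of us] pset[of ws] pc[of v] pc[of w] lin[of v w c] unfolding om_def by simp
 next
  fix us v ys ws assume a: "Suc (Suc (length us + length ys + length ws)) = length es" "set us \<subseteq> B" "set ys \<subseteq> B" "set ws \<subseteq> B" "v \<in> B"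
  then show "om (us @ v # ys @ v # ws) = \<zero>"
   using d(3)[of "map p us" "map p ys" "map p ws" "p v"] pset[of us] pset[of ys] pset[of ws] pc[of v] unfolding om_def by simp
 next
  fix us m ws assume a: "Suc (length us + length ws) = length es" "set us \<subseteq> B" "set ws \<subseteq> B" "m \<in> M"
  then have "p m = m" using pN[of m] MN by auto
  then show "om (us @ m # ws) = \<zero>"
   using a d(4)[of "map p us" "map p ws" m] pset[of us] pset[of ws] unfolding om_def by simp
 qed
 have 1: "altf B M (Suc (length es)) (wedge_form K l om)"
  using lc lin lN MN NB B om by (intro alt_wedge_form) auto
 have "map p es = es" using esN pN by (simp add: map_idI subset_iff)
 then have omes: "om es = \<one>" using D(2) by (simp add: om_def)
 have "wedge_form K l (\<lambda>xs. om (e # xs)) es = \<zero>"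
 proof (rule wedge_form_zero'[where B = B])
  fix xs :: "'v list" assume "Suc (length xs) = length es" "set xs \<subseteq> B"
  then show "om (e # xs) \<in> carrier K" using eB by (intro altD(1)[OF om]) auto
 qed (use esN NB lN in blast)+
 then have "wedge_form K l om (e # es) = \<one>" using le omes by (simp add: a_minus_def)
 with 1 show ?case unfolding B_def by (intro exI[of _ "wedge_form K l om"]) simp
qed

text \<open>Two alternating forms of top degree that are proportional on a basis are proportional. If the
degree exceeds the number of generators both forms vanish; this is why \<open>base\<close> is conditional.\<close>

lemma alt_expand:
 assumes M: "sub M" and es: "set es \<subseteq> carrier V" and B: "B = spanm M es" and len: "length es \<le> n"
  and D: "altf B M n D" and E: "altf B M n E"
  and cc: "c \<in> carrier K" "d \<in> carrier K"
  and base: "length es = n ==> c \<otimes> D es = d \<otimes> E es"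
  and bs: "length bs = n" "set bs \<subseteq> B"
 shows "c \<otimes> D bs = d \<otimes> E bs"
proof -
 have sB: "sub B" using spn_sub[OF M es] B by simp
 note dD = altD[OF D] note dE = altD[OF E]
 define P where "P bs \<longleftrightarrow> c \<otimes> D bs = d \<otimes> E bs" for bs
 have "P bs"
 proof (rule multilinear_expand[where P = P, OF M es B])
  fix us a v w ws
  assume a: "Suc (length us + length ws) = n" "set us \<subseteq> B" "set ws \<subseteq> B" "v \<in> B" "w \<in> B" "a \<in> carrier K"
   and P: "P (us @ v # ws)" "P (us @ w # ws)"
  have "D (us @ x # ws) \<in> carrier K \<and> E (us @ x # ws) \<in> carrier K" if "x \<in> B" for x
   using a(1-3) that by (intro conjI dD(1) dE(1)) auto
  from this[OF a(4)] this[OF a(5)] show "P (us @ (w \<oplus>\<^bsub>V\<^esub> a \<odot>\<^bsub>V\<^esub> v) # ws)"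
   using a(6) P cc unfolding P_def dD(2)[OF a(1-6)] dE(2)[OF a(1-6)]
   by (simp add: R.r_distr R.m_lcomm[of c a] R.m_lcomm[of d a])
 next
  fix us v w ws
  assume a: "Suc (Suc (length us + length ws)) = n" "set us \<subseteq> B" "set ws \<subseteq> B" "v \<in> B" "w \<in> B"
   and P: "P (us @ v # w # ws)"
  have "D (us @ v # w # ws) \<in> carrier K" "E (us @ v # w # ws) \<in> carrier K"
   using a(1-5) by (auto intro!: dD(1) dE(1))
  then show "P (us @ w # v # ws)"
   using P cc unfolding P_def alt_swap[OF D sB a(1-5)] alt_swap[OF E sB a(1-5)] by (simp add: R.r_minus)
 next
  fix us v ys ws assume "Suc (Suc (length us + length ys + length ws)) = n" "set us \<subseteq> B" "set ys \<subseteq> B" "set ws \<subseteq> B" "v \<in> B"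
  from dD(3)[OF this] dE(3)[OF this] show "P (us @ v # ys @ v # ws)" using cc by (simp add: P_def)
 next
  fix us m ws assume "Suc (length us + length ws) = n" "set us \<subseteq> B" "set ws \<subseteq> B" "m \<in> M"
  from dD(4)[OF this] dE(4)[OF this] show "P (us @ m # ws)" using cc by (simp add: P_def)
 next
  show "length es = n ==> P es" using base by (simp add: P_def)
 qed (fact len bs)+
 then show ?thesis by (simp add: P_def)
qed

lemma zero_alt: "altf B M n (\<lambda>_. \<zero>)"
 by (rule altI) (simp_all add: R.zero_closed)

text \<open>The volume form of an independent list \<open>bs\<close> takes the value \<open>1\<close>; if \<open>bs\<close> were longer than a
generating list, every such form would vanish by \<open>alt_expand\<close>.\<close>

lemma indep_length_le:
 assumes M: "sub M" and es: "set es \<subseteq> carrier V" "indepm M es" and bs: "set bs \<subseteq> carrier V" "spanm M bs = spanm M es"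
 shows "length es \<le> length bs"
proof (rule ccontr)
 assume len: "\<not> length es \<le> length bs"
 obtain D where D: "altf (spanm M es) M (length es) D" "D es = \<one>" using volume_form_exists[OF M es] by auto
 have "\<one> \<otimes> D es = \<one> \<otimes> (\<lambda>_. \<zero>) es"
 proof (rule alt_expand[OF M bs(1) bs(2)[symmetric] _ D(1)])
  show "altf (spanm M es) M (length es) (\<lambda>_. \<zero>)" by (rule zero_alt)
  show "set es \<subseteq> spanm M es" by (rule spn_gen[OF M es(1)])
 qed (use len in simp_all)
 then show False using D(2) by simp
qed

end

section \<open>Quotients and their dimensions\<close>

text \<open>Module laws are transported along any surjection that respects the operations. This is applied
to the coset map, whose target carries operations defined on cosets.\<close>

lemma image_module:
 assumes U: "module K U"
  and car: "q ` carrier U = carrier W"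
  and add: "!!x y. x \<in> carrier U ==> y \<in> carrier U ==> q x \<oplus>\<^bsub>W\<^esub> q y = q (x \<oplus>\<^bsub>U\<^esub> y)"
  and smult: "!!c x. c \<in> carrier K ==> x \<in> carrier U ==> c \<odot>\<^bsub>W\<^esub> q x = q (c \<odot>\<^bsub>U\<^esub> x)"
  and zero: "\<zero>\<^bsub>W\<^esub> = q \<zero>\<^bsub>U\<^esub>"
 shows "module K W"
proof -
 interpret U: module K U by fact
 have *: "(\<forall>w\<in>carrier W. P w) \<longleftrightarrow> (\<forall>x\<in>carrier U. P (q x))" for P
  using car by (metis imageE image_eqI)
 have all: "(\<forall>w. w \<in> carrier W --> P w) \<longleftrightarrow> (\<forall>x\<in>carrier U. P (q x))" for P
  using * by blast
 have qc: "q x \<in> carrier W" if "x \<in> carrier U" for x using car that by blast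
 show ?thesis
 proof (rule module_criteria)
  show "cring K" by (rule U.R.is_cring)
  show "\<zero>\<^bsub>W\<^esub> \<in> carrier W" using zero qc by simp
  show "\<forall>v w. v \<in> carrier W \<and> w \<in> carrier W --> v \<oplus>\<^bsub>W\<^esub> w \<in> carrier W"
   by (simp add: imp_conjL all add qc)
  show "\<forall>v\<in>carrier W. \<exists>neg_v\<in>carrier W. v \<oplus>\<^bsub>W\<^esub> neg_v = \<zero>\<^bsub>W\<^esub>"
   unfolding * by (metis U.M.add.inv_closed U.M.r_neg add qc zero)
  show "\<forall>c v. c \<in> carrier K \<and> v \<in> carrier W --> c \<odot>\<^bsub>W\<^esub> v \<in> carrier W"
   by (simp add: imp_conjL all smult qc)
  show "\<forall>v w. v \<in> carrier W \<and> w \<in> carrier W --> v \<oplus>\<^bsub>W\<^esub> w = w \<oplus>\<^bsub>W\<^esub> v"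
   by (simp add: imp_conjL all add U.M.a_comm)
  show "\<forall>v w x. v \<in> carrier W \<and> w \<in> carrier W \<and> x \<in> carrier W --> v \<oplus>\<^bsub>W\<^esub> w \<oplus>\<^bsub>W\<^esub> x = v \<oplus>\<^bsub>W\<^esub> (w \<oplus>\<^bsub>W\<^esub> x)"
   by (simp add: imp_conjL all add U.M.a_assoc)
  show "\<forall>v\<in>carrier W. v \<oplus>\<^bsub>W\<^esub> \<zero>\<^bsub>W\<^esub> = v" unfolding * by (simp add: zero add)
  show "\<forall>a b v. a \<in> carrier K \<and> b \<in> carrier K \<and> v \<in> carrier W --> (a \<otimes>\<^bsub>K\<^esub> b) \<odot>\<^bsub>W\<^esub> v = a \<odot>\<^bsub>W\<^esub> (b \<odot>\<^bsub>W\<^esub> v)"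
   by (simp add: imp_conjL all smult U.smult_assoc1)
  show "\<forall>v\<in>carrier W. \<one>\<^bsub>K\<^esub> \<odot>\<^bsub>W\<^esub> v = v" unfolding * by (simp add: smult)
  show "\<forall>a b v. a \<in> carrier K \<and> b \<in> carrier K \<and> v \<in> carrier W --> (a \<oplus>\<^bsub>K\<^esub> b) \<odot>\<^bsub>W\<^esub> v = a \<odot>\<^bsub>W\<^esub> v \<oplus>\<^bsub>W\<^esub> b \<odot>\<^bsub>W\<^esub> v"
   by (simp add: imp_conjL all smult add U.smult_l_distr)
  show "\<forall>a v w. a \<in> carrier K \<and> v \<in> carrier W \<and> w \<in> carrier W --> a \<odot>\<^bsub>W\<^esub> (v \<oplus>\<^bsub>W\<^esub> w) = a \<odot>\<^bsub>W\<^esub> v \<oplus>\<^bsub>W\<^esub> a \<odot>\<^bsub>W\<^esub> w"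
   by (simp add: imp_conjL all smult add U.smult_r_distr)
 qed
qed

lemma coset_def': "N +>\<^bsub>U\<^esub> a = (\<lambda>h. h \<oplus>\<^bsub>U\<^esub> a) ` N"
 by (auto simp: a_r_coset_def')

lemma coset_carrier_update [simp]: "N +>\<^bsub>U\<lparr>carrier := B\<rparr>\<^esub> a = N +>\<^bsub>U\<^esub> (a :: 'a)"
 by (simp add: coset_def')

locale quot_space = module K U for K :: "'k ring" and U :: "('k, 'u) module" +
 fixes N :: "'u set"
 assumes N: "submodule K N U"
begin

abbreviation q where "q x \<equiv> N +>\<^bsub>U\<^esub> x"

lemma Nsub: "N \<subseteq> carrier U" and Nzero: "\<zero>\<^bsub>U\<^esub> \<in> N" and Nadd: "x \<in> N ==> y \<in> N ==> x \<oplus>\<^bsub>U\<^esub> y \<in> N"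
 and Nsmult: "c \<in> carrier K ==> x \<in> N ==> c \<odot>\<^bsub>U\<^esub> x \<in> N"
 using N by (auto simp: submodule_def)

lemma Nc: "x \<in> N ==> x \<in> carrier U" using Nsub by auto

lemma Nneg: "x \<in> N ==> \<ominus>\<^bsub>U\<^esub> x \<in> N"
 using Nsmult[of "\<ominus>\<^bsub>K\<^esub> \<one>\<^bsub>K\<^esub>" x] by (simp add: smult_minus_1 Nc)

lemma q_self: "x \<in> carrier U ==> x \<in> q x"
 using Nzero by (auto simp: coset_def' intro!: image_eqI[of _ _ "\<zero>\<^bsub>U\<^esub>"])

lemma q_eq_iff: "x \<in> carrier U ==> y \<in> carrier U ==> q x = q y \<longleftrightarrow> x \<ominus>\<^bsub>U\<^esub> y \<in> N"
proof
 assume c: "x \<in> carrier U" "y \<in> carrier U"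
 { assume "q x = q y"
  then have "x \<in> q y" using q_self[OF c(1)] by simp
  then obtain h where "h \<in> N" "x = h \<oplus>\<^bsub>U\<^esub> y" by (auto simp: coset_def')
  then show "x \<ominus>\<^bsub>U\<^esub> y \<in> N" using c Nc[of h] by (simp add: a_minus_def M.a_assoc M.r_neg) }
 { assume xy: "x \<ominus>\<^bsub>U\<^esub> y \<in> N"
  have 1: "q a \<subseteq> q b" if "a \<in> carrier U" "b \<in> carrier U" "a \<ominus>\<^bsub>U\<^esub> b \<in> N" for a b
  proof
   fix z assume "z \<in> q a"
   then obtain h where h: "h \<in> N" "z = h \<oplus>\<^bsub>U\<^esub> a" by (auto simp: coset_def')
   then have "z = (h \<oplus>\<^bsub>U\<^esub> (a \<ominus>\<^bsub>U\<^esub> b)) \<oplus>\<^bsub>U\<^esub> b" using that Nc[of h] by (simp add: a_minus_def M.a_assoc M.l_neg)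
   then show "z \<in> q b" using Nadd[OF h(1) that(3)] by (auto simp: coset_def')
  qed
  have "\<ominus>\<^bsub>U\<^esub> (x \<ominus>\<^bsub>U\<^esub> y) = y \<ominus>\<^bsub>U\<^esub> x" using c by (simp add: a_minus_def M.minus_add M.a_comm)
  then have "y \<ominus>\<^bsub>U\<^esub> x \<in> N" using Nneg[OF xy] by simp
  then show "q x = q y" using 1 xy c by blast }
qed

lemma q_mem: "x \<in> carrier U ==> y \<in> q x ==> y \<in> carrier U \<and> q y = q x"
proof -
 assume x: "x \<in> carrier U" and "y \<in> q x"
 then obtain h where h: "h \<in> N" "y = h \<oplus>\<^bsub>U\<^esub> x" by (auto simp: coset_def')
 then have "y \<in> carrier U" "y \<ominus>\<^bsub>U\<^esub> x = h" using x Nc[of h] by (auto simp: a_minus_def M.a_assoc M.r_neg)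
 then show ?thesis using q_eq_iff[of y x] x h by auto
qed

lemma q_carrier: "carrier (quot_mod U N) = q ` carrier U"
 by (auto simp: quot_mod_def A_RCOSETS_def RCOSETS_def a_r_coset_def)

lemma q_add: "x \<in> carrier U ==> y \<in> carrier U ==> q x \<oplus>\<^bsub>quot_mod U N\<^esub> q y = q (x \<oplus>\<^bsub>U\<^esub> y)"
proof -
 assume c: "x \<in> carrier U" "y \<in> carrier U"
 have "q x <+>\<^bsub>U\<^esub> q y = q (x \<oplus>\<^bsub>U\<^esub> y)"
 proof safe
  fix z assume "z \<in> q x <+>\<^bsub>U\<^esub> q y"
  then obtain h k where h: "h \<in> N" "k \<in> N" "z = (h \<oplus>\<^bsub>U\<^esub> x) \<oplus>\<^bsub>U\<^esub> (k \<oplus>\<^bsub>U\<^esub> y)"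
   by (auto simp: coset_def' set_add_def')
  then have "z = (h \<oplus>\<^bsub>U\<^esub> k) \<oplus>\<^bsub>U\<^esub> (x \<oplus>\<^bsub>U\<^esub> y)" using c Nc by (simp add: M.a_ac)
  then show "z \<in> q (x \<oplus>\<^bsub>U\<^esub> y)" using Nadd h by (auto simp: coset_def')
 next
  fix z assume "z \<in> q (x \<oplus>\<^bsub>U\<^esub> y)"
  then obtain h where h: "h \<in> N" "z = h \<oplus>\<^bsub>U\<^esub> (x \<oplus>\<^bsub>U\<^esub> y)" by (auto simp: coset_def')
  then have "z = (h \<oplus>\<^bsub>U\<^esub> x) \<oplus>\<^bsub>U\<^esub> y" using c Nc[of h] by (simp add: M.a_assoc)
  moreover have "h \<oplus>\<^bsub>U\<^esub> x \<in> q x" using h by (auto simp: coset_def')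
  ultimately show "z \<in> q x <+>\<^bsub>U\<^esub> q y" using q_self[OF c(2)] unfolding set_add_def' by blast
 qed
 then show ?thesis by (simp add: quot_mod_def)
qed

lemma q_smult: "c \<in> carrier K ==> x \<in> carrier U ==> c \<odot>\<^bsub>quot_mod U N\<^esub> q x = q (c \<odot>\<^bsub>U\<^esub> x)"
proof -
 assume c: "c \<in> carrier K" "x \<in> carrier U"
 have "N <+>\<^bsub>U\<^esub> ((\<lambda>y. c \<odot>\<^bsub>U\<^esub> y) ` q x) = q (c \<odot>\<^bsub>U\<^esub> x)"
 proof safe
  fix z assume "z \<in> N <+>\<^bsub>U\<^esub> ((\<lambda>y. c \<odot>\<^bsub>U\<^esub> y) ` q x)"
  then obtain h k where h: "h \<in> N" "k \<in> N" "z = h \<oplus>\<^bsub>U\<^esub> c \<odot>\<^bsub>U\<^esub> (k \<oplus>\<^bsub>U\<^esub> x)"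
   by (auto simp: coset_def' set_add_def')
  then have "z = (h \<oplus>\<^bsub>U\<^esub> c \<odot>\<^bsub>U\<^esub> k) \<oplus>\<^bsub>U\<^esub> c \<odot>\<^bsub>U\<^esub> x" using c Nc by (simp add: M.a_assoc smult_r_distr)
  then show "z \<in> q (c \<odot>\<^bsub>U\<^esub> x)" using Nadd[OF h(1) Nsmult[OF c(1) h(2)]] by (auto simp: coset_def')
 next
  fix z assume "z \<in> q (c \<odot>\<^bsub>U\<^esub> x)"
  then obtain h where h: "h \<in> N" "z = h \<oplus>\<^bsub>U\<^esub> c \<odot>\<^bsub>U\<^esub> x" by (auto simp: coset_def')
  then show "z \<in> N <+>\<^bsub>U\<^esub> ((\<lambda>y. c \<odot>\<^bsub>U\<^esub> y) ` q x)" using q_self[OF c(2)] unfolding set_add_def' by blast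
 qed
 then show ?thesis by (simp add: quot_mod_def)
qed

lemma q_zero: "\<zero>\<^bsub>quot_mod U N\<^esub> = q \<zero>\<^bsub>U\<^esub>"
 using Nc by (auto simp: quot_mod_def coset_def' intro!: image_eqI)

lemma quot_module: "module K (quot_mod U N)"
 by (rule image_module[where q = "\<lambda>x. q x" and U = U]) (auto simp: q_carrier q_add q_smult q_zero module_axioms)

lemma vimage_submodule:
 assumes "submodule K L (quot_mod U N)" shows "submodule K {x \<in> carrier U. q x \<in> L} U"
 using assms module_axioms unfolding submodule_def
 by (auto simp: q_add[symmetric] q_smult[symmetric] q_zero[symmetric])

lemma image_submodule:
 assumes "submodule K L U" shows "submodule K (q ` L) (quot_mod U N)"
proof -
 have L: "L \<subseteq> carrier U" "\<zero>\<^bsub>U\<^esub> \<in> L" "!!x y. x \<in> L ==> y \<in> L ==> x \<oplus>\<^bsub>U\<^esub> y \<in> L"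
  "!!c x. c \<in> carrier K ==> x \<in> L ==> c \<odot>\<^bsub>U\<^esub> x \<in> L" using assms by (auto simp: submodule_def)
 have c: "x \<in> carrier U" if "x \<in> L" for x using that L by auto
 show ?thesis unfolding submodule_def
  using L c by (auto simp: q_add q_smult q_zero quot_module q_carrier)
qed

end

lemma span_submodule_eq:
 assumes "module K U" "S \<subseteq> carrier U"
 shows "LinearCombinations.module.span K U S = carrier U \<longleftrightarrow> (\<forall>L. submodule K L U --> S \<subseteq> L --> carrier U \<subseteq> L)"
proof -
 interpret module K U by fact
 show ?thesis
  using span_is_submodule[OF assms(2)] in_own_span[OF assms(2)] span_is_subset[of S] span_is_subset2[OF assms(2)]
  by (metis subset_antisym)
qed

context kspace
begin

lemma subquot_quot: "sub B ==> sub M ==> M \<subseteq> B ==> quot_space K (V\<lparr>carrier := B\<rparr>) M"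
 unfolding quot_space_def quot_space_axioms_def
 by (auto intro!: submodule_is_module simp: submodule_def)

lemma subquot_kspace: "sub B ==> sub M ==> M \<subseteq> B ==> kspace K (subquot V B M)"
 using quot_space.quot_module[OF subquot_quot] field_axioms
 by (simp add: kspace_def vectorspace_def subquot_def)

end

lemma (in quot_space) q_N: "m \<in> N ==> q m = q \<zero>\<^bsub>U\<^esub>"
 using q_eq_iff[of m "\<zero>\<^bsub>U\<^esub>"] Nc[of m] Nadd[OF _ Nneg[OF Nzero], of m] by (simp add: a_minus_def)

context kspace
begin

text \<open>Generating sets of the quotient record \<open>subquot V B M\<close> in terms of lists of representatives.\<close>

lemma gen_set_subquot:
 assumes B: "sub B" and M: "sub M" "M \<subseteq> B" and bs: "set bs \<subseteq> B"
 shows "LinearCombinations.module.span K (subquot V B M) ((\<lambda>b. M +>\<^bsub>V\<^esub> b) ` set bs) = carrier (subquot V B M) \<longleftrightarrow>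
  spanm M bs = B"
proof -
 interpret Q: quot_space K "V\<lparr>carrier := B\<rparr>" M by (rule subquot_quot[OF B M])
 have bsc: "set bs \<subseteq> carrier V" using bs subD(1)[OF B] by auto
 have subB: "submodule K L (V\<lparr>carrier := B\<rparr>) \<longleftrightarrow> sub L \<and> L \<subseteq> B" for L
  using B module_axioms Q.module_axioms by (auto simp: submodule_def)
 have car: "carrier (subquot V B M) = (\<lambda>b. M +>\<^bsub>V\<^esub> b) ` B" using Q.q_carrier by (simp add: subquot_def)
 have im: "(\<lambda>b. M +>\<^bsub>V\<^esub> b) ` set bs \<subseteq> carrier (subquot V B M)" using bs car by auto
 have mod: "module K (subquot V B M)" using Q.quot_module by (simp add: subquot_def)
 let ?N = "spanm M bs"
 have N: "sub ?N" "?N \<subseteq> B" "M \<subseteq> ?N" "set bs \<subseteq> ?N"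
  using spn_sub[OF M(1) bsc] spn_least[OF B M(2) bs] spn_base[OF M(1) bsc] spn_gen[OF M(1) bsc] by auto
 show ?thesis unfolding span_submodule_eq[OF mod im]
 proof (intro iffI allI impI)
  fix L assume eq: "?N = B" and L: "submodule K L (subquot V B M)" "(\<lambda>b. M +>\<^bsub>V\<^esub> b) ` set bs \<subseteq> L"
  let ?L = "{x \<in> B. M +>\<^bsub>V\<^esub> x \<in> L}"
  have "sub ?L" using Q.vimage_submodule[of L] L(1) subB by (simp add: subquot_def)
  moreover have "M \<subseteq> ?L"
  proof
   fix m assume m: "m \<in> M"
   then have mB: "m \<in> B" using M by auto
   have "M +>\<^bsub>V\<^esub> m = M +>\<^bsub>V\<^esub> \<zero>\<^bsub>V\<^esub>" using Q.q_N[OF m] by simp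
   moreover have "M +>\<^bsub>V\<^esub> \<zero>\<^bsub>V\<^esub> \<in> L" using L(1) Q.q_zero by (simp add: submodule_def subquot_def)
   ultimately show "m \<in> ?L" using mB by simp
  qed
  ultimately have "B \<subseteq> ?L" using spn_least[of ?L M bs] L(2) bs eq by auto
  then show "carrier (subquot V B M) \<subseteq> L" using car by auto
 next
  assume a: "\<forall>L. submodule K L (subquot V B M) --> (\<lambda>b. M +>\<^bsub>V\<^esub> b) ` set bs \<subseteq> L --> carrier (subquot V B M) \<subseteq> L"
  have "submodule K ((\<lambda>b. M +>\<^bsub>V\<^esub> b) ` ?N) (subquot V B M)"
   using Q.image_submodule[of ?N] subB N by (simp add: subquot_def)
  then have *: "(\<lambda>b. M +>\<^bsub>V\<^esub> b) ` B \<subseteq> (\<lambda>b. M +>\<^bsub>V\<^esub> b) ` ?N" using a N(4) car by auto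
  have "B \<subseteq> ?N"
  proof
   fix b assume b: "b \<in> B"
   then obtain x where x: "x \<in> ?N" "M +>\<^bsub>V\<^esub> b = M +>\<^bsub>V\<^esub> x" using * by auto
   have "b \<in> M +>\<^bsub>V\<^esub> x" using Q.q_self[of b] b x by simp
   then obtain m where "m \<in> M" "b = m \<oplus>\<^bsub>V\<^esub> x" by (auto simp: coset_def')
   then show "b \<in> ?N" using N x subD(3) by auto
  qed
  then show "?N = B" using N by auto
 qed
qed

lemma sub_fgen_basis:
 assumes "sub M" "fgen B M" shows "\<exists>es. mbasis B M es"
 using assms spn_extract_basis[OF assms(1)] unfolding fin_gen_mod_def basis_mod_def by (metis subset_trans)

lemma mbasisD:
 assumes "sub M" "mbasis B M es"
 shows "set es \<subseteq> B" "M \<subseteq> B" "sub B" "set es \<subseteq> carrier V" "fgen B M"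
 using assms spn_gen spn_base spn_sub unfolding basis_mod_def fin_gen_mod_def by blast+

lemma mbasis_length:
 assumes M: "sub M" and es: "mbasis B M es" and bs: "set bs \<subseteq> carrier V" "spanm M bs = B"
 shows "length es \<le> length bs"
 using indep_length_le[OF M, of es bs] es bs unfolding basis_mod_def by simp

lemma fgen_sub: "sub M ==> fgen B M ==> M \<subseteq> B \<and> sub B"
 using spn_sub spn_base unfolding fin_gen_mod_def by blast

lemma finite_gens_subquot:
 assumes B: "sub B" and M: "sub M" "M \<subseteq> B"
 shows "(finite A \<and> card A = n \<and> A \<subseteq> carrier (subquot V B M) \<and>
   LinearCombinations.module.span K (subquot V B M) A = carrier (subquot V B M)) ==>
   \<exists>bs. set bs \<subseteq> B \<and> length bs = n \<and> spanm M bs = B"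
proof -
 assume A: "finite A \<and> card A = n \<and> A \<subseteq> carrier (subquot V B M) \<and>
   LinearCombinations.module.span K (subquot V B M) A = carrier (subquot V B M)"
 interpret Q: quot_space K "V\<lparr>carrier := B\<rparr>" M by (rule subquot_quot[OF B M])
 have car: "carrier (subquot V B M) = (\<lambda>b. M +>\<^bsub>V\<^esub> b) ` B" using Q.q_carrier by (simp add: subquot_def)
 obtain S where S: "S \<subseteq> B" "inj_on (\<lambda>b. M +>\<^bsub>V\<^esub> b) S" "A = (\<lambda>b. M +>\<^bsub>V\<^esub> b) ` S"
  using A car subset_image_inj[of A "\<lambda>b. M +>\<^bsub>V\<^esub> b" B] by auto
 have "finite S" using A finite_imageD[OF _ S(2)] unfolding S(3) by simp
 moreover have "card S = n" using A card_image[OF S(2)] unfolding S(3) by simp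
 ultimately obtain bs where bs: "set bs = S" "length bs = n" using finite_distinct_list[of S] distinct_card by metis
 have "spanm M bs = B" using gen_set_subquot[OF B M, of bs] bs(1) S(1) A unfolding S(3) by simp
 then show ?thesis using bs S(1) by blast
qed

lemma gens_finite_subquot:
 assumes B: "sub B" and M: "sub M" "M \<subseteq> B" and bs: "set bs \<subseteq> B" "spanm M bs = B"
 shows "\<exists>A. finite A \<and> card A \<le> length bs \<and> A \<subseteq> carrier (subquot V B M) \<and>
   LinearCombinations.module.span K (subquot V B M) A = carrier (subquot V B M)"
proof -
 interpret Q: quot_space K "V\<lparr>carrier := B\<rparr>" M by (rule subquot_quot[OF B M])
 have car: "carrier (subquot V B M) = (\<lambda>b. M +>\<^bsub>V\<^esub> b) ` B" using Q.q_carrier by (simp add: subquot_def)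
 show ?thesis
  using gen_set_subquot[OF B M bs(1)] bs car
  by (intro exI[of _ "(\<lambda>b. M +>\<^bsub>V\<^esub> b) ` set bs"]) (auto intro: le_trans[OF card_image_le] card_length)
qed

lemma fin_dim_subquot:
 assumes B: "sub B" and M: "sub M" "M \<subseteq> B"
 shows "vectorspace.fin_dim K (subquot V B M) \<longleftrightarrow> fgen B M"
proof -
 interpret W: kspace K "subquot V B M" by (rule subquot_kspace[OF B M])
 show ?thesis
 proof
  assume "W.fin_dim"
  then obtain A where A: "finite A \<and> A \<subseteq> carrier (subquot V B M) \<and> W.span A = carrier (subquot V B M)"
   unfolding W.fin_dim_def by auto
  obtain bs where bs: "set bs \<subseteq> B" "spanm M bs = B"
   using finite_gens_subquot[OF B M, of A "card A"] A by auto
  then show "fgen B M" using subD(1)[OF B] unfolding fin_gen_mod_def by (intro exI[of _ bs]) auto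
 next
  assume "fgen B M"
  then obtain bs where bs: "set bs \<subseteq> carrier V" "spanm M bs = B" by (auto simp: fin_gen_mod_def)
  then have "set bs \<subseteq> B" using spn_gen[OF M(1) bs(1)] by simp
  from gens_finite_subquot[OF B M this bs(2)] show "W.fin_dim" unfolding W.fin_dim_def by auto
 qed
qed

text \<open>Links the dimension of the quotient record with bases modulo \<open>M\<close>; everything later about
\<open>qdim\<close> is deduced from it.\<close>

lemma qdim_eq_length:
 assumes M: "sub M" and es: "mbasis B M es"
 shows "qdim K V B M = length es"
proof -
 note d = mbasisD[OF M es]
 interpret W: kspace K "subquot V B M" by (rule subquot_kspace[OF d(3) M d(2)])
 let ?P = "\<lambda>n. \<exists>A. finite A \<and> card A = n \<and> A \<subseteq> carrier (subquot V B M) \<and> W.span A = carrier (subquot V B M)"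
 have le: "length es \<le> n" if n: "?P n" for n
 proof -
  obtain A where A: "finite A \<and> card A = n \<and> A \<subseteq> carrier (subquot V B M) \<and> W.span A = carrier (subquot V B M)"
   using n by blast
  obtain bs where bs: "set bs \<subseteq> B" "length bs = n" "spanm M bs = B"
   using finite_gens_subquot[OF d(3) M d(2) A] by blast
  then show ?thesis using mbasis_length[OF M es, of bs] subD(1)[OF d(3)] by auto
 qed
 obtain A where A: "finite A" "card A \<le> length es" "A \<subseteq> carrier (subquot V B M)" "W.span A = carrier (subquot V B M)"
  using gens_finite_subquot[OF d(3) M d(2,1)] es unfolding basis_mod_def by blast
 then have PA: "?P (card A)" by (intro exI[of _ A]) simp
 have "card A = length es" using le[OF PA] A(2) by (rule order_antisym[rotated])
 with PA have "?P (length es)" by simp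
 then show ?thesis unfolding qdim_def W.dim_def
  by (rule Least_equality) (rule le)
qed

end

lemma free_on_simps:
 "carrier (free_on K I) = {f \<in> I \<rightarrow>\<^sub>E carrier K. finite {x \<in> I. f x \<noteq> \<zero>\<^bsub>K\<^esub>}}"
 "f \<oplus>\<^bsub>free_on K I\<^esub> g = (\<lambda>v\<in>I. f v \<oplus>\<^bsub>K\<^esub> g v)"
 "c \<odot>\<^bsub>free_on K I\<^esub> f = (\<lambda>v\<in>I. c \<otimes>\<^bsub>K\<^esub> f v)"
 "\<zero>\<^bsub>free_on K I\<^esub> = (\<lambda>v\<in>I. \<zero>\<^bsub>K\<^esub>)"
 if "ring K"
 using that by (simp_all add: free_on_def ring.func_space_def)

context kspace
begin

lemma ringK: "ring K" by (rule R.ring_axioms)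

lemma free_module: "module K (free_on K (I :: 'x set))"
proof -
 interpret F: module K "func_space I" by (rule R.func_space_is_module)
 let ?S = "{f \<in> I \<rightarrow>\<^sub>E carrier K. finite {x \<in> I. f x \<noteq> \<zero>}}"
 have car: "carrier (func_space I) = I \<rightarrow>\<^sub>E carrier K" by (simp add: func_space_def)
 have supp: "finite {x \<in> I. h x \<noteq> \<zero>}" if "finite A" "!!x. x \<in> I ==> x \<notin> A ==> h x = \<zero>" for h :: "'x => 'k" and A
  by (rule finite_subset[OF _ that(1)]) (use that(2) in blast)
 have "submodule K ?S (func_space I)"
 proof (rule submodule.intro)
  show "?S \<subseteq> carrier (func_space I)" unfolding car by blast
  show "\<zero>\<^bsub>func_space I\<^esub> \<in> ?S"
  proof -
   have "{x \<in> I. \<zero>\<^bsub>func_space I\<^esub> x \<noteq> \<zero>} = {}" by (auto simp: func_space_def)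
   then show ?thesis using F.M.zero_closed unfolding car by (simp only: mem_Collect_eq finite.emptyI simp_thms)
  qed
 next
  fix f g assume a: "f \<in> ?S" "g \<in> ?S"
  have "f \<oplus>\<^bsub>func_space I\<^esub> g \<in> I \<rightarrow>\<^sub>E carrier K" using F.M.add.m_closed[of f g] a unfolding car by simp
  moreover have "finite {x \<in> I. (f \<oplus>\<^bsub>func_space I\<^esub> g) x \<noteq> \<zero>}"
  proof (rule supp)
   show "finite ({x \<in> I. f x \<noteq> \<zero>} \<union> {x \<in> I. g x \<noteq> \<zero>})" using a by simp
   show "(f \<oplus>\<^bsub>func_space I\<^esub> g) x = \<zero>" if "x \<in> I" "x \<notin> {x \<in> I. f x \<noteq> \<zero>} \<union> {x \<in> I. g x \<noteq> \<zero>}" for x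
    using that a by (simp add: func_space_def)
  qed
  ultimately show "f \<oplus>\<^bsub>func_space I\<^esub> g \<in> ?S" by simp
 next
  fix c f assume a: "c \<in> carrier K" "f \<in> ?S"
  have "c \<odot>\<^bsub>func_space I\<^esub> f \<in> I \<rightarrow>\<^sub>E carrier K" using F.smult_closed[of c f] a unfolding car by simp
  moreover have "finite {x \<in> I. (c \<odot>\<^bsub>func_space I\<^esub> f) x \<noteq> \<zero>}"
  proof (rule supp)
   show "finite ({x \<in> I. f x \<noteq> \<zero>})" using a by simp
   show "(c \<odot>\<^bsub>func_space I\<^esub> f) x = \<zero>" if "x \<in> I" "x \<notin> {x \<in> I. f x \<noteq> \<zero>}" for x
    using that a by (simp add: func_space_def)
  qed
  ultimately show "c \<odot>\<^bsub>func_space I\<^esub> f \<in> ?S" by simp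
 qed (rule F.module_axioms)
 from F.submodule_is_module[OF this] show ?thesis by (simp add: free_on_def)
qed

lemma free_gen_carrier: "x \<in> I ==> free_gen K I x \<in> carrier (free_on K I)"
proof -
 assume "x \<in> I"
 then have "{y \<in> I. free_gen K I x y \<noteq> \<zero>} = {x}" by (auto simp: free_gen_def)
 then show ?thesis by (auto simp: free_on_simps[OF ringK] free_gen_def)
qed

lemma free_on_induct:
 assumes L: "submodule K L (free_on K I)" and gen: "!!x. x \<in> I ==> free_gen K I x \<in> L"
 shows "carrier (free_on K I) \<subseteq> L"
proof
 interpret F: module K "free_on K I" by (rule free_module)
 fix f assume f: "f \<in> carrier (free_on K I)"
 have "\<forall>f. f \<in> carrier (free_on K I) --> {x \<in> I. f x \<noteq> \<zero>} \<subseteq> A --> f \<in> L" if "finite A" for A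
  using that
 proof (induction A)
  case empty
  show ?case
  proof (intro allI impI)
   fix f assume f: "f \<in> carrier (free_on K I)" "{x \<in> I. f x \<noteq> \<zero>} \<subseteq> {}"
   then have "f = \<zero>\<^bsub>free_on K I\<^esub>"
    by (auto simp: free_on_simps[OF ringK] PiE_def extensional_def fun_eq_iff)
   then show "f \<in> L" using L by (simp add: submodule_def)
  qed
 next
  case (insert a A)
  show ?case
  proof (intro allI impI)
   fix f assume f: "f \<in> carrier (free_on K I)" "{x \<in> I. f x \<noteq> \<zero>} \<subseteq> insert a A"
   show "f \<in> L"
   proof (cases "a \<in> I")
    case False
    then have "{x \<in> I. f x \<noteq> \<zero>} \<subseteq> A" using f(2) by auto
    with insert.IH f(1) show ?thesis by simp
   next
    case True
    have fa: "f x \<in> carrier K" if "x \<in> I" for x using f that by (auto simp: free_on_simps[OF ringK])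
    define g where "g = (\<lambda>x\<in>I. if x = a then \<zero> else f x)"
    have "{x \<in> I. g x \<noteq> \<zero>} \<subseteq> {x \<in> I. f x \<noteq> \<zero>}" by (auto simp: g_def)
    moreover have "finite {x \<in> I. f x \<noteq> \<zero>}" using f(1) by (simp add: free_on_simps[OF ringK])
    ultimately have "finite {x \<in> I. g x \<noteq> \<zero>}" by (rule finite_subset)
    moreover have "g \<in> I \<rightarrow>\<^sub>E carrier K" using fa by (auto simp: g_def)
    ultimately have g: "g \<in> carrier (free_on K I)" by (simp add: free_on_simps[OF ringK])
    have "{x \<in> I. g x \<noteq> \<zero>} \<subseteq> A" using f(2) by (auto simp: g_def)
    with insert.IH g have "g \<in> L" by simp
    moreover have "f a \<odot>\<^bsub>free_on K I\<^esub> free_gen K I a \<in> L" using L gen[OF True] fa[OF True] by (simp add: submodule_def)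
    ultimately have mem: "g \<oplus>\<^bsub>free_on K I\<^esub> f a \<odot>\<^bsub>free_on K I\<^esub> free_gen K I a \<in> L" using L by (simp add: submodule_def)
    have eq: "f = g \<oplus>\<^bsub>free_on K I\<^esub> f a \<odot>\<^bsub>free_on K I\<^esub> free_gen K I a"
    proof
     fix x show "f x = (g \<oplus>\<^bsub>free_on K I\<^esub> f a \<odot>\<^bsub>free_on K I\<^esub> free_gen K I a) x"
      using f True fa[OF True] fa[of x]
      by (auto simp: free_on_simps[OF ringK] g_def free_gen_def PiE_def extensional_def)
    qed
    show ?thesis using mem by (simp only: eq[symmetric])
   qed
  qed
 qed
 moreover have "finite {x \<in> I. f x \<noteq> \<zero>}" using f by (simp add: free_on_simps[OF ringK])
 ultimately show "f \<in> L" using f by (meson order_refl)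
qed

definition free_ext :: "'x set => ('x => 'k) => ('x => 'k) => 'k" where
 "free_ext I D f = (\<Oplus>x\<in>{x \<in> I. f x \<noteq> \<zero>}. f x \<otimes> D x)"

lemma free_ext_superset:
 assumes "f \<in> carrier (free_on K I)" "D \<in> I \<rightarrow> carrier K" "finite A" "A \<subseteq> I" "{x \<in> I. f x \<noteq> \<zero>} \<subseteq> A"
 shows "free_ext I D f = (\<Oplus>x\<in>A. f x \<otimes> D x)"
 unfolding free_ext_def using assms
 by (intro R.add.finprod_mono_neutral_cong_left) (auto simp: free_on_simps[OF ringK] Pi_iff intro!: R.m_closed)

lemma free_ext_closed: "f \<in> carrier (free_on K I) ==> D \<in> I \<rightarrow> carrier K ==> free_ext I D f \<in> carrier K"
 unfolding free_ext_def by (intro R.finsum_closed) (auto simp: free_on_simps[OF ringK])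

lemma free_ext_add:
 assumes "f \<in> carrier (free_on K I)" "g \<in> carrier (free_on K I)" "D \<in> I \<rightarrow> carrier K"
 shows "free_ext I D (f \<oplus>\<^bsub>free_on K I\<^esub> g) = free_ext I D f \<oplus> free_ext I D g"
proof -
 interpret F: module K "free_on K I" by (rule free_module)
 define A where "A = {x \<in> I. f x \<noteq> \<zero>} \<union> {x \<in> I. g x \<noteq> \<zero>}"
 have A: "finite A" "A \<subseteq> I" using assms by (auto simp: A_def free_on_simps[OF ringK])
 have c: "f x \<in> carrier K" "g x \<in> carrier K" "D x \<in> carrier K" if "x \<in> I" for x
  using assms that by (auto simp: free_on_simps[OF ringK])
 have "free_ext I D (f \<oplus>\<^bsub>free_on K I\<^esub> g) = (\<Oplus>x\<in>A. (f \<oplus>\<^bsub>free_on K I\<^esub> g) x \<otimes> D x)"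
  using assms A by (intro free_ext_superset F.M.add.m_closed) (auto simp: A_def free_on_simps[OF ringK])
 also have "\<dots> = (\<Oplus>x\<in>A. f x \<otimes> D x \<oplus> g x \<otimes> D x)"
  using A c by (intro R.finsum_cong') (auto simp: free_on_simps[OF ringK] R.l_distr subset_iff)
 also have "\<dots> = (\<Oplus>x\<in>A. f x \<otimes> D x) \<oplus> (\<Oplus>x\<in>A. g x \<otimes> D x)"
  using A c by (intro R.finsum_addf) auto
 also have "(\<Oplus>x\<in>A. f x \<otimes> D x) = free_ext I D f"
  using assms A by (intro free_ext_superset[symmetric]) (auto simp: A_def)
 also have "(\<Oplus>x\<in>A. g x \<otimes> D x) = free_ext I D g"
  using assms A by (intro free_ext_superset[symmetric]) (auto simp: A_def)
 finally show ?thesis .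
qed

lemma free_ext_smult:
 assumes "f \<in> carrier (free_on K I)" "a \<in> carrier K" "D \<in> I \<rightarrow> carrier K"
 shows "free_ext I D (a \<odot>\<^bsub>free_on K I\<^esub> f) = a \<otimes> free_ext I D f"
proof -
 interpret F: module K "free_on K I" by (rule free_module)
 define A where "A = {x \<in> I. f x \<noteq> \<zero>}"
 have A: "finite A" "A \<subseteq> I" using assms by (auto simp: A_def free_on_simps[OF ringK])
 have c: "f x \<in> carrier K" "D x \<in> carrier K" if "x \<in> I" for x
  using assms that by (auto simp: free_on_simps[OF ringK])
 have "free_ext I D (a \<odot>\<^bsub>free_on K I\<^esub> f) = (\<Oplus>x\<in>A. (a \<odot>\<^bsub>free_on K I\<^esub> f) x \<otimes> D x)"
  using assms A by (intro free_ext_superset F.smult_closed) (auto simp: A_def free_on_simps[OF ringK])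
 also have "\<dots> = (\<Oplus>x\<in>A. a \<otimes> (f x \<otimes> D x))"
  using A c assms by (intro R.finsum_cong') (auto simp: free_on_simps[OF ringK] R.m_assoc subset_iff)
 also have "\<dots> = a \<otimes> (\<Oplus>x\<in>A. f x \<otimes> D x)"
  using A c assms by (intro R.finsum_rdistr[symmetric]) auto
 finally show ?thesis by (simp add: A_def free_ext_def)
qed

lemma free_ext_gen:
 assumes "x \<in> I" "D \<in> I \<rightarrow> carrier K" shows "free_ext I D (free_gen K I x) = D x"
proof -
 have "free_ext I D (free_gen K I x) = (\<Oplus>y\<in>{x}. free_gen K I x y \<otimes> D y)"
  using assms by (intro free_ext_superset free_gen_carrier) (auto simp: free_gen_def)
 also have "\<dots> = D x" using assms by (subst R.add.finprod_insert) (auto simp: free_gen_def Pi_iff)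
 finally show ?thesis .
qed

end

context kspace
begin

lemma tuples_split: "us @ v # ws \<in> tuples V n \<longleftrightarrow>
  Suc (length us + length ws) = n \<and> set us \<subseteq> carrier V \<and> v \<in> carrier V \<and> set ws \<subseteq> carrier V"
 by (auto simp: tuples_def)

lemma ext_relations_carrier: "ext_relations K V n \<subseteq> carrier (free_on K (tuples V n))"
proof -
 interpret F: module K "free_on K (tuples V n)" by (rule free_module)
 show ?thesis
  unfolding ext_relations_def Let_def
  apply (intro Un_least subsetI; elim CollectE exE conjE; simp only:)
   apply (auto intro!: F.M.minus_closed F.M.add.m_closed F.smult_closed free_gen_carrier)
   apply (auto simp: tuples_split)
  done
qed

lemma ext_quot: "quot_space K (free_on K (tuples V n)) (ext_null K V n)"
proof -
 interpret F: module K "free_on K (tuples V n)" by (rule free_module)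
 show ?thesis unfolding quot_space_def quot_space_axioms_def ext_null_def
  by (intro conjI F.module_axioms F.span_is_submodule ext_relations_carrier)
qed

lemma ext_module: "module K (ext_power K V n)"
 using quot_space.quot_module[OF ext_quot] by (simp add: ext_power_def)

lemma ext_relations_null: "r \<in> ext_relations K V n ==> r \<in> ext_null K V n"
proof -
 interpret F: module K "free_on K (tuples V n)" by (rule free_module)
 show "r \<in> ext_relations K V n ==> r \<in> ext_null K V n"
  unfolding ext_null_def using F.in_own_span[OF ext_relations_carrier] by blast
qed

lemma wedge_eq: "length ws = n ==> wedge K V ws = ext_null K V n +>\<^bsub>free_on K (tuples V n)\<^esub> free_gen K (tuples V n) ws"
 by (simp add: wedge_def)

lemma wedge_closed: "ws \<in> tuples V n ==> wedge K V ws \<in> carrier (ext_power K V n)"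
proof -
 assume a: "ws \<in> tuples V n"
 interpret Q: quot_space K "free_on K (tuples V n)" "ext_null K V n" by (rule ext_quot)
 have "wedge K V ws = Q.q (free_gen K (tuples V n) ws)" using a by (intro wedge_eq) (simp add: tuples_def)
 then show ?thesis using Q.q_carrier free_gen_carrier[OF a] by (simp add: ext_power_def)
qed

lemma wedge_lin:
 assumes a: "Suc (length us + length ws) = n" "set us \<subseteq> carrier V" "set ws \<subseteq> carrier V" "v \<in> carrier V" "w \<in> carrier V"
  "c \<in> carrier K"
 shows "wedge K V (us @ (w \<oplus>\<^bsub>V\<^esub> c \<odot>\<^bsub>V\<^esub> v) # ws) =
  wedge K V (us @ w # ws) \<oplus>\<^bsub>ext_power K V n\<^esub> c \<odot>\<^bsub>ext_power K V n\<^esub> wedge K V (us @ v # ws)"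
proof -
 interpret Q: quot_space K "free_on K (tuples V n)" "ext_null K V n" by (rule ext_quot)
 let ?e = "\<lambda>x. free_gen K (tuples V n) (us @ x # ws)"
 have w: "wedge K V (us @ x # ws) = Q.q (?e x)" for x by (rule wedge_eq) (use a in simp)
 have t: "us @ x # ws \<in> tuples V n" if "x \<in> carrier V" for x using a that by (simp add: tuples_split)
 have e: "?e x \<in> carrier (free_on K (tuples V n))" if "x \<in> carrier V" for x using free_gen_carrier[OF t[OF that]] .
 have cv: "c \<odot>\<^bsub>V\<^esub> v \<in> carrier V" using a by simp
 have r1: "?e (w \<oplus>\<^bsub>V\<^esub> c \<odot>\<^bsub>V\<^esub> v) \<ominus>\<^bsub>free_on K (tuples V n)\<^esub> (?e w \<oplus>\<^bsub>free_on K (tuples V n)\<^esub> ?e (c \<odot>\<^bsub>V\<^esub> v)) \<in> ext_null K V n"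
  using t[OF a(5)] cv by (intro ext_relations_null) (auto simp: ext_relations_def Let_def)
 have r2: "?e (c \<odot>\<^bsub>V\<^esub> v) \<ominus>\<^bsub>free_on K (tuples V n)\<^esub> (c \<odot>\<^bsub>free_on K (tuples V n)\<^esub> ?e v) \<in> ext_null K V n"
  using t[OF a(4)] a(6) by (intro ext_relations_null) (auto simp: ext_relations_def Let_def)
 have "Q.q (?e (w \<oplus>\<^bsub>V\<^esub> c \<odot>\<^bsub>V\<^esub> v)) = Q.q (?e w \<oplus>\<^bsub>free_on K (tuples V n)\<^esub> ?e (c \<odot>\<^bsub>V\<^esub> v))"
  using Q.q_eq_iff[OF e Q.M.add.m_closed[OF e e]] r1 a(5) cv by simp
 also have "\<dots> = Q.q (?e w) \<oplus>\<^bsub>ext_power K V n\<^esub> Q.q (?e (c \<odot>\<^bsub>V\<^esub> v))"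
  using Q.q_add[OF e e] a(5) cv by (simp add: ext_power_def)
 also have "Q.q (?e (c \<odot>\<^bsub>V\<^esub> v)) = Q.q (c \<odot>\<^bsub>free_on K (tuples V n)\<^esub> ?e v)"
  using Q.q_eq_iff[OF e Q.smult_closed[OF a(6) e]] r2 a(4) cv by simp
 also have "\<dots> = c \<odot>\<^bsub>ext_power K V n\<^esub> Q.q (?e v)"
  using Q.q_smult[OF a(6) e[OF a(4)]] by (simp add: ext_power_def)
 finally show ?thesis by (simp add: w)
qed

lemma wedge_rep:
 assumes a: "Suc (Suc (length us + length ys + length ws)) = n" "set us \<subseteq> carrier V" "set ys \<subseteq> carrier V" "set ws \<subseteq> carrier V"
  "v \<in> carrier V"
 shows "wedge K V (us @ v # ys @ v # ws) = \<zero>\<^bsub>ext_power K V n\<^esub>"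
proof -
 interpret Q: quot_space K "free_on K (tuples V n)" "ext_null K V n" by (rule ext_quot)
 have t: "us @ v # ys @ v # ws \<in> tuples V n" using a by (simp add: tuples_split)
 have w: "wedge K V (us @ v # ys @ v # ws) = Q.q (free_gen K (tuples V n) (us @ v # ys @ v # ws))"
  by (rule wedge_eq) (use a in simp)
 have "free_gen K (tuples V n) (us @ v # ys @ v # ws) \<in> ext_null K V n"
  using t by (intro ext_relations_null) (auto simp: ext_relations_def Let_def)
 from Q.q_N[OF this] show ?thesis using w Q.q_zero by (simp add: ext_power_def)
qed

lemma ext_power_induct:
 assumes L: "submodule K L (ext_power K V n)" and w: "!!ws. ws \<in> tuples V n ==> wedge K V ws \<in> L"
 shows "carrier (ext_power K V n) \<subseteq> L"
proof -
 interpret Q: quot_space K "free_on K (tuples V n)" "ext_null K V n" by (rule ext_quot)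
 have "carrier (free_on K (tuples V n)) \<subseteq> {x \<in> carrier (free_on K (tuples V n)). Q.q x \<in> L}"
 proof (rule free_on_induct)
  show "submodule K {x \<in> carrier (free_on K (tuples V n)). Q.q x \<in> L} (free_on K (tuples V n))"
   using L by (intro Q.vimage_submodule) (simp add: ext_power_def)
  fix x assume x: "x \<in> tuples V n"
  then show "free_gen K (tuples V n) x \<in> {x \<in> carrier (free_on K (tuples V n)). Q.q x \<in> L}"
   using w[OF x] wedge_eq[of x n] free_gen_carrier[OF x] by (simp add: tuples_def)
 qed
 then show ?thesis using Q.q_carrier by (auto simp: ext_power_def)
qed

text \<open>The universal property of the exterior power: the linear extension of \<open>D\<close> to the free module
kills the relations.\<close>

lemma ext_functional:
 assumes D: "altf (carrier V) {\<zero>\<^bsub>V\<^esub>} n D"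
 obtains l where "!!X1. X1 \<in> carrier (ext_power K V n) ==> l X1 \<in> carrier K"
  "!!X1 Y1. X1 \<in> carrier (ext_power K V n) ==> Y1 \<in> carrier (ext_power K V n) ==> l (X1 \<oplus>\<^bsub>ext_power K V n\<^esub> Y1) = l X1 \<oplus> l Y1"
  "!!c X1. c \<in> carrier K ==> X1 \<in> carrier (ext_power K V n) ==> l (c \<odot>\<^bsub>ext_power K V n\<^esub> X1) = c \<otimes> l X1"
  "!!ws. ws \<in> tuples V n ==> l (wedge K V ws) = D ws"
proof -
 define T where "T = tuples V n"
 interpret Q: quot_space K "free_on K T" "ext_null K V n" unfolding T_def by (rule ext_quot)
 note d = altD[OF D]
 have DT: "D \<in> T \<rightarrow> carrier K" using d(1) by (auto simp: T_def tuples_def)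
 define L where "L = free_ext T D"
 note Lc = free_ext_closed[OF _ DT, folded L_def] and La = free_ext_add[OF _ _ DT, folded L_def]
  and Ls = free_ext_smult[OF _ _ DT, folded L_def] and Lg = free_ext_gen[OF _ DT, folded L_def]
 have Lm: "L (x \<ominus>\<^bsub>free_on K T\<^esub> y) = L x \<ominus> L y" if "x \<in> carrier (free_on K T)" "y \<in> carrier (free_on K T)" for x y
 proof -
  have "x \<ominus>\<^bsub>free_on K T\<^esub> y = x \<oplus>\<^bsub>free_on K T\<^esub> (\<ominus> \<one>) \<odot>\<^bsub>free_on K T\<^esub> y"
   using that by (simp add: a_minus_def Q.smult_minus_1)
  then show ?thesis using that by (simp add: La Ls Lc R.l_minus a_minus_def)
 qed
 have z: "L \<zero>\<^bsub>free_on K T\<^esub> = \<zero>" using Ls[of "\<zero>\<^bsub>free_on K T\<^esub>" \<zero>] Lc by simp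
 have gc: "free_gen K T x \<in> carrier (free_on K T)" if "x \<in> T" for x using that by (rule free_gen_carrier)
 have t: "us @ x # ws \<in> T" if "us @ y # ws \<in> T" "x \<in> carrier V" for us x y ws
  using that by (simp add: tuples_split T_def)
 have "submodule K {f \<in> carrier (free_on K T). L f = \<zero>} (free_on K T)"
  unfolding submodule_def by (auto simp: Q.module_axioms La Ls z)
 moreover have "ext_relations K V n \<subseteq> {f \<in> carrier (free_on K T). L f = \<zero>}"
 proof
  fix r assume r: "r \<in> ext_relations K V n"
  then have "r \<in> carrier (free_on K T)" using ext_relations_carrier T_def by auto
  moreover have "L r = \<zero>"
  proof -
   from r consider (add) us v w zs where "us @ v # zs \<in> T" "w \<in> carrier V"
     "r = free_gen K T (us @ (v \<oplus>\<^bsub>V\<^esub> w) # zs) \<ominus>\<^bsub>free_on K T\<^esub> (free_gen K T (us @ v # zs) \<oplus>\<^bsub>free_on K T\<^esub> free_gen K T (us @ w # zs))"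
    | (smult) us c v zs where "us @ v # zs \<in> T" "c \<in> carrier K"
     "r = free_gen K T (us @ (c \<odot>\<^bsub>V\<^esub> v) # zs) \<ominus>\<^bsub>free_on K T\<^esub> c \<odot>\<^bsub>free_on K T\<^esub> free_gen K T (us @ v # zs)"
    | (rep) us v ys zs where "us @ v # ys @ v # zs \<in> T" "r = free_gen K T (us @ v # ys @ v # zs)"
    unfolding ext_relations_def Let_def T_def by blast
   then show ?thesis
   proof cases
    case add
    have v: "v \<in> carrier V" "Suc (length us + length zs) = n" "set us \<subseteq> carrier V" "set zs \<subseteq> carrier V"
     using add(1) by (auto simp: tuples_split T_def)
    have "D (us @ (v \<oplus>\<^bsub>V\<^esub> w) # zs) = D (us @ v # zs) \<oplus> D (us @ w # zs)"
     using d(2)[of us zs w v \<one>] v add(2) DT t[OF add(1)] by (simp add: Pi_iff)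
    then show ?thesis using add t[OF add(1)] v DT
     by (simp add: Lm La Lg gc Pi_iff)
   next
    case smult
    have v: "v \<in> carrier V" "Suc (length us + length zs) = n" "set us \<subseteq> carrier V" "set zs \<subseteq> carrier V"
     using smult(1) by (auto simp: tuples_split T_def)
    have cv: "c \<odot>\<^bsub>V\<^esub> v \<in> carrier V" using v smult by simp
    have "D (us @ (\<zero>\<^bsub>V\<^esub> \<oplus>\<^bsub>V\<^esub> c \<odot>\<^bsub>V\<^esub> v) # zs) = \<zero> \<oplus> c \<otimes> D (us @ v # zs)"
     using d(2)[of us zs v "\<zero>\<^bsub>V\<^esub>" c] v smult(2) d(4)[of us zs "\<zero>\<^bsub>V\<^esub>"] by simp
    then have "D (us @ (c \<odot>\<^bsub>V\<^esub> v) # zs) = c \<otimes> D (us @ v # zs)"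
     using cv smult DT by (simp add: Pi_iff)
    then show ?thesis using smult t[OF smult(1) cv] DT
     by (simp add: Lm Ls Lg gc Pi_iff)
   next
    case rep
    have "D (us @ v # ys @ v # zs) = \<zero>" using rep(1) by (intro d(3)) (auto simp: tuples_def T_def)
    then show ?thesis using rep by (simp add: Lg)
   qed
  qed
  ultimately show "r \<in> {f \<in> carrier (free_on K T). L f = \<zero>}" by simp
 qed
 ultimately have null: "ext_null K V n \<subseteq> {f \<in> carrier (free_on K T). L f = \<zero>}"
  unfolding ext_null_def T_def[symmetric] by (intro Q.span_is_subset)
 define l where "l X1 = L (SOME f. f \<in> X1)" for X1
 have lq: "l (Q.q f) = L f" if f: "f \<in> carrier (free_on K T)" for f
 proof -
  define g where "g = (SOME g. g \<in> Q.q f)"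
  have "g \<in> Q.q f" unfolding g_def by (rule someI[of _ f]) (rule Q.q_self[OF f])
  then have g: "g \<in> carrier (free_on K T)" "Q.q g = Q.q f" using Q.q_mem[OF f] by auto
  then have "L g \<ominus> L f = \<zero>" using Q.q_eq_iff[OF g(1) f] null Lm[OF g(1) f] by auto
  then have "L g = L f" using Lc[OF g(1)] Lc[OF f] R.r_right_minus_eq by blast
  then show ?thesis by (simp add: l_def g_def)
 qed
 have car: "carrier (ext_power K V n) = Q.q ` carrier (free_on K T)" using Q.q_carrier by (simp add: ext_power_def T_def)
 show thesis
 proof (rule that[of l])
  show "l X1 \<in> carrier K" if "X1 \<in> carrier (ext_power K V n)" for X1 using that lq Lc unfolding car by auto
  show "l (X1 \<oplus>\<^bsub>ext_power K V n\<^esub> Y1) = l X1 \<oplus> l Y1" if "X1 \<in> carrier (ext_power K V n)" "Y1 \<in> carrier (ext_power K V n)" for X1 Y1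
  proof -
   from that obtain f g where f: "f \<in> carrier (free_on K T)" "X1 = Q.q f" and g: "g \<in> carrier (free_on K T)" "Y1 = Q.q g"
    unfolding car by blast
   have "X1 \<oplus>\<^bsub>ext_power K V n\<^esub> Y1 = Q.q (f \<oplus>\<^bsub>free_on K T\<^esub> g)" using Q.q_add[OF f(1) g(1)] f g by (simp add: ext_power_def T_def)
   then show ?thesis using f g by (simp add: lq La)
  qed
  show "l (c \<odot>\<^bsub>ext_power K V n\<^esub> X1) = c \<otimes> l X1" if "c \<in> carrier K" "X1 \<in> carrier (ext_power K V n)" for c X1
  proof -
   from that obtain f where f: "f \<in> carrier (free_on K T)" "X1 = Q.q f" unfolding car by blast
   have "c \<odot>\<^bsub>ext_power K V n\<^esub> X1 = Q.q (c \<odot>\<^bsub>free_on K T\<^esub> f)" using Q.q_smult[OF that(1) f(1)] f by (simp add: ext_power_def T_def)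
   then show ?thesis using f that by (simp add: lq Ls)
  qed
  show "l (wedge K V ws) = D ws" if "ws \<in> tuples V n" for ws
  proof -
   have "wedge K V ws = Q.q (free_gen K T ws)" using that wedge_eq[of ws n] by (simp add: T_def tuples_def)
   then show ?thesis using lq[OF gc, of ws] Lg that by (simp add: T_def)
  qed
 qed
qed

end

section \<open>Volume forms and determinant lines\<close>

text \<open>A fixed nonzero alternating form of top degree on \<open>B/M\<close>. The choice is arbitrary; \<open>det_gen\<close> is the
generator of the determinant line on which the corresponding functional is \<open>1\<close>.\<close>

definition vol :: "'k ring => ('k, 'v) module => 'v set => 'v set => 'v list => 'k" where
 "vol K V B M = (SOME D. alt_form K V B M (qdim K V B M) D \<and> (\<exists>es. basis_mod K V B M es \<and> D es = \<one>\<^bsub>K\<^esub>))"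

definition det_gen :: "'k ring => ('k, 'v) module => 'v set => 'v set => ('k, 'v) det_elem" where
 "det_gen K V B M = det_wedge K V B M (SOME es. basis_mod K V B M es \<and> vol K V B M es = \<one>\<^bsub>K\<^esub>)"

context kspace
begin

abbreviation vl where "vl \<equiv> vol K V"
abbreviation dg where "dg \<equiv> det_gen K V"

lemma frames_iff: "bs \<in> fr B M \<longleftrightarrow> length bs = qdim K V B M \<and> set bs \<subseteq> B"
 by (simp add: frames_def)

lemma mbasis_frame: "sub M ==> mbasis B M es ==> es \<in> fr B M"
 using mbasisD(1) qdim_eq_length by (simp add: frames_iff)

lemma vol_spec:
 assumes M: "sub M" and B: "fgen B M"
 shows "altf B M (qdim K V B M) (vl B M)" "\<exists>es. mbasis B M es \<and> vl B M es = \<one>"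
proof -
 obtain es where es: "mbasis B M es" using sub_fgen_basis[OF M B] by auto
 have es': "set es \<subseteq> carrier V" "indepm M es" "spanm M es = B" using es by (auto simp: basis_mod_def)
 obtain D where "altf (spanm M es) M (length es) D" "D es = \<one>" using volume_form_exists[OF M es'(1,2)] by auto
 then have "altf B M (qdim K V B M) D \<and> (\<exists>es. mbasis B M es \<and> D es = \<one>)"
  using es es' qdim_eq_length[OF M es] by auto
 from someI[of "\<lambda>D. altf B M (qdim K V B M) D \<and> (\<exists>es. mbasis B M es \<and> D es = \<one>)", OF this]
 show "altf B M (qdim K V B M) (vl B M)" "\<exists>es. mbasis B M es \<and> vl B M es = \<one>"
  unfolding vol_def by auto
qed

lemma vol_closed: "sub M ==> fgen B M ==> bs \<in> fr B M ==> vl B M bs \<in> carrier K"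
 using altD(1)[OF vol_spec(1)] by (simp add: frames_iff)

text \<open>Top-degree forms are determined by their value on one basis.\<close>

lemma alt_compare:
 assumes M: "sub M" and es: "mbasis B M es" and D: "altf B M (length es) D" and E: "altf B M (length es) E"
  and Ees: "E es = \<one>" and bs: "length bs = length es" "set bs \<subseteq> B"
 shows "D bs = D es \<otimes> E bs"
proof -
 have es': "set es \<subseteq> carrier V" "B = spanm M es" using es by (auto simp: basis_mod_def)
 have esB: "set es \<subseteq> B" using mbasisD[OF M es] by simp
 have c: "D es \<in> carrier K" "D bs \<in> carrier K" using altD(1)[OF D] esB bs by auto
 have "\<one> \<otimes> D bs = D es \<otimes> E bs"
 proof (rule alt_expand[OF M es' _ D E])
  show "\<one> \<otimes> D es = D es \<otimes> E es" using c Ees by simp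
 qed (use c bs in simp_all)
 then show ?thesis using c by simp
qed

lemma alt_proportional:
 assumes M: "sub M" and B: "fgen B M" and D: "altf B M (qdim K V B M) D"
 shows "\<exists>c\<in>carrier K. \<forall>bs\<in>fr B M. D bs = c \<otimes> vl B M bs"
proof -
 note v = vol_spec[OF M B]
 obtain es where es: "mbasis B M es" "vl B M es = \<one>" using v(2) by auto
 have q: "qdim K V B M = length es" by (rule qdim_eq_length[OF M es(1)])
 have "D es \<in> carrier K" using altD(1)[OF D] mbasisD[OF M es(1)] q by simp
 moreover have "D bs = D es \<otimes> vl B M bs" if "bs \<in> fr B M" for bs
  using alt_compare[OF M es(1), of D "vl B M" bs] D v(1) es(2) q that by (simp add: frames_iff)
 ultimately show ?thesis by blast
qed

lemma vol_basis_nonzero: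
 assumes M: "sub M" and es: "mbasis B M es" shows "vl B M es \<noteq> \<zero>"
proof
 assume z: "vl B M es = \<zero>"
 have es': "set es \<subseteq> carrier V" "indepm M es" "spanm M es = B" using es by (auto simp: basis_mod_def)
 obtain D where D: "altf B M (length es) D" "D es = \<one>" using volume_form_exists[OF M es'(1,2)] es'(3) by auto
 obtain c where "c \<in> carrier K" "\<forall>bs\<in>fr B M. D bs = c \<otimes> vl B M bs"
  using alt_proportional[OF M mbasisD(5)[OF M es], of D] D qdim_eq_length[OF M es] by auto
 then show False using mbasis_frame[OF M es] D(2) z by simp
qed

text \<open>An alternating form on \<open>B/M\<close> may be evaluated on representatives.\<close>

lemma alt_slot_cong:
 assumes D: "altf B M n D" and B: "sub B" and M: "M \<subseteq> B"
  and a: "Suc (length us + length ws) = n" "set us \<subseteq> B" "set ws \<subseteq> B" "x \<in> B" "y \<in> B" "x \<ominus>\<^bsub>V\<^esub> y \<in> M"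
 shows "D (us @ x # ws) = D (us @ y # ws)"
proof -
 have c: "x \<in> carrier V" "y \<in> carrier V" using a subD(1)[OF B] by auto
 have "x = y \<oplus>\<^bsub>V\<^esub> \<one> \<odot>\<^bsub>V\<^esub> (x \<ominus>\<^bsub>V\<^esub> y)" using c by (simp add: a_minus_def M.a_lcomm[of y x] M.r_neg)
 then have "D (us @ x # ws) = D (us @ (y \<oplus>\<^bsub>V\<^esub> \<one> \<odot>\<^bsub>V\<^esub> (x \<ominus>\<^bsub>V\<^esub> y)) # ws)" by simp
 also have "\<dots> = D (us @ y # ws) \<oplus> \<one> \<otimes> D (us @ (x \<ominus>\<^bsub>V\<^esub> y) # ws)"
  using a M by (intro altD(2)[OF D]) auto
 also have "D (us @ (x \<ominus>\<^bsub>V\<^esub> y) # ws) = \<zero>" using a by (intro altD(4)[OF D])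
 finally show ?thesis using altD(1)[OF D, of "us @ y # ws"] a by simp
qed

lemma alt_cong:
 assumes D: "altf B M n D" and B: "sub B" and M: "M \<subseteq> B"
 shows "[|list_all2 (\<lambda>x y. x \<in> B \<and> y \<in> B \<and> x \<ominus>\<^bsub>V\<^esub> y \<in> M) bs bs'; length pre + length bs = n; set pre \<subseteq> B|] ==>
  D (pre @ bs) = D (pre @ bs')"
proof (induction bs bs' arbitrary: pre rule: list_all2_induct)
 case (Cons x xs y ys)
 have "set xs \<subseteq> B" using Cons.hyps(2) by (auto simp: list_all2_conv_all_nth in_set_conv_nth)
 then have "D (pre @ x # xs) = D (pre @ y # xs)"
  using Cons by (intro alt_slot_cong[OF D B M]) auto
 also have "\<dots> = D ((pre @ [y]) @ xs)" by simp
 also have "\<dots> = D ((pre @ [y]) @ ys)" using Cons by (intro Cons.IH) auto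
 finally show ?case by simp
qed simp

context
 fixes B M assumes B: "sub B" and M: "sub M" and MB: "M \<subseteq> B"
begin

interpretation Q: quot_space K "V\<lparr>carrier := B\<rparr>" M by (rule subquot_quot[OF B M MB])
interpretation W: kspace K "subquot V B M" by (rule subquot_kspace[OF B M MB])

lemma subquot_car: "carrier (subquot V B M) = (\<lambda>b. M +>\<^bsub>V\<^esub> b) ` B"
 using Q.q_carrier by (simp add: subquot_def)

lemma subquot_lin: "v \<in> B ==> w \<in> B ==> c \<in> carrier K ==>
  (M +>\<^bsub>V\<^esub> w) \<oplus>\<^bsub>subquot V B M\<^esub> c \<odot>\<^bsub>subquot V B M\<^esub> (M +>\<^bsub>V\<^esub> v) = M +>\<^bsub>V\<^esub> (w \<oplus>\<^bsub>V\<^esub> c \<odot>\<^bsub>V\<^esub> v)"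
 using Q.q_add[of w "c \<odot>\<^bsub>V\<^esub> v"] Q.q_smult[of c v] subD(4)[OF B] by (simp add: subquot_def)

lemma minus_restrict: "x \<in> B ==> y \<in> B ==> x \<ominus>\<^bsub>V\<lparr>carrier := B\<rparr>\<^esub> y = x \<ominus>\<^bsub>V\<^esub> y"
proof -
 assume a: "x \<in> B" "y \<in> B"
 have "x \<ominus>\<^bsub>V\<lparr>carrier := B\<rparr>\<^esub> y = x \<oplus>\<^bsub>V\<^esub> ((\<ominus> \<one>) \<odot>\<^bsub>V\<^esub> y)"
  using Q.smult_minus_1[of y] a by (simp add: a_minus_def)
 then show ?thesis using a subD(1)[OF B] by (simp add: a_minus_def smult_minus_1)
qed

lemma coset_eq_iff: "x \<in> B ==> y \<in> B ==> M +>\<^bsub>V\<^esub> x = M +>\<^bsub>V\<^esub> y \<longleftrightarrow> x \<ominus>\<^bsub>V\<^esub> y \<in> M"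
 using Q.q_eq_iff[of x y] minus_restrict by simp

lemma det_module: "module K (det_line K V B M)"
 unfolding det_line_def by (rule W.ext_module)

lemma map_coset_tuples: "bs \<in> frames K V B M ==> map (\<lambda>b. M +>\<^bsub>V\<^esub> b) bs \<in> tuples (subquot V B M) (qdim K V B M)"
 by (auto simp: frames_iff tuples_def subquot_car)

lemma det_wedge_closed: "bs \<in> frames K V B M ==> det_wedge K V B M bs \<in> carrier (det_line K V B M)"
 unfolding det_wedge_def det_line_def by (intro W.wedge_closed map_coset_tuples)

lemma det_wedge_lin:
 assumes "Suc (length us + length ws) = qdim K V B M" "set us \<subseteq> B" "set ws \<subseteq> B" "v \<in> B" "w \<in> B" "c \<in> carrier K"
 shows "det_wedge K V B M (us @ (w \<oplus>\<^bsub>V\<^esub> c \<odot>\<^bsub>V\<^esub> v) # ws) =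
  det_wedge K V B M (us @ w # ws) \<oplus>\<^bsub>det_line K V B M\<^esub> c \<odot>\<^bsub>det_line K V B M\<^esub> det_wedge K V B M (us @ v # ws)"
 using W.wedge_lin[of "map (\<lambda>b. M +>\<^bsub>V\<^esub> b) us" "map (\<lambda>b. M +>\<^bsub>V\<^esub> b) ws" "qdim K V B M" "M +>\<^bsub>V\<^esub> v" "M +>\<^bsub>V\<^esub> w" c]
  assms subquot_lin by (simp add: det_wedge_def det_line_def subquot_car image_mono)

lemma det_wedge_rep:
 assumes "Suc (Suc (length us + length ys + length ws)) = qdim K V B M" "set us \<subseteq> B" "set ys \<subseteq> B" "set ws \<subseteq> B" "v \<in> B"
 shows "det_wedge K V B M (us @ v # ys @ v # ws) = \<zero>\<^bsub>det_line K V B M\<^esub>"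
 using W.wedge_rep[of "map (\<lambda>b. M +>\<^bsub>V\<^esub> b) us" "map (\<lambda>b. M +>\<^bsub>V\<^esub> b) ys" "map (\<lambda>b. M +>\<^bsub>V\<^esub> b) ws" "qdim K V B M" "M +>\<^bsub>V\<^esub> v"]
  assms by (simp add: det_wedge_def det_line_def subquot_car image_mono)

lemma det_functional:
 assumes D: "altf B M (qdim K V B M) D"
 obtains l where "!!x. x \<in> carrier (det_line K V B M) ==> l x \<in> carrier K"
  "!!x y. x \<in> carrier (det_line K V B M) ==> y \<in> carrier (det_line K V B M) ==> l (x \<oplus>\<^bsub>det_line K V B M\<^esub> y) = l x \<oplus> l y"
  "!!c x. c \<in> carrier K ==> x \<in> carrier (det_line K V B M) ==> l (c \<odot>\<^bsub>det_line K V B M\<^esub> x) = c \<otimes> l x"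
  "!!bs. bs \<in> frames K V B M ==> l (det_wedge K V B M bs) = D bs"
proof -
 define W where "W = subquot V B M"
 define n where "n = qdim K V B M"
 define q where "q b = M +>\<^bsub>V\<^esub> b" for b
 define r where "r w = (SOME b. b \<in> B \<and> q b = w)" for w
 note car = subquot_car[folded W_def q_def]
 have D: "altf B M n D" using D n_def by simp
 have r: "r w \<in> B \<and> q (r w) = w" if "w \<in> carrier W" for w
 proof -
  from that car obtain b where "b \<in> B \<and> q b = w" by auto
  then show ?thesis unfolding r_def by (rule someI)
 qed
 have rs: "set (map r ws) \<subseteq> B" if "set ws \<subseteq> carrier W" for ws using r that by auto
 have qeq: "q x = q y \<longleftrightarrow> x \<ominus>\<^bsub>V\<^esub> y \<in> M" if "x \<in> B" "y \<in> B" for x y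
  using coset_eq_iff that by (simp add: q_def)
 note d = altD[OF D]
 have "W.altf (carrier W) {\<zero>\<^bsub>W\<^esub>} n (\<lambda>ws. D (map r ws))" unfolding W_def
 proof (rule W.altI, unfold W_def[symmetric])
  fix ws assume "length ws = n" "set ws \<subseteq> carrier W"
  then show "D (map r ws) \<in> carrier K" using rs[of ws] by (intro d(1)) simp_all
 next
  fix us c v w ws
  assume a: "Suc (length us + length ws) = n" "set us \<subseteq> carrier W" "set ws \<subseteq> carrier W" "v \<in> carrier W" "w \<in> carrier W" "c \<in> carrier K"
  have rv: "r v \<in> B" "q (r v) = v" "r w \<in> B" "q (r w) = w" using r a by auto
  have lc: "r w \<oplus>\<^bsub>V\<^esub> c \<odot>\<^bsub>V\<^esub> r v \<in> B" using rv a subD[OF B] by auto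
  have e: "w \<oplus>\<^bsub>W\<^esub> c \<odot>\<^bsub>W\<^esub> v = q (r w \<oplus>\<^bsub>V\<^esub> c \<odot>\<^bsub>V\<^esub> r v)"
   using subquot_lin[OF rv(1,3) a(6)] rv by (simp add: q_def W_def)
  then have "w \<oplus>\<^bsub>W\<^esub> c \<odot>\<^bsub>W\<^esub> v \<in> carrier W" using car lc by auto
  from r[OF this] have rr: "r (w \<oplus>\<^bsub>W\<^esub> c \<odot>\<^bsub>W\<^esub> v) \<in> B" "r (w \<oplus>\<^bsub>W\<^esub> c \<odot>\<^bsub>W\<^esub> v) \<ominus>\<^bsub>V\<^esub> (r w \<oplus>\<^bsub>V\<^esub> c \<odot>\<^bsub>V\<^esub> r v) \<in> M"
   using qeq lc e by auto
  have "D (map r us @ r (w \<oplus>\<^bsub>W\<^esub> c \<odot>\<^bsub>W\<^esub> v) # map r ws) = D (map r us @ (r w \<oplus>\<^bsub>V\<^esub> c \<odot>\<^bsub>V\<^esub> r v) # map r ws)"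
   using a(1) rs[OF a(2)] rs[OF a(3)] rr lc by (intro alt_slot_cong[OF D B MB]) simp_all
  also have "\<dots> = D (map r us @ r w # map r ws) \<oplus> c \<otimes> D (map r us @ r v # map r ws)"
   using a(1,6) rs[OF a(2)] rs[OF a(3)] rv by (intro d(2)) simp_all
  finally show "D (map r (us @ (w \<oplus>\<^bsub>W\<^esub> c \<odot>\<^bsub>W\<^esub> v) # ws)) = D (map r (us @ w # ws)) \<oplus> c \<otimes> D (map r (us @ v # ws))" by simp
 next
  fix us v ys ws
  assume a: "Suc (Suc (length us + length ys + length ws)) = n" "set us \<subseteq> carrier W" "set ys \<subseteq> carrier W" "set ws \<subseteq> carrier W" "v \<in> carrier W"
  have "D (map r us @ r v # map r ys @ r v # map r ws) = \<zero>"
   using a(1) rs[OF a(2)] rs[OF a(3)] rs[OF a(4)] r[OF a(5)] by (intro d(3)) simp_all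
  then show "D (map r (us @ v # ys @ v # ws)) = \<zero>" by simp
 next
  fix us m ws
  assume a: "Suc (length us + length ws) = n" "set us \<subseteq> carrier W" "set ws \<subseteq> carrier W" "m \<in> {\<zero>\<^bsub>W\<^esub>}"
  have m: "m = q \<zero>\<^bsub>V\<^esub>" using a(4) Q.q_zero by (simp add: q_def W_def subquot_def)
  then have "m \<in> carrier W" using car subD(2)[OF B] by auto
  then have "r m \<in> B" "r m \<ominus>\<^bsub>V\<^esub> \<zero>\<^bsub>V\<^esub> \<in> M" using r[of m] qeq[of "r m" "\<zero>\<^bsub>V\<^esub>"] subD(2)[OF B] m by auto
  then have "r m \<in> M" using subD(1)[OF B] M.minus_equality[of "\<zero>\<^bsub>V\<^esub>" "\<zero>\<^bsub>V\<^esub>"] by (simp add: a_minus_def)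
  then have "D (map r us @ r m # map r ws) = \<zero>"
   using a(1) rs[OF a(2)] rs[OF a(3)] by (intro d(4)) simp_all
  then show "D (map r (us @ m # ws)) = \<zero>" by simp
 qed
 then have alt: "W.altf (carrier (subquot V B M)) {\<zero>\<^bsub>subquot V B M\<^esub>} (qdim K V B M) (\<lambda>ws. D (map r ws))"
  by (simp only: W_def n_def)
 show thesis
 proof (rule W.ext_functional[OF alt], fold det_line_def)
  fix l
  assume l: "!!x. x \<in> carrier (det_line K V B M) ==> l x \<in> carrier K"
  "!!x y. x \<in> carrier (det_line K V B M) ==> y \<in> carrier (det_line K V B M) ==> l (x \<oplus>\<^bsub>det_line K V B M\<^esub> y) = l x \<oplus> l y"
  "!!c x. c \<in> carrier K ==> x \<in> carrier (det_line K V B M) ==> l (c \<odot>\<^bsub>det_line K V B M\<^esub> x) = c \<otimes> l x"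
  "!!ws. ws \<in> tuples (subquot V B M) (qdim K V B M) ==> l (wedge K (subquot V B M) ws) = D (map r ws)"
  have "l (det_wedge K V B M bs) = D bs" if bs: "bs \<in> frames K V B M" for bs
  proof -
  from bs have bsB: "set bs \<subseteq> B" "length bs = n" by (auto simp: frames_iff n_def)
  have "list_all2 (\<lambda>x y. x \<in> B \<and> y \<in> B \<and> x \<ominus>\<^bsub>V\<^esub> y \<in> M) (map r (map q bs)) bs"
   unfolding list_all2_conv_all_nth
  proof (intro conjI allI impI)
   fix i assume "i < length (map r (map q bs))"
   then have i: "bs ! i \<in> B" "i < length bs" using bsB nth_mem by auto
   then have "r (q (bs ! i)) \<in> B \<and> q (r (q (bs ! i))) = q (bs ! i)" using car by (intro r) auto
   then show "map r (map q bs) ! i \<in> B" "bs ! i \<in> B" "map r (map q bs) ! i \<ominus>\<^bsub>V\<^esub> bs ! i \<in> M"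
    using i qeq by auto
  qed simp
  from alt_cong[OF D B MB this, of "[]"] have "D (map r (map q bs)) = D bs" using bsB by simp
  then show ?thesis
   using l(4)[of "map q bs"] map_coset_tuples[OF bs] by (simp add: det_wedge_def q_def[abs_def])
  qed
  with l(1,2,3) show thesis by (rule that)
 qed
qed

text \<open>The determinant line has dimension at most one. The set of multiples of the wedge of the basis is
a submodule, and by \<open>multilinear_expand\<close> it contains every decomposable element.\<close>

lemma det_line_span:
 assumes es: "mbasis B M es" and x: "x \<in> carrier (det_line K V B M)"
 shows "\<exists>c\<in>carrier K. x = c \<odot>\<^bsub>det_line K V B M\<^esub> det_wedge K V B M es"
proof -
 define L where "L = det_line K V B M"
 define om where "om = det_wedge K V B M es"
 define n where "n = qdim K V B M"
 interpret L: module K L unfolding L_def by (rule det_module)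
 have om: "om \<in> carrier L" unfolding om_def L_def by (rule det_wedge_closed[OF mbasis_frame[OF M es]])
 define S where "S = {c \<odot>\<^bsub>L\<^esub> om |c. c \<in> carrier K}"
 have S: "submodule K S L" unfolding submodule_def
 proof (intro conjI allI impI L.module_axioms)
  show "S \<subseteq> carrier L" using om by (auto simp: S_def)
  fix v w assume "v \<in> S" "w \<in> S"
  then obtain a b where "a \<in> carrier K" "b \<in> carrier K" "v = a \<odot>\<^bsub>L\<^esub> om" "w = b \<odot>\<^bsub>L\<^esub> om" by (auto simp: S_def)
  then have "v \<oplus>\<^bsub>L\<^esub> w = (a \<oplus> b) \<odot>\<^bsub>L\<^esub> om" "a \<oplus> b \<in> carrier K" using om by (simp_all add: L.smult_l_distr)
  then show "v \<oplus>\<^bsub>L\<^esub> w \<in> S" unfolding S_def by blast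
 next
  show "\<zero>\<^bsub>L\<^esub> \<in> S" using om by (auto simp: S_def intro!: exI[of _ \<zero>])
 next
  fix c v assume "c \<in> carrier K" "v \<in> S"
  then obtain a where "a \<in> carrier K" "c \<in> carrier K" "v = a \<odot>\<^bsub>L\<^esub> om" by (auto simp: S_def)
  then have "c \<odot>\<^bsub>L\<^esub> v = (c \<otimes> a) \<odot>\<^bsub>L\<^esub> om" "c \<otimes> a \<in> carrier K" using om by (simp_all add: L.smult_assoc1)
  then show "c \<odot>\<^bsub>L\<^esub> v \<in> S" unfolding S_def by blast
 qed
 have Sd: "\<zero>\<^bsub>L\<^esub> \<in> S" "!!v w. v \<in> S ==> w \<in> S ==> v \<oplus>\<^bsub>L\<^esub> w \<in> S"
  "!!c v. c \<in> carrier K ==> v \<in> S ==> c \<odot>\<^bsub>L\<^esub> v \<in> S" "!!v. v \<in> S ==> v \<in> carrier L" using S by (auto simp: submodule_def)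
 have omS: "om \<in> S" using om by (auto simp: S_def intro!: exI[of _ \<one>])
 have esc: "set es \<subseteq> carrier V" "B = spanm M es" using es by (auto simp: basis_mod_def)
 have n: "length es = n" using qdim_eq_length[OF M es] n_def by simp
 define w where "w bs = det_wedge K V B M bs" for bs
 note lin = det_wedge_lin[folded w_def L_def n_def] and rep = det_wedge_rep[folded w_def L_def n_def]
 have wc: "w bs \<in> carrier L" if "length bs = n" "set bs \<subseteq> B" for bs
  unfolding w_def L_def using that by (intro det_wedge_closed) (simp add: frames_iff n_def)
 have kill: "w (us @ m # ws) = \<zero>\<^bsub>L\<^esub>" if "Suc (length us + length ws) = n" "set us \<subseteq> B" "set ws \<subseteq> B" "m \<in> M" for us m ws
 proof -
  have z: "\<zero>\<^bsub>V\<^esub> \<in> B" "m \<in> B" using subD(2)[OF B] that MB by auto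
  define u where "u = w (us @ \<zero>\<^bsub>V\<^esub> # ws)"
  have u: "u \<in> carrier L" unfolding u_def using that z by (intro wc) auto
  have M0: "M +>\<^bsub>V\<^esub> m = M +>\<^bsub>V\<^esub> \<zero>\<^bsub>V\<^esub>" using Q.q_N[OF that(4)] by simp
  then have wu: "w (us @ m # ws) = u" by (simp add: w_def u_def det_wedge_def)
  have "w (us @ (\<zero>\<^bsub>V\<^esub> \<oplus>\<^bsub>V\<^esub> \<one> \<odot>\<^bsub>V\<^esub> \<zero>\<^bsub>V\<^esub>) # ws) = u \<oplus>\<^bsub>L\<^esub> \<one> \<odot>\<^bsub>L\<^esub> u"
   unfolding u_def using that z by (intro lin) auto
  then have "u = u \<oplus>\<^bsub>L\<^esub> u" using u by (simp add: u_def[symmetric])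
  then show ?thesis using u wu L.M.add.l_cancel_one'[OF u u] by simp
 qed
 have mem: "w bs \<in> S" if bs: "length bs = n" "set bs \<subseteq> B" for bs
 proof (rule multilinear_expand[where P = "\<lambda>bs. w bs \<in> S" and n = n, OF M esc])
  fix us c v x ws assume a: "Suc (length us + length ws) = n" "set us \<subseteq> B" "set ws \<subseteq> B" "v \<in> B" "x \<in> B" "c \<in> carrier K"
   "w (us @ v # ws) \<in> S" "w (us @ x # ws) \<in> S"
  then show "w (us @ (x \<oplus>\<^bsub>V\<^esub> c \<odot>\<^bsub>V\<^esub> v) # ws) \<in> S" using lin[OF a(1-6)] Sd by simp
 next
  fix us v ys ws assume a: "Suc (Suc (length us + length ys + length ws)) = n" "set us \<subseteq> B" "set ys \<subseteq> B" "set ws \<subseteq> B" "v \<in> B"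
  then show "w (us @ v # ys @ v # ws) \<in> S" using rep Sd by simp
 next
  fix us m ws assume a: "Suc (length us + length ws) = n" "set us \<subseteq> B" "set ws \<subseteq> B" "m \<in> M"
  then show "w (us @ m # ws) \<in> S" using kill Sd by simp
 next
  fix us v x ws assume a: "Suc (Suc (length us + length ws)) = n" "set us \<subseteq> B" "set ws \<subseteq> B" "v \<in> B" "x \<in> B"
   and vx: "w (us @ v # x # ws) \<in> S"
  define g where "g y z = w (us @ y # z # ws)" for y z
  have gc: "g y z \<in> carrier L" if "y \<in> B" "z \<in> B" for y z unfolding g_def using a that by (intro wc) auto
  have e: "v \<oplus>\<^bsub>V\<^esub> x = v \<oplus>\<^bsub>V\<^esub> \<one> \<odot>\<^bsub>V\<^esub> x" using a subD(1)[OF B] by simp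
  have s: "v \<oplus>\<^bsub>V\<^esub> x \<in> B" using a subD(3)[OF B] by simp
  have g1: "g (v \<oplus>\<^bsub>V\<^esub> x) z = g v z \<oplus>\<^bsub>L\<^esub> g x z" if "z \<in> B" for z
   using lin[of us "z # ws" x v \<one>] a that gc e by (simp add: g_def[symmetric])
  have g2: "g y (v \<oplus>\<^bsub>V\<^esub> x) = g y v \<oplus>\<^bsub>L\<^esub> g y x" if "y \<in> B" for y
   using lin[of "us @ [y]" ws x v \<one>] a that gc e by (simp add: g_def[symmetric])
  have g0: "g y y = \<zero>\<^bsub>L\<^esub>" if "y \<in> B" for y using rep[of us "[]" ws y] a that by (simp add: g_def)
  have "\<zero>\<^bsub>L\<^esub> = g v x \<oplus>\<^bsub>L\<^esub> g x v"
   using g0[OF s] g1[OF s] g2[OF a(4)] g2[OF a(5)] g0[OF a(4)] g0[OF a(5)] gc[OF a(4,5)] gc[OF a(5,4)] by simp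
  then have "g x v = \<ominus>\<^bsub>L\<^esub> g v x"
   using gc[OF a(4,5)] gc[OF a(5,4)] L.M.minus_equality[of "g x v" "g v x"] L.M.a_comm[of "g x v" "g v x"] by simp
  also have "\<dots> = (\<ominus> \<one>) \<odot>\<^bsub>L\<^esub> g v x" using gc[OF a(4,5)] by (simp add: L.smult_minus_1)
  also have "\<dots> \<in> S" using vx by (intro Sd) (simp_all add: g_def)
  finally show "w (us @ x # v # ws) \<in> S" by (simp add: g_def)
 next
  show "w es \<in> S" using omS by (simp add: w_def om_def)
 qed (use n bs in simp_all)
 have "carrier (ext_power K (subquot V B M) n) \<subseteq> S"
 proof (rule W.ext_power_induct)
  show "submodule K S (ext_power K (subquot V B M) n)" using S by (simp add: L_def det_line_def n_def)
  fix ws assume ws: "ws \<in> tuples (subquot V B M) n"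
  then have "ws \<in> lists ((\<lambda>b. M +>\<^bsub>V\<^esub> b) ` B)" "length ws = n" by (auto simp: tuples_def subquot_car)
  then obtain bs where bs: "bs \<in> lists B" "ws = map (\<lambda>b. M +>\<^bsub>V\<^esub> b) bs" "length ws = n"
   unfolding lists_image by blast
  then have "set bs \<subseteq> B" by auto
  with bs(2,3) show "wedge K (subquot V B M) ws \<in> S" using mem[of bs] by (simp add: w_def det_wedge_def)
 qed
 then have "x \<in> S" using x by (auto simp: det_line_def n_def)
 then show ?thesis by (auto simp: S_def L_def om_def)
qed

end

end

context kspace
begin

text \<open>The functional belonging to the volume form shows that \<open>det_gen\<close> is not a torsion element, so that
the determinant line is free on it; coordinates with respect to it are values of \<open>vol\<close>.\<close>

lemma det_gen_facts:
 assumes M: "sub M" and B: "fgen B M"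
 shows det_gen_closed: "dg B M \<in> carrier (dl B M)"
  and det_line_coord: "!!x. x \<in> carrier (dl B M) ==> \<exists>c\<in>carrier K. x = c \<odot>\<^bsub>dl B M\<^esub> dg B M"
  and det_wedge_vol: "!!bs. bs \<in> fr B M ==>
   dw B M bs = vl B M bs \<odot>\<^bsub>dl B M\<^esub> dg B M"
  and det_gen_cancel: "!!c d. c \<in> carrier K ==> d \<in> carrier K ==>
   c \<odot>\<^bsub>dl B M\<^esub> dg B M = d \<odot>\<^bsub>dl B M\<^esub> dg B M \<longleftrightarrow> c = d"
proof -
 define es where "es = (SOME es. mbasis B M es \<and> vl B M es = \<one>)"
 have es: "mbasis B M es" "vl B M es = \<one>"
  using someI_ex[OF vol_spec(2)[OF M B]] unfolding es_def by auto
 have g: "dg B M = dw B M es" by (simp add: det_gen_def es_def)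
 note sB = mbasisD(3)[OF M es(1)] and MB = mbasisD(2)[OF M es(1)]
 have esf: "es \<in> fr B M" by (rule mbasis_frame[OF M es(1)])
 show gc: "dg B M \<in> carrier (dl B M)" unfolding g by (rule det_wedge_closed[OF sB M MB esf])
 show span: "\<exists>c\<in>carrier K. x = c \<odot>\<^bsub>dl B M\<^esub> dg B M"
  if "x \<in> carrier (dl B M)" for x unfolding g by (rule det_line_span[OF sB M MB es(1) that])
 obtain l where l: "!!c x. c \<in> carrier K ==> x \<in> carrier (dl B M) ==> l (c \<odot>\<^bsub>dl B M\<^esub> x) = c \<otimes> l x"
  "!!bs. bs \<in> fr B M ==> l (dw B M bs) = vl B M bs"
  using det_functional[OF sB M MB vol_spec(1)[OF M B]] by metis
 have lg: "l (c \<odot>\<^bsub>dl B M\<^esub> dg B M) = c" if "c \<in> carrier K" for c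
  using l(1)[OF that gc] l(2)[OF esf] es(2) that by (simp add: g)
 show "dw B M bs = vl B M bs \<odot>\<^bsub>dl B M\<^esub> dg B M" if bs: "bs \<in> fr B M" for bs
 proof -
  obtain c where "c \<in> carrier K" "dw B M bs = c \<odot>\<^bsub>dl B M\<^esub> dg B M"
   using span[OF det_wedge_closed[OF sB M MB bs]] by auto
  moreover from this have "c = vl B M bs" using lg l(2)[OF bs] by metis
  ultimately show ?thesis by simp
 qed
 show "c \<odot>\<^bsub>dl B M\<^esub> dg B M = d \<odot>\<^bsub>dl B M\<^esub> dg B M \<longleftrightarrow> c = d"
  if "c \<in> carrier K" "d \<in> carrier K" for c d using lg that by metis
qed

section \<open>Commensurability\<close>

lemma fgen_refl: "fgen B B"
 unfolding fin_gen_mod_def by (intro exI[of _ "[]"]) simp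

lemma fgen_trans: "fgen N M ==> fgen B N ==> fgen B M"
proof -
 assume "fgen N M" "fgen B N"
 then obtain as bs where "set as \<subseteq> carrier V" "spanm M as = N" "set bs \<subseteq> carrier V" "spanm N bs = B"
  by (auto simp: fin_gen_mod_def)
 then show ?thesis unfolding fin_gen_mod_def by (intro exI[of _ "bs @ as"]) (auto simp: spn_append)
qed

text \<open>Finite codimension passes to intersections. Adding one vector \<open>b\<close> to \<open>M\<close> enlarges \<open>Y \<inter> M\<close> by at most
one dimension: either some element of \<open>Y\<close> involves \<open>b\<close>, and it generates the rest, or none does.\<close>

lemma fgen_restrict:
 assumes M: "sub M" and Y: "sub Y"
 shows "set bs \<subseteq> carrier V ==> fgen (Y \<inter> spanm M bs) (Y \<inter> M)"
proof (induction bs)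
 case (Cons b bs)
 let ?N = "spanm M bs"
 have b: "b \<in> carrier V" and N: "sub ?N" using Cons.prems spn_sub[OF M] by auto
 have YN: "sub (Y \<inter> ?N)" by (rule sub_Int[OF Y N])
 have IH: "fgen (Y \<inter> ?N) (Y \<inter> M)" using Cons by auto
 note dN = subD[OF N] and dY = subD[OF Y]
 show ?case
 proof (cases "Y \<inter> spanm M (b # bs) \<subseteq> ?N")
  case True
  then have "Y \<inter> spanm M (b # bs) = Y \<inter> ?N" using spn_Cons_mono[OF M Cons.prems] by blast
  then show ?thesis using IH by simp
 next
  case False
  then obtain x where x: "x \<in> Y" "x \<in> spanm M (b # bs)" "x \<notin> ?N" by auto
  then obtain y c where y: "y \<in> ?N" "c \<in> carrier K" "x = y \<oplus>\<^bsub>V\<^esub> c \<odot>\<^bsub>V\<^esub> b" by auto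
  have yc: "y \<in> carrier V" using y dN by auto
  have c0: "c \<noteq> \<zero>" using x(3) y yc b by auto
  note ic = invK[OF y(2) c0]
  have xc: "x \<in> carrier V" using x dY by auto
  have "Y \<inter> spanm M (b # bs) = spanm (Y \<inter> ?N) [x]"
  proof
   show "Y \<inter> spanm M (b # bs) \<subseteq> spanm (Y \<inter> ?N) [x]"
   proof
    fix z assume z: "z \<in> Y \<inter> spanm M (b # bs)"
    then obtain y' c' where y': "y' \<in> ?N" "c' \<in> carrier K" "z = y' \<oplus>\<^bsub>V\<^esub> c' \<odot>\<^bsub>V\<^esub> b" by auto
    have yc': "y' \<in> carrier V" using y' dN by auto
    let ?d = "c' \<otimes> inv c"
    have d: "?d \<in> carrier K" using y'(2) ic by simp
    have zc: "z \<in> carrier V" using z dY by auto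
    have "?d \<otimes> c = c'" using y'(2) y(2) ic by (simp add: R.m_assoc)
    then have dx: "?d \<odot>\<^bsub>V\<^esub> x = ?d \<odot>\<^bsub>V\<^esub> y \<oplus>\<^bsub>V\<^esub> c' \<odot>\<^bsub>V\<^esub> b"
     using d y yc b by (simp add: smult_r_distr smult_assoc1[symmetric])
    have eqv: "z \<ominus>\<^bsub>V\<^esub> ?d \<odot>\<^bsub>V\<^esub> x = y' \<ominus>\<^bsub>V\<^esub> ?d \<odot>\<^bsub>V\<^esub> y"
    proof -
     have "(?d \<odot>\<^bsub>V\<^esub> y) \<oplus>\<^bsub>V\<^esub> z = y' \<oplus>\<^bsub>V\<^esub> (?d \<odot>\<^bsub>V\<^esub> x)"
      unfolding dx y'(3) using d y yc yc' y'(2) b by (simp add: M.a_ac)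
     then show ?thesis using d yc yc' zc xc by (intro add_eq_minus) auto
    qed
    have "z \<ominus>\<^bsub>V\<^esub> ?d \<odot>\<^bsub>V\<^esub> x \<in> Y" using z x d dY by auto
    moreover have "z \<ominus>\<^bsub>V\<^esub> ?d \<odot>\<^bsub>V\<^esub> x \<in> ?N" unfolding eqv using y y' d dN by auto
    moreover have "z = (z \<ominus>\<^bsub>V\<^esub> ?d \<odot>\<^bsub>V\<^esub> x) \<oplus>\<^bsub>V\<^esub> ?d \<odot>\<^bsub>V\<^esub> x"
     using zc xc d by (simp add: a_minus_def M.a_assoc M.l_neg)
    ultimately show "z \<in> spanm (Y \<inter> ?N) [x]" using d unfolding spn.simps by blast
   qed
   have "sub (Y \<inter> spanm M (b # bs))" by (rule sub_Int[OF Y spn_sub[OF M Cons.prems]])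
   then show "spanm (Y \<inter> ?N) [x] \<subseteq> Y \<inter> spanm M (b # bs)"
    using x spn_Cons_mono[OF M Cons.prems] by (intro spn_least) auto
  qed
  then have "fgen (Y \<inter> spanm M (b # bs)) (Y \<inter> ?N)" using xc unfolding fin_gen_mod_def by (intro exI[of _ "[x]"]) auto
  then show ?thesis using fgen_trans[OF IH] by blast
 qed
qed (simp add: fgen_refl)

lemma fgen_Int: "sub M ==> sub Y ==> fgen B M ==> fgen (Y \<inter> B) (Y \<inter> M)"
 using fgen_restrict by (auto simp: fin_gen_mod_def[of K V B])

lemma fgen_lower: "sub M ==> sub N ==> fgen B M ==> M \<subseteq> N ==> N \<subseteq> B ==> fgen N M"
 using fgen_Int[of M N B] by (simp add: Int_absorb1 Int_absorb2)

lemma fgen_upper: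
 assumes M: "sub M" and N: "sub N" and B: "fgen B M" and MN: "M \<subseteq> N" and NB: "N \<subseteq> B"
 shows "fgen B N"
proof -
 obtain bs where bs: "set bs \<subseteq> carrier V" "spanm M bs = B" using B by (auto simp: fin_gen_mod_def)
 have sB: "sub B" using spn_sub[OF M bs(1)] bs(2) by simp
 have "spanm N bs = B"
 proof
  show "spanm N bs \<subseteq> B" using spn_gen[OF M bs(1)] bs(2) NB by (intro spn_least sB) auto
  have "spanm M bs \<subseteq> spanm N bs" using MN spn_base[OF N bs(1)] spn_gen[OF N bs(1)] by (intro spn_least spn_sub N bs(1)) auto
  then show "B \<subseteq> spanm N bs" using bs by simp
 qed
 then show ?thesis using bs(1) by (auto simp: fin_gen_mod_def)
qed

text \<open>The second isomorphism theorem in the form needed: generators of \<open>B\<close> modulo \<open>A \<inter> B\<close> generate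
\<open>A + B\<close> modulo \<open>A\<close>.\<close>

lemma set_add_spn:
 assumes A: "sub A" and B: "sub B" and bs: "set bs \<subseteq> carrier V" "spanm (A \<inter> B) bs = B"
 shows "A <+>\<^bsub>V\<^esub> B = spanm A bs"
proof
 have AB: "sub (A \<inter> B)" by (rule sub_Int[OF A B])
 have S: "sub (spanm A bs)" by (rule spn_sub[OF A bs(1)])
 have "spanm (A \<inter> B) bs \<subseteq> spanm A bs"
  using spn_base[OF A bs(1)] spn_gen[OF A bs(1)] by (intro spn_least S) auto
 then have "B \<subseteq> spanm A bs" using bs(2) by simp
 then show "A <+>\<^bsub>V\<^esub> B \<subseteq> spanm A bs" using spn_base[OF A bs(1)] subD(3)[OF S] by (auto simp: set_add_def')
 have "set xs \<subseteq> B ==> z \<in> spanm A xs ==> \<exists>a\<in>A. \<exists>b\<in>B. z = a \<oplus>\<^bsub>V\<^esub> b" for xs z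
 proof (induction xs arbitrary: z)
  case Nil
  then show ?case using subD(1)[OF A] subD(2)[OF B] by (intro bexI[of _ z] bexI[of _ "\<zero>\<^bsub>V\<^esub>"]) auto
 next
  case (Cons x xs)
  then obtain y c where y: "y \<in> spanm A xs" "c \<in> carrier K" "z = y \<oplus>\<^bsub>V\<^esub> c \<odot>\<^bsub>V\<^esub> x" by auto
  have "\<exists>a\<in>A. \<exists>b\<in>B. y = a \<oplus>\<^bsub>V\<^esub> b" by (rule Cons.IH) (use Cons.prems y in simp_all)
  then obtain a b where ab: "a \<in> A" "b \<in> B" "y = a \<oplus>\<^bsub>V\<^esub> b" by blast
  have x: "x \<in> B" using Cons by simp
  have "z = a \<oplus>\<^bsub>V\<^esub> (b \<oplus>\<^bsub>V\<^esub> c \<odot>\<^bsub>V\<^esub> x)" using ab y x subD(1)[OF A] subD(1)[OF B] by (simp add: M.a_assoc)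
  moreover have "b \<oplus>\<^bsub>V\<^esub> c \<odot>\<^bsub>V\<^esub> x \<in> B" using ab y x subD[OF B] by auto
  ultimately show ?case using ab by blast
 qed
 moreover have "set bs \<subseteq> B" using spn_gen[OF AB bs(1)] bs(2) by simp
 ultimately show "spanm A bs \<subseteq> A <+>\<^bsub>V\<^esub> B" by (fastforce simp: set_add_def')
qed

lemma sub_set_add: "sub A ==> sub B ==> sub (A <+>\<^bsub>V\<^esub> B) \<and> A \<subseteq> A <+>\<^bsub>V\<^esub> B \<and> B \<subseteq> A <+>\<^bsub>V\<^esub> B"
proof (intro conjI)
 assume A: "sub A" and B: "sub B"
 note dA = subD[OF A] and dB = subD[OF B]
 have el: "z \<in> A <+>\<^bsub>V\<^esub> B \<longleftrightarrow> (\<exists>a\<in>A. \<exists>b\<in>B. z = a \<oplus>\<^bsub>V\<^esub> b)" for z by (auto simp: set_add_def')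
 show "A \<subseteq> A <+>\<^bsub>V\<^esub> B"
 proof
  fix a assume "a \<in> A"
  moreover from this have "a = a \<oplus>\<^bsub>V\<^esub> \<zero>\<^bsub>V\<^esub>" using dA by simp
  ultimately show "a \<in> A <+>\<^bsub>V\<^esub> B" using dB(2) unfolding el by blast
 qed
 show "B \<subseteq> A <+>\<^bsub>V\<^esub> B"
 proof
  fix b assume "b \<in> B"
  moreover from this have "b = \<zero>\<^bsub>V\<^esub> \<oplus>\<^bsub>V\<^esub> b" using dB by simp
  ultimately show "b \<in> A <+>\<^bsub>V\<^esub> B" using dA(2) unfolding el by blast
 qed
 then have z: "\<zero>\<^bsub>V\<^esub> \<in> A <+>\<^bsub>V\<^esub> B" using dB by auto
 show "sub (A <+>\<^bsub>V\<^esub> B)" unfolding sub_iff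
 proof (intro conjI ballI z)
  show "A <+>\<^bsub>V\<^esub> B \<subseteq> carrier V" using dA(1) dB(1) by (auto simp: el)
  fix v w assume "v \<in> A <+>\<^bsub>V\<^esub> B" "w \<in> A <+>\<^bsub>V\<^esub> B"
  then obtain a b a' b' where ab: "a \<in> A" "b \<in> B" "v = a \<oplus>\<^bsub>V\<^esub> b" "a' \<in> A" "b' \<in> B" "w = a' \<oplus>\<^bsub>V\<^esub> b'" unfolding el by blast
  then have "v \<oplus>\<^bsub>V\<^esub> w = (a \<oplus>\<^bsub>V\<^esub> a') \<oplus>\<^bsub>V\<^esub> (b \<oplus>\<^bsub>V\<^esub> b')" using dA(1) dB(1) by (simp add: M.a_ac)
  then show "v \<oplus>\<^bsub>V\<^esub> w \<in> A <+>\<^bsub>V\<^esub> B" using dA(3) dB(3) ab unfolding el by blast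
 next
  fix c v assume c: "c \<in> carrier K" "v \<in> A <+>\<^bsub>V\<^esub> B"
  then obtain a b where ab: "a \<in> A" "b \<in> B" "v = a \<oplus>\<^bsub>V\<^esub> b" unfolding el by blast
  then have "c \<odot>\<^bsub>V\<^esub> v = c \<odot>\<^bsub>V\<^esub> a \<oplus>\<^bsub>V\<^esub> c \<odot>\<^bsub>V\<^esub> b" using c dA(1) dB(1) by (simp add: smult_r_distr)
  then show "c \<odot>\<^bsub>V\<^esub> v \<in> A <+>\<^bsub>V\<^esub> B" using dA(4) dB(4) ab c unfolding el by blast
 qed
qed

text \<open>Replaces the definition by two one-sided conditions, which are easier to compose.\<close>

lemma commensurable_iff:
 assumes A: "sub A" and B: "sub B"
 shows "commensurable K V A B \<longleftrightarrow> fgen A (A \<inter> B) \<and> fgen B (A \<inter> B)"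
proof -
 have AB: "sub (A \<inter> B)" by (rule sub_Int[OF A B])
 note S = sub_set_add[OF A B]
 have "commensurable K V A B \<longleftrightarrow> fgen (A <+>\<^bsub>V\<^esub> B) (A \<inter> B)"
  unfolding commensurable_def using S by (intro fin_dim_subquot AB) auto
 also have "\<dots> \<longleftrightarrow> fgen A (A \<inter> B) \<and> fgen B (A \<inter> B)"
 proof
  assume f: "fgen (A <+>\<^bsub>V\<^esub> B) (A \<inter> B)"
  show "fgen A (A \<inter> B) \<and> fgen B (A \<inter> B)"
   using fgen_lower[OF AB A f] fgen_lower[OF AB B f] S by auto
 next
  assume f: "fgen A (A \<inter> B) \<and> fgen B (A \<inter> B)"
  then obtain bs where bs: "set bs \<subseteq> carrier V" "spanm (A \<inter> B) bs = B" by (auto simp: fin_gen_mod_def)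
  have "fgen (A <+>\<^bsub>V\<^esub> B) A" using set_add_spn[OF A B bs] bs(1) by (auto simp: fin_gen_mod_def)
  then show "fgen (A <+>\<^bsub>V\<^esub> B) (A \<inter> B)" using f fgen_trans by blast
 qed
 finally show ?thesis .
qed

lemma commensurable_sym: "sub A ==> sub B ==> commensurable K V A B ==> commensurable K V B A"
 by (simp add: commensurable_iff Int_commute)

lemma commensurable_trans:
 assumes A: "sub A" and B: "sub B" and C: "sub C" and AB: "commensurable K V A B" and BC: "commensurable K V B C"
 shows "commensurable K V A C"
proof -
 have f: "fgen A (A \<inter> B)" "fgen B (A \<inter> B)" "fgen B (B \<inter> C)" "fgen C (B \<inter> C)"
  using AB BC A B C by (auto simp: commensurable_iff)
 have s: "sub (A \<inter> B)" "sub (B \<inter> C)" "sub (A \<inter> C)" "sub (A \<inter> B \<inter> C)" using A B C by (auto intro!: sub_Int)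
 have "fgen (A \<inter> B \<inter> B) (A \<inter> B \<inter> (B \<inter> C))" by (rule fgen_Int[OF s(2,1) f(3)])
 then have "fgen (A \<inter> B) (A \<inter> B \<inter> C)" by (simp add: Int_ac)
 then have 1: "fgen A (A \<inter> B \<inter> C)" using fgen_trans f(1) by blast
 have "fgen (B \<inter> C \<inter> B) (B \<inter> C \<inter> (A \<inter> B))" by (rule fgen_Int[OF s(1,2) f(2)])
 moreover have "B \<inter> C \<inter> B = B \<inter> C" "B \<inter> C \<inter> (A \<inter> B) = A \<inter> B \<inter> C" by auto
 ultimately have "fgen (B \<inter> C) (A \<inter> B \<inter> C)" by simp
 then have 2: "fgen C (A \<inter> B \<inter> C)" using fgen_trans f(4) by blast
 show ?thesis unfolding commensurable_iff[OF A C]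
  using fgen_upper[OF s(4,3) 1] fgen_upper[OF s(4,3) 2] by auto
qed

section \<open>Volumes along a flag\<close>

lemma mbasis_append:
 assumes M': "sub M'" and ms: "mbasis M M' ms" and bs: "mbasis B M bs"
 shows "mbasis B M' (bs @ ms)"
proof -
 have ind: "indepm (spanm M' ms) xs ==> indepm M' ms ==> indepm M' (xs @ ms)" for xs
  by (induction xs) (auto simp: spn_append)
 show ?thesis using ms bs ind[of bs] by (auto simp: basis_mod_def spn_append)
qed

lemma qdim_add:
 assumes M': "sub M'" and M: "fgen M M'" and B: "fgen B M"
 shows "qdim K V B M' = qdim K V M M' + qdim K V B M"
proof -
 have sM: "sub M" using fgen_sub[OF M' M] by simp
 obtain ms where ms: "mbasis M M' ms" using sub_fgen_basis[OF M' M] by auto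
 obtain bs where bs: "mbasis B M bs" using sub_fgen_basis[OF sM B] by auto
 show ?thesis using qdim_eq_length[OF M' mbasis_append[OF M' ms bs]] qdim_eq_length[OF M' ms] qdim_eq_length[OF sM bs] by simp
qed

text \<open>Fixing vectors \<open>ms\<close> which generate \<open>M/M'\<close> as first arguments makes the form vanish on \<open>M\<close> in
all other arguments: an entry from \<open>M\<close> makes \<open>m + 1\<close> vectors in the \<open>m\<close>-dimensional space \<open>M/M'\<close>.\<close>

lemma alt_prefix:
 assumes D: "altf B M' (m + n) D" and M: "M \<subseteq> B" and MM: "M' \<subseteq> M" and M': "sub M'" and B: "sub B"
  and ms: "mbasis M M' ms'" "length ms' = m" "length ms = m" "set ms \<subseteq> M"
 shows "altf B M n (\<lambda>bs. D (ms @ bs))"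
proof (rule altI)
 note d = altD[OF D]
 have msB: "set ms \<subseteq> B" using ms M by auto
 fix bs assume "length bs = n" "set bs \<subseteq> B"
 then show "D (ms @ bs) \<in> carrier K" using ms msB by (intro d(1)) auto
next
 note d = altD[OF D]
 have msB: "set ms \<subseteq> B" using ms M by auto
 fix us c v w ws assume a: "Suc (length us + length ws) = n" "set us \<subseteq> B" "set ws \<subseteq> B" "v \<in> B" "w \<in> B" "c \<in> carrier K"
 show "D (ms @ us @ (w \<oplus>\<^bsub>V\<^esub> c \<odot>\<^bsub>V\<^esub> v) # ws) = D (ms @ us @ w # ws) \<oplus> c \<otimes> D (ms @ us @ v # ws)"
  using d(2)[of "ms @ us" ws v w c] a ms msB by simp
next
 note d = altD[OF D]
 have msB: "set ms \<subseteq> B" using ms M by auto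
 fix us v ys ws assume a: "Suc (Suc (length us + length ys + length ws)) = n" "set us \<subseteq> B" "set ys \<subseteq> B" "set ws \<subseteq> B" "v \<in> B"
 show "D (ms @ us @ v # ys @ v # ws) = \<zero>" using d(3)[of "ms @ us" ys ws v] a ms msB by simp
next
 note d = altD[OF D]
 have msB: "set ms \<subseteq> B" using ms M by auto
 fix us x ws assume a: "Suc (length us + length ws) = n" "set us \<subseteq> B" "set ws \<subseteq> B" "x \<in> M"
 define E where "E zs = D ((\<lambda>ys. take m ys @ us @ drop m ys @ ws) zs)" for zs
 have es: "set ms' \<subseteq> carrier V" "M = spanm M' ms'" using ms by (auto simp: basis_mod_def)
 have E: "altf M M' (Suc m) E"
 proof (rule altI)
  fix bs assume b: "length bs = Suc m" "set bs \<subseteq> M"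
  then have "set (take m bs) \<subseteq> B" "set (drop m bs) \<subseteq> B" using M set_take_subset[of m bs] set_drop_subset[of m bs] by auto
  then show "E bs \<in> carrier K" unfolding E_def using a b by (intro d(1)) auto
 next
  fix ps c v w qs assume b: "Suc (length ps + length qs) = Suc m" "set ps \<subseteq> M" "set qs \<subseteq> M" "v \<in> M" "w \<in> M" "c \<in> carrier K"
  show "E (ps @ (w \<oplus>\<^bsub>V\<^esub> c \<odot>\<^bsub>V\<^esub> v) # qs) = E (ps @ w # qs) \<oplus> c \<otimes> E (ps @ v # qs)"
  proof (cases qs rule: rev_cases)
   case Nil
   then have m: "m = length ps" using b by simp
   then show ?thesis using d(2)[of "ps @ us" ws v w c] a b M Nil by (simp add: E_def m subset_iff)
  next
   case (snoc qs' z)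
   then have m: "m = Suc (length ps + length qs')" using b by simp
   then show ?thesis using d(2)[of ps "qs' @ us @ z # ws" v w c] a b M snoc by (simp add: E_def m subset_iff)
  qed
 next
  fix ps v ys qs assume b: "Suc (Suc (length ps + length ys + length qs)) = Suc m" "set ps \<subseteq> M" "set ys \<subseteq> M" "set qs \<subseteq> M" "v \<in> M"
  show "E (ps @ v # ys @ v # qs) = \<zero>"
  proof (cases qs rule: rev_cases)
   case Nil
   then have m: "m = Suc (length ps + length ys)" using b by simp
   then show ?thesis using d(3)[of ps "ys @ us" ws v] a b M Nil by (simp add: E_def m subset_iff)
  next
   case (snoc qs' z)
   then have m: "m = Suc (Suc (length ps + length ys + length qs'))" using b by simp
   have e: "m - length ps = Suc (Suc (length ys + length qs'))" using m by simp
   show ?thesis using d(3)[of ps ys "qs' @ us @ z # ws" v] a b M snoc by (simp add: E_def m e subset_iff)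
  qed
 next
  fix ps v qs assume b: "Suc (length ps + length qs) = Suc m" "set ps \<subseteq> M" "set qs \<subseteq> M" "v \<in> M'"
  show "E (ps @ v # qs) = \<zero>"
  proof (cases qs rule: rev_cases)
   case Nil
   then have m: "m = length ps" using b by simp
   then show ?thesis using d(4)[of "ps @ us" ws v] a b M Nil by (simp add: E_def m subset_iff)
  next
   case (snoc qs' z)
   then have m: "m = Suc (length ps + length qs')" using b by simp
   then show ?thesis using d(4)[of ps "qs' @ us @ z # ws" v] a b M snoc by (simp add: E_def m subset_iff)
  qed
 qed
 have Z: "altf M M' (Suc m) (\<lambda>_. \<zero>)" by (rule zero_alt)
 have "\<one> \<otimes> E (ms @ [x]) = \<one> \<otimes> (\<lambda>_. \<zero>) (ms @ [x])"
 proof (rule alt_expand[OF M' es _ E Z])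
 qed (use ms a in simp_all)
 moreover have Ex: "E (ms @ [x]) = D (ms @ us @ x # ws)" using ms by (simp add: E_def)
 moreover have "E (ms @ [x]) \<in> carrier K" using altD(1)[OF E, of "ms @ [x]"] ms a by simp
 ultimately show "D (ms @ us @ x # ws) = \<zero>" by simp
qed

lemma alt_suffix:
 assumes D: "altf B M' (m + n) D" and M: "M \<subseteq> B" and bs: "length bs = n" "set bs \<subseteq> B"
 shows "altf M M' m (\<lambda>ms. D (ms @ bs))"
proof -
 note d = altD[OF D]
 show ?thesis
 proof (rule altI)
  fix ms assume "length ms = m" "set ms \<subseteq> M"
  then show "D (ms @ bs) \<in> carrier K" using bs M by (intro d(1)) auto
 next
  fix us c v w ws assume a: "Suc (length us + length ws) = m" "set us \<subseteq> M" "set ws \<subseteq> M" "v \<in> M" "w \<in> M" "c \<in> carrier K"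
  show "D ((us @ (w \<oplus>\<^bsub>V\<^esub> c \<odot>\<^bsub>V\<^esub> v) # ws) @ bs) = D ((us @ w # ws) @ bs) \<oplus> c \<otimes> D ((us @ v # ws) @ bs)"
   using d(2)[of us "ws @ bs" v w c] a bs M by (simp add: subset_iff)
 next
  fix us v ys ws assume a: "Suc (Suc (length us + length ys + length ws)) = m" "set us \<subseteq> M" "set ys \<subseteq> M" "set ws \<subseteq> M" "v \<in> M"
  show "D ((us @ v # ys @ v # ws) @ bs) = \<zero>" using d(3)[of us ys "ws @ bs" v] a bs M by (simp add: subset_iff)
 next
  fix us x ws assume a: "Suc (length us + length ws) = m" "set us \<subseteq> M" "set ws \<subseteq> M" "x \<in> M'"
  show "D ((us @ x # ws) @ bs) = \<zero>" using d(4)[of us "ws @ bs" x] a bs M by (simp add: subset_iff)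
 qed
qed

text \<open>Source of all signs: two blocks pass each other by as many transpositions as there are pairs.\<close>

lemma alt_block_swap:
 assumes D: "altf B M n D" and B: "sub B"
 shows "[|length us + length xs + length ys + length ws = n; set us \<subseteq> B; set xs \<subseteq> B; set ys \<subseteq> B; set ws \<subseteq> B|] ==>
  D (us @ ys @ xs @ ws) = (\<ominus> \<one>) [^] (length xs * length ys) \<otimes> D (us @ xs @ ys @ ws)"
proof -
 have one: "D (us @ ys @ x # ws) = (\<ominus> \<one>) [^] (length ys) \<otimes> D (us @ x # ys @ ws)"
  if "Suc (length us + length ys + length ws) = n" "set us \<subseteq> B" "x \<in> B" "set ys \<subseteq> B" "set ws \<subseteq> B" for us x ys ws
  using that
 proof (induction ys arbitrary: us)
  case Nil
  then show ?case using altD(1)[OF D, of "us @ x # ws"] by simp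
 next
  case (Cons y ys)
  have c: "D (us @ y # x # ys @ ws) \<in> carrier K" "D (us @ x # y # ys @ ws) \<in> carrier K"
   using Cons.prems by (auto intro!: altD(1)[OF D])
  have "D ((us @ [y]) @ ys @ x # ws) = (\<ominus> \<one>) [^] (length ys) \<otimes> D ((us @ [y]) @ x # ys @ ws)"
   using Cons.prems by (intro Cons.IH) auto
  moreover have "D (us @ y # x # ys @ ws) = \<ominus> D (us @ x # y # ys @ ws)"
   using Cons.prems by (intro alt_swap[OF D B]) auto
  ultimately show ?case using c by (simp add: R.m_assoc R.l_minus R.r_minus)
 qed
 show "[|length us + length xs + length ys + length ws = n; set us \<subseteq> B; set xs \<subseteq> B; set ys \<subseteq> B; set ws \<subseteq> B|] ==>
  D (us @ ys @ xs @ ws) = (\<ominus> \<one>) [^] (length xs * length ys) \<otimes> D (us @ xs @ ys @ ws)"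
 proof (induction xs arbitrary: us)
  case Nil
  then show ?case using altD(1)[OF D, of "us @ ys @ ws"] by simp
 next
  case (Cons x xs)
  have c: "D (us @ x # xs @ ys @ ws) \<in> carrier K" using Cons.prems by (auto intro!: altD(1)[OF D])
  have "D (us @ ys @ x # xs @ ws) = (\<ominus> \<one>) [^] (length ys) \<otimes> D (us @ x # ys @ xs @ ws)"
   using Cons.prems by (intro one) auto
  also have "D ((us @ [x]) @ ys @ xs @ ws) = (\<ominus> \<one>) [^] (length xs * length ys) \<otimes> D ((us @ [x]) @ xs @ ys @ ws)"
   using Cons.prems by (intro Cons.IH) auto
  then have "D (us @ x # ys @ xs @ ws) = (\<ominus> \<one>) [^] (length xs * length ys) \<otimes> D (us @ x # xs @ ys @ ws)" by simp
  finally show ?case using c by (simp add: R.nat_pow_mult[symmetric] R.m_assoc)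
 qed
qed

text \<open>Both sides are alternating of top degree in \<open>bs\<close> and in \<open>ms\<close>, hence proportional. The
factor is nonzero because concatenated bases form a basis.\<close>

lemma vol_flag:
 assumes M': "sub M'" and M: "fgen M M'" and B: "fgen B M"
 shows "\<exists>t\<in>carrier K. t \<noteq> \<zero> \<and> (\<forall>ms\<in>fr M M'. \<forall>bs\<in>fr B M.
  vl B M' (ms @ bs) = t \<otimes> (vl M M' ms \<otimes> vl B M bs))"
proof -
 have sM: "sub M" "M' \<subseteq> M" using fgen_sub[OF M' M] by auto
 have sB: "sub B" "M \<subseteq> B" using fgen_sub[OF sM(1) B] by auto
 have BM': "fgen B M'" by (rule fgen_trans[OF M B])
 obtain ms where ms: "mbasis M M' ms" "vl M M' ms = \<one>" using vol_spec(2)[OF M' M] by auto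
 obtain bs where bs: "mbasis B M bs" "vl B M bs = \<one>" using vol_spec(2)[OF sM(1) B] by auto
 note qm = qdim_eq_length[OF M' ms(1)] and qb = qdim_eq_length[OF sM(1) bs(1)]
 have D: "altf B M' (length ms + length bs) (vl B M')"
  using vol_spec(1)[OF M' BM'] qdim_add[OF M' M B] qm qb by simp
 have msM: "set ms \<subseteq> M" "set bs \<subseteq> B" using mbasisD[OF M' ms(1)] mbasisD[OF sM(1) bs(1)] by auto
 define t where "t = vl B M' (ms @ bs)"
 have t: "t \<in> carrier K" unfolding t_def using altD(1)[OF D, of "ms @ bs"] msM sB by auto
 have 1: "vl B M' (xs @ ys) = t \<otimes> (vl M M' xs \<otimes> vl B M ys)"
  if xs: "xs \<in> fr M M'" and ys: "ys \<in> fr B M" for xs ys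
 proof -
  have l: "length xs = length ms" "set xs \<subseteq> M" "length ys = length bs" "set ys \<subseteq> B"
   using xs ys qm qb by (auto simp: frames_iff)
  have "vl B M' (xs @ ys) = vl B M' (ms @ ys) \<otimes> vl M M' xs"
   using alt_compare[OF M' ms(1) alt_suffix[OF D sB(2) l(3,4)], of "vl M M'" xs] vol_spec(1)[OF M' M] qm ms(2) l by simp
  also have "vl B M' (ms @ ys) = t \<otimes> vl B M ys"
   using alt_compare[OF sM(1) bs(1) alt_prefix[OF D sB(2) sM(2) M' sB(1) ms(1) refl refl msM(1)], of "vl B M" ys]
    vol_spec(1)[OF sM(1) B] qb bs(2) l by (simp add: t_def)
  finally show ?thesis using t vol_closed[OF M' M xs] vol_closed[OF sM(1) B ys] by (simp add: R.m_ac)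
 qed
 have "vl B M' (bs @ ms) \<noteq> \<zero>" by (rule vol_basis_nonzero[OF M' mbasis_append[OF M' ms(1) bs(1)]])
 moreover have "vl B M' (bs @ ms) = (\<ominus> \<one>) [^] (length ms * length bs) \<otimes> t"
  using alt_block_swap[OF D sB(1), of "[]" ms bs "[]"] msM sB by (auto simp: t_def)
 ultimately have "t \<noteq> \<zero>" by auto
 with t 1 show ?thesis by blast
qed

end

section \<open>The lines \<open>(A|B)\<close>\<close>

text \<open>The factor in \<open>vol_flag\<close>. It measures how the chosen volume forms fail to be compatible with the
isomorphism \<open>\<and>\<^sup>t\<^sup>o\<^sup>p(M/M') \<otimes> \<and>\<^sup>t\<^sup>o\<^sup>p(B/M) = \<and>\<^sup>t\<^sup>o\<^sup>p(B/M')\<close>.\<close>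

definition flag_coeff :: "'k ring => ('k, 'v) module => 'v set => 'v set => 'v set => 'k" where
 "flag_coeff K V B M M' = (SOME t. t \<in> carrier K \<and> t \<noteq> \<zero>\<^bsub>K\<^esub> \<and> (\<forall>ms\<in>frames K V M M'. \<forall>bs\<in>frames K V B M.
   vol K V B M' (ms @ bs) = t \<otimes>\<^bsub>K\<^esub> (vol K V M M' ms \<otimes>\<^bsub>K\<^esub> vol K V B M bs)))"

text \<open>The coordinate of the component \<open>\<phi>\<^sub>M\<close> with respect to the generators of both determinant lines.\<close>

definition line_coeff :: "'k ring => ('k, 'v) module => 'v set => 'v set => ('k, 'v) line_elem => 'v set => 'k" where
 "line_coeff K V A B \<phi> M = (THE k. k \<in> carrier K \<and> \<phi> M (det_gen K V B M) = k \<odot>\<^bsub>det_line K V A M\<^esub> det_gen K V A M)"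

locale lattice_kspace = kspace K V for K :: "'k ring" (structure) and V :: "('k, 'v) module" +
 fixes P :: "'v set"
 assumes P: "submodule K P V"
begin

text \<open>Lattices are the subspaces commensurable with \<open>P\<close>.\<close>

definition lat :: "'v set => bool" where "lat A \<longleftrightarrow> sub A \<and> commensurable K V A P"

lemma lat_sub: "lat A ==> sub A" by (simp add: lat_def)

lemma lat_P: "lat P" using P fgen_refl by (simp add: lat_def commensurable_iff)

lemma lat_comm: "lat A ==> lat B ==> commensurable K V A B"
 unfolding lat_def using P commensurable_sym commensurable_trans by blast

lemma lat_fgen: "lat M ==> lat B ==> M \<subseteq> B ==> fgen B M"
 using lat_comm[of M B] commensurable_iff[OF lat_sub lat_sub, of M B] by (simp add: Int_absorb2)

lemma lat_lower: "lat B ==> sub M ==> M \<subseteq> B ==> fgen B M ==> lat M"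
proof -
 assume a: "lat B" "sub M" "M \<subseteq> B" "fgen B M"
 have "commensurable K V M B" using a lat_sub[OF a(1)] fgen_refl by (simp add: commensurable_iff Int_absorb2)
 then show "lat M" using a commensurable_trans[OF a(2) lat_sub[OF a(1)] P] by (simp add: lat_def)
qed

lemma lat_Int: "lat A ==> lat B ==> lat (A \<inter> B)"
 using lat_lower[of A "A \<inter> B"] lat_comm[of A B] commensurable_iff[OF lat_sub lat_sub, of A B] sub_Int[OF lat_sub lat_sub, of A B]
 by simp

abbreviation minor where "minor \<equiv> minorants K V P"

lemma minor_iff: "M \<in> minor A B \<longleftrightarrow> lat M \<and> M \<subseteq> A \<and> M \<subseteq> B"
 by (auto simp: minorants_def lat_def VectorSpace.subspace_def vectorspace_axioms)

abbreviation th where "th \<equiv> flag_coeff K V"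
abbreviation kap where "kap \<equiv> line_coeff K V"
abbreviation rl where "rl \<equiv> rel_line K V P"

lemma lat_vol_closed: "lat M ==> lat B ==> M \<subseteq> B ==> bs \<in> fr B M ==> vl B M bs \<in> carrier K"
 by (rule vol_closed[OF lat_sub lat_fgen])

lemma lat_basis:
 assumes "lat M" "lat B" "M \<subseteq> B"
 obtains bs where "bs \<in> fr B M" "vl B M bs = \<one>"
 using vol_spec(2)[OF lat_sub lat_fgen, OF assms(1) assms] mbasis_frame[OF lat_sub[OF assms(1)]] by blast

lemma lat_det:
 assumes "lat M" "lat B" "M \<subseteq> B"
 shows dg_closed: "dg B M \<in> carrier (dl B M)"
  and dl_coord: "!!x. x \<in> carrier (dl B M) ==> \<exists>c\<in>carrier K. x = c \<odot>\<^bsub>dl B M\<^esub> dg B M"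
  and dw_vol: "!!bs. bs \<in> fr B M ==> dw B M bs = vl B M bs \<odot>\<^bsub>dl B M\<^esub> dg B M"
  and dg_cancel: "!!c d. c \<in> carrier K ==> d \<in> carrier K ==> c \<odot>\<^bsub>dl B M\<^esub> dg B M = d \<odot>\<^bsub>dl B M\<^esub> dg B M \<longleftrightarrow> c = d"
  and dl_module: "module K (dl B M)"
 using det_gen_facts[OF lat_sub lat_fgen, OF assms(1) assms] det_module[OF lat_sub lat_sub, of B M] assms by auto

lemma th:
 assumes "lat M'" "lat M" "lat B" "M' \<subseteq> M" "M \<subseteq> B"
 shows th_closed: "th B M M' \<in> carrier K" and th_nz: "th B M M' \<noteq> \<zero>"
  and vol_th: "!!ms bs. ms \<in> fr M M' ==> bs \<in> fr B M ==> vl B M' (ms @ bs) = th B M M' \<otimes> (vl M M' ms \<otimes> vl B M bs)"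
proof -
 have "\<exists>t. t \<in> carrier K \<and> t \<noteq> \<zero> \<and> (\<forall>ms\<in>fr M M'. \<forall>bs\<in>fr B M. vl B M' (ms @ bs) = t \<otimes> (vl M M' ms \<otimes> vl B M bs))"
  using vol_flag[OF lat_sub[OF assms(1)] lat_fgen lat_fgen, of M B] assms by blast
 from someI_ex[OF this, folded flag_coeff_def]
 show "th B M M' \<in> carrier K" "th B M M' \<noteq> \<zero>"
  "!!ms bs. ms \<in> fr M M' ==> bs \<in> fr B M ==> vl B M' (ms @ bs) = th B M M' \<otimes> (vl M M' ms \<otimes> vl B M bs)"
  by auto
qed

lemma lat_qdim: "lat M' ==> lat M ==> lat B ==> M' \<subseteq> M ==> M \<subseteq> B ==> qdim K V B M' = qdim K V M M' + qdim K V B M"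
 using qdim_add lat_sub lat_fgen by blast

lemma frames_append:
 "lat M' ==> lat M ==> lat B ==> M' \<subseteq> M ==> M \<subseteq> B ==> ms \<in> fr M M' ==> bs \<in> fr B M ==> ms @ bs \<in> fr B M'"
 using lat_qdim[of M' M B] by (auto simp: frames_iff)

text \<open>Evaluate the volume form of \<open>B/N\<close> on a concatenation of three bases, bracketed in two ways.\<close>

lemma th_cocycle:
 assumes l: "lat N" "lat M'" "lat M" "lat B" and s: "N \<subseteq> M'" "M' \<subseteq> M" "M \<subseteq> B"
 shows "th B M N \<otimes> th M M' N = th B M' N \<otimes> th B M M'"
proof -
 obtain ns where ns: "ns \<in> fr M' N" "vl M' N ns = \<one>" using lat_basis[OF l(1,2) s(1)] .
 obtain ms where ms: "ms \<in> fr M M'" "vl M M' ms = \<one>" using lat_basis[OF l(2,3) s(2)] .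
 obtain bs where bs: "bs \<in> fr B M" "vl B M bs = \<one>" using lat_basis[OF l(3,4) s(3)] .
 have nm: "ns @ ms \<in> fr M N" by (rule frames_append[OF l(1-3) s(1,2) ns(1) ms(1)])
 have mb: "ms @ bs \<in> fr B M'" by (rule frames_append[OF l(2-4) s(2,3) ms(1) bs(1)])
 have s': "N \<subseteq> M" "M' \<subseteq> B" using s by auto
 note c = th_closed[OF l(1,3,4) s'(1) s(3)] th_closed[OF l(1-3) s(1,2)] th_closed[OF l(1,2,4) s(1) s'(2)] th_closed[OF l(2-4) s(2,3)]
 have "vl B N ((ns @ ms) @ bs) = th B M N \<otimes> th M M' N"
  using vol_th[OF l(1,3,4) s'(1) s(3) nm bs(1)] vol_th[OF l(1-3) s(1,2) ns(1) ms(1)] ns ms bs c by simp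
 moreover have "vl B N (ns @ (ms @ bs)) = th B M' N \<otimes> th B M M'"
  using vol_th[OF l(1,2,4) s(1) s'(2) ns(1) mb] vol_th[OF l(2-4) s(2,3) ms(1) bs(1)] ns ms bs c by simp
 ultimately show ?thesis by simp
qed

lemma kap:
 assumes l: "lat A" "lat B" and \<phi>: "\<phi> \<in> rl A B" and M: "M \<in> minor A B"
 shows kap_closed: "kap A B \<phi> M \<in> carrier K"
  and kap_apply: "!!c. c \<in> carrier K ==> \<phi> M (c \<odot>\<^bsub>dl B M\<^esub> dg B M) = (kap A B \<phi> M \<otimes> c) \<odot>\<^bsub>dl A M\<^esub> dg A M"
proof -
 have m: "lat M" "M \<subseteq> A" "M \<subseteq> B" using M by (auto simp: minor_iff)
 have h: "\<phi> M \<in> module_hom K (dl B M) (dl A M)" using \<phi> M unfolding rel_line_def PiE_def by blast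
 note gB = dg_closed[OF m(1) l(2) m(3)]
 interpret A: module K "dl A M" by (rule dl_module[OF m(1) l(1) m(2)])
 have "\<phi> M (dg B M) \<in> carrier (dl A M)" using module_hom_closed[OF h] gB by auto
 then obtain k where k: "k \<in> carrier K" "\<phi> M (dg B M) = k \<odot>\<^bsub>dl A M\<^esub> dg A M" using dl_coord[OF m(1) l(1) m(2)] by auto
 have kk: "kap A B \<phi> M = k" unfolding line_coeff_def
  by (rule the_equality) (use k dg_cancel[OF m(1) l(1) m(2)] in auto)
 then show "kap A B \<phi> M \<in> carrier K" using k by simp
 fix c assume c: "c \<in> carrier K"
 have "\<phi> M (c \<odot>\<^bsub>dl B M\<^esub> dg B M) = c \<odot>\<^bsub>dl A M\<^esub> \<phi> M (dg B M)" by (rule module_hom_smult[OF h c gB])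
 also have "\<dots> = (k \<otimes> c) \<odot>\<^bsub>dl A M\<^esub> dg A M"
  using k c dg_closed[OF m(1) l(1) m(2)] by (simp add: A.smult_assoc1[symmetric] R.m_comm)
 finally show "\<phi> M (c \<odot>\<^bsub>dl B M\<^esub> dg B M) = (kap A B \<phi> M \<otimes> c) \<odot>\<^bsub>dl A M\<^esub> dg A M" by (simp add: kk)
qed

lemma kap_dw:
 assumes l: "lat A" "lat B" and \<phi>: "\<phi> \<in> rl A B" and M: "M \<in> minor A B" and f: "as \<in> fr A M" "bs \<in> fr B M" and c: "c \<in> carrier K"
 shows "\<phi> M (dw B M bs) = c \<odot>\<^bsub>dl A M\<^esub> dw A M as \<longleftrightarrow> kap A B \<phi> M \<otimes> vl B M bs = c \<otimes> vl A M as"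
proof -
 have m: "lat M" "M \<subseteq> A" "M \<subseteq> B" using M by (auto simp: minor_iff)
 interpret A: module K "dl A M" by (rule dl_module[OF m(1) l(1) m(2)])
 have v: "vl A M as \<in> carrier K" "vl B M bs \<in> carrier K" using lat_vol_closed m l f by auto
 note k = kap_closed[OF l \<phi> M]
 have "\<phi> M (dw B M bs) = (kap A B \<phi> M \<otimes> vl B M bs) \<odot>\<^bsub>dl A M\<^esub> dg A M"
  using dw_vol[OF m(1) l(2) m(3) f(2)] kap_apply[OF l \<phi> M v(2)] by simp
 moreover have "c \<odot>\<^bsub>dl A M\<^esub> dw A M as = (c \<otimes> vl A M as) \<odot>\<^bsub>dl A M\<^esub> dg A M"
  using dw_vol[OF m(1) l(1) m(2) f(1)] c v dg_closed[OF m(1) l(1) m(2)] by (simp add: A.smult_assoc1)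
 ultimately show ?thesis using dg_cancel[OF m(1) l(1) m(2)] k v c by simp
qed

text \<open>The compatibility condition on the family \<open>\<phi>\<close>, in coordinates: passing from \<open>M\<close> to \<open>M'\<close>
rescales the coordinate by the ratio of the two flag coefficients.\<close>

lemma kap_cons:
 assumes l: "lat A" "lat B" and \<phi>: "\<phi> \<in> rl A B" and M: "M \<in> minor A B" and M': "lat M'" "M' \<subseteq> M"
 shows "kap A B \<phi> M' \<otimes> th B M M' = kap A B \<phi> M \<otimes> th A M M'"
proof -
 have m: "lat M" "M \<subseteq> A" "M \<subseteq> B" using M by (auto simp: minor_iff)
 have Mm: "M' \<in> minor A B" using m M' by (auto simp: minor_iff)
 obtain ms where ms: "ms \<in> fr M M'" "vl M M' ms = \<one>" using lat_basis[OF M'(1) m(1) M'(2)] .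
 obtain as where as: "as \<in> fr A M" "vl A M as = \<one>" using lat_basis[OF m(1) l(1) m(2)] .
 obtain bs where bs: "bs \<in> fr B M" "vl B M bs = \<one>" using lat_basis[OF m(1) l(2) m(3)] .
 note k = kap_closed[OF l \<phi> M] and k' = kap_closed[OF l \<phi> Mm]
 have "\<phi> M (dw B M bs) = kap A B \<phi> M \<odot>\<^bsub>dl A M\<^esub> dw A M as"
  using kap_dw[OF l \<phi> M as(1) bs(1) k] as bs k by simp
 then have "\<phi> M' (dw B M' (ms @ bs)) = kap A B \<phi> M \<odot>\<^bsub>dl A M'\<^esub> dw A M' (ms @ as)"
  using \<phi> M Mm M'(2) ms(1) as(1) bs(1) k unfolding rel_line_def by blast
 then have "kap A B \<phi> M' \<otimes> vl B M' (ms @ bs) = kap A B \<phi> M \<otimes> vl A M' (ms @ as)"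
  using kap_dw[OF l \<phi> Mm _ _ k] frames_append[OF M'(1) m(1) l(1) M'(2) m(2) ms(1) as(1)]
   frames_append[OF M'(1) m(1) l(2) M'(2) m(3) ms(1) bs(1)] by simp
 then show ?thesis
  using vol_th[OF M'(1) m(1) l(1) M'(2) m(2) ms(1) as(1)] vol_th[OF M'(1) m(1) l(2) M'(2) m(3) ms(1) bs(1)]
   th_closed[OF M'(1) m(1) l(1) M'(2) m(2)] th_closed[OF M'(1) m(1) l(2) M'(2) m(3)] ms as bs by simp
qed

lemma mult_cancel: "a \<in> carrier K ==> b \<in> carrier K ==> c \<in> carrier K ==> c \<noteq> \<zero> ==> a \<otimes> c = b \<otimes> c \<longleftrightarrow> a = b"
 using m_rcancel[of c a b] by simp

text \<open>The line \<open>(A|B)\<close> has dimension at most one: the coordinate on \<open>M\<close> determines the one on every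
smaller lattice, and any two lattices have a common smaller one.\<close>

lemma rl_eqI:
 assumes l: "lat A" "lat B" and \<phi>: "\<phi> \<in> rl A B" and \<psi>: "\<psi> \<in> rl A B" and M: "M \<in> minor A B"
  and eq: "kap A B \<phi> M = kap A B \<psi> M"
 shows "\<phi> = \<psi>"
proof -
 have m: "lat M" "M \<subseteq> A" "M \<subseteq> B" using M by (auto simp: minor_iff)
 have k: "kap A B \<phi> N = kap A B \<psi> N" if N: "N \<in> minor A B" for N
 proof -
  have n: "lat N" "N \<subseteq> A" "N \<subseteq> B" using N by (auto simp: minor_iff)
  have i: "lat (M \<inter> N)" "M \<inter> N \<subseteq> M" "M \<inter> N \<subseteq> N" using lat_Int m n by auto
  then have im: "M \<inter> N \<in> minor A B" using m n by (auto simp: minor_iff)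
  note c = kap_closed[OF l \<phi> im] kap_closed[OF l \<psi> im] kap_closed[OF l \<phi> N] kap_closed[OF l \<psi> N]
  have "kap A B \<phi> (M \<inter> N) \<otimes> th B M (M \<inter> N) = kap A B \<psi> (M \<inter> N) \<otimes> th B M (M \<inter> N)"
   using kap_cons[OF l \<phi> M i(1,2)] kap_cons[OF l \<psi> M i(1,2)] eq by simp
  then have "kap A B \<phi> (M \<inter> N) = kap A B \<psi> (M \<inter> N)"
   using c th_closed[OF i(1) m(1) l(2) i(2) m(3)] th_nz[OF i(1) m(1) l(2) i(2) m(3)] mult_cancel by blast
  then have "kap A B \<phi> N \<otimes> th A N (M \<inter> N) = kap A B \<psi> N \<otimes> th A N (M \<inter> N)"
   using kap_cons[OF l \<phi> N i(1,3)] kap_cons[OF l \<psi> N i(1,3)] by simp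
  then show ?thesis
   using c th_closed[OF i(1) n(1) l(1) i(3) n(2)] th_nz[OF i(1) n(1) l(1) i(3) n(2)] mult_cancel by blast
 qed
 have "\<phi> N = \<psi> N" if N: "N \<in> minor A B" for N
 proof -
  have n: "lat N" "N \<subseteq> A" "N \<subseteq> B" using N by (auto simp: minor_iff)
  have e: "\<phi> N \<in> extensional (carrier (dl B N))" "\<psi> N \<in> extensional (carrier (dl B N))"
   using \<phi> \<psi> N unfolding rel_line_def PiE_def by blast+
  show ?thesis
  proof (rule extensionalityI[OF e])
   fix x assume "x \<in> carrier (dl B N)"
   then obtain c where "c \<in> carrier K" "x = c \<odot>\<^bsub>dl B N\<^esub> dg B N" using dl_coord[OF n(1) l(2) n(3)] by auto
   then show "\<phi> N x = \<psi> N x" using kap_apply[OF l \<phi> N] kap_apply[OF l \<psi> N] k[OF N] by simp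
  qed
 qed
 moreover have "\<phi> \<in> extensional (minor A B)" "\<psi> \<in> extensional (minor A B)"
  using \<phi> \<psi> unfolding rel_line_def PiE_def by blast+
 ultimately show ?thesis by (intro extensionalityI[of \<phi> "minor A B" \<psi>])
qed

text \<open>The line \<open>(A|B)\<close> is nonzero: the coordinate on \<open>M0\<close> prescribes coordinates on \<open>M \<inter> M0\<close> and then on
\<open>M\<close>; the cocycle relation \<open>th_cocycle\<close> makes the resulting family compatible.\<close>

lemma rl_exists:
 assumes l: "lat A" "lat B" and M0: "M0 \<in> minor A B" and k0: "k0 \<in> carrier K"
 shows "\<exists>\<phi>\<in>rl A B. kap A B \<phi> M0 = k0"
proof -
 define T where "T = A \<inter> B"
 have T: "lat T" "T \<subseteq> A" "T \<subseteq> B" using lat_Int l by (auto simp: T_def)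
 have top: "M \<subseteq> T" if "M \<in> minor A B" for M using that by (auto simp: minor_iff T_def)
 have tA: "th A T M \<in> carrier K" "th A T M \<noteq> \<zero>" and tB: "th B T M \<in> carrier K" "th B T M \<noteq> \<zero>"
  if "M \<in> minor A B" for M
  using th_closed[OF _ T(1) l(1) _ T(2)] th_nz[OF _ T(1) l(1) _ T(2)] th_closed[OF _ T(1) l(2) _ T(3)] th_nz[OF _ T(1) l(2) _ T(3)]
   that top minor_iff by auto
 define r where "r M = th A T M \<otimes> inv (th B T M)" for M
 have r: "r M \<in> carrier K" "r M \<noteq> \<zero>" "r M \<otimes> th B T M = th A T M" if "M \<in> minor A B" for M
  unfolding r_def using tA[OF that] tB[OF that] invK[of "th B T M"] integral_iff by (auto simp: R.m_assoc)
 define c where "c = k0 \<otimes> inv (r M0)"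
 have c: "c \<in> carrier K" "c \<otimes> r M0 = k0" unfolding c_def using k0 r[OF M0] invK[of "r M0"] by (auto simp: R.m_assoc)
 define kk where "kk M = c \<otimes> r M" for M
 have kk: "kk M \<in> carrier K" if "M \<in> minor A B" for M using c r that by (simp add: kk_def)
 have cons: "kk M' \<otimes> th B M M' = kk M \<otimes> th A M M'" if M: "M \<in> minor A B" and M': "M' \<in> minor A B" "M' \<subseteq> M" for M M'
 proof -
  have m: "lat M" "M \<subseteq> A" "M \<subseteq> B" "lat M'" using M M' by (auto simp: minor_iff)
  define u where "u = th T M M'"
  have u: "u \<in> carrier K" "u \<noteq> \<zero>" unfolding u_def using th_closed[OF m(4,1) T(1) M'(2) top[OF M]] th_nz[OF m(4,1) T(1) M'(2) top[OF M]] by auto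
  have a: "th A M M' \<in> carrier K" "th B M M' \<in> carrier K" using th_closed m l M'(2) by auto
  have cA: "th A T M' \<otimes> u = th A M M' \<otimes> th A T M" unfolding u_def by (rule th_cocycle[OF m(4,1) T(1) l(1) M'(2) top[OF M] T(2)])
  have cB: "th B T M' \<otimes> u = th B M M' \<otimes> th B T M" unfolding u_def by (rule th_cocycle[OF m(4,1) T(1) l(2) M'(2) top[OF M] T(3)])
  note f = r[OF M] r[OF M'(1)] tA[OF M] tA[OF M'(1)] tB[OF M] tB[OF M'(1)]
  have "(r M' \<otimes> th B M M') \<otimes> th B T M = r M' \<otimes> (th B T M' \<otimes> u)" unfolding cB using f a by (simp add: R.m_assoc)
  also have "\<dots> = th A T M' \<otimes> u" using f(6) f u by (simp add: R.m_assoc[symmetric])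
  also have "\<dots> = th A M M' \<otimes> (r M \<otimes> th B T M)" unfolding cA using f by simp
  also have "\<dots> = (r M \<otimes> th A M M') \<otimes> th B T M" using r(1)[OF M] tB(1)[OF M] a by (simp add: R.m_ac)
  finally have "r M' \<otimes> th B M M' = r M \<otimes> th A M M'" using f a mult_cancel[of "r M' \<otimes> th B M M'" "r M \<otimes> th A M M'" "th B T M"] by simp
  then show ?thesis unfolding kk_def using c f a by (simp add: R.m_assoc)
 qed
 define co where "co M x = (THE c. c \<in> carrier K \<and> x = c \<odot>\<^bsub>dl B M\<^esub> dg B M)" for M x
 have co: "co M (c \<odot>\<^bsub>dl B M\<^esub> dg B M) = c" if "M \<in> minor A B" "c \<in> carrier K" for M c
  unfolding co_def by (rule the_equality) (use that dg_cancel[of M B] l minor_iff in auto)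
 define \<phi> where "\<phi> = (\<lambda>M\<in>minor A B. \<lambda>x\<in>carrier (dl B M). (kk M \<otimes> co M x) \<odot>\<^bsub>dl A M\<^esub> dg A M)"
 have phi: "\<phi> M (c \<odot>\<^bsub>dl B M\<^esub> dg B M) = (kk M \<otimes> c) \<odot>\<^bsub>dl A M\<^esub> dg A M" if M: "M \<in> minor A B" and c: "c \<in> carrier K" for M c
 proof -
  have m: "lat M" "M \<subseteq> A" "M \<subseteq> B" using M by (auto simp: minor_iff)
  interpret B: module K "dl B M" by (rule dl_module[OF m(1) l(2) m(3)])
  have "c \<odot>\<^bsub>dl B M\<^esub> dg B M \<in> carrier (dl B M)" using c dg_closed[OF m(1) l(2) m(3)] by simp
  then show ?thesis using M c by (simp add: \<phi>_def co)
 qed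
 have hom: "\<phi> M \<in> module_hom K (dl B M) (dl A M)" if M: "M \<in> minor A B" for M
 proof -
  have m: "lat M" "M \<subseteq> A" "M \<subseteq> B" using M by (auto simp: minor_iff)
  interpret A: module K "dl A M" by (rule dl_module[OF m(1) l(1) m(2)])
  interpret B: module K "dl B M" by (rule dl_module[OF m(1) l(2) m(3)])
  note gA = dg_closed[OF m(1) l(1) m(2)] and gB = dg_closed[OF m(1) l(2) m(3)] and cB = dl_coord[OF m(1) l(2) m(3)]
  show ?thesis unfolding module_hom_def
  proof (intro CollectI conjI allI impI)
   show "\<phi> M \<in> carrier (dl B M) \<rightarrow> carrier (dl A M)"
   proof
    fix x assume "x \<in> carrier (dl B M)"
    then obtain c where "c \<in> carrier K" "x = c \<odot>\<^bsub>dl B M\<^esub> dg B M" using cB by auto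
    then show "\<phi> M x \<in> carrier (dl A M)" using phi[OF M] kk[OF M] gA by simp
   qed
   fix x y assume "x \<in> carrier (dl B M) \<and> y \<in> carrier (dl B M)"
   then obtain c d where cd: "c \<in> carrier K" "x = c \<odot>\<^bsub>dl B M\<^esub> dg B M" "d \<in> carrier K" "y = d \<odot>\<^bsub>dl B M\<^esub> dg B M" using cB by blast
   then have "x \<oplus>\<^bsub>dl B M\<^esub> y = (c \<oplus> d) \<odot>\<^bsub>dl B M\<^esub> dg B M" using gB by (simp add: B.smult_l_distr)
   then show "\<phi> M (x \<oplus>\<^bsub>dl B M\<^esub> y) = \<phi> M x \<oplus>\<^bsub>dl A M\<^esub> \<phi> M y"
    using cd phi[OF M] kk[OF M] gA by (simp add: A.smult_l_distr R.r_distr)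
  next
   fix a x assume "a \<in> carrier K \<and> x \<in> carrier (dl B M)"
   then obtain c where cd: "a \<in> carrier K" "c \<in> carrier K" "x = c \<odot>\<^bsub>dl B M\<^esub> dg B M" using cB by blast
   then have "a \<odot>\<^bsub>dl B M\<^esub> x = (a \<otimes> c) \<odot>\<^bsub>dl B M\<^esub> dg B M" using gB by (simp add: B.smult_assoc1)
   then show "\<phi> M (a \<odot>\<^bsub>dl B M\<^esub> x) = a \<odot>\<^bsub>dl A M\<^esub> \<phi> M x"
    using cd phi[OF M] kk[OF M] gA by (simp add: A.smult_assoc1[symmetric] R.m_lcomm)
  qed
 qed
 have dwv: "\<phi> M (dw B M bs) = c \<odot>\<^bsub>dl A M\<^esub> dw A M as \<longleftrightarrow> kk M \<otimes> vl B M bs = c \<otimes> vl A M as"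
  if M: "M \<in> minor A B" and f: "as \<in> fr A M" "bs \<in> fr B M" "c \<in> carrier K" for M as bs c
 proof -
  have m: "lat M" "M \<subseteq> A" "M \<subseteq> B" using M by (auto simp: minor_iff)
  interpret A: module K "dl A M" by (rule dl_module[OF m(1) l(1) m(2)])
  have v: "vl A M as \<in> carrier K" "vl B M bs \<in> carrier K" using lat_vol_closed m l f by auto
  have "c \<odot>\<^bsub>dl A M\<^esub> dw A M as = (c \<otimes> vl A M as) \<odot>\<^bsub>dl A M\<^esub> dg A M"
   using dw_vol[OF m(1) l(1) m(2) f(1)] f v dg_closed[OF m(1) l(1) m(2)] by (simp add: A.smult_assoc1)
  moreover have "\<phi> M (dw B M bs) = (kk M \<otimes> vl B M bs) \<odot>\<^bsub>dl A M\<^esub> dg A M"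
   using dw_vol[OF m(1) l(2) m(3) f(2)] phi[OF M v(2)] by simp
  ultimately show ?thesis using dg_cancel[OF m(1) l(1) m(2)] kk[OF M] v f by simp
 qed
 have \<phi>: "\<phi> \<in> rl A B" unfolding rel_line_def
 proof (intro CollectI conjI ballI impI)
  show "\<phi> \<in> (\<Pi>\<^sub>E M\<in>minor A B. module_hom K (dl B M) (dl A M) \<inter> extensional (carrier (dl B M)))"
   using hom by (auto simp: \<phi>_def)
  fix M M' ms bs as c
  assume M: "M \<in> minor A B" and M': "M' \<in> minor A B" "M' \<subseteq> M" and f: "ms \<in> fr M M'" "bs \<in> fr B M" "as \<in> fr A M"
   and c: "c \<in> carrier K" and eq: "\<phi> M (dw B M bs) = c \<odot>\<^bsub>dl A M\<^esub> dw A M as"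
  have m: "lat M" "M \<subseteq> A" "M \<subseteq> B" "lat M'" using M M' by (auto simp: minor_iff)
  have v: "vl A M as \<in> carrier K" "vl B M bs \<in> carrier K" "vl M M' ms \<in> carrier K" using lat_vol_closed m l f M'(2) by auto
  have a: "th A M M' \<in> carrier K" "th B M M' \<in> carrier K" using th_closed m l M'(2) by auto
  have e: "kk M \<otimes> vl B M bs = c \<otimes> vl A M as" using eq dwv[OF M f(3,2) c] by simp
  have "kk M' \<otimes> vl B M' (ms @ bs) = (kk M' \<otimes> th B M M') \<otimes> (vl M M' ms \<otimes> vl B M bs)"
   using vol_th[OF m(4,1) l(2) M'(2) m(3) f(1,2)] a v kk[OF M'(1)] by (simp add: R.m_assoc)
  also have "\<dots> = (th A M M' \<otimes> vl M M' ms) \<otimes> (kk M \<otimes> vl B M bs)"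
   using cons[OF M M'] a v kk[OF M] by (simp add: R.m_ac)
  also have "\<dots> = c \<otimes> vl A M' (ms @ as)"
   using vol_th[OF m(4,1) l(1) M'(2) m(2) f(1,3)] a v e c by (simp add: R.m_ac)
  finally show "\<phi> M' (dw B M' (ms @ bs)) = c \<odot>\<^bsub>dl A M'\<^esub> dw A M' (ms @ as)"
   using dwv[OF M'(1) frames_append[OF m(4,1) l(1) M'(2) m(2) f(1,3)] frames_append[OF m(4,1) l(2) M'(2) m(3) f(1,2)] c] by simp
 qed
 have m0: "lat M0" "M0 \<subseteq> A" "M0 \<subseteq> B" using M0 by (auto simp: minor_iff)
 have "(kap A B \<phi> M0 \<otimes> \<one>) \<odot>\<^bsub>dl A M0\<^esub> dg A M0 = (kk M0 \<otimes> \<one>) \<odot>\<^bsub>dl A M0\<^esub> dg A M0"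
  using kap_apply[OF l \<phi> M0, of \<one>] phi[OF M0, of \<one>] by simp
 then have "kap A B \<phi> M0 = k0"
  using dg_cancel[OF m0(1) l(1) m0(2)] kap_closed[OF l \<phi> M0] kk[OF M0] c(2) by (simp add: kk_def)
 with \<phi> show ?thesis by blast
qed

end

context kspace
begin

end

section \<open>Transport of structure and the group \<open>Gl(V)\<close>\<close>

text \<open>Used for elements of \<open>Gl(V)\<close> as well as for the inclusion of a direct summand.\<close>

locale lin_inj = V: kspace K V + U: kspace K U for K :: "'k ring" and V :: "('k, 'v) module" and U :: "('k, 'u) module" +
 fixes f :: "'v => 'u"
 assumes hom: "f \<in> module_hom K V U" and inj: "inj_on f (carrier V)"
begin

lemma f_closed: "x \<in> carrier V ==> f x \<in> carrier U" using module_hom_closed[OF hom] by auto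
lemma f_add: "x \<in> carrier V ==> y \<in> carrier V ==> f (x \<oplus>\<^bsub>V\<^esub> y) = f x \<oplus>\<^bsub>U\<^esub> f y" by (rule module_hom_add[OF hom])
lemma f_smult: "c \<in> carrier K ==> x \<in> carrier V ==> f (c \<odot>\<^bsub>V\<^esub> x) = c \<odot>\<^bsub>U\<^esub> f x" by (rule module_hom_smult[OF hom])

lemma f_zero: "f \<zero>\<^bsub>V\<^esub> = \<zero>\<^bsub>U\<^esub>"
 using f_smult[of "\<zero>\<^bsub>K\<^esub>" "\<zero>\<^bsub>V\<^esub>"] f_closed[of "\<zero>\<^bsub>V\<^esub>"] by simp

lemma f_mem_iff: "A \<subseteq> carrier V ==> x \<in> carrier V ==> f x \<in> f ` A \<longleftrightarrow> x \<in> A"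
 using inj by (meson imageI inj_on_image_mem_iff)

lemma f_Int: "A \<subseteq> carrier V ==> B \<subseteq> carrier V ==> f ` (A \<inter> B) = f ` A \<inter> f ` B"
 by (rule inj_on_image_Int[OF inj])

lemma f_sub: "V.sub M ==> U.sub (f ` M)"
proof -
 assume M: "V.sub M"
 note d = V.subD[OF M]
 show ?thesis unfolding U.sub_iff
 proof (intro conjI ballI)
  show "f ` M \<subseteq> carrier U" using d(1) f_closed by auto
  show "\<zero>\<^bsub>U\<^esub> \<in> f ` M" using d(2) f_zero by (metis imageI)
  fix v w assume "v \<in> f ` M" "w \<in> f ` M"
  then obtain x y where "x \<in> M" "y \<in> M" "v = f x" "w = f y" by blast
  then show "v \<oplus>\<^bsub>U\<^esub> w \<in> f ` M" using d(1,3) f_add[of x y] by (metis imageI)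
 next
  fix c v assume c: "c \<in> carrier K" and "v \<in> f ` M"
  then obtain x where "x \<in> M" "v = f x" by blast
  then show "c \<odot>\<^bsub>U\<^esub> v \<in> f ` M" using c d(1,4) f_smult[of c x] by (metis imageI)
 qed
qed

lemma f_spn: "V.sub M ==> set bs \<subseteq> carrier V ==> spn K U (f ` M) (map f bs) = f ` spn K V M bs"
proof (induction bs)
 case (Cons b bs)
 then have IH: "spn K U (f ` M) (map f bs) = f ` spn K V M bs" and b: "b \<in> carrier V" by auto
 have c: "x \<in> carrier V" if "x \<in> spn K V M bs" for x using V.subD(1)[OF V.spn_sub that] Cons.prems by auto
 have e: "f (x \<oplus>\<^bsub>V\<^esub> c \<odot>\<^bsub>V\<^esub> b) = f x \<oplus>\<^bsub>U\<^esub> c \<odot>\<^bsub>U\<^esub> f b" if "x \<in> spn K V M bs" "c \<in> carrier K" for x c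
  using c[OF that(1)] that(2) b by (simp add: f_add f_smult)
 show ?case
 proof safe
  fix z assume "z \<in> spn K U (f ` M) (map f (b # bs))"
  then obtain x c where x: "x \<in> spn K V M bs" "c \<in> carrier K" "z = f x \<oplus>\<^bsub>U\<^esub> c \<odot>\<^bsub>U\<^esub> f b" by (auto simp: IH)
  then have "x \<oplus>\<^bsub>V\<^esub> c \<odot>\<^bsub>V\<^esub> b \<in> spn K V M (b # bs)" by auto
  then show "z \<in> f ` spn K V M (b # bs)" unfolding x(3) e[OF x(1,2), symmetric] by (rule imageI)
 next
  fix z assume "z \<in> spn K V M (b # bs)"
  then obtain x c where x: "x \<in> spn K V M bs" "c \<in> carrier K" "z = x \<oplus>\<^bsub>V\<^esub> c \<odot>\<^bsub>V\<^esub> b" by auto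
  then show "f z \<in> spn K U (f ` M) (map f (b # bs))" using e[OF x(1,2)] by (auto simp: IH)
 qed
qed simp

lemma f_indep: "V.sub M ==> set bs \<subseteq> carrier V ==> indep_mod K V M bs ==> indep_mod K U (f ` M) (map f bs)"
proof (induction bs)
 case (Cons b bs)
 have "spn K V M bs \<subseteq> carrier V" using V.subD(1)[OF V.spn_sub[of M bs]] Cons.prems by auto
 then show ?case using Cons f_spn[of M bs] f_mem_iff[of "spn K V M bs" b] by auto
qed simp

lemma f_basis: "V.sub M ==> basis_mod K V B M es ==> basis_mod K U (f ` B) (f ` M) (map f es)"
 unfolding basis_mod_def using f_spn f_indep f_closed by (auto simp del: indep_mod.simps)

lemma f_fgen: "V.sub M ==> fin_gen_mod K V B M ==> fin_gen_mod K U (f ` B) (f ` M)"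
 using V.sub_fgen_basis[of M B] f_basis[of M B] U.mbasisD(5)[OF f_sub[of M]] by blast

lemma f_qdim: "V.sub M ==> fin_gen_mod K V B M ==> qdim K U (f ` B) (f ` M) = qdim K V B M"
 using V.sub_fgen_basis[of M B] f_basis[of M B] V.qdim_eq_length[of M B] U.qdim_eq_length[OF f_sub[of M], of "f ` B"]
 by fastforce

lemma f_frames: "V.sub M ==> fin_gen_mod K V B M ==> bs \<in> frames K V B M ==> map f bs \<in> frames K U (f ` B) (f ` M)"
 using f_qdim by (auto simp: frames_def)

lemma f_commensurable:
 assumes A: "V.sub A" and B: "V.sub B" and c: "commensurable K V A B" shows "commensurable K U (f ` A) (f ` B)"
proof -
 have AB: "V.sub (A \<inter> B)" by (rule V.sub_Int[OF A B])
 have "A \<subseteq> carrier V" "B \<subseteq> carrier V" using V.subD(1)[OF A] V.subD(1)[OF B] by auto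
 note i = f_Int[OF this]
 show ?thesis using c f_fgen[OF AB, of A] f_fgen[OF AB, of B]
  unfolding V.commensurable_iff[OF A B] U.commensurable_iff[OF f_sub[OF A] f_sub[OF B]] i by blast
qed

lemma f_alt: "V.sub B ==> M \<subseteq> carrier V ==> alt_form K U (f ` B) (f ` M) n D ==> alt_form K V B M n (\<lambda>bs. D (map f bs))"
proof -
 assume B: "V.sub B" and M: "M \<subseteq> carrier V" and D: "alt_form K U (f ` B) (f ` M) n D"
 note d = U.altD[OF D] and b = V.subD(1)[OF B]
 have s: "set (map f us) \<subseteq> f ` B" if "set us \<subseteq> B" for us using that by auto
 show ?thesis
 proof (rule V.altI)
  fix bs assume "length bs = n" "set bs \<subseteq> B"
  then show "D (map f bs) \<in> carrier K" using s by (intro d(1)) simp_all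
 next
  fix us c v w ws assume a: "Suc (length us + length ws) = n" "set us \<subseteq> B" "set ws \<subseteq> B" "v \<in> B" "w \<in> B" "c \<in> carrier K"
  have "f (w \<oplus>\<^bsub>V\<^esub> c \<odot>\<^bsub>V\<^esub> v) = f w \<oplus>\<^bsub>U\<^esub> c \<odot>\<^bsub>U\<^esub> f v" using a b[of v] b[of w] by (simp add: f_add f_smult)
  then show "D (map f (us @ (w \<oplus>\<^bsub>V\<^esub> c \<odot>\<^bsub>V\<^esub> v) # ws)) = D (map f (us @ w # ws)) \<oplus>\<^bsub>K\<^esub> c \<otimes>\<^bsub>K\<^esub> D (map f (us @ v # ws))"
   using d(2)[of "map f us" "map f ws" "f v" "f w" c] a s by simp
 next
  fix us v ys ws assume a: "Suc (Suc (length us + length ys + length ws)) = n" "set us \<subseteq> B" "set ys \<subseteq> B" "set ws \<subseteq> B" "v \<in> B"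
  then show "D (map f (us @ v # ys @ v # ws)) = \<zero>\<^bsub>K\<^esub>" using d(3)[of "map f us" "map f ys" "map f ws" "f v"] s by simp
 next
  fix us m ws assume a: "Suc (length us + length ws) = n" "set us \<subseteq> B" "set ws \<subseteq> B" "m \<in> M"
  then show "D (map f (us @ m # ws)) = \<zero>\<^bsub>K\<^esub>" using d(4)[of "map f us" "map f ws" "f m"] s by simp
 qed
qed

text \<open>The ratio between the chosen volume form of \<open>f(B)/f(M)\<close> and the transported one of \<open>B/M\<close>.\<close>

definition eta where "eta B M = (SOME c. c \<in> carrier K \<and> c \<noteq> \<zero>\<^bsub>K\<^esub> \<and>
 (\<forall>bs\<in>frames K V B M. vol K U (f ` B) (f ` M) (map f bs) = c \<otimes>\<^bsub>K\<^esub> vol K V B M bs))"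

lemma eta:
 assumes M: "V.sub M" and B: "fin_gen_mod K V B M"
 shows eta_closed: "eta B M \<in> carrier K" and eta_nz: "eta B M \<noteq> \<zero>\<^bsub>K\<^esub>"
  and eta_vol: "!!bs. bs \<in> frames K V B M ==> vol K U (f ` B) (f ` M) (map f bs) = eta B M \<otimes>\<^bsub>K\<^esub> vol K V B M bs"
proof -
 have sB: "V.sub B" "M \<subseteq> B" using V.fgen_sub[OF M B] by auto
 have Mc: "M \<subseteq> carrier V" using V.subD(1)[OF M] by auto
 have D: "alt_form K V B M (qdim K V B M) (\<lambda>bs. vol K U (f ` B) (f ` M) (map f bs))"
  using f_alt[OF sB(1) Mc U.vol_spec(1)[OF f_sub[OF M] f_fgen[OF M B]]] by (simp add: f_qdim[OF M B])
 obtain c where c: "c \<in> carrier K" "\<forall>bs\<in>frames K V B M. vol K U (f ` B) (f ` M) (map f bs) = c \<otimes>\<^bsub>K\<^esub> vol K V B M bs"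
  using V.alt_proportional[OF M B D] by auto
 obtain es where es: "basis_mod K V B M es" "vol K V B M es = \<one>\<^bsub>K\<^esub>" using V.vol_spec(2)[OF M B] by auto
 have "vol K U (f ` B) (f ` M) (map f es) \<noteq> \<zero>\<^bsub>K\<^esub>" by (rule U.vol_basis_nonzero[OF f_sub[OF M] f_basis[OF M es(1)]])
 then have "c \<noteq> \<zero>\<^bsub>K\<^esub>" using c V.mbasis_frame[OF M es(1)] es(2) by auto
 then have "\<exists>c. c \<in> carrier K \<and> c \<noteq> \<zero>\<^bsub>K\<^esub> \<and> (\<forall>bs\<in>frames K V B M. vol K U (f ` B) (f ` M) (map f bs) = c \<otimes>\<^bsub>K\<^esub> vol K V B M bs)"
  using c by auto
 from someI_ex[OF this, folded eta_def]
 show "eta B M \<in> carrier K" "eta B M \<noteq> \<zero>\<^bsub>K\<^esub>"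
  "!!bs. bs \<in> frames K V B M ==> vol K U (f ` B) (f ` M) (map f bs) = eta B M \<otimes>\<^bsub>K\<^esub> vol K V B M bs" by auto
qed

end

context lattice_kspace
begin

abbreviation GL where "GL \<equiv> carrier (Gl K V P)"

lemma line_zero:
 assumes l: "lat A" "lat B"
 shows line_zero_rl: "line_zero K V P A B \<in> rl A B"
  and line_zero_iff: "!!\<phi> M. \<phi> \<in> rl A B ==> M \<in> minor A B ==> \<phi> = line_zero K V P A B \<longleftrightarrow> kap A B \<phi> M = \<zero>"
proof -
 have T: "A \<inter> B \<in> minor A B" "lat (A \<inter> B)" using lat_Int l by (auto simp: minor_iff)
 obtain \<phi> where \<phi>: "\<phi> \<in> rl A B" "kap A B \<phi> (A \<inter> B) = \<zero>" using rl_exists[OF l T(1), of \<zero>] by auto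
 have k: "kap A B \<phi> M = \<zero>" if M: "M \<in> minor A B" for M
 proof -
  have m: "lat M" "M \<subseteq> A \<inter> B" using M by (auto simp: minor_iff)
  have t: "th B (A \<inter> B) M \<in> carrier K" "th B (A \<inter> B) M \<noteq> \<zero>" "th A (A \<inter> B) M \<in> carrier K"
   using th_closed th_nz m T l by auto
  then have "kap A B \<phi> M \<otimes> th B (A \<inter> B) M = \<zero> \<otimes> th B (A \<inter> B) M" using kap_cons[OF l \<phi>(1) T(1) m] \<phi>(2) by simp
  then show ?thesis using t mult_cancel kap_closed[OF l \<phi>(1) M] by blast
 qed
 have "\<phi> = line_zero K V P A B"
 proof
  fix M
  show "\<phi> M = line_zero K V P A B M"
  proof (cases "M \<in> minor A B")
   case False
   then show ?thesis using \<phi>(1) by (auto simp: rel_line_def line_zero_def PiE_def extensional_def)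
  next
   case True
   have m: "lat M" "M \<subseteq> A" "M \<subseteq> B" using True by (auto simp: minor_iff)
   interpret A: module K "dl A M" by (rule dl_module[OF m(1) l(1) m(2)])
   have e: "\<phi> M \<in> extensional (carrier (dl B M))" using \<phi>(1) True unfolding rel_line_def PiE_def by blast
   have "\<phi> M = (\<lambda>x\<in>carrier (dl B M). \<zero>\<^bsub>dl A M\<^esub>)"
   proof (rule extensionalityI[OF e])
    fix x assume x: "x \<in> carrier (dl B M)"
    then obtain c where c: "c \<in> carrier K" "x = c \<odot>\<^bsub>dl B M\<^esub> dg B M" using dl_coord[OF m(1) l(2) m(3)] by auto
    then show "\<phi> M x = (\<lambda>x\<in>carrier (dl B M). \<zero>\<^bsub>dl A M\<^esub>) x"
     using x kap_apply[OF l \<phi>(1) True c(1)] k[OF True] dg_closed[OF m(1) l(1) m(2)] by simp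
   qed simp
   then show ?thesis using True by (simp add: line_zero_def)
  qed
 qed
 then show r: "line_zero K V P A B \<in> rl A B" using \<phi> by simp
 fix \<psi> M assume \<psi>: "\<psi> \<in> rl A B" and M: "M \<in> minor A B"
 show "\<psi> = line_zero K V P A B \<longleftrightarrow> kap A B \<psi> M = \<zero>"
  using rl_eqI[OF l \<psi> \<phi>(1) M] k[OF M] \<open>\<phi> = line_zero K V P A B\<close> by auto
qed

lemma line_scalar:
 assumes l: "lat A" and c: "c \<in> carrier K"
 shows line_scalar_rl: "line_scalar K V P A c \<in> rl A A"
  and line_scalar_kap: "!!M. M \<in> minor A A ==> kap A A (line_scalar K V P A c) M = c"
proof -
 have T: "A \<in> minor A A" using l by (auto simp: minor_iff)
 obtain \<phi> where \<phi>: "\<phi> \<in> rl A A" "kap A A \<phi> A = c" using rl_exists[OF l l T c] by auto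
 have k: "kap A A \<phi> M = c" if M: "M \<in> minor A A" for M
 proof -
  have m: "lat M" "M \<subseteq> A" using M by (auto simp: minor_iff)
  have t: "th A A M \<in> carrier K" "th A A M \<noteq> \<zero>" using th_closed th_nz m l by auto
  have "kap A A \<phi> M \<otimes> th A A M = c \<otimes> th A A M" using kap_cons[OF l l \<phi>(1) T m] \<phi>(2) by simp
  then show ?thesis using t mult_cancel kap_closed[OF l l \<phi>(1) M] c by blast
 qed
 have "\<phi> = line_scalar K V P A c"
 proof
  fix M
  show "\<phi> M = line_scalar K V P A c M"
  proof (cases "M \<in> minor A A")
   case False
   then show ?thesis using \<phi>(1) by (auto simp: rel_line_def line_scalar_def PiE_def extensional_def)
  next
   case True
   have m: "lat M" "M \<subseteq> A" using True by (auto simp: minor_iff)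
   interpret A: module K "dl A M" by (rule dl_module[OF m(1) l m(2)])
   have e: "\<phi> M \<in> extensional (carrier (dl A M))" using \<phi>(1) True unfolding rel_line_def PiE_def by blast
   have "\<phi> M = (\<lambda>x\<in>carrier (dl A M). c \<odot>\<^bsub>dl A M\<^esub> x)"
   proof (rule extensionalityI[OF e])
    fix x assume x: "x \<in> carrier (dl A M)"
    then obtain d where d: "d \<in> carrier K" "x = d \<odot>\<^bsub>dl A M\<^esub> dg A M" using dl_coord[OF m(1) l m(2)] by auto
    then show "\<phi> M x = (\<lambda>x\<in>carrier (dl A M). c \<odot>\<^bsub>dl A M\<^esub> x) x"
     using x kap_apply[OF l l \<phi>(1) True d(1)] k[OF True] dg_closed[OF m(1) l m(2)] c by (simp add: A.smult_assoc1)
   qed simp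
   then show ?thesis using True by (simp add: line_scalar_def)
  qed
 qed
 then show "line_scalar K V P A c \<in> rl A A" "!!M. M \<in> minor A A ==> kap A A (line_scalar K V P A c) M = c"
  using \<phi> k by auto
qed

text \<open>The element described by \<open>line_comp\<close> exists and is unique, and coordinates multiply. The element
is constructed from its coordinate on one common lattice by \<open>rl_exists\<close>.\<close>

lemma line_comp:
 assumes l: "lat A" "lat B" "lat C" and \<phi>: "\<phi> \<in> rl A B" and \<psi>: "\<psi> \<in> rl B C"
 shows line_comp_rl: "line_comp K V P A B C \<phi> \<psi> \<in> rl A C"
  and line_comp_kap: "!!M. M \<in> minor A B ==> M \<in> minor B C ==>
   kap A C (line_comp K V P A B C \<phi> \<psi>) M = kap A B \<phi> M \<otimes> kap B C \<psi> M"
proof -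
 define T where "T = A \<inter> B \<inter> C"
 have T: "lat T" "T \<subseteq> A" "T \<subseteq> B" "T \<subseteq> C" using lat_Int l by (auto simp: T_def)
 have Tm: "T \<in> minor A B" "T \<in> minor B C" "T \<in> minor A C" using T by (auto simp: minor_iff)
 obtain \<chi> where \<chi>: "\<chi> \<in> rl A C" "kap A C \<chi> T = kap A B \<phi> T \<otimes> kap B C \<psi> T"
  using rl_exists[OF l(1,3) Tm(3)] kap_closed[OF l(1,2) \<phi> Tm(1)] kap_closed[OF l(2,3) \<psi> Tm(2)] by blast
 have k: "kap A C \<chi> M = kap A B \<phi> M \<otimes> kap B C \<psi> M" if M: "M \<in> minor A B" "M \<in> minor B C" for M
 proof -
  have m: "lat M" "M \<subseteq> T" "M \<in> minor A C" using M by (auto simp: minor_iff T_def)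
  have a: "th A T M \<in> carrier K" "th B T M \<in> carrier K" "th C T M \<in> carrier K" "th C T M \<noteq> \<zero>"
   using th_closed th_nz T l m by auto
  note c = kap_closed[OF l(1,2) \<phi> M(1)] kap_closed[OF l(2,3) \<psi> M(2)] kap_closed[OF l(1,2) \<phi> Tm(1)] kap_closed[OF l(2,3) \<psi> Tm(2)]
   kap_closed[OF l(1,3) \<chi>(1) m(3)]
  have "kap A C \<chi> M \<otimes> th C T M = kap A B \<phi> T \<otimes> th A T M \<otimes> kap B C \<psi> T"
   using kap_cons[OF l(1,3) \<chi>(1) Tm(3) m(1,2)] \<chi>(2) c a by (simp add: R.m_ac)
  also have "\<dots> = kap A B \<phi> M \<otimes> (kap B C \<psi> T \<otimes> th B T M)"
   using kap_cons[OF l(1,2) \<phi> Tm(1) m(1,2), symmetric] c a by (simp add: R.m_ac)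
  also have "\<dots> = (kap A B \<phi> M \<otimes> kap B C \<psi> M) \<otimes> th C T M"
   using kap_cons[OF l(2,3) \<psi> Tm(2) m(1,2), symmetric] c a by (simp add: R.m_assoc)
  finally show ?thesis using mult_cancel[of "kap A C \<chi> M" "kap A B \<phi> M \<otimes> kap B C \<psi> M" "th C T M"] c a by simp
 qed
 have ap: "\<phi> M (\<psi> M (c \<odot>\<^bsub>dl C M\<^esub> dg C M)) = (kap A B \<phi> M \<otimes> kap B C \<psi> M \<otimes> c) \<odot>\<^bsub>dl A M\<^esub> dg A M"
  if "M \<in> minor A B" "M \<in> minor B C" "c \<in> carrier K" for M c
  using that kap_apply[OF l(1,2) \<phi> that(1)] kap_apply[OF l(2,3) \<psi> that(2)] kap_closed[OF l(1,2) \<phi> that(1)] kap_closed[OF l(2,3) \<psi> that(2)]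
  by (simp add: R.m_assoc)
 have "line_comp K V P A B C \<phi> \<psi> = \<chi>" unfolding line_comp_def
 proof (rule the_equality)
  have "\<chi> M = compose (carrier (dl C M)) (\<phi> M) (\<psi> M)" if M: "M \<in> minor A B \<inter> minor B C" for M
  proof -
   have M: "M \<in> minor A B" "M \<in> minor B C" "M \<in> minor A C" and m: "lat M" "M \<subseteq> A" "M \<subseteq> C" using M by (auto simp: minor_iff)
   have e: "\<chi> M \<in> extensional (carrier (dl C M))" using \<chi>(1) M(3) unfolding rel_line_def PiE_def by blast
   show ?thesis
   proof (rule extensionalityI[OF e])
    show "compose (carrier (dl C M)) (\<phi> M) (\<psi> M) \<in> extensional (carrier (dl C M))" by (simp add: compose_def)
    fix x assume x: "x \<in> carrier (dl C M)"
    then obtain c where c: "c \<in> carrier K" "x = c \<odot>\<^bsub>dl C M\<^esub> dg C M" using dl_coord[OF m(1) l(3) m(3)] by auto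
    then show "\<chi> M x = compose (carrier (dl C M)) (\<phi> M) (\<psi> M) x"
     using x kap_apply[OF l(1,3) \<chi>(1) M(3) c(1)] ap[OF M(1,2) c(1)] k[OF M(1,2)] by (simp add: compose_def)
   qed
  qed
  then show "\<chi> \<in> rl A C \<and> (\<forall>M\<in>minor A B \<inter> minor B C. \<chi> M = compose (carrier (dl C M)) (\<phi> M) (\<psi> M))" using \<chi>(1) by blast
  fix \<chi>' assume \<chi>': "\<chi>' \<in> rl A C \<and> (\<forall>M\<in>minor A B \<inter> minor B C. \<chi>' M = compose (carrier (dl C M)) (\<phi> M) (\<psi> M))"
  then have r': "\<chi>' \<in> rl A C" by simp
  interpret C: module K "dl C T" by (rule dl_module[OF T(1) l(3) T(4)])
  have g: "\<one> \<odot>\<^bsub>dl C T\<^esub> dg C T \<in> carrier (dl C T)" using dg_closed[OF T(1) l(3) T(4)] by simp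
  have "\<chi>' T (\<one> \<odot>\<^bsub>dl C T\<^esub> dg C T) = (kap A B \<phi> T \<otimes> kap B C \<psi> T \<otimes> \<one>) \<odot>\<^bsub>dl A T\<^esub> dg A T"
   using \<chi>' Tm g ap[OF Tm(1,2), of \<one>] by (simp add: compose_def)
  then have "kap A C \<chi>' T = kap A B \<phi> T \<otimes> kap B C \<psi> T"
   using kap_apply[OF l(1,3) r' Tm(3), of \<one>] dg_cancel[OF T(1) l(1) T(2)] kap_closed[OF l(1,3) r' Tm(3)]
    kap_closed[OF l(1,2) \<phi> Tm(1)] kap_closed[OF l(2,3) \<psi> Tm(2)] by simp
  then show "\<chi>' = \<chi>" using rl_eqI[OF l(1,3) r' \<chi>(1) Tm(3)] \<chi>(2) by simp
 qed
 then show "line_comp K V P A B C \<phi> \<psi> \<in> rl A C" "!!M. M \<in> minor A B ==> M \<in> minor B C ==>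
   kap A C (line_comp K V P A B C \<phi> \<psi>) M = kap A B \<phi> M \<otimes> kap B C \<psi> M" using \<chi>(1) k by auto
qed

lemma GL_D:
 assumes "S \<in> GL"
 shows "S \<in> Bij (carrier V)" "S \<in> module_hom K V V" "bij_betw S (carrier V) (carrier V)" "lin_inj K V V S"
proof -
 show *: "S \<in> Bij (carrier V)" "S \<in> module_hom K V V" using assms by (auto simp: Gl_def)
 then show b: "bij_betw S (carrier V) (carrier V)" by (simp add: Bij_def)
 show "lin_inj K V V S" using * b by (auto simp: lin_inj_def lin_inj_axioms_def kspace_axioms bij_betw_def)
qed

lemma image_lat0: "lin_inj K V V S ==> lat (S ` P) ==> lat A ==> lat (S ` A)"
proof -
 assume S: "lin_inj K V V S" and p: "lat (S ` P)" and A: "lat A"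
 interpret S: lin_inj K V V S by fact
 have "commensurable K V (S ` A) (S ` P)" using A P by (intro S.f_commensurable) (auto simp: lat_def)
 then show ?thesis using p A S.f_sub commensurable_trans[OF _ _ P] unfolding lat_def by blast
qed

text \<open>The condition on the inverse of \<open>S\<close> is most easily checked by exhibiting the preimage \<open>Q\<close> of \<open>P\<close>.\<close>

lemma GL_I:
 assumes S: "S \<in> Bij (carrier V)" "S \<in> module_hom K V V" "lat (S ` P)" "lat Q" "S ` Q = P"
 shows "S \<in> GL"
proof -
 have "inj_on S (carrier V)" "Q \<subseteq> carrier V" using S subD(1)[OF lat_sub[OF S(4)]] by (auto simp: Bij_def bij_betw_def)
 then have "inv_into (carrier V) S ` P = Q" unfolding S(5)[symmetric] by (rule inv_into_image_cancel)
 then show ?thesis using S by (simp add: Gl_def lat_def)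
qed

lemma GL_lat:
 assumes S: "S \<in> GL"
 shows "lat (S ` P)" "\<exists>Q. lat Q \<and> S ` Q = P"
proof -
 note d = GL_D[OF S]
 interpret S: lin_inj K V V S by (rule d(4))
 show "lat (S ` P)" using S S.f_sub[OF P] by (simp add: lat_def Gl_def)
 let ?Q = "inv_into (carrier V) S ` P"
 have Pc: "P \<subseteq> S ` carrier V" using subD(1)[OF P] d(3) by (auto simp: bij_betw_def)
 have i: "S ` ?Q = P" using Pc by (rule image_inv_into_cancel[OF refl])
 have Qc: "?Q \<subseteq> carrier V" using Pc by (auto intro: inv_into_into)
 have "sub ?Q" unfolding sub_iff
 proof (intro conjI ballI Qc)
  show "\<zero>\<^bsub>V\<^esub> \<in> ?Q" using S.f_mem_iff[OF Qc, of "\<zero>\<^bsub>V\<^esub>"] i S.f_zero subD(2)[OF P] by simp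
  fix v w assume a: "v \<in> ?Q" "w \<in> ?Q"
  then have vw: "v \<in> carrier V" "w \<in> carrier V" "S v \<in> P" "S w \<in> P" using Qc i by auto
  then show "v \<oplus>\<^bsub>V\<^esub> w \<in> ?Q" using S.f_mem_iff[OF Qc, of "v \<oplus>\<^bsub>V\<^esub> w"] i subD(3)[OF P] S.f_add by simp
 next
  fix c v assume a: "c \<in> carrier K" "v \<in> ?Q"
  then have vw: "v \<in> carrier V" "S v \<in> P" using Qc i by auto
  then show "c \<odot>\<^bsub>V\<^esub> v \<in> ?Q" using S.f_mem_iff[OF Qc, of "c \<odot>\<^bsub>V\<^esub> v"] i subD(4)[OF P] S.f_smult a(1) by simp
 qed
 then show "\<exists>Q. lat Q \<and> S ` Q = P" using i S by (auto simp: Gl_def lat_def)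
qed

lemma lat_image: "S \<in> GL ==> lat A ==> lat (S ` A)"
 using image_lat0 GL_D(4) GL_lat(1) by blast

definition ginv where "ginv S = (\<lambda>x\<in>carrier V. inv_into (carrier V) S x)"

lemma ginv:
 assumes S: "S \<in> GL"
 shows "ginv S \<in> GL" "compose (carrier V) (ginv S) S = (\<lambda>x\<in>carrier V. x)"
  "!!A. A \<subseteq> carrier V ==> ginv S ` S ` A = A" "!!A. A \<subseteq> carrier V ==> S ` ginv S ` A = A"
proof -
 note d = GL_D[OF S]
 interpret S: lin_inj K V V S by (rule d(4))
 have b: "ginv S \<in> Bij (carrier V)" unfolding ginv_def by (rule restrict_inv_into_Bij[OF d(1)])
 have gS: "ginv S (S x) = x" if "x \<in> carrier V" for x
  using that S.f_closed bij_betw_inv_into_left[OF d(3)] by (simp add: ginv_def)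
 have Sg: "S (ginv S x) = x" if "x \<in> carrier V" for x
  using that bij_betw_inv_into_right[OF d(3)] by (simp add: ginv_def)
 have gc: "ginv S x \<in> carrier V" if "x \<in> carrier V" for x using that Bij_imp_funcset[OF b] by auto
 have h: "ginv S \<in> module_hom K V V" unfolding module_hom_def
 proof (intro CollectI conjI allI impI)
  show "ginv S \<in> carrier V \<rightarrow> carrier V" using gc by auto
  fix x y assume "x \<in> carrier V \<and> y \<in> carrier V"
  then show "ginv S (x \<oplus>\<^bsub>V\<^esub> y) = ginv S x \<oplus>\<^bsub>V\<^esub> ginv S y"
   using S.f_add[of "ginv S x" "ginv S y"] gc Sg gS[of "ginv S x \<oplus>\<^bsub>V\<^esub> ginv S y"] by simp
 next
  fix c x assume "c \<in> carrier K \<and> x \<in> carrier V"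
  then show "ginv S (c \<odot>\<^bsub>V\<^esub> x) = c \<odot>\<^bsub>V\<^esub> ginv S x"
   using S.f_smult[of c "ginv S x"] gc Sg gS[of "c \<odot>\<^bsub>V\<^esub> ginv S x"] by simp
 qed
 show i1: "ginv S ` S ` A = A" if "A \<subseteq> carrier V" for A using that gS by (force simp: image_image)
 show "S ` ginv S ` A = A" if "A \<subseteq> carrier V" for A using that Sg by (force simp: image_image)
 show "compose (carrier V) (ginv S) S = (\<lambda>x\<in>carrier V. x)" unfolding ginv_def by (rule Bij_compose_restrict_eq[OF d(1)])
 obtain Q where Q: "lat Q" "S ` Q = P" using GL_lat(2)[OF S] by auto
 have "ginv S ` P = Q" using i1[of Q] Q subD(1)[OF lat_sub[OF Q(1)]] by auto
 then show "ginv S \<in> GL"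
  using GL_I[OF b h _ GL_lat(1)[OF S] i1] Q(1) subD(1)[OF P] by auto
qed

lemma compose_image: "A \<subseteq> carrier V ==> compose (carrier V) S T ` A = S ` T ` A"
 by (force simp: compose_def image_image)

lemma GL_mult: "S \<in> GL ==> T \<in> GL ==> S \<otimes>\<^bsub>Gl K V P\<^esub> T = compose (carrier V) S T"
 by (simp add: Gl_def BijGroup_def)

lemma GL_one: "\<one>\<^bsub>Gl K V P\<^esub> = (\<lambda>x\<in>carrier V. x)"
 by (simp add: Gl_def BijGroup_def)

lemma GL_compose: "S \<in> GL ==> T \<in> GL ==> compose (carrier V) S T \<in> GL"
proof -
 assume S: "S \<in> GL" and T: "T \<in> GL"
 note dS = GL_D[OF S] and dT = GL_D[OF T]
 interpret S: lin_inj K V V S by (rule dS(4))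
 interpret T: lin_inj K V V T by (rule dT(4))
 have Pc: "P \<subseteq> carrier V" using subD(1)[OF P] by auto
 have b: "compose (carrier V) S T \<in> Bij (carrier V)" by (rule compose_Bij[OF dS(1) dT(1)])
 have h: "compose (carrier V) S T \<in> module_hom K V V"
  unfolding module_hom_def by (auto simp: compose_def S.f_closed T.f_closed S.f_add T.f_add S.f_smult T.f_smult)
 obtain Q where Q: "lat Q" "S ` Q = P" using GL_lat(2)[OF S] by auto
 have Qc: "Q \<subseteq> carrier V" using subD(1)[OF lat_sub[OF Q(1)]] by auto
 have gQ: "lat (ginv T ` Q)" by (rule lat_image[OF ginv(1)[OF T] Q(1)])
 have "compose (carrier V) S T ` ginv T ` Q = S ` T ` ginv T ` Q"
  using subD(1)[OF lat_sub[OF gQ]] by (intro compose_image) auto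
 then have "compose (carrier V) S T ` ginv T ` Q = P" using ginv(4)[OF T Qc] Q(2) by simp
 moreover have "lat (compose (carrier V) S T ` P)"
  unfolding compose_image[OF Pc] by (rule lat_image[OF S lat_image[OF T lat_P]])
 ultimately show ?thesis by (intro GL_I[OF b h _ gQ])
qed

lemma GL_id: "(\<lambda>x\<in>carrier V. x) \<in> GL"
proof -
 have i: "(\<lambda>x\<in>carrier V. x) ` P = P" using subD(1)[OF P] by auto
 show ?thesis
 proof (rule GL_I[of _ P])
  show "(\<lambda>x\<in>carrier V. x) \<in> module_hom K V V" by (auto simp: module_hom_def)
 qed (simp_all only: id_Bij i lat_P)
qed

lemma group_GL: "group (Gl K V P)"
proof (rule groupI)
 fix S T R assume "S \<in> GL" "T \<in> GL" "R \<in> GL"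
 moreover from this have "compose (carrier V) (compose (carrier V) S T) R = compose (carrier V) S (compose (carrier V) T R)"
  using Bij_imp_funcset[OF GL_D(1), of R] by (auto simp: compose_def fun_eq_iff Pi_iff)
 ultimately show "S \<otimes>\<^bsub>Gl K V P\<^esub> T \<otimes>\<^bsub>Gl K V P\<^esub> R = S \<otimes>\<^bsub>Gl K V P\<^esub> (T \<otimes>\<^bsub>Gl K V P\<^esub> R)"
  by (simp add: GL_mult GL_compose)
next
 fix S assume S: "S \<in> GL"
 show "\<one>\<^bsub>Gl K V P\<^esub> \<otimes>\<^bsub>Gl K V P\<^esub> S = S"
  using S GL_D(1)[OF S] by (simp add: GL_one GL_mult GL_id Bij_imp_funcset Bij_imp_extensional)
 show "\<exists>y\<in>GL. y \<otimes>\<^bsub>Gl K V P\<^esub> S = \<one>\<^bsub>Gl K V P\<^esub>"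
  using ginv(1,2)[OF S] S by (auto simp: GL_mult GL_one intro!: bexI[of _ "ginv S"])
qed (auto simp: GL_mult GL_compose GL_one GL_id)

end

context lattice_kspace
begin

lemma inv_mult_K: "a \<in> carrier K ==> b \<in> carrier K ==> a \<noteq> \<zero> ==> b \<noteq> \<zero> ==> inv (a \<otimes> b) = inv a \<otimes> inv b"
proof -
 assume a: "a \<in> carrier K" "b \<in> carrier K" "a \<noteq> \<zero>" "b \<noteq> \<zero>"
 note i = invK[OF a(1,3)] invK[OF a(2,4)]
 have "(a \<otimes> b) \<otimes> (inv a \<otimes> inv b) = (a \<otimes> inv a) \<otimes> (b \<otimes> inv b)" using a(1,2) i by (simp add: R.m_ac)
 then have "(a \<otimes> b) \<otimes> (inv a \<otimes> inv b) = \<one>" using i by simp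
 then show ?thesis using a i by (intro R.comm_inv_char) auto
qed

lemma carrier_lat: "lat A ==> A \<subseteq> carrier V"
 using subD(1)[OF lat_sub] by auto

text \<open>Transport both sides of \<open>vol_flag\<close> along \<open>S\<close>; this makes transported families compatible again.\<close>

lemma eta_th:
 assumes S: "lin_inj K V V S" and p: "lat (S ` P)" and l: "lat M'" "lat M" "lat B" "M' \<subseteq> M" "M \<subseteq> B"
 shows "lin_inj.eta K V V S B M' \<otimes> th B M M' =
  th (S ` B) (S ` M) (S ` M') \<otimes> (lin_inj.eta K V V S M M' \<otimes> lin_inj.eta K V V S B M)"
proof -
 interpret S: lin_inj K V V S by fact
 note im = image_lat0[OF S p]
 obtain ms where ms: "ms \<in> fr M M'" "vl M M' ms = \<one>" using lat_basis[OF l(1,2,4)] .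
 obtain bs where bs: "bs \<in> fr B M" "vl B M bs = \<one>" using lat_basis[OF l(2,3,5)] .
 have l6: "M' \<subseteq> B" using l by auto
 note f = lat_fgen[OF l(1,2,4)] lat_fgen[OF l(2,3,5)] lat_fgen[OF l(1,3) l6]
 note e = S.eta_closed[OF lat_sub[OF l(1)] f(1)] S.eta_closed[OF lat_sub[OF l(2)] f(2)] S.eta_closed[OF lat_sub[OF l(1)] f(3)]
 have mb: "ms @ bs \<in> fr B M'" by (rule frames_append[OF l ms(1) bs(1)])
 have "vl (S ` B) (S ` M') (map S (ms @ bs)) = S.eta B M' \<otimes> th B M M'"
  using S.eta_vol[OF lat_sub[OF l(1)] f(3) mb] vol_th[OF l ms(1) bs(1)] ms bs e th_closed[OF l] by simp
 moreover have "vl (S ` B) (S ` M') (map S ms @ map S bs) = th (S ` B) (S ` M) (S ` M') \<otimes> (S.eta M M' \<otimes> S.eta B M)"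
  using vol_th[OF im[OF l(1)] im[OF l(2)] im[OF l(3)] image_mono[OF l(4)] image_mono[OF l(5)]
    S.f_frames[OF lat_sub[OF l(1)] f(1) ms(1)] S.f_frames[OF lat_sub[OF l(2)] f(2) bs(1)]]
   S.eta_vol[OF lat_sub[OF l(1)] f(1) ms(1)] S.eta_vol[OF lat_sub[OF l(2)] f(2) bs(1)] ms bs e by simp
 ultimately show ?thesis by simp
qed

lemma line_push:
 assumes S: "S \<in> GL" and l: "lat A" "lat B" and \<phi>: "\<phi> \<in> rl A B"
 shows line_push_rl: "line_push K V P S A B \<phi> \<in> rl (S ` A) (S ` B)"
  and line_push_kap: "!!M. M \<in> minor A B ==>
   kap (S ` A) (S ` B) (line_push K V P S A B \<phi>) (S ` M) \<otimes> lin_inj.eta K V V S B M = kap A B \<phi> M \<otimes> lin_inj.eta K V V S A M"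
proof -
 note Sl = GL_D(4)[OF S] and p = GL_lat(1)[OF S]
 interpret S: lin_inj K V V S by (rule Sl)
 note im = lat_image[OF S]
 note il = im[OF l(1)] im[OF l(2)]
 have eA: "S.eta C M \<in> carrier K" "S.eta C M \<noteq> \<zero>" if "lat M" "lat C" "M \<subseteq> C" for C M
  using S.eta_closed[OF lat_sub[OF that(1)] lat_fgen[OF that]] S.eta_nz[OF lat_sub[OF that(1)] lat_fgen[OF that]] by auto
 have mi: "S ` M \<in> minor (S ` A) (S ` B)" if "M \<in> minor A B" for M using that im by (auto simp: minor_iff)
 define T where "T = A \<inter> B"
 have T: "lat T" "T \<subseteq> A" "T \<subseteq> B" using lat_Int l by (auto simp: T_def)
 have Tm: "T \<in> minor A B" using T by (simp add: minor_iff)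
 note kT = kap_closed[OF l \<phi> Tm]
 note eT = eA[OF T(1) l(2) T(3)] eA[OF T(1) l(1) T(2)]
 define k0 where "k0 = kap A B \<phi> T \<otimes> S.eta A T \<otimes> inv (S.eta B T)"
 have k0: "k0 \<in> carrier K" "k0 \<otimes> S.eta B T = kap A B \<phi> T \<otimes> S.eta A T"
  unfolding k0_def using kT eT invK[OF eT(1,2)] by (auto simp: R.m_assoc)
 obtain \<psi> where \<psi>: "\<psi> \<in> rl (S ` A) (S ` B)" "kap (S ` A) (S ` B) \<psi> (S ` T) = k0"
  using rl_exists[OF il mi[OF Tm] k0(1)] by auto
 have k: "kap (S ` A) (S ` B) \<psi> (S ` M) \<otimes> S.eta B M = kap A B \<phi> M \<otimes> S.eta A M" if M: "M \<in> minor A B" for M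
 proof -
  have m: "lat M" "M \<subseteq> A" "M \<subseteq> B" "M \<subseteq> T" using M by (auto simp: minor_iff T_def)
  note c = kap_closed[OF l \<phi> M] kap_closed[OF il \<psi>(1) mi[OF M]]
  note e = eA[OF m(1) l(1) m(2)] eA[OF m(1) l(2) m(3)] eA[OF m(1) T(1) m(4)]
  note tc = th_closed[OF m(1) T(1) l(2) m(4) T(3)] th_nz[OF m(1) T(1) l(2) m(4) T(3)] th_closed[OF m(1) T(1) l(1) m(4) T(2)]
  note sm = image_mono[OF m(4), of S] image_mono[OF T(2), of S] image_mono[OF T(3), of S]
  note tS = th_closed[OF im[OF m(1)] im[OF T(1)] il(1) sm(1,2)] th_closed[OF im[OF m(1)] im[OF T(1)] il(2) sm(1,3)]
  have cons: "kap (S ` A) (S ` B) \<psi> (S ` M) \<otimes> th (S ` B) (S ` T) (S ` M) = k0 \<otimes> th (S ` A) (S ` T) (S ` M)"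
   using kap_cons[OF il \<psi>(1) mi[OF Tm] im[OF m(1)] sm(1)] \<psi>(2) by simp
  have "(kap (S ` A) (S ` B) \<psi> (S ` M) \<otimes> S.eta B M) \<otimes> th B T M =
    kap (S ` A) (S ` B) \<psi> (S ` M) \<otimes> (th (S ` B) (S ` T) (S ` M) \<otimes> (S.eta T M \<otimes> S.eta B T))"
   using eta_th[OF Sl p m(1) T(1) l(2) m(4) T(3)] c e tc by (simp add: R.m_assoc)
  also have "\<dots> = (kap (S ` A) (S ` B) \<psi> (S ` M) \<otimes> th (S ` B) (S ` T) (S ` M)) \<otimes> (S.eta T M \<otimes> S.eta B T)"
   using c e eT tS by (simp add: R.m_assoc)
  also have "\<dots> = th (S ` A) (S ` T) (S ` M) \<otimes> S.eta T M \<otimes> (k0 \<otimes> S.eta B T)"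
   unfolding cons using k0(1) e eT tS by (simp add: R.m_ac)
  also have "\<dots> = kap A B \<phi> T \<otimes> (th (S ` A) (S ` T) (S ` M) \<otimes> (S.eta T M \<otimes> S.eta A T))"
   unfolding k0(2) using kT e eT tS by (simp add: R.m_ac)
  also have "\<dots> = S.eta A M \<otimes> (kap A B \<phi> T \<otimes> th A T M)"
   unfolding eta_th[OF Sl p m(1) T(1) l(1) m(4) T(2), symmetric] using kT e tc by (simp add: R.m_ac)
  also have "\<dots> = S.eta A M \<otimes> (kap A B \<phi> M \<otimes> th B T M)"
   using kap_cons[OF l \<phi> Tm m(1,4)] by simp
  also have "\<dots> = (kap A B \<phi> M \<otimes> S.eta A M) \<otimes> th B T M" using c e tc by (simp add: R.m_ac)
  finally show ?thesis using mult_cancel[of "kap (S ` A) (S ` B) \<psi> (S ` M) \<otimes> S.eta B M" "kap A B \<phi> M \<otimes> S.eta A M" "th B T M"] c e tc by simp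
 qed
 have "line_push K V P S A B \<phi> = \<psi>" unfolding line_push_def
 proof (rule the_equality)
  show "\<psi> \<in> rl (S ` A) (S ` B) \<and> (\<forall>M\<in>minor A B. \<forall>bs\<in>fr B M. \<forall>as\<in>fr A M. \<forall>c\<in>carrier K.
    \<phi> M (dw B M bs) = c \<odot>\<^bsub>dl A M\<^esub> dw A M as -->
    \<psi> (S ` M) (dw (S ` B) (S ` M) (map S bs)) = c \<odot>\<^bsub>dl (S ` A) (S ` M)\<^esub> dw (S ` A) (S ` M) (map S as))"
  proof (intro conjI ballI impI \<psi>(1))
   fix M bs as c assume M: "M \<in> minor A B" and f: "bs \<in> fr B M" "as \<in> fr A M" "c \<in> carrier K"
    and eq: "\<phi> M (dw B M bs) = c \<odot>\<^bsub>dl A M\<^esub> dw A M as"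
   have m: "lat M" "M \<subseteq> A" "M \<subseteq> B" using M by (auto simp: minor_iff)
   note g = lat_fgen[OF m(1) l(1) m(2)] lat_fgen[OF m(1) l(2) m(3)]
   note v = lat_vol_closed[OF m(1) l(1) m(2) f(2)] lat_vol_closed[OF m(1) l(2) m(3) f(1)]
   note c = kap_closed[OF l \<phi> M] kap_closed[OF il \<psi>(1) mi[OF M]]
   note e = eA[OF m(1) l(1) m(2)] eA[OF m(1) l(2) m(3)]
   have e1: "kap A B \<phi> M \<otimes> vl B M bs = c \<otimes> vl A M as" using eq kap_dw[OF l \<phi> M f(2,1,3)] by simp
   have "kap (S ` A) (S ` B) \<psi> (S ` M) \<otimes> vl (S ` B) (S ` M) (map S bs) = (kap (S ` A) (S ` B) \<psi> (S ` M) \<otimes> S.eta B M) \<otimes> vl B M bs"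
    using S.eta_vol[OF lat_sub[OF m(1)] g(2) f(1)] c e v by (simp add: R.m_assoc)
   also have "\<dots> = S.eta A M \<otimes> (kap A B \<phi> M \<otimes> vl B M bs)" unfolding k[OF M] using c e v by (simp add: R.m_ac)
   also have "\<dots> = c \<otimes> vl (S ` A) (S ` M) (map S as)"
    unfolding e1 using S.eta_vol[OF lat_sub[OF m(1)] g(1) f(2)] f(3) e v by (simp add: R.m_ac)
   finally show "\<psi> (S ` M) (dw (S ` B) (S ` M) (map S bs)) = c \<odot>\<^bsub>dl (S ` A) (S ` M)\<^esub> dw (S ` A) (S ` M) (map S as)"
    using kap_dw[OF il \<psi>(1) mi[OF M] S.f_frames[OF lat_sub[OF m(1)] g(1) f(2)] S.f_frames[OF lat_sub[OF m(1)] g(2) f(1)] f(3)] by simp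
  qed
  fix \<psi>' assume a: "\<psi>' \<in> rl (S ` A) (S ` B) \<and> (\<forall>M\<in>minor A B. \<forall>bs\<in>fr B M. \<forall>as\<in>fr A M. \<forall>c\<in>carrier K.
    \<phi> M (dw B M bs) = c \<odot>\<^bsub>dl A M\<^esub> dw A M as -->
    \<psi>' (S ` M) (dw (S ` B) (S ` M) (map S bs)) = c \<odot>\<^bsub>dl (S ` A) (S ` M)\<^esub> dw (S ` A) (S ` M) (map S as))"
  then have r': "\<psi>' \<in> rl (S ` A) (S ` B)" by simp
  obtain as where as: "as \<in> fr A T" "vl A T as = \<one>" using lat_basis[OF T(1) l(1) T(2)] .
  obtain bs where bs: "bs \<in> fr B T" "vl B T bs = \<one>" using lat_basis[OF T(1) l(2) T(3)] .
  note g = lat_fgen[OF T(1) l(1) T(2)] lat_fgen[OF T(1) l(2) T(3)]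
  have "\<phi> T (dw B T bs) = kap A B \<phi> T \<odot>\<^bsub>dl A T\<^esub> dw A T as" using kap_dw[OF l \<phi> Tm as(1) bs(1) kT] as bs kT by simp
  then have "\<psi>' (S ` T) (dw (S ` B) (S ` T) (map S bs)) = kap A B \<phi> T \<odot>\<^bsub>dl (S ` A) (S ` T)\<^esub> dw (S ` A) (S ` T) (map S as)"
   using a Tm as(1) bs(1) kT by blast
  then have "kap (S ` A) (S ` B) \<psi>' (S ` T) \<otimes> S.eta B T = k0 \<otimes> S.eta B T"
   using kap_dw[OF il r' mi[OF Tm] S.f_frames[OF lat_sub[OF T(1)] g(1) as(1)] S.f_frames[OF lat_sub[OF T(1)] g(2) bs(1)] kT]
    S.eta_vol[OF lat_sub[OF T(1)] g(1) as(1)] S.eta_vol[OF lat_sub[OF T(1)] g(2) bs(1)] as bs eT k0(2) by simp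
  then have "kap (S ` A) (S ` B) \<psi>' (S ` T) = kap (S ` A) (S ` B) \<psi> (S ` T)"
   using mult_cancel kap_closed[OF il r' mi[OF Tm]] k0(1) eT \<psi>(2) by blast
  then show "\<psi>' = \<psi>" by (rule rl_eqI[OF il r' \<psi>(1) mi[OF Tm]])
 qed
 then show "line_push K V P S A B \<phi> \<in> rl (S ` A) (S ` B)" "!!M. M \<in> minor A B ==>
   kap (S ` A) (S ` B) (line_push K V P S A B \<phi>) (S ` M) \<otimes> S.eta B M = kap A B \<phi> M \<otimes> S.eta A M"
  using \<psi>(1) k by auto
qed

text \<open>Bases of \<open>B/M\<close>. The value \<open>val\<close> is the coordinate of a line element with respect to two such bases. In
contrast to \<open>line_coeff\<close> it does not depend on the choice of volume forms.\<close>

definition bf :: "'v set => 'v set => 'v list set" where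
 "bf B M = {bs \<in> fr B M. vl B M bs \<noteq> \<zero>}"

definition val :: "'v set => 'v set => ('k, 'v) line_elem => 'v set => 'v list => 'v list => 'k" where
 "val A B \<phi> M as bs = kap A B \<phi> M \<otimes> vl B M bs \<otimes> inv (vl A M as)"

lemma bfD: "lat M ==> lat B ==> M \<subseteq> B ==> bs \<in> bf B M ==>
  bs \<in> fr B M \<and> vl B M bs \<in> carrier K \<and> vl B M bs \<noteq> \<zero> \<and> inv (vl B M bs) \<in> carrier K \<and>
  vl B M bs \<otimes> inv (vl B M bs) = \<one> \<and> inv (vl B M bs) \<otimes> vl B M bs = \<one> \<and> inv (vl B M bs) \<noteq> \<zero>"
 using lat_vol_closed[of M B bs] invK[of "vl B M bs"] by (simp add: bf_def)

lemma bf_closed: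
 assumes "lat M" "lat B" "M \<subseteq> B" "bs \<in> bf B M"
 shows "vl B M bs \<in> carrier K" "inv (vl B M bs) \<in> carrier K"
 using bfD[OF assms] by auto

lemma bf_exists: "lat M ==> lat B ==> M \<subseteq> B ==> \<exists>bs. bs \<in> bf B M"
 using lat_basis[of M B] unfolding bf_def by (metis (mono_tags, lifting) mem_Collect_eq zero_not_one)

lemma val_closed:
 assumes "lat A" "lat B" "\<phi> \<in> rl A B" "M \<in> minor A B" "as \<in> bf A M" "bs \<in> bf B M"
 shows "val A B \<phi> M as bs \<in> carrier K"
 using assms kap_closed[OF assms(1-4)] bfD[of M A as] bfD[of M B bs] by (simp add: val_def minor_iff)

lemma kap_eq_val:
 assumes "lat A" "lat B" "\<phi> \<in> rl A B" "M \<in> minor A B" "as \<in> bf A M" "bs \<in> bf B M"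
 shows "kap A B \<phi> M = val A B \<phi> M as bs \<otimes> vl A M as \<otimes> inv (vl B M bs)"
proof -
 have m: "lat M" "M \<subseteq> A" "M \<subseteq> B" using assms(4) by (auto simp: minor_iff)
 have "val A B \<phi> M as bs \<otimes> vl A M as \<otimes> inv (vl B M bs) =
   kap A B \<phi> M \<otimes> ((vl B M bs \<otimes> inv (vl B M bs)) \<otimes> (inv (vl A M as) \<otimes> vl A M as))"
  using kap_closed[OF assms(1-4)] bf_closed[OF m(1) assms(1) m(2) assms(5)] bf_closed[OF m(1) assms(2) m(3) assms(6)]
  unfolding val_def by (simp only: R.m_ac R.m_closed)
 then show ?thesis using kap_closed[OF assms(1-4)] bfD[OF m(1) assms(1) m(2) assms(5)] bfD[OF m(1) assms(2) m(3) assms(6)] by simp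
qed

lemma val_eqI:
 assumes "lat A" "lat B" "\<phi> \<in> rl A B" "\<psi> \<in> rl A B" "M \<in> minor A B" "as \<in> bf A M" "bs \<in> bf B M"
  "val A B \<phi> M as bs = val A B \<psi> M as bs"
 shows "\<phi> = \<psi>"
 using rl_eqI[OF assms(1-5)] kap_eq_val[OF assms(1,2,3,5-7)] kap_eq_val[OF assms(1,2,4,5-7)] assms(8) by simp

lemma val_exists:
 assumes "lat A" "lat B" "M \<in> minor A B" "as \<in> bf A M" "bs \<in> bf B M" "c \<in> carrier K"
 shows "\<exists>\<phi>\<in>rl A B. val A B \<phi> M as bs = c"
proof -
 have m: "lat M" "M \<subseteq> A" "M \<subseteq> B" using assms(3) by (auto simp: minor_iff)
 note a = bfD[OF m(1) assms(1) m(2) assms(4)] and b = bfD[OF m(1) assms(2) m(3) assms(5)]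
 obtain \<phi> where \<phi>: "\<phi> \<in> rl A B" "kap A B \<phi> M = c \<otimes> vl A M as \<otimes> inv (vl B M bs)"
  using rl_exists[OF assms(1-3), of "c \<otimes> vl A M as \<otimes> inv (vl B M bs)"] a b assms(6) by auto
 have "c \<otimes> vl A M as \<otimes> inv (vl B M bs) \<otimes> vl B M bs \<otimes> inv (vl A M as) = c"
  using a b assms(6) by (simp add: R.m_assoc)
 then have "val A B \<phi> M as bs = c" unfolding val_def \<phi>(2) .
 with \<phi>(1) show ?thesis by blast
qed

lemma val_zero_iff:
 assumes "lat A" "lat B" "\<phi> \<in> rl A B" "M \<in> minor A B" "as \<in> bf A M" "bs \<in> bf B M"
 shows "val A B \<phi> M as bs = \<zero> \<longleftrightarrow> \<phi> = line_zero K V P A B"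
proof -
 have m: "lat M" "M \<subseteq> A" "M \<subseteq> B" using assms(4) by (auto simp: minor_iff)
 show ?thesis
  using line_zero_iff[OF assms(1-4)] kap_closed[OF assms(1-4)] bfD[OF m(1) assms(1) m(2) assms(5)] bfD[OF m(1) assms(2) m(3) assms(6)]
  by (simp add: val_def integral_iff)
qed

text \<open>Composition of line elements is multiplication of their values; the intermediate basis cancels.\<close>

lemma val_comp:
 assumes l: "lat A" "lat B" "lat C" and \<phi>: "\<phi> \<in> rl A B" and \<psi>: "\<psi> \<in> rl B C"
  and M: "lat M" "M \<subseteq> A" "M \<subseteq> B" "M \<subseteq> C" and f: "as \<in> bf A M" "bs \<in> bf B M" "cs \<in> bf C M"
 shows "val A C (line_comp K V P A B C \<phi> \<psi>) M as cs = val A B \<phi> M as bs \<otimes> val B C \<psi> M bs cs"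
proof -
 have m: "M \<in> minor A B" "M \<in> minor B C" using M by (auto simp: minor_iff)
 note b = bfD[OF M(1) l(1) M(2) f(1)] bfD[OF M(1) l(2) M(3) f(2)] bfD[OF M(1) l(3) M(4) f(3)]
 note k = kap_closed[OF l(1,2) \<phi> m(1)] kap_closed[OF l(2,3) \<psi> m(2)]
 have "val A B \<phi> M as bs \<otimes> val B C \<psi> M bs cs =
  (kap A B \<phi> M \<otimes> kap B C \<psi> M) \<otimes> vl C M cs \<otimes> inv (vl A M as) \<otimes> (vl B M bs \<otimes> inv (vl B M bs))"
  unfolding val_def
  using bf_closed[OF M(1) l(1) M(2) f(1)] bf_closed[OF M(1) l(2) M(3) f(2)] bf_closed[OF M(1) l(3) M(4) f(3)] k
  by (simp only: R.m_ac R.m_closed)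
 then show ?thesis using b k line_comp_kap[OF l \<phi> \<psi> m] by (simp add: val_def)
qed

lemma bf_image:
 assumes S: "S \<in> GL" and M: "lat M" "lat B" "M \<subseteq> B" "bs \<in> bf B M"
 shows "map S bs \<in> bf (S ` B) (S ` M)"
proof -
 interpret S: lin_inj K V V S by (rule GL_D(4)[OF S])
 note b = bfD[OF M]
 note g = lat_sub[OF M(1)] lat_fgen[OF M(1-3)]
 show ?thesis using S.f_frames[OF g] S.eta_vol[OF g] S.eta_closed[OF g] S.eta_nz[OF g] b integral_iff by (auto simp: bf_def)
qed

text \<open>The factors \<open>eta\<close> for \<open>A\<close> and \<open>B\<close> enter the coordinate and the volumes of the bases inversely.\<close>

lemma val_push:
 assumes S: "S \<in> GL" and l: "lat A" "lat B" and \<phi>: "\<phi> \<in> rl A B" and M: "M \<in> minor A B" and f: "as \<in> bf A M" "bs \<in> bf B M"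
 shows "val (S ` A) (S ` B) (line_push K V P S A B \<phi>) (S ` M) (map S as) (map S bs) = val A B \<phi> M as bs"
proof -
 interpret S: lin_inj K V V S by (rule GL_D(4)[OF S])
 have m: "lat M" "M \<subseteq> A" "M \<subseteq> B" using M by (auto simp: minor_iff)
 note b = bfD[OF m(1) l(1) m(2) f(1)] bfD[OF m(1) l(2) m(3) f(2)]
 note gA = lat_sub[OF m(1)] lat_fgen[OF m(1) l(1) m(2)] and gB = lat_sub[OF m(1)] lat_fgen[OF m(1) l(2) m(3)]
 note e = S.eta_closed[OF gA] S.eta_nz[OF gA] S.eta_closed[OF gB] S.eta_nz[OF gB] invK[OF S.eta_closed[OF gA] S.eta_nz[OF gA]]
 have Sm: "S ` M \<in> minor (S ` A) (S ` B)" using m lat_image[OF S] by (auto simp: minor_iff)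
 note k = kap_closed[OF l \<phi> M] kap_closed[OF lat_image[OF S l(1)] lat_image[OF S l(2)] line_push_rl[OF S l \<phi>] Sm]
 have "val (S ` A) (S ` B) (line_push K V P S A B \<phi>) (S ` M) (map S as) (map S bs) =
  (kap (S ` A) (S ` B) (line_push K V P S A B \<phi>) (S ` M) \<otimes> S.eta B M) \<otimes> (vl B M bs \<otimes> (inv (S.eta A M) \<otimes> inv (vl A M as)))"
  unfolding val_def using S.eta_vol[OF gA, of as] S.eta_vol[OF gB, of bs] b e k inv_mult_K[of "S.eta A M" "vl A M as"] by (simp add: R.m_assoc)
 also have "\<dots> = kap A B \<phi> M \<otimes> vl B M bs \<otimes> inv (vl A M as) \<otimes> (S.eta A M \<otimes> inv (S.eta A M))"
  unfolding line_push_kap[OF S l \<phi> M]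
  using bf_closed[OF m(1) l(1) m(2) f(1)] bf_closed[OF m(1) l(2) m(3) f(2)] e(1,3) e(5)[THEN conjunct1] k
  by (simp only: R.m_ac R.m_closed)
 finally show ?thesis using b e k by (simp add: val_def)
qed

end

context lattice_kspace
begin

abbreviation G where "G \<equiv> Gl_ext K V P"

section \<open>The central extension\<close>

definition gv :: "('k, 'v) line_elem \<times> ('v => 'v) => 'v set => 'v list => 'v list => 'k" where
 "gv a M as bs = val P (snd a ` P) (fst a) M as bs"

lemma G_iff: "a \<in> carrier G \<longleftrightarrow> snd a \<in> GL \<and> fst a \<in> rl P (snd a ` P) \<and> fst a \<noteq> line_zero K V P P (snd a ` P)"
 by (cases a) (simp add: Gl_ext_def)

lemma G_D:
 assumes "a \<in> carrier G"
 shows "snd a \<in> GL" "fst a \<in> rl P (snd a ` P)" "fst a \<noteq> line_zero K V P P (snd a ` P)" "lat (snd a ` P)"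
 using assms GL_lat(1) by (auto simp: G_iff)

lemma gv_nonzero:
 assumes a: "a \<in> carrier G" and M: "lat M" "M \<subseteq> P" "M \<subseteq> snd a ` P" and f: "as \<in> bf P M" "bs \<in> bf (snd a ` P) M"
 shows "gv a M as bs \<in> carrier K" "gv a M as bs \<noteq> \<zero>"
 using val_closed[OF lat_P G_D(4)[OF a] G_D(2)[OF a] _ f] val_zero_iff[OF lat_P G_D(4)[OF a] G_D(2)[OF a] _ f] G_D(3)[OF a] M
 by (simp_all add: gv_def minor_iff)

lemma G_eqI:
 assumes a: "a \<in> carrier G" and b: "b \<in> carrier G" and S: "snd a = snd b" and M: "lat M" "M \<subseteq> P" "M \<subseteq> snd a ` P"
  and f: "as \<in> bf P M" "bs \<in> bf (snd a ` P) M" and eq: "gv a M as bs = gv b M as bs"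
 shows "a = b"
proof (rule prod_eqI)
 show "fst a = fst b"
  using val_eqI[OF lat_P G_D(4)[OF a] G_D(2)[OF a] _ _ f] G_D(2)[OF b] S eq M by (simp add: gv_def minor_iff)
qed fact

lemma G_exists:
 assumes S: "S \<in> GL" and M: "lat M" "M \<subseteq> P" "M \<subseteq> S ` P" and f: "as \<in> bf P M" "bs \<in> bf (S ` P) M"
  and c: "c \<in> carrier K" "c \<noteq> \<zero>"
 obtains a where "a \<in> carrier G" "snd a = S" "gv a M as bs = c"
proof -
 have m: "M \<in> minor P (S ` P)" using M by (simp add: minor_iff)
 obtain \<phi> where \<phi>: "\<phi> \<in> rl P (S ` P)" "val P (S ` P) \<phi> M as bs = c"
  using val_exists[OF lat_P GL_lat(1)[OF S] m f c(1)] by auto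
 have "(\<phi>, S) \<in> carrier G"
  using \<phi> S c val_zero_iff[OF lat_P GL_lat(1)[OF S] \<phi>(1) m f] by (simp add: G_iff)
 then show thesis using that[of "(\<phi>, S)"] \<phi> by (simp add: gv_def)
qed

lemma mult_G: "a \<otimes>\<^bsub>G\<^esub> b = (line_comp K V P P (snd a ` P) (snd a ` snd b ` P) (fst a) (line_push K V P (snd a) P (snd b ` P) (fst b)),
  snd a \<otimes>\<^bsub>Gl K V P\<^esub> snd b)"
 by (cases a; cases b) (simp add: Gl_ext_def)

lemma snd_mult_G: "a \<in> carrier G ==> b \<in> carrier G ==> snd (a \<otimes>\<^bsub>G\<^esub> b) = compose (carrier V) (snd a) (snd b)"
 by (simp add: mult_G GL_mult G_D)

lemma snd_mult_image: "a \<in> carrier G ==> b \<in> carrier G ==> A \<subseteq> carrier V ==> snd (a \<otimes>\<^bsub>G\<^esub> b) ` A = snd a ` snd b ` A"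
 by (simp add: snd_mult_G compose_image)

text \<open>The group law in terms of values: transport the second factor by the first automorphism, then
compose. All computations in the central extension are reduced to this rule.\<close>

lemma gv_mult:
 assumes a: "a \<in> carrier G" and b: "b \<in> carrier G"
  and M: "lat M" "M \<subseteq> P" "M \<subseteq> snd b ` P" "snd a ` M \<subseteq> P"
  and f: "as \<in> bf P (snd a ` M)" "bs \<in> bf P M" "cs \<in> bf (snd b ` P) M"
 shows "gv (a \<otimes>\<^bsub>G\<^esub> b) (snd a ` M) as (map (snd a) cs) = gv a (snd a ` M) as (map (snd a) bs) \<otimes> gv b M bs cs"
  and "a \<otimes>\<^bsub>G\<^esub> b \<in> carrier G"
proof -
 let ?S = "snd a" and ?T = "snd b"
 note A = G_D[OF a] and B = G_D[OF b]
 have l: "lat P" "lat (?S ` P)" "lat (?S ` ?T ` P)" using lat_P A B lat_image by auto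
 note ps = line_push_rl[OF A(1) lat_P B(4) B(2)]
 have Mm: "M \<in> minor P (?T ` P)" using M by (simp add: minor_iff)
 have SM: "lat (?S ` M)" "?S ` M \<subseteq> P" "?S ` M \<subseteq> ?S ` P" "?S ` M \<subseteq> ?S ` ?T ` P" using M lat_image[OF A(1)] by auto
 note f' = bf_image[OF A(1) M(1) lat_P M(2) f(2)] bf_image[OF A(1) M(1) B(4) M(3) f(3)]
 have im: "snd (a \<otimes>\<^bsub>G\<^esub> b) ` P = ?S ` ?T ` P" by (rule snd_mult_image[OF a b carrier_lat[OF lat_P]])
 show eq: "gv (a \<otimes>\<^bsub>G\<^esub> b) (?S ` M) as (map ?S cs) = gv a (?S ` M) as (map ?S bs) \<otimes> gv b M bs cs"
  using val_comp[OF l A(2) ps SM f(1) f'] val_push[OF A(1) lat_P B(4) B(2) Mm f(2,3)] im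
  unfolding gv_def by (simp add: mult_G)
 have r: "fst (a \<otimes>\<^bsub>G\<^esub> b) \<in> rl P (?S ` ?T ` P)" unfolding mult_G fst_conv by (rule line_comp_rl[OF l A(2) ps])
 have s: "snd (a \<otimes>\<^bsub>G\<^esub> b) \<in> GL" unfolding snd_mult_G[OF a b] by (rule GL_compose[OF A(1) B(1)])
 have "gv a (?S ` M) as (map ?S bs) \<otimes> gv b M bs cs \<noteq> \<zero>"
  using gv_nonzero[OF a SM(1-3) f(1) f'(1)] gv_nonzero[OF b M(1-3) f(2,3)] integral_iff by auto
 then have "val P (?S ` ?T ` P) (fst (a \<otimes>\<^bsub>G\<^esub> b)) (?S ` M) as (map ?S cs) \<noteq> \<zero>" using eq im by (simp add: gv_def)
 then have "fst (a \<otimes>\<^bsub>G\<^esub> b) \<noteq> line_zero K V P P (?S ` ?T ` P)"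
  using val_zero_iff[OF l(1,3) r _ f(1) f'(2)] SM by (simp add: minor_iff)
 then show "a \<otimes>\<^bsub>G\<^esub> b \<in> carrier G" using r s im by (simp add: G_iff)
qed

lemma lat_preimage: "S \<in> GL ==> lat A ==> lat (ginv S ` A) \<and> S ` ginv S ` A = A"
 using lat_image[OF ginv(1)] ginv(4)[OF _ carrier_lat] by auto

lemma mult_closed_G: "a \<in> carrier G ==> b \<in> carrier G ==> a \<otimes>\<^bsub>G\<^esub> b \<in> carrier G"
proof -
 assume a: "a \<in> carrier G" and b: "b \<in> carrier G"
 note A = G_D[OF a] and B = G_D[OF b]
 define M where "M = P \<inter> snd b ` P \<inter> ginv (snd a) ` P"
 note pr = lat_preimage[OF A(1) lat_P]
 have M: "lat M" "M \<subseteq> P" "M \<subseteq> snd b ` P" using lat_Int lat_P B pr by (auto simp: M_def)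
 have SM: "snd a ` M \<subseteq> P"
 proof -
  have "snd a ` M \<subseteq> snd a ` ginv (snd a) ` P" by (auto simp: M_def)
  then show ?thesis using pr by simp
 qed
 obtain as bs cs where "as \<in> bf P (snd a ` M)" "bs \<in> bf P M" "cs \<in> bf (snd b ` P) M"
  using bf_exists[OF lat_image[OF A(1) M(1)] lat_P SM] bf_exists[OF M(1) lat_P M(2)] bf_exists[OF M(1) B(4) M(3)] by auto
 then show ?thesis by (rule gv_mult(2)[OF a b M SM])
qed

definition zc :: "'k => ('k, 'v) line_elem \<times> ('v => 'v)" where
 "zc c = (line_scalar K V P P c, \<one>\<^bsub>Gl K V P\<^esub>)"

lemma id_image: "A \<subseteq> carrier V ==> \<one>\<^bsub>Gl K V P\<^esub> ` A = A"
 by (auto simp: GL_one)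

lemma snd_zc [simp]: "snd (zc c) = \<one>\<^bsub>Gl K V P\<^esub>" by (simp add: zc_def)

lemma one_GL: "\<one>\<^bsub>Gl K V P\<^esub> \<in> GL" by (simp add: GL_one GL_id)

lemma Pc: "P \<subseteq> carrier V" by (rule carrier_lat[OF lat_P])

lemma gv_zc:
 assumes c: "c \<in> carrier K" and M: "lat M" "M \<subseteq> P" and f: "as \<in> bf P M"
 shows "gv (zc c) M as as = c"
proof -
 have "P \<in> minor P P" "M \<in> minor P P" using M lat_P by (auto simp: minor_iff)
 then show ?thesis
  using line_scalar_kap[OF lat_P c, of M] bfD[OF M(1) lat_P M(2) f] c
  by (simp add: gv_def zc_def val_def id_image[OF Pc] R.m_assoc)
qed

lemma zc_closed: "c \<in> carrier K ==> c \<noteq> \<zero> ==> zc c \<in> carrier G"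
proof -
 assume c: "c \<in> carrier K" "c \<noteq> \<zero>"
 have m: "P \<in> minor P P" using lat_P by (auto simp: minor_iff)
 show ?thesis
  using line_scalar_rl[OF lat_P c(1)] line_scalar_kap[OF lat_P c(1) m] c
   line_zero_iff[OF lat_P lat_P line_scalar_rl[OF lat_P c(1)] m] one_GL
  by (simp add: G_iff zc_def id_image[OF Pc])
qed

lemma one_G: "\<one>\<^bsub>G\<^esub> = zc \<one>" by (simp add: Gl_ext_def zc_def)

lemma id_map: "set cs \<subseteq> carrier V ==> map (\<one>\<^bsub>Gl K V P\<^esub>) cs = cs"
 by (simp add: GL_one map_idI subset_iff)

lemma bf_set: "lat B ==> bs \<in> bf B M ==> set bs \<subseteq> carrier V"
 using carrier_lat by (auto simp: bf_def frames_def)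

lemma zc_mult:
 assumes c: "c \<in> carrier K" "c \<noteq> \<zero>" and a: "a \<in> carrier G"
  and M: "lat M" "M \<subseteq> P" "M \<subseteq> snd a ` P" and f: "as \<in> bf P M" "bs \<in> bf (snd a ` P) M"
 shows "gv (zc c \<otimes>\<^bsub>G\<^esub> a) M as bs = c \<otimes> gv a M as bs"
proof -
 have i: "\<one>\<^bsub>Gl K V P\<^esub> ` M = M" by (rule id_image[OF carrier_lat[OF M(1)]])
 show ?thesis
  using gv_mult(1)[OF zc_closed[OF c] a M, of as as bs] i M f gv_zc[OF c(1) M(1,2) f(1)]
   id_map[OF bf_set[OF lat_P f(1)]] id_map[OF bf_set[OF G_D(4)[OF a] f(2)]] by simp
qed

lemma snd_zc_mult: "c \<in> carrier K ==> c \<noteq> \<zero> ==> a \<in> carrier G ==> snd (zc c \<otimes>\<^bsub>G\<^esub> a) = snd a"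
 using group.is_monoid[OF group_GL, THEN monoid.l_one, of "snd a"] G_D(1)[of a] by (simp add: mult_G)

lemma snd_mult_zc: "c \<in> carrier K ==> c \<noteq> \<zero> ==> a \<in> carrier G ==> snd (a \<otimes>\<^bsub>G\<^esub> zc c) = snd a"
 using group.is_monoid[OF group_GL, THEN monoid.r_one, of "snd a"] G_D(1)[of a] by (simp add: mult_G)

lemma mult_zc:
 assumes c: "c \<in> carrier K" "c \<noteq> \<zero>" and a: "a \<in> carrier G"
 shows "a \<otimes>\<^bsub>G\<^esub> zc c = zc c \<otimes>\<^bsub>G\<^esub> a"
proof -
 let ?S = "snd a"
 note A = G_D[OF a]
 define M where "M = P \<inter> ginv ?S ` P"
 note pr = lat_preimage[OF A(1) lat_P]
 have M: "lat M" "M \<subseteq> P" using lat_Int lat_P pr by (auto simp: M_def)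
 have "?S ` M \<subseteq> ?S ` ginv ?S ` P" by (auto simp: M_def)
 then have SM: "lat (?S ` M)" "?S ` M \<subseteq> P" "?S ` M \<subseteq> ?S ` P" using pr lat_image[OF A(1) M(1)] M by auto
 obtain as bs where f: "as \<in> bf P (?S ` M)" "bs \<in> bf P M"
  using bf_exists[OF SM(1) lat_P SM(2)] bf_exists[OF M(1) lat_P M(2)] by auto
 have f2: "map ?S bs \<in> bf (?S ` P) (?S ` M)" by (rule bf_image[OF A(1) M(1) lat_P M(2) f(2)])
 have i: "\<one>\<^bsub>Gl K V P\<^esub> ` P = P" by (rule id_image[OF Pc])
 have 1: "gv (a \<otimes>\<^bsub>G\<^esub> zc c) (?S ` M) as (map ?S bs) = gv a (?S ` M) as (map ?S bs) \<otimes> c"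
  using gv_mult(1)[OF a zc_closed[OF c] M(1,2) _ SM(2) f(1,2), of bs] i M f(2) gv_zc[OF c(1) M(1,2) f(2)] by simp
 have 2: "gv (zc c \<otimes>\<^bsub>G\<^esub> a) (?S ` M) as (map ?S bs) = c \<otimes> gv a (?S ` M) as (map ?S bs)"
  by (rule zc_mult[OF c a SM f(1) f2])
 show ?thesis
 proof (rule G_eqI[OF mult_closed_G[OF a zc_closed[OF c]] mult_closed_G[OF zc_closed[OF c] a]])
  show "snd (a \<otimes>\<^bsub>G\<^esub> zc c) = snd (zc c \<otimes>\<^bsub>G\<^esub> a)" using snd_mult_zc[OF c a] snd_zc_mult[OF c a] by simp
  show "?S ` M \<subseteq> snd (a \<otimes>\<^bsub>G\<^esub> zc c) ` P" "map ?S bs \<in> bf (snd (a \<otimes>\<^bsub>G\<^esub> zc c) ` P) (?S ` M)"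
   using snd_mult_zc[OF c a] SM f2 by simp_all
  show "gv (a \<otimes>\<^bsub>G\<^esub> zc c) (?S ` M) as (map ?S bs) = gv (zc c \<otimes>\<^bsub>G\<^esub> a) (?S ` M) as (map ?S bs)"
   using 1 2 gv_nonzero(1)[OF a SM f(1) f2] c by (simp add: R.m_comm)
 qed (fact SM f)+
qed

text \<open>Elements with the same automorphism agree if their values on one lattice agree; for both
bracketings the value is the product of the same three factors.\<close>

lemma assoc_G:
 assumes a: "a \<in> carrier G" and b: "b \<in> carrier G" and c: "c \<in> carrier G"
 shows "a \<otimes>\<^bsub>G\<^esub> b \<otimes>\<^bsub>G\<^esub> c = a \<otimes>\<^bsub>G\<^esub> (b \<otimes>\<^bsub>G\<^esub> c)"
proof -
 define S T R where "S = snd a" and "T = snd b" and "R = snd c"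
 note A = G_D[OF a, folded S_def] and B = G_D[OF b, folded T_def] and C = G_D[OF c, folded R_def]
 define N1 where "N1 = ginv T ` P"
 define N2 where "N2 = ginv T ` ginv S ` P"
 have n: "lat N1" "T ` N1 = P" "lat N2" "S ` T ` N2 = P"
  using lat_preimage[OF B(1) lat_P] lat_preimage[OF A(1) lat_P] lat_preimage[OF B(1), of "ginv S ` P"] by (auto simp: N1_def N2_def)
 define N where "N = P \<inter> R ` P \<inter> N1 \<inter> N2"
 have N: "lat N" "N \<subseteq> P" "N \<subseteq> R ` P" using lat_Int lat_P C n by (auto simp: N_def)
 have TN: "lat (T ` N)" "T ` N \<subseteq> P" "T ` N \<subseteq> T ` P" "T ` N \<subseteq> T ` R ` P"
  using lat_image[OF B(1) N(1)] n(2) by (auto simp: N_def)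
 have "S ` T ` N \<subseteq> S ` T ` N2" by (auto simp: N_def)
 then have STN: "lat (S ` T ` N)" "S ` T ` N \<subseteq> P" using lat_image[OF A(1) TN(1)] n(4) by auto
 have Nc: "N \<subseteq> carrier V" by (rule carrier_lat[OF N(1)])
 obtain p r q o' where f: "p \<in> bf P N" "r \<in> bf (R ` P) N" "q \<in> bf P (T ` N)" "o' \<in> bf P (S ` T ` N)"
  using bf_exists[OF N(1) lat_P N(2)] bf_exists[OF N(1) C(4) N(3)] bf_exists[OF TN(1) lat_P TN(2)] bf_exists[OF STN(1) lat_P STN(2)] by auto
 have ab: "a \<otimes>\<^bsub>G\<^esub> b \<in> carrier G" and bc: "b \<otimes>\<^bsub>G\<^esub> c \<in> carrier G" using mult_closed_G a b c by auto
 have abi: "snd (a \<otimes>\<^bsub>G\<^esub> b) ` Y0 = S ` T ` Y0" if "Y0 \<subseteq> carrier V" for Y0 using snd_mult_image[OF a b that] by (simp add: S_def T_def)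
 have bci: "snd (b \<otimes>\<^bsub>G\<^esub> c) ` P = T ` R ` P" using snd_mult_image[OF b c Pc] by (simp add: T_def R_def)
 have abm: "map (snd (a \<otimes>\<^bsub>G\<^esub> b)) xs = map S (map T xs)" if "set xs \<subseteq> carrier V" for xs
  using that by (auto simp: snd_mult_G[OF a b] compose_def S_def T_def)
 have Tp: "map T p \<in> bf (T ` P) (T ` N)" by (rule bf_image[OF B(1) N(1) lat_P N(2) f(1)])
 have Tr: "map T r \<in> bf (T ` R ` P) (T ` N)" by (rule bf_image[OF B(1) N(1) C(4) N(3) f(2)])
 have Sq: "map S q \<in> bf (S ` P) (S ` T ` N)" by (rule bf_image[OF A(1) TN(1) lat_P TN(2) f(3)])
 have STr: "map S (map T r) \<in> bf (S ` T ` R ` P) (S ` T ` N)" by (rule bf_image[OF A(1) TN(1) lat_image[OF B(1) C(4)] TN(4) Tr])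
 have 1: "gv (a \<otimes>\<^bsub>G\<^esub> b \<otimes>\<^bsub>G\<^esub> c) (S ` T ` N) o' (map S (map T r)) = gv (a \<otimes>\<^bsub>G\<^esub> b) (S ` T ` N) o' (map S (map T p)) \<otimes> gv c N p r"
  using gv_mult(1)[OF ab c N(1,2), of o' p r] abi[OF Nc] N(3) STN f abm[OF bf_set[OF lat_P f(1)]] abm[OF bf_set[OF C(4) f(2)]]
  by (simp add: R_def)
 have 2: "gv (a \<otimes>\<^bsub>G\<^esub> b) (S ` T ` N) o' (map S (map T p)) = gv a (S ` T ` N) o' (map S q) \<otimes> gv b (T ` N) q (map T p)"
  using gv_mult(1)[OF a b TN(1,2), of o' q "map T p"] TN STN f Tp unfolding S_def T_def by simp
 have 3: "gv (a \<otimes>\<^bsub>G\<^esub> (b \<otimes>\<^bsub>G\<^esub> c)) (S ` T ` N) o' (map S (map T r)) = gv a (S ` T ` N) o' (map S q) \<otimes> gv (b \<otimes>\<^bsub>G\<^esub> c) (T ` N) q (map T r)"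
  using gv_mult(1)[OF a bc TN(1,2), of o' q "map T r"] bci TN STN f Tr unfolding S_def by simp
 have 4: "gv (b \<otimes>\<^bsub>G\<^esub> c) (T ` N) q (map T r) = gv b (T ` N) q (map T p) \<otimes> gv c N p r"
  using gv_mult(1)[OF b c N(1,2), of q p r] N(3) TN f unfolding T_def R_def by simp
 have k: "gv a (S ` T ` N) o' (map S q) \<in> carrier K" "gv b (T ` N) q (map T p) \<in> carrier K" "gv c N p r \<in> carrier K"
  using gv_nonzero(1)[OF a STN _ f(4)] gv_nonzero(1)[OF b TN(1,2) _ f(3)] gv_nonzero(1)[OF c N(1,2) _ f(1)] Sq Tp f(2) TN N(3) STN
  by (auto simp: S_def[symmetric] T_def[symmetric] R_def[symmetric] image_mono)
 have im: "snd (a \<otimes>\<^bsub>G\<^esub> b \<otimes>\<^bsub>G\<^esub> c) ` P = S ` T ` R ` P"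
  using snd_mult_image[OF ab c Pc] abi[OF carrier_lat[OF C(4)]] by (simp add: R_def)
 show ?thesis
 proof (rule G_eqI[OF mult_closed_G[OF ab c] mult_closed_G[OF a bc]])
  show "snd (a \<otimes>\<^bsub>G\<^esub> b \<otimes>\<^bsub>G\<^esub> c) = snd (a \<otimes>\<^bsub>G\<^esub> (b \<otimes>\<^bsub>G\<^esub> c))"
   using group.is_monoid[OF group_GL, THEN monoid.m_assoc, of S T R] A B C by (simp add: mult_G S_def T_def R_def)
  show "S ` T ` N \<subseteq> snd (a \<otimes>\<^bsub>G\<^esub> b \<otimes>\<^bsub>G\<^esub> c) ` P" unfolding im using TN(4) by (rule image_mono)
  show "map S (map T r) \<in> bf (snd (a \<otimes>\<^bsub>G\<^esub> b \<otimes>\<^bsub>G\<^esub> c) ` P) (S ` T ` N)" unfolding im by (rule STr)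
  show "gv (a \<otimes>\<^bsub>G\<^esub> b \<otimes>\<^bsub>G\<^esub> c) (S ` T ` N) o' (map S (map T r)) = gv (a \<otimes>\<^bsub>G\<^esub> (b \<otimes>\<^bsub>G\<^esub> c)) (S ` T ` N) o' (map S (map T r))"
   using 1 2 3 4 k by (simp add: R.m_assoc)
 qed (fact STN f)+
qed

lemma l_one_G:
 assumes a: "a \<in> carrier G" shows "\<one>\<^bsub>G\<^esub> \<otimes>\<^bsub>G\<^esub> a = a"
proof -
 note A = G_D[OF a]
 define M where "M = P \<inter> snd a ` P"
 have M: "lat M" "M \<subseteq> P" "M \<subseteq> snd a ` P" using lat_Int lat_P A by (auto simp: M_def)
 obtain as bs where f: "as \<in> bf P M" "bs \<in> bf (snd a ` P) M" using bf_exists[OF M(1) lat_P M(2)] bf_exists[OF M(1) A(4) M(3)] by auto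
 note z = zc_closed[OF R.one_closed]
 have z1: "\<one> \<in> carrier K" "\<one> \<noteq> \<zero>" by simp_all
 show ?thesis unfolding one_G
 proof (rule G_eqI[OF mult_closed_G[OF zc_closed[OF z1] a] a])
  show "gv (zc \<one> \<otimes>\<^bsub>G\<^esub> a) M as bs = gv a M as bs" using zc_mult[OF z1 a M f] gv_nonzero(1)[OF a M f] by simp
 qed (use snd_zc_mult[OF z1 a] M f in simp_all)
qed

text \<open>A lift of the inverse automorphism is a left inverse up to a scalar; rescale it.\<close>

lemma l_inv_G:
 assumes a: "a \<in> carrier G" shows "\<exists>b\<in>carrier G. b \<otimes>\<^bsub>G\<^esub> a = \<one>\<^bsub>G\<^esub>"
proof -
 define S where "S = snd a"
 note A = G_D[OF a, folded S_def]
 define T where "T = ginv S"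
 have T: "T \<in> GL" using ginv(1)[OF A(1)] by (simp add: T_def)
 have TS: "T ` S ` B = B" if "B \<subseteq> carrier V" for B unfolding T_def by (rule ginv(3)[OF A(1) that])
 define N where "N = P \<inter> S ` P"
 have N: "lat N" "N \<subseteq> P" "N \<subseteq> S ` P" using lat_Int lat_P A by (auto simp: N_def)
 have TN: "lat (T ` N)" "T ` N \<subseteq> P" "T ` N \<subseteq> T ` P"
  using lat_image[OF T N(1)] N(2) image_mono[OF N(3), of T] TS[OF Pc] by auto
 obtain p r q where f: "p \<in> bf P N" "r \<in> bf (S ` P) N" "q \<in> bf P (T ` N)"
  using bf_exists[OF N(1) lat_P N(2)] bf_exists[OF N(1) A(4) N(3)] bf_exists[OF TN(1) lat_P TN(2)] by auto
 have Tp: "map T p \<in> bf (T ` P) (T ` N)" by (rule bf_image[OF T N(1) lat_P N(2) f(1)])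
 have Tr: "map T r \<in> bf P (T ` N)" using bf_image[OF T N(1) A(4) N(3) f(2)] TS[OF Pc] by simp
 have z1: "\<one> \<in> carrier K" "\<one> \<noteq> \<zero>" by simp_all
 have g1: "gv (zc \<one>) (T ` N) q (map T r) \<in> carrier K" "gv (zc \<one>) (T ` N) q (map T r) \<noteq> \<zero>"
  using gv_nonzero[OF zc_closed[OF z1] TN(1,2) _ f(3)] TN(2) Tr by (simp_all add: id_image[OF Pc])
 have ga: "gv a N p r \<in> carrier K" "gv a N p r \<noteq> \<zero>" using gv_nonzero[OF a N(1,2) _ f(1)] N(3) f(2) by (simp_all add: S_def)
 note ia = invK[OF ga]
 define c where "c = gv (zc \<one>) (T ` N) q (map T r) \<otimes> inv (gv a N p r)"
 have c: "c \<in> carrier K" "c \<noteq> \<zero>" "c \<otimes> gv a N p r = gv (zc \<one>) (T ` N) q (map T r)"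
  unfolding c_def using g1 ga ia integral_iff by (auto simp: R.m_assoc)
 obtain b where b: "b \<in> carrier G" "snd b = T" "gv b (T ` N) q (map T p) = c"
  by (rule G_exists[OF T TN f(3) Tp c(1,2)])
 have bs: "snd (b \<otimes>\<^bsub>G\<^esub> a) = \<one>\<^bsub>Gl K V P\<^esub>"
  using snd_mult_G[OF b(1) a] ginv(2)[OF A(1)] b(2) by (simp add: GL_one S_def T_def)
 have "b \<otimes>\<^bsub>G\<^esub> a = zc \<one>"
 proof (rule G_eqI[OF mult_closed_G[OF b(1) a] zc_closed[OF z1]])
  show "gv (b \<otimes>\<^bsub>G\<^esub> a) (T ` N) q (map T r) = gv (zc \<one>) (T ` N) q (map T r)"
   using gv_mult(1)[OF b(1) a N(1,2), of q p r] N(3) TN f b c(3) by (simp add: S_def)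
  show "T ` N \<subseteq> snd (b \<otimes>\<^bsub>G\<^esub> a) ` P" "map T r \<in> bf (snd (b \<otimes>\<^bsub>G\<^esub> a) ` P) (T ` N)"
   unfolding bs id_image[OF Pc] using TN(2) Tr by simp_all
 qed (use bs TN f in simp_all)
 then show ?thesis using b(1) by (auto simp: one_G)
qed

lemma group_G: "group G"
proof (rule groupI)
 show "\<one>\<^bsub>G\<^esub> \<in> carrier G" unfolding one_G by (rule zc_closed) simp_all
qed (rule mult_closed_G assoc_G l_one_G l_inv_G; assumption)+

lemma zc_inj: "c \<in> carrier K ==> d \<in> carrier K ==> zc c = zc d ==> c = d"
proof -
 assume a: "c \<in> carrier K" "d \<in> carrier K" "zc c = zc d"
 obtain as where as: "as \<in> bf P P" using bf_exists[OF lat_P lat_P order_refl] by blast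
 show ?thesis using gv_zc[OF a(1) lat_P order_refl as] gv_zc[OF a(2) lat_P order_refl as] unfolding a(3) by (rule trans[OF sym])
qed

lemma comm_lift:
 assumes a: "a \<in> carrier G" and b: "b \<in> carrier G" and c: "c \<in> carrier K" "c \<noteq> \<zero>"
 shows "a \<otimes>\<^bsub>G\<^esub> b \<otimes>\<^bsub>G\<^esub> inv\<^bsub>G\<^esub> a \<otimes>\<^bsub>G\<^esub> inv\<^bsub>G\<^esub> b = zc c \<longleftrightarrow> a \<otimes>\<^bsub>G\<^esub> b = zc c \<otimes>\<^bsub>G\<^esub> (b \<otimes>\<^bsub>G\<^esub> a)"
proof -
 interpret G: group G by (rule group_G)
 note z = zc_closed[OF c]
 have "a \<otimes>\<^bsub>G\<^esub> b \<otimes>\<^bsub>G\<^esub> inv\<^bsub>G\<^esub> a \<otimes>\<^bsub>G\<^esub> inv\<^bsub>G\<^esub> b = a \<otimes>\<^bsub>G\<^esub> b \<otimes>\<^bsub>G\<^esub> inv\<^bsub>G\<^esub> (b \<otimes>\<^bsub>G\<^esub> a)"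
  using a b by (simp add: G.inv_mult_group G.m_assoc)
 moreover have "zc c = a \<otimes>\<^bsub>G\<^esub> b \<otimes>\<^bsub>G\<^esub> inv\<^bsub>G\<^esub> (b \<otimes>\<^bsub>G\<^esub> a) \<longleftrightarrow> a \<otimes>\<^bsub>G\<^esub> b = zc c \<otimes>\<^bsub>G\<^esub> (b \<otimes>\<^bsub>G\<^esub> a)"
  by (rule G.inv_solve_right) (use a b z in simp_all)
 ultimately show ?thesis by metis
qed

text \<open>Two lifts of the same automorphism differ by a central scalar, so that the commutator does not
depend on the lifts.\<close>

lemma comm_scale:
 assumes a: "a \<in> carrier G" "a' \<in> carrier G" "snd a' = snd a"
 shows "\<exists>k. k \<in> carrier K \<and> k \<noteq> \<zero> \<and> a' = zc k \<otimes>\<^bsub>G\<^esub> a"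
proof -
 note A = G_D[OF a(1)]
 define M where "M = P \<inter> snd a ` P"
 have M: "lat M" "M \<subseteq> P" "M \<subseteq> snd a ` P" using lat_Int lat_P A by (auto simp: M_def)
 obtain as bs where f: "as \<in> bf P M" "bs \<in> bf (snd a ` P) M" using bf_exists[OF M(1) lat_P M(2)] bf_exists[OF M(1) A(4) M(3)] by auto
 have g: "gv a M as bs \<in> carrier K" "gv a M as bs \<noteq> \<zero>" using gv_nonzero[OF a(1) M f] by auto
 have g': "gv a' M as bs \<in> carrier K" "gv a' M as bs \<noteq> \<zero>" using gv_nonzero[OF a(2), of M as bs] M f a(3) by auto
 define k where "k = gv a' M as bs \<otimes> inv (gv a M as bs)"
 have k: "k \<in> carrier K" "k \<noteq> \<zero>" "k \<otimes> gv a M as bs = gv a' M as bs"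
  unfolding k_def using g g' invK[OF g] integral_iff by (auto simp: R.m_assoc)
 have "a' = zc k \<otimes>\<^bsub>G\<^esub> a"
  using G_eqI[OF a(2) mult_closed_G[OF zc_closed[OF k(1,2)] a(1)], of M as bs] snd_zc_mult[OF k(1,2) a(1)] a(3) M f
   zc_mult[OF k(1,2) a(1) M f] k(3) by simp
 with k show ?thesis by blast
qed

text \<open>One pair of lifts is enough to compute the symbol.\<close>

lemma comm_unique:
 assumes a: "a \<in> carrier G" "b \<in> carrier G" and c: "c \<in> carrier K" "c \<noteq> \<zero>" and eq: "a \<otimes>\<^bsub>G\<^esub> b = zc c \<otimes>\<^bsub>G\<^esub> (b \<otimes>\<^bsub>G\<^esub> a)"
 shows "commutator_symbol K V P (snd a) (snd b) = c"
 unfolding commutator_symbol_def zc_def[symmetric]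
proof (rule the_equality)
 interpret G: group G by (rule group_G)
 show "c \<in> carrier K - {\<zero>} \<and> (\<forall>a'\<in>carrier G. \<forall>b'\<in>carrier G. snd a' = snd a \<and> snd b' = snd b -->
   a' \<otimes>\<^bsub>G\<^esub> b' \<otimes>\<^bsub>G\<^esub> inv\<^bsub>G\<^esub> a' \<otimes>\<^bsub>G\<^esub> inv\<^bsub>G\<^esub> b' = zc c)"
 proof (intro conjI ballI impI)
  fix a' b' assume ab: "a' \<in> carrier G" "b' \<in> carrier G" "snd a' = snd a \<and> snd b' = snd b"
  obtain k where k: "k \<in> carrier K" "k \<noteq> \<zero>" "a' = zc k \<otimes>\<^bsub>G\<^esub> a" using comm_scale[OF a(1) ab(1)] ab(3) by auto
  obtain l where l: "l \<in> carrier K" "l \<noteq> \<zero>" "b' = zc l \<otimes>\<^bsub>G\<^esub> b" using comm_scale[OF a(2) ab(2)] ab(3) by auto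
  note z = zc_closed[OF k(1,2)] zc_closed[OF l(1,2)] zc_closed[OF c]
  have pull: "x \<otimes>\<^bsub>G\<^esub> (zc k \<otimes>\<^bsub>G\<^esub> y) = zc k \<otimes>\<^bsub>G\<^esub> (x \<otimes>\<^bsub>G\<^esub> y)"
   "x \<otimes>\<^bsub>G\<^esub> (zc l \<otimes>\<^bsub>G\<^esub> y) = zc l \<otimes>\<^bsub>G\<^esub> (x \<otimes>\<^bsub>G\<^esub> y)" if "x \<in> carrier G" "y \<in> carrier G" for x y
   using mult_zc[OF k(1,2) that(1)] mult_zc[OF l(1,2) that(1)] that z by (simp_all add: G.m_assoc[symmetric])
  have ab': "a \<otimes>\<^bsub>G\<^esub> b \<in> carrier G" "b \<otimes>\<^bsub>G\<^esub> a \<in> carrier G" using a by auto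
  have 1: "a' \<otimes>\<^bsub>G\<^esub> b' = zc k \<otimes>\<^bsub>G\<^esub> (zc l \<otimes>\<^bsub>G\<^esub> (a \<otimes>\<^bsub>G\<^esub> b))"
   unfolding k(3) l(3) using a z pull(2)[OF a] by (simp add: G.m_assoc)
  have "b' \<otimes>\<^bsub>G\<^esub> a' = zc l \<otimes>\<^bsub>G\<^esub> (zc k \<otimes>\<^bsub>G\<^esub> (b \<otimes>\<^bsub>G\<^esub> a))"
   unfolding k(3) l(3) using a z pull(1)[OF a(2,1)] by (simp add: G.m_assoc)
  then have 2: "b' \<otimes>\<^bsub>G\<^esub> a' = zc k \<otimes>\<^bsub>G\<^esub> (zc l \<otimes>\<^bsub>G\<^esub> (b \<otimes>\<^bsub>G\<^esub> a))"
   using pull(1)[OF z(2) ab'(2)] by simp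
  have "zc k \<otimes>\<^bsub>G\<^esub> (zc l \<otimes>\<^bsub>G\<^esub> (zc c \<otimes>\<^bsub>G\<^esub> (b \<otimes>\<^bsub>G\<^esub> a))) = zc c \<otimes>\<^bsub>G\<^esub> (zc k \<otimes>\<^bsub>G\<^esub> (zc l \<otimes>\<^bsub>G\<^esub> (b \<otimes>\<^bsub>G\<^esub> a)))"
   unfolding pull(1)[OF z(3) G.m_closed[OF z(2) ab'(2)]] pull(2)[OF z(3) ab'(2)] by (rule refl)
  then have "a' \<otimes>\<^bsub>G\<^esub> b' = zc c \<otimes>\<^bsub>G\<^esub> (b' \<otimes>\<^bsub>G\<^esub> a')" unfolding 1 2 eq .
  then show "a' \<otimes>\<^bsub>G\<^esub> b' \<otimes>\<^bsub>G\<^esub> inv\<^bsub>G\<^esub> a' \<otimes>\<^bsub>G\<^esub> inv\<^bsub>G\<^esub> b' = zc c" using comm_lift[OF ab(1,2) c] by simp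
 qed (use c in simp)
 fix d assume d: "d \<in> carrier K - {\<zero>} \<and> (\<forall>a'\<in>carrier G. \<forall>b'\<in>carrier G. snd a' = snd a \<and> snd b' = snd b -->
   a' \<otimes>\<^bsub>G\<^esub> b' \<otimes>\<^bsub>G\<^esub> inv\<^bsub>G\<^esub> a' \<otimes>\<^bsub>G\<^esub> inv\<^bsub>G\<^esub> b' = zc d)"
 then have "a \<otimes>\<^bsub>G\<^esub> b \<otimes>\<^bsub>G\<^esub> inv\<^bsub>G\<^esub> a \<otimes>\<^bsub>G\<^esub> inv\<^bsub>G\<^esub> b = zc d" using a by blast
 moreover have "a \<otimes>\<^bsub>G\<^esub> b \<otimes>\<^bsub>G\<^esub> inv\<^bsub>G\<^esub> a \<otimes>\<^bsub>G\<^esub> inv\<^bsub>G\<^esub> b = zc c" using comm_lift[OF a c] eq by simp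
 ultimately show "d = c" using zc_inj[of d c] d c by auto
qed

end

section \<open>Commutator symbols and winding numbers\<close>

text \<open>The symbol with the sign that makes it multiplicative in direct sums.\<close>

definition signed_symbol :: "'k ring => ('k, 'v) module => 'v set => ('v => 'v) => ('v => 'v) => 'k" where
 "signed_symbol K V P S T =
  (\<ominus>\<^bsub>K\<^esub> \<one>\<^bsub>K\<^esub>) [^]\<^bsub>K\<^esub> (winding K V P S * winding K V P T) \<otimes>\<^bsub>K\<^esub> commutator_symbol K V P S T"

context kspace
begin

text \<open>The sign \<open>(-1)^n\<close>.\<close>

definition sg :: "nat => 'k" where "sg n = (if even n then \<one> else \<ominus> \<one>)"

lemma sg_closed [simp]: "sg n \<in> carrier K" by (simp add: sg_def)

lemma sg_mult: "sg m \<otimes> sg n = sg (m + n)" by (auto simp: sg_def R.l_minus)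

lemma sg_sq: "sg m \<otimes> sg m = \<one>" by (simp add: sg_def R.l_minus)

lemma sg_nonzero: "sg n \<noteq> \<zero>"
 using sg_sq[of n] by (metis R.r_null sg_closed zero_not_one)

lemma sg_nat_pow: "(\<ominus> \<one>) [^] (n :: nat) = sg n"
 by (induction n) (auto simp: sg_def R.l_minus)

lemma sg_int_pow: "(\<ominus> \<one>) [^] (n :: int) = (if even n then \<one> else \<ominus> \<one>)"
proof -
 have i: "inv (\<ominus> \<one>) = \<ominus> \<one>" by (rule R.comm_inv_char) (simp_all add: R.l_minus)
 have o: "inv \<one> = \<one>" by simp
 have e: "even (nat m) \<longleftrightarrow> even m" if "m \<ge> 0" for m :: int using that by (simp add: even_nat_iff)
 show ?thesis unfolding int_pow_def2 sg_nat_pow sg_def using e[of n] e[of "- n"] i o by auto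
qed

end

context lattice_kspace
begin

text \<open>Take \<open>P \<inter> S P \<inter> T P \<inter> S T P\<close> and pull it back along \<open>S\<close> and along \<open>T\<close>. On it both products of lifts of
\<open>S\<close> and \<open>T\<close> can be evaluated by \<open>gv_mult\<close>.\<close>

lemma common_lattice:
 assumes S: "S \<in> GL" and T: "T \<in> GL" and comm: "compose (carrier V) S T = compose (carrier V) T S"
 shows "\<exists>M1 M2. lat M1 \<and> lat M2 \<and> S ` M1 = T ` M2 \<and> M1 \<subseteq> P \<and> M1 \<subseteq> T ` P \<and> M2 \<subseteq> P \<and> M2 \<subseteq> S ` P \<and> S ` M1 \<subseteq> P"
proof -
 note lS = GL_lat(1)[OF S] and lT = GL_lat(1)[OF T]
 define M where "M = P \<inter> S ` P \<inter> T ` P \<inter> S ` T ` P"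
 have M: "lat M" "M \<subseteq> P" "M \<subseteq> S ` P" "M \<subseteq> T ` P" "M \<subseteq> S ` T ` P"
  using lat_Int lat_P lS lT lat_image[OF S lT] by (auto simp: M_def)
 have ST: "S ` T ` P = T ` S ` P" using compose_image[OF Pc, of S T] compose_image[OF Pc, of T S] comm by simp
 define M1 where "M1 = ginv S ` M"
 define M2 where "M2 = ginv T ` M"
 have 1: "lat M1" "S ` M1 = M" and 2: "lat M2" "T ` M2 = M"
  using lat_preimage[OF S M(1)] lat_preimage[OF T M(1)] by (auto simp: M1_def M2_def)
 have "M1 \<subseteq> ginv S ` S ` P" "M1 \<subseteq> ginv S ` S ` T ` P" unfolding M1_def using M by (auto intro!: image_mono)
 then have i1: "M1 \<subseteq> P" "M1 \<subseteq> T ` P" using ginv(3)[OF S Pc] ginv(3)[OF S carrier_lat[OF lT]] by auto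
 have "M2 \<subseteq> ginv T ` T ` P" "M2 \<subseteq> ginv T ` T ` S ` P" unfolding M2_def using M ST by (auto intro!: image_mono)
 then have i2: "M2 \<subseteq> P" "M2 \<subseteq> S ` P" using ginv(3)[OF T Pc] ginv(3)[OF T carrier_lat[OF lS]] by auto
 show ?thesis using 1 2 i1 i2 M(2) by (intro exI[of _ M1] exI[of _ M2]) auto
qed

text \<open>The symbol is the quotient of the values of \<open>ab\<close> and \<open>ba\<close>, on any lattice and any bases.\<close>

lemma comm_ratio:
 assumes a: "a \<in> carrier G" and b: "b \<in> carrier G" and comm: "compose (carrier V) (snd a) (snd b) = compose (carrier V) (snd b) (snd a)"
  and M: "lat M" "M \<subseteq> P" "M \<subseteq> snd a ` snd b ` P" and f: "as \<in> bf P M" "ds \<in> bf (snd a ` snd b ` P) M"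
  and c: "c \<in> carrier K" "c \<noteq> \<zero>" and eq: "gv (a \<otimes>\<^bsub>G\<^esub> b) M as ds = c \<otimes> gv (b \<otimes>\<^bsub>G\<^esub> a) M as ds"
 shows "commutator_symbol K V P (snd a) (snd b) = c"
proof (rule comm_unique[OF a b c])
 have ab: "a \<otimes>\<^bsub>G\<^esub> b \<in> carrier G" and ba: "b \<otimes>\<^bsub>G\<^esub> a \<in> carrier G" using mult_closed_G a b by auto
 have s: "snd (a \<otimes>\<^bsub>G\<^esub> b) = snd (b \<otimes>\<^bsub>G\<^esub> a)" using snd_mult_G[OF a b] snd_mult_G[OF b a] comm by simp
 have im: "snd (a \<otimes>\<^bsub>G\<^esub> b) ` P = snd a ` snd b ` P" by (rule snd_mult_image[OF a b Pc])
 show "a \<otimes>\<^bsub>G\<^esub> b = zc c \<otimes>\<^bsub>G\<^esub> (b \<otimes>\<^bsub>G\<^esub> a)"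
 proof (rule G_eqI[OF ab mult_closed_G[OF zc_closed[OF c] ba]])
  show "snd (a \<otimes>\<^bsub>G\<^esub> b) = snd (zc c \<otimes>\<^bsub>G\<^esub> (b \<otimes>\<^bsub>G\<^esub> a))" using s snd_zc_mult[OF c ba] by simp
  show "M \<subseteq> snd (a \<otimes>\<^bsub>G\<^esub> b) ` P" "ds \<in> bf (snd (a \<otimes>\<^bsub>G\<^esub> b) ` P) M" unfolding im by (fact M f)+
  show "gv (a \<otimes>\<^bsub>G\<^esub> b) M as ds = gv (zc c \<otimes>\<^bsub>G\<^esub> (b \<otimes>\<^bsub>G\<^esub> a)) M as ds"
   using zc_mult[OF c ba M(1,2) _ f(1)] M(3) f(2) im s eq by simp
 qed (fact M f)+
qed

lemma comm_symbol:
 assumes a: "a \<in> carrier G" and b: "b \<in> carrier G" and comm: "compose (carrier V) (snd a) (snd b) = compose (carrier V) (snd b) (snd a)"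
 shows "commutator_symbol K V P (snd a) (snd b) \<in> carrier K" "commutator_symbol K V P (snd a) (snd b) \<noteq> \<zero>"
  "!!M as ds. [|lat M; M \<subseteq> P; M \<subseteq> snd a ` snd b ` P; as \<in> bf P M; ds \<in> bf (snd a ` snd b ` P) M|] ==>
   gv (a \<otimes>\<^bsub>G\<^esub> b) M as ds = commutator_symbol K V P (snd a) (snd b) \<otimes> gv (b \<otimes>\<^bsub>G\<^esub> a) M as ds"
proof -
 have ab: "a \<otimes>\<^bsub>G\<^esub> b \<in> carrier G" and ba: "b \<otimes>\<^bsub>G\<^esub> a \<in> carrier G" using mult_closed_G a b by auto
 have im: "snd (a \<otimes>\<^bsub>G\<^esub> b) ` P = snd a ` snd b ` P" by (rule snd_mult_image[OF a b Pc])
 have im': "snd (b \<otimes>\<^bsub>G\<^esub> a) ` P = snd a ` snd b ` P" using im snd_mult_G[OF a b] snd_mult_G[OF b a] comm by simp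
 have nz: "gv (a \<otimes>\<^bsub>G\<^esub> b) M as ds \<in> carrier K \<and> gv (a \<otimes>\<^bsub>G\<^esub> b) M as ds \<noteq> \<zero> \<and>
   gv (b \<otimes>\<^bsub>G\<^esub> a) M as ds \<in> carrier K \<and> gv (b \<otimes>\<^bsub>G\<^esub> a) M as ds \<noteq> \<zero>"
  if "lat M" "M \<subseteq> P" "M \<subseteq> snd a ` snd b ` P" "as \<in> bf P M" "ds \<in> bf (snd a ` snd b ` P) M" for M as ds
  using gv_nonzero[OF ab, of M as ds] gv_nonzero[OF ba, of M as ds] that im im' by simp
 have *: "commutator_symbol K V P (snd a) (snd b) = gv (a \<otimes>\<^bsub>G\<^esub> b) M as ds \<otimes> inv (gv (b \<otimes>\<^bsub>G\<^esub> a) M as ds)"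
  if m: "lat M" "M \<subseteq> P" "M \<subseteq> snd a ` snd b ` P" "as \<in> bf P M" "ds \<in> bf (snd a ` snd b ` P) M" for M as ds
 proof -
  note n = nz[OF m]
  note i = invK[of "gv (b \<otimes>\<^bsub>G\<^esub> a) M as ds"]
  show ?thesis
   by (rule comm_ratio[OF a b comm m]) (use n i integral_iff in \<open>auto simp: R.m_assoc\<close>)
 qed
 have l: "lat (snd a ` snd b ` P)" using lat_image G_D(1)[OF a] G_D(4)[OF b] by blast
 have l0: "lat (P \<inter> snd a ` snd b ` P)" by (rule lat_Int[OF lat_P l])
 obtain as ds where f: "as \<in> bf P (P \<inter> snd a ` snd b ` P)" "ds \<in> bf (snd a ` snd b ` P) (P \<inter> snd a ` snd b ` P)"
  using bf_exists[OF l0 lat_P] bf_exists[OF l0 l] by auto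
 show "commutator_symbol K V P (snd a) (snd b) \<in> carrier K" "commutator_symbol K V P (snd a) (snd b) \<noteq> \<zero>"
  unfolding *[OF l0 Int_lower1 Int_lower2 f]
  using nz[OF l0 Int_lower1 Int_lower2 f] invK[of "gv (b \<otimes>\<^bsub>G\<^esub> a) (P \<inter> snd a ` snd b ` P) as ds"] integral_iff by auto
 show "gv (a \<otimes>\<^bsub>G\<^esub> b) M as ds = commutator_symbol K V P (snd a) (snd b) \<otimes> gv (b \<otimes>\<^bsub>G\<^esub> a) M as ds"
  if m: "lat M" "M \<subseteq> P" "M \<subseteq> snd a ` snd b ` P" "as \<in> bf P M" "ds \<in> bf (snd a ` snd b ` P) M" for M as ds
  unfolding *[OF m] using nz[OF m] invK[of "gv (b \<otimes>\<^bsub>G\<^esub> a) M as ds"] by (simp add: R.m_assoc)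
qed

lemma G_lift: "S \<in> GL ==> \<exists>a\<in>carrier G. snd a = S"
proof -
 assume S: "S \<in> GL"
 define M where "M = P \<inter> S ` P"
 have M: "lat M" "M \<subseteq> P" "M \<subseteq> S ` P" using lat_Int lat_P GL_lat(1)[OF S] by (auto simp: M_def)
 obtain as bs where f: "as \<in> bf P M" "bs \<in> bf (S ` P) M"
  using bf_exists[OF M(1) lat_P M(2)] bf_exists[OF M(1) GL_lat(1)[OF S] M(3)] by auto
 obtain a where "a \<in> carrier G" "snd a = S" by (rule G_exists[OF S M f R.one_closed one_not_zero])
 then show ?thesis by blast
qed

lemma symbol_closed:
 assumes "S \<in> GL" "T \<in> GL" "compose (carrier V) S T = compose (carrier V) T S"
 shows "commutator_symbol K V P S T \<in> carrier K"
proof -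
 obtain a b where "a \<in> carrier G" "snd a = S" "b \<in> carrier G" "snd b = T" using G_lift assms by metis
 then show ?thesis using comm_symbol(1)[of a b] assms(3) by simp
qed

lemma bf_self: "lat B ==> bs \<in> bf B B ==> bs = []"
proof -
 assume l: "lat B" and b: "bs \<in> bf B B"
 have "mbasis B B []" by (simp add: basis_mod_def)
 then have "qdim K V B B = 0" using qdim_eq_length[OF lat_sub[OF l]] by fastforce
 then show "bs = []" using b by (simp add: bf_def frames_def)
qed

text \<open>If \<open>P\<close> is stable, evaluate on \<open>M = P\<close>, where all bases are empty: lifts with value \<open>1\<close> commute.\<close>

lemma symbol_stable:
 assumes S: "S \<in> GL" and T: "T \<in> GL" and comm: "compose (carrier V) S T = compose (carrier V) T S"
  and SP: "S ` P = P" and TP: "T ` P = P"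
 shows "commutator_symbol K V P S T = \<one>"
proof -
 obtain e where e: "e \<in> bf P P" using bf_exists[OF lat_P lat_P order_refl] by blast
 have e0: "e = []" by (rule bf_self[OF lat_P e])
 note n = e[unfolded e0]
 have nS: "[] \<in> bf (S ` P) P" and nT: "[] \<in> bf (T ` P) P" using n SP TP by simp_all
 obtain a where a: "a \<in> carrier G" "snd a = S" "gv a P [] [] = \<one>"
  by (rule G_exists[OF S lat_P order_refl _ n nS R.one_closed one_not_zero]) (simp add: SP)
 obtain b where b: "b \<in> carrier G" "snd b = T" "gv b P [] [] = \<one>"
  by (rule G_exists[OF T lat_P order_refl _ n nT R.one_closed one_not_zero]) (simp add: TP)
 have 1: "gv (a \<otimes>\<^bsub>G\<^esub> b) P [] [] = \<one>"
  using gv_mult(1)[OF a(1) b(1) lat_P order_refl, of "[]" "[]" "[]"] a b n SP TP by simp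
 have 2: "gv (b \<otimes>\<^bsub>G\<^esub> a) P [] [] = \<one>"
  using gv_mult(1)[OF b(1) a(1) lat_P order_refl, of "[]" "[]" "[]"] a b n SP TP by simp
 have "commutator_symbol K V P (snd a) (snd b) = \<one>"
 proof (rule comm_ratio[OF a(1) b(1) _ lat_P order_refl _ n])
  show "[] \<in> bf (snd a ` snd b ` P) P" using a b SP TP n by simp
  show "gv (a \<otimes>\<^bsub>G\<^esub> b) P [] [] = \<one> \<otimes> gv (b \<otimes>\<^bsub>G\<^esub> a) P [] []" unfolding 1 2 by simp
 qed (use comm a b SP TP in simp_all)
 then show ?thesis using a b by simp
qed

lemma winding_eq:
 assumes S: "S \<in> GL" and M: "lat M" "M \<subseteq> P" "M \<subseteq> S ` P"
 shows "winding K V P S = int (qdim K V P M) - int (qdim K V (S ` P) M)"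
proof -
 have l: "lat (P \<inter> S ` P)" using lat_Int lat_P GL_lat(1)[OF S] by blast
 have m: "M \<subseteq> P \<inter> S ` P" using M by auto
 show ?thesis
  using lat_qdim[OF M(1) l lat_P m Int_lower1] lat_qdim[OF M(1) l GL_lat(1)[OF S] m Int_lower2]
  by (simp add: winding_def)
qed

lemma qdim_image: "S \<in> GL ==> lat M ==> lat B ==> M \<subseteq> B ==> qdim K V (S ` B) (S ` M) = qdim K V B M"
 using lin_inj.f_qdim[OF GL_D(4) lat_sub lat_fgen] by blast

lemma winding_stable: "S ` P = P ==> winding K V P S = 0"
 by (simp add: winding_def)

lemma bf_length: "bs \<in> bf B M ==> length bs = qdim K V B M"
 by (simp add: bf_def frames_def)

lemma signed_symbol_stable:
 assumes "S \<in> GL" "T \<in> GL" "compose (carrier V) S T = compose (carrier V) T S" "S ` P = P" "T ` P = P"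
 shows "signed_symbol K V P S T = \<one>"
 unfolding signed_symbol_def winding_stable[OF assms(4)] winding_stable[OF assms(5)] symbol_stable[OF assms]
 by (simp add: sg_int_pow)

lemma signed_symbol_closed:
 assumes "S \<in> GL" "T \<in> GL" "compose (carrier V) S T = compose (carrier V) T S"
 shows "signed_symbol K V P S T \<in> carrier K"
 unfolding signed_symbol_def using symbol_closed[OF assms] by (simp add: sg_int_pow)

end

context lattice_kspace
begin

text \<open>Writes the symbol as a ratio of four values, together with the winding numbers as differences of
lengths of the bases involved. The basis \<open>e\<close> is chosen so that \<open>T e = S d\<close>; thus both products of lifts are
evaluated on the same pair of bases.\<close>

lemma comm_frames:
 assumes x: "x \<in> carrier G" and y: "y \<in> carrier G" and S: "snd x = S" and T: "snd y = T"
  and comm: "compose (carrier V) S T = compose (carrier V) T S"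
 obtains M M' a b c d e where "lat M" "lat M'" "S ` M = T ` M'" "M \<subseteq> P" "M \<subseteq> T ` P" "M' \<subseteq> P" "M' \<subseteq> S ` P" "S ` M \<subseteq> P"
  "a \<in> bf P (S ` M)" "b \<in> bf P M" "d \<in> bf (T ` P) M" "c \<in> bf P M'" "e \<in> bf (S ` P) M'" "map T e = map S d"
  "gv x (S ` M) a (map S b) \<otimes> gv y M b d =
   commutator_symbol K V P S T \<otimes> (gv y (S ` M) a (map T c) \<otimes> gv x M' c e)"
  "winding K V P S = int (length a) - int (length b)" "winding K V P T = int (length a) - int (length c)"
  "winding K V P T = int (length b) - int (length d)" "winding K V P S = int (length c) - int (length d)"
proof -
 note X1 = G_D[OF x, unfolded S] and Y1 = G_D[OF y, unfolded T]
 obtain M M' where M: "lat M" "lat M'" "S ` M = T ` M'" "M \<subseteq> P" "M \<subseteq> T ` P" "M' \<subseteq> P" "M' \<subseteq> S ` P" "S ` M \<subseteq> P"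
  using common_lattice[OF X1(1) Y1(1) comm] by (elim exE conjE)
 have SM: "lat (S ` M)" by (rule lat_image[OF X1(1) M(1)])
 obtain a where a: "a \<in> bf P (S ` M)" using bf_exists[OF SM lat_P M(8)] by (rule exE)
 obtain b where b: "b \<in> bf P M" using bf_exists[OF M(1) lat_P M(4)] by (rule exE)
 obtain c where c: "c \<in> bf P M'" using bf_exists[OF M(2) lat_P M(6)] by (rule exE)
 obtain d where d: "d \<in> bf (T ` P) M" using bf_exists[OF M(1) Y1(4) M(5)] by (rule exE)
 note f = a b c d
 have ST: "S ` T ` P = T ` S ` P" using compose_image[OF Pc, of S T] compose_image[OF Pc, of T S] comm by simp
 have Sd: "map S d \<in> bf (S ` T ` P) (S ` M)" by (rule bf_image[OF X1(1) M(1) Y1(4) M(5) f(4)])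
 have lST: "lat (S ` T ` P)" by (rule lat_image[OF X1(1) Y1(4)])
 define e where "e = map (ginv T) (map S d)"
 have "e \<in> bf (ginv T ` S ` T ` P) (ginv T ` S ` M)"
  unfolding e_def by (rule bf_image[OF ginv(1)[OF Y1(1)] SM lST image_mono[OF M(5)] Sd])
 then have e: "e \<in> bf (S ` P) M'"
  unfolding ST M(3) ginv(3)[OF Y1(1) carrier_lat[OF X1(4)]] ginv(3)[OF Y1(1) carrier_lat[OF M(2)]] .
 have Tg: "T (ginv T v) = v" if "v \<in> carrier V" for v
  using ginv(4)[OF Y1(1), of "{v}"] that by auto
 have Te: "map T e = map S d"
  unfolding e_def map_map using bf_set[OF lST Sd] by (intro map_cong refl) (simp add: Tg subset_iff)
 have SMST: "S ` M \<subseteq> S ` T ` P" by (rule image_mono[OF M(5)])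
 have g1: "gv (x \<otimes>\<^bsub>G\<^esub> y) (S ` M) a (map S d) = gv x (S ` M) a (map S b) \<otimes> gv y M b d"
  using gv_mult(1)[OF x y M(1,4), of a b d] M(5,8) f unfolding S T by simp
 have g2: "gv (y \<otimes>\<^bsub>G\<^esub> x) (S ` M) a (map S d) = gv y (S ` M) a (map T c) \<otimes> gv x M' c e"
  using gv_mult(1)[OF y x M(2,6), of a c e] M(7,8) f(1,3) e unfolding S T M(3)[symmetric] Te by simp
 have g3: "gv (x \<otimes>\<^bsub>G\<^esub> y) (S ` M) a (map S d) = commutator_symbol K V P S T \<otimes> gv (y \<otimes>\<^bsub>G\<^esub> x) (S ` M) a (map S d)"
  using comm_symbol(3)[OF x y _ SM M(8), of a "map S d"] comm SMST f(1) Sd unfolding S T by simp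
 have q: "qdim K V (S ` P) (S ` M) = length b" "qdim K V (T ` P) (S ` M) = length c"
  using qdim_image[OF X1(1) M(1) lat_P M(4)] qdim_image[OF Y1(1) M(2) lat_P M(6)] bf_length[OF f(2)] bf_length[OF f(3)] M(3) by auto
 have le: "length e = length d" using arg_cong[OF Te, of length] by simp
 have TM: "S ` M \<subseteq> T ` P" unfolding M(3) by (rule image_mono[OF M(6)])
 show thesis
 proof (rule that[OF M f(1,2,4,3) e Te])
  show "gv x (S ` M) a (map S b) \<otimes> gv y M b d =
   commutator_symbol K V P S T \<otimes> (gv y (S ` M) a (map T c) \<otimes> gv x M' c e)" using g1 g2 g3 by simp
  show "winding K V P S = int (length a) - int (length b)"
   using winding_eq[OF X1(1) SM M(8) image_mono[OF M(4)]] q bf_length[OF f(1)] by simp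
  show "winding K V P T = int (length a) - int (length c)"
   using winding_eq[OF Y1(1) SM M(8) TM] q bf_length[OF f(1)] by simp
  show "winding K V P T = int (length b) - int (length d)"
   using winding_eq[OF Y1(1) M(1,4,5)] bf_length[OF f(2)] bf_length[OF f(4)] by simp
  show "winding K V P S = int (length c) - int (length d)"
   using winding_eq[OF X1(1) M(2,6,7)] bf_length[OF f(3)] bf_length[OF e] le by simp
 qed
qed

end

context kspace
begin

section \<open>Direct sums\<close>

lemma alt_mono: "altf B M n D ==> A \<subseteq> B ==> N \<subseteq> M ==> altf A N n D"
proof -
 assume D: "altf B M n D" and AB: "A \<subseteq> B" and NM: "N \<subseteq> M"
 note d = altD[OF D]
 show "altf A N n D"
 proof (rule altI)
  fix bs assume "length bs = n" "set bs \<subseteq> A"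
  then show "D bs \<in> carrier K" using AB by (intro d(1)) auto
 next
  fix us c v w ws assume "Suc (length us + length ws) = n" "set us \<subseteq> A" "set ws \<subseteq> A" "v \<in> A" "w \<in> A" "c \<in> carrier K"
  then show "D (us @ (w \<oplus>\<^bsub>V\<^esub> c \<odot>\<^bsub>V\<^esub> v) # ws) = D (us @ w # ws) \<oplus> c \<otimes> D (us @ v # ws)"
   using AB by (intro d(2)) auto
 next
  fix us v ys ws assume "Suc (Suc (length us + length ys + length ws)) = n" "set us \<subseteq> A" "set ys \<subseteq> A" "set ws \<subseteq> A" "v \<in> A"
  then show "D (us @ v # ys @ v # ws) = \<zero>" using AB by (intro d(3)) auto
 next
  fix us x ws assume "Suc (length us + length ws) = n" "set us \<subseteq> A" "set ws \<subseteq> A" "x \<in> N"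
  then show "D (us @ x # ws) = \<zero>" using AB NM by (intro d(4)) auto
 qed
qed

lemma alt_fix_prefix:
 assumes D: "altf B M (m + n) D" and as: "length as = m" "set as \<subseteq> B"
 shows "altf B M n (\<lambda>bs. D (as @ bs))"
proof -
 note d = altD[OF D]
 show ?thesis
 proof (rule altI)
  fix bs assume "length bs = n" "set bs \<subseteq> B"
  then show "D (as @ bs) \<in> carrier K" using as by (intro d(1)) auto
 next
  fix us c v w ws assume "Suc (length us + length ws) = n" "set us \<subseteq> B" "set ws \<subseteq> B" "v \<in> B" "w \<in> B" "c \<in> carrier K"
  then show "D (as @ us @ (w \<oplus>\<^bsub>V\<^esub> c \<odot>\<^bsub>V\<^esub> v) # ws) = D (as @ us @ w # ws) \<oplus> c \<otimes> D (as @ us @ v # ws)"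
   using d(2)[of "as @ us" ws v w c] as by simp
 next
  fix us v ys ws assume "Suc (Suc (length us + length ys + length ws)) = n" "set us \<subseteq> B" "set ys \<subseteq> B" "set ws \<subseteq> B" "v \<in> B"
  then show "D (as @ us @ v # ys @ v # ws) = \<zero>" using d(3)[of "as @ us" ys ws v] as by simp
 next
  fix us x ws assume "Suc (length us + length ws) = n" "set us \<subseteq> B" "set ws \<subseteq> B" "x \<in> M"
  then show "D (as @ us @ x # ws) = \<zero>" using d(4)[of "as @ us" ws x] as by simp
 qed
qed

end

locale direct_sum_lattices =
 A: lattice_kspace K V1 P1 + B: lattice_kspace K V2 P2 + W: lattice_kspace K V P +
 I1: lin_inj K V1 V i1 + I2: lin_inj K V2 V i2
 for K :: "'k ring" (structure) and V1 :: "('k, 'v1) module" and P1 and V2 :: "('k, 'v2) module" and P2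
  and V :: "('k, 'v) module" and P and i1 and i2 +
 assumes split: "v \<in> carrier V ==> \<exists>x\<in>carrier V1. \<exists>y\<in>carrier V2. v = i1 x \<oplus>\<^bsub>V\<^esub> i2 y"
  and uniq: "[|x \<in> carrier V1; x' \<in> carrier V1; y \<in> carrier V2; y' \<in> carrier V2;
   i1 x \<oplus>\<^bsub>V\<^esub> i2 y = i1 x' \<oplus>\<^bsub>V\<^esub> i2 y'|] ==> x = x' \<and> y = y'"
  and P_eq: "P = {i1 x \<oplus>\<^bsub>V\<^esub> i2 y |x y. x \<in> P1 \<and> y \<in> P2}"
begin

text \<open>The subspace \<open>A \<oplus> B\<close> of \<open>V\<close>.\<close>

definition ds where "ds A B = {i1 x \<oplus>\<^bsub>V\<^esub> i2 y |x y. x \<in> A \<and> y \<in> B}"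

lemma P_ds: "P = ds P1 P2" by (simp add: ds_def P_eq)

lemma ds_lin:
 assumes "x \<in> carrier V1" "x' \<in> carrier V1" "y \<in> carrier V2" "y' \<in> carrier V2" "c \<in> carrier K"
 shows "(i1 x \<oplus>\<^bsub>V\<^esub> i2 y) \<oplus>\<^bsub>V\<^esub> c \<odot>\<^bsub>V\<^esub> (i1 x' \<oplus>\<^bsub>V\<^esub> i2 y') = i1 (x \<oplus>\<^bsub>V1\<^esub> c \<odot>\<^bsub>V1\<^esub> x') \<oplus>\<^bsub>V\<^esub> i2 (y \<oplus>\<^bsub>V2\<^esub> c \<odot>\<^bsub>V2\<^esub> y')"
 using assms I1.f_closed I2.f_closed
 by (simp add: I1.f_add I2.f_add I1.f_smult I2.f_smult W.smult_r_distr W.M.a_ac)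

lemma ds_mem_iff:
 "[|A \<subseteq> carrier V1; B \<subseteq> carrier V2; x \<in> carrier V1; y \<in> carrier V2|] ==> i1 x \<oplus>\<^bsub>V\<^esub> i2 y \<in> ds A B \<longleftrightarrow> x \<in> A \<and> y \<in> B"
proof
 assume c: "A \<subseteq> carrier V1" "B \<subseteq> carrier V2" "x \<in> carrier V1" "y \<in> carrier V2" and "i1 x \<oplus>\<^bsub>V\<^esub> i2 y \<in> ds A B"
 then obtain x' y' where xy: "x' \<in> A" "y' \<in> B" "i1 x \<oplus>\<^bsub>V\<^esub> i2 y = i1 x' \<oplus>\<^bsub>V\<^esub> i2 y'" unfolding ds_def by blast
 then have "x = x' \<and> y = y'" using c by (intro uniq) auto
 then show "x \<in> A \<and> y \<in> B" using xy by simp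
qed (auto simp: ds_def)

lemma ds_mono: "A \<subseteq> A' ==> B \<subseteq> B' ==> ds A B \<subseteq> ds A' B'"
 unfolding ds_def by blast

lemma ds_Int: "[|A \<subseteq> carrier V1; A' \<subseteq> carrier V1; B \<subseteq> carrier V2; B' \<subseteq> carrier V2|] ==> ds A B \<inter> ds A' B' = ds (A \<inter> A') (B \<inter> B')"
proof
 assume c: "A \<subseteq> carrier V1" "A' \<subseteq> carrier V1" "B \<subseteq> carrier V2" "B' \<subseteq> carrier V2"
 show "ds A B \<inter> ds A' B' \<subseteq> ds (A \<inter> A') (B \<inter> B')"
 proof
  fix v assume v: "v \<in> ds A B \<inter> ds A' B'"
  then obtain x y where xy: "x \<in> A" "y \<in> B" "v = i1 x \<oplus>\<^bsub>V\<^esub> i2 y" by (auto simp: ds_def)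
  then have "x \<in> A' \<and> y \<in> B'" using ds_mem_iff[OF c(2,4), of x y] v c by auto
  then show "v \<in> ds (A \<inter> A') (B \<inter> B')" using xy by (auto simp: ds_def)
 qed
 show "ds (A \<inter> A') (B \<inter> B') \<subseteq> ds A B \<inter> ds A' B'" unfolding ds_def by blast
qed

lemma ds_sub: "A.sub A ==> B.sub B ==> W.sub (ds A B)"
proof -
 assume A: "A.sub A" and B: "B.sub B"
 note a = A.subD[OF A] and b = B.subD[OF B]
 have lin: "v \<oplus>\<^bsub>V\<^esub> c \<odot>\<^bsub>V\<^esub> w \<in> ds A B" if vw: "v \<in> ds A B" "w \<in> ds A B" "c \<in> carrier K" for v w c
 proof -
  obtain x y x' y' where xy: "x \<in> A" "y \<in> B" "v = i1 x \<oplus>\<^bsub>V\<^esub> i2 y" "x' \<in> A" "y' \<in> B" "w = i1 x' \<oplus>\<^bsub>V\<^esub> i2 y'"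
   using vw unfolding ds_def by blast
  have "x \<oplus>\<^bsub>V1\<^esub> c \<odot>\<^bsub>V1\<^esub> x' \<in> A" "y \<oplus>\<^bsub>V2\<^esub> c \<odot>\<^bsub>V2\<^esub> y' \<in> B" using a(3,4) b(3,4) xy vw(3) by auto
  then show ?thesis using ds_lin[of x x' y y' c] xy a(1) b(1) vw(3) unfolding ds_def by auto
 qed
 have sc: "ds A B \<subseteq> carrier V" using a(1) b(1) I1.f_closed I2.f_closed unfolding ds_def by auto
 have z: "\<zero>\<^bsub>V\<^esub> \<in> ds A B" unfolding ds_def using a(2) b(2) I1.f_zero I2.f_zero
  by (intro CollectI exI[of _ "\<zero>\<^bsub>V1\<^esub>"] exI[of _ "\<zero>\<^bsub>V2\<^esub>"]) simp
 show ?thesis unfolding W.sub_iff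
 proof (intro conjI ballI sc z)
  fix v w assume vw: "v \<in> ds A B" "w \<in> ds A B"
  then show "v \<oplus>\<^bsub>V\<^esub> w \<in> ds A B" using lin[OF vw, of \<one>] sc by auto
 next
  fix c v assume cv: "c \<in> carrier K" "v \<in> ds A B"
  then show "c \<odot>\<^bsub>V\<^esub> v \<in> ds A B" using lin[OF z cv(2) cv(1)] sc by auto
 qed
qed

lemma i1_eq: "x \<in> carrier V1 ==> i1 x = i1 x \<oplus>\<^bsub>V\<^esub> i2 \<zero>\<^bsub>V2\<^esub>"
 using I1.f_closed by (simp add: I2.f_zero)

lemma i2_eq: "y \<in> carrier V2 ==> i2 y = i1 \<zero>\<^bsub>V1\<^esub> \<oplus>\<^bsub>V\<^esub> i2 y"
 using I2.f_closed by (simp add: I1.f_zero)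

lemma spn_i2: "A.sub M ==> B.sub N ==> set bs \<subseteq> carrier V2 ==> spn K V (ds M N) (map i2 bs) = ds M (spn K V2 N bs)"
proof (induction bs)
 case (Cons b bs)
 then have b: "b \<in> carrier V2" and IH: "spn K V (ds M N) (map i2 bs) = ds M (spn K V2 N bs)" by auto
 have yc: "y \<in> carrier V2" if "y \<in> spn K V2 N bs" for y using B.subD(1)[OF B.spn_sub that] Cons.prems by auto
 have xc: "x \<in> carrier V1" if "x \<in> M" for x using A.subD(1)[OF Cons.prems(1) that] .
 have e: "(i1 x \<oplus>\<^bsub>V\<^esub> i2 y) \<oplus>\<^bsub>V\<^esub> c \<odot>\<^bsub>V\<^esub> i2 b = i1 x \<oplus>\<^bsub>V\<^esub> i2 (y \<oplus>\<^bsub>V2\<^esub> c \<odot>\<^bsub>V2\<^esub> b)" if "x \<in> M" "y \<in> spn K V2 N bs" "c \<in> carrier K" for x y c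
  using xc[OF that(1)] yc[OF that(2)] that(3) b I1.f_closed I2.f_closed by (simp add: I2.f_add I2.f_smult W.M.a_assoc)
 show ?case
 proof safe
  fix v assume "v \<in> spn K V (ds M N) (map i2 (b # bs))"
  then obtain u c where u: "u \<in> ds M (spn K V2 N bs)" "c \<in> carrier K" "v = u \<oplus>\<^bsub>V\<^esub> c \<odot>\<^bsub>V\<^esub> i2 b"
   by (auto simp: IH)
  then obtain x y where v: "x \<in> M" "y \<in> spn K V2 N bs" "c \<in> carrier K" "v = (i1 x \<oplus>\<^bsub>V\<^esub> i2 y) \<oplus>\<^bsub>V\<^esub> c \<odot>\<^bsub>V\<^esub> i2 b"
   unfolding ds_def by blast
  then have "y \<oplus>\<^bsub>V2\<^esub> c \<odot>\<^bsub>V2\<^esub> b \<in> spn K V2 N (b # bs)" by auto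
  then show "v \<in> ds M (spn K V2 N (b # bs))" unfolding v(4) e[OF v(1-3)] ds_def using v(1) by blast
 next
  fix v assume "v \<in> ds M (spn K V2 N (b # bs))"
  then obtain x y c where v: "x \<in> M" "y \<in> spn K V2 N bs" "c \<in> carrier K" "v = i1 x \<oplus>\<^bsub>V\<^esub> i2 (y \<oplus>\<^bsub>V2\<^esub> c \<odot>\<^bsub>V2\<^esub> b)"
   by (auto simp: ds_def)
  have "i1 x \<oplus>\<^bsub>V\<^esub> i2 y \<in> ds M (spn K V2 N bs)" unfolding ds_def using v by blast
  then have "i1 x \<oplus>\<^bsub>V\<^esub> i2 y \<in> spn K V (ds M N) (map i2 bs)" by (simp only: IH)
  then show "v \<in> spn K V (ds M N) (map i2 (b # bs))" unfolding v(4) e[OF v(1-3), symmetric] using v(3) by auto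
 qed
qed simp

lemma spn_i1: "A.sub M ==> B.sub N ==> set as \<subseteq> carrier V1 ==> spn K V (ds M N) (map i1 as) = ds (spn K V1 M as) N"
proof (induction as)
 case (Cons b bs)
 then have b: "b \<in> carrier V1" and IH: "spn K V (ds M N) (map i1 bs) = ds (spn K V1 M bs) N" by auto
 have yc: "y \<in> carrier V1" if "y \<in> spn K V1 M bs" for y using A.subD(1)[OF A.spn_sub that] Cons.prems by auto
 have xc: "x \<in> carrier V2" if "x \<in> N" for x using B.subD(1)[OF Cons.prems(2) that] .
 have e: "(i1 y \<oplus>\<^bsub>V\<^esub> i2 x) \<oplus>\<^bsub>V\<^esub> c \<odot>\<^bsub>V\<^esub> i1 b = i1 (y \<oplus>\<^bsub>V1\<^esub> c \<odot>\<^bsub>V1\<^esub> b) \<oplus>\<^bsub>V\<^esub> i2 x" if "x \<in> N" "y \<in> spn K V1 M bs" "c \<in> carrier K" for x y c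
  using xc[OF that(1)] yc[OF that(2)] that(3) b I1.f_closed I2.f_closed by (simp add: I1.f_add I1.f_smult W.M.a_ac)
 show ?case
 proof safe
  fix v assume "v \<in> spn K V (ds M N) (map i1 (b # bs))"
  then obtain u c where u: "u \<in> ds (spn K V1 M bs) N" "c \<in> carrier K" "v = u \<oplus>\<^bsub>V\<^esub> c \<odot>\<^bsub>V\<^esub> i1 b"
   by (auto simp: IH)
  then obtain x y where v: "x \<in> N" "y \<in> spn K V1 M bs" "c \<in> carrier K" "v = (i1 y \<oplus>\<^bsub>V\<^esub> i2 x) \<oplus>\<^bsub>V\<^esub> c \<odot>\<^bsub>V\<^esub> i1 b"
   unfolding ds_def by blast
  then have "y \<oplus>\<^bsub>V1\<^esub> c \<odot>\<^bsub>V1\<^esub> b \<in> spn K V1 M (b # bs)" by auto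
  then show "v \<in> ds (spn K V1 M (b # bs)) N" unfolding v(4) e[OF v(1-3)] ds_def using v(1) by blast
 next
  fix v assume "v \<in> ds (spn K V1 M (b # bs)) N"
  then obtain x y c where v: "x \<in> N" "y \<in> spn K V1 M bs" "c \<in> carrier K" "v = i1 (y \<oplus>\<^bsub>V1\<^esub> c \<odot>\<^bsub>V1\<^esub> b) \<oplus>\<^bsub>V\<^esub> i2 x"
   by (auto simp: ds_def)
  have "i1 y \<oplus>\<^bsub>V\<^esub> i2 x \<in> ds (spn K V1 M bs) N" unfolding ds_def using v by blast
  then have "i1 y \<oplus>\<^bsub>V\<^esub> i2 x \<in> spn K V (ds M N) (map i1 bs)" by (simp only: IH)
  then show "v \<in> spn K V (ds M N) (map i1 (b # bs))" unfolding v(4) e[OF v(1-3), symmetric] using v(3) by auto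
 qed
qed simp

lemma indep_i2: "A.sub M ==> B.sub N ==> set bs \<subseteq> carrier V2 ==> indep_mod K V2 N bs ==> indep_mod K V (ds M N) (map i2 bs)"
proof (induction bs)
 case (Cons b bs)
 have b: "b \<in> carrier V2" and s: "set bs \<subseteq> carrier V2" using Cons.prems by auto
 have c: "spn K V2 N bs \<subseteq> carrier V2" "M \<subseteq> carrier V1" using B.subD(1)[OF B.spn_sub[OF Cons.prems(2) s]] A.subD(1)[OF Cons.prems(1)] by auto
 have "i2 b \<notin> ds M (spn K V2 N bs)" using ds_mem_iff[OF c(2,1), of "\<zero>\<^bsub>V1\<^esub>" b] i2_eq[OF b] b Cons.prems(4) by auto
 then show ?case using Cons spn_i2[OF Cons.prems(1,2) s] by simp
qed simp

lemma indep_i1: "A.sub M ==> B.sub N ==> set bs \<subseteq> carrier V1 ==> indep_mod K V1 M bs ==> indep_mod K V (ds M N) (map i1 bs)"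
proof (induction bs)
 case (Cons b bs)
 have b: "b \<in> carrier V1" and s: "set bs \<subseteq> carrier V1" using Cons.prems by auto
 have c: "spn K V1 M bs \<subseteq> carrier V1" "N \<subseteq> carrier V2" using A.subD(1)[OF A.spn_sub[OF Cons.prems(1) s]] B.subD(1)[OF Cons.prems(2)] by auto
 have "i1 b \<notin> ds (spn K V1 M bs) N" using ds_mem_iff[OF c(1,2), of b "\<zero>\<^bsub>V2\<^esub>"] i1_eq[OF b] b Cons.prems(4) by auto
 then show ?case using Cons spn_i1[OF Cons.prems(1,2) s] by simp
qed simp

lemma basis_ds:
 assumes M: "A.sub M" and N: "B.sub N" and as: "basis_mod K V1 A M as" and bs: "basis_mod K V2 B N bs"
 shows "basis_mod K V (ds A B) (ds M N) (map i1 as @ map i2 bs)"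
proof -
 have a: "set as \<subseteq> carrier V1" "indep_mod K V1 M as" "spn K V1 M as = A"
  and b: "set bs \<subseteq> carrier V2" "indep_mod K V2 N bs" "spn K V2 N bs = B" using as bs by (auto simp: basis_mod_def)
 have sB: "B.sub B" using B.mbasisD(3)[OF N bs] .
 have "basis_mod K V (ds M B) (ds M N) (map i2 bs)"
  using spn_i2[OF M N b(1)] indep_i2[OF M N b(1,2)] b I2.f_closed by (auto simp: basis_mod_def)
 moreover have "basis_mod K V (ds A B) (ds M B) (map i1 as)"
  using spn_i1[OF M sB a(1)] indep_i1[OF M sB a(1,2)] a I1.f_closed by (auto simp: basis_mod_def)
 ultimately show ?thesis using W.mbasis_append[OF ds_sub[OF M N]] by blast
qed

lemma fgen_ds: "A.sub M ==> B.sub N ==> A.fgen A M ==> B.fgen B N ==> W.fgen (ds A B) (ds M N)"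
 using A.sub_fgen_basis B.sub_fgen_basis basis_ds W.mbasisD(5)[OF ds_sub] by blast

lemma qdim_ds: "A.sub M ==> B.sub N ==> A.fgen A M ==> B.fgen B N ==>
  qdim K V (ds A B) (ds M N) = qdim K V1 A M + qdim K V2 B N"
proof -
 assume a: "A.sub M" "B.sub N" "A.fgen A M" "B.fgen B N"
 obtain as bs where "basis_mod K V1 A M as" "basis_mod K V2 B N bs" using A.sub_fgen_basis B.sub_fgen_basis a by blast
 then show ?thesis using W.qdim_eq_length[OF ds_sub basis_ds, OF a(1,2) a(1,2)] A.qdim_eq_length[OF a(1)] B.qdim_eq_length[OF a(2)] by simp
qed

lemma lat_ds: "A.lat A ==> B.lat B ==> W.lat (ds A B)"
proof -
 assume A: "A.lat A" and B: "B.lat B"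
 have c: "A \<subseteq> carrier V1" "P1 \<subseteq> carrier V1" "B \<subseteq> carrier V2" "P2 \<subseteq> carrier V2"
  using A.carrier_lat B.carrier_lat A B A.lat_P B.lat_P by auto
 have i: "ds A B \<inter> P = ds (A \<inter> P1) (B \<inter> P2)" unfolding P_ds by (rule ds_Int[OF c])
 have l: "A.lat (A \<inter> P1)" "B.lat (B \<inter> P2)" using A.lat_Int A.lat_P B.lat_Int B.lat_P A B by auto
 have "W.fgen (ds A B) (ds (A \<inter> P1) (B \<inter> P2))" "W.fgen P (ds (A \<inter> P1) (B \<inter> P2))"
  unfolding P_ds using A.lat_fgen[OF l(1)] B.lat_fgen[OF l(2)] A B A.lat_P B.lat_P A.lat_sub[OF l(1)] B.lat_sub[OF l(2)]
  by (auto intro!: fgen_ds)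
 then show ?thesis unfolding W.lat_def W.commensurable_iff[OF ds_sub[OF A.lat_sub[OF A] B.lat_sub[OF B]] W.P] i
  using ds_sub[OF A.lat_sub[OF A] B.lat_sub[OF B]] by simp
qed

lemma frames_ds:
 assumes "A.lat M" "A.lat A" "M \<subseteq> A" "B.lat N" "B.lat B" "N \<subseteq> B" "as \<in> A.fr A M" "bs \<in> B.fr B N"
 shows "map i1 as @ map i2 bs \<in> W.fr (ds A B) (ds M N)"
proof -
 have "i1 x \<in> ds A B" if "x \<in> A" for x
  using i1_eq[of x] that A.carrier_lat[OF assms(2)] B.subD(2)[OF B.lat_sub[OF assms(5)]] unfolding ds_def by blast
 moreover have "i2 y \<in> ds A B" if "y \<in> B" for y
  using i2_eq[of y] that B.carrier_lat[OF assms(5)] A.subD(2)[OF A.lat_sub[OF assms(2)]] unfolding ds_def by blast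
 ultimately show ?thesis
  using assms qdim_ds[OF A.lat_sub[OF assms(1)] B.lat_sub[OF assms(4)] A.lat_fgen[OF assms(1-3)] B.lat_fgen[OF assms(4-6)]]
  by (auto simp: frames_def)
qed

text \<open>As in \<open>vol_flag\<close>, both sides are alternating of top degree in either block.\<close>

lemma vol_ds_exists:
 assumes l: "A.lat M" "A.lat A" "M \<subseteq> A" "B.lat N" "B.lat B" "N \<subseteq> B"
 shows "\<exists>t. t \<in> carrier K \<and> t \<noteq> \<zero> \<and> (\<forall>as\<in>A.fr A M. \<forall>bs\<in>B.fr B N.
  vol K V (ds A B) (ds M N) (map i1 as @ map i2 bs) = t \<otimes> (vol K V1 A M as \<otimes> vol K V2 B N bs))"
proof -
 note sM = A.lat_sub[OF l(1)] and sN = B.lat_sub[OF l(4)] and sA = A.lat_sub[OF l(2)] and sB = B.lat_sub[OF l(5)]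
 note gA = A.lat_fgen[OF l(1-3)] and gB = B.lat_fgen[OF l(4-6)]
 have lD: "W.lat (ds M N)" "W.lat (ds A B)" "ds M N \<subseteq> ds A B" using lat_ds l ds_mono by auto
 obtain as0 where as0: "basis_mod K V1 A M as0" "vol K V1 A M as0 = \<one>" using A.vol_spec(2)[OF sM gA] by auto
 obtain bs0 where bs0: "basis_mod K V2 B N bs0" "vol K V2 B N bs0 = \<one>" using B.vol_spec(2)[OF sN gB] by auto
 note qa = A.qdim_eq_length[OF sM as0(1)] and qb = B.qdim_eq_length[OF sN bs0(1)]
 define D where "D = vol K V (ds A B) (ds M N)"
 have D: "W.altf (ds A B) (ds M N) (length as0 + length bs0) D"
  using W.vol_spec(1)[OF W.lat_sub[OF lD(1)] W.lat_fgen[OF lD]] qdim_ds[OF sM sN gA gB] qa qb by (simp add: D_def)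
 have j1: "i1 ` Y \<subseteq> ds Y Z" if "Y \<subseteq> carrier V1" "\<zero>\<^bsub>V2\<^esub> \<in> Z" for Y Z
  using i1_eq that unfolding ds_def by blast
 have j2: "i2 ` Z \<subseteq> ds Y Z" if "Z \<subseteq> carrier V2" "\<zero>\<^bsub>V1\<^esub> \<in> Y" for Y Z
  using i2_eq that unfolding ds_def by blast
 note cM = A.carrier_lat[OF l(1)] and cA = A.carrier_lat[OF l(2)] and cN = B.carrier_lat[OF l(4)] and cB = B.carrier_lat[OF l(5)]
 note zs = A.subD(2)[OF sM] A.subD(2)[OF sA] B.subD(2)[OF sN] B.subD(2)[OF sB]
 have f1: "A.altf A M (length as0) (\<lambda>as. D (map i1 as @ map i2 bs))" if bs: "length bs = length bs0" "set bs \<subseteq> B" for bs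
 proof -
  have "set (map i2 bs) \<subseteq> ds A B" using j2[OF cB zs(2)] bs by auto
  from W.alt_suffix[OF D order_refl _ this] have "W.altf (ds A B) (ds M N) (length as0) (\<lambda>ms. D (ms @ map i2 bs))" using bs by simp
  from W.alt_mono[OF this j1[OF cA zs(4)] j1[OF cM zs(3)]] show ?thesis by (rule I1.f_alt[OF sA cM])
 qed
 have as0A: "set as0 \<subseteq> A" using A.mbasisD(1)[OF sM as0(1)] .
 have f2: "B.altf B N (length bs0) (\<lambda>bs. D (map i1 as0 @ map i2 bs))"
 proof -
  have "set (map i1 as0) \<subseteq> ds A B" using j1[OF cA zs(4)] as0A by auto
  from W.alt_fix_prefix[OF D _ this] have "W.altf (ds A B) (ds M N) (length bs0) (\<lambda>bs. D (map i1 as0 @ bs))" by simp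
  from W.alt_mono[OF this j2[OF cB zs(2)] j2[OF cN zs(1)]] show ?thesis by (rule I2.f_alt[OF sB cN])
 qed
 define t where "t = D (map i1 as0 @ map i2 bs0)"
 have bs0B: "set bs0 \<subseteq> B" using B.mbasisD(1)[OF sN bs0(1)] .
 have tc: "t \<in> carrier K" unfolding t_def using B.altD(1)[OF f2 _ bs0B] by simp
 have "t \<noteq> \<zero>" unfolding t_def D_def by (rule W.vol_basis_nonzero[OF W.lat_sub[OF lD(1)] basis_ds[OF sM sN as0(1) bs0(1)]])
 moreover have "D (map i1 as @ map i2 bs) = t \<otimes> (vol K V1 A M as \<otimes> vol K V2 B N bs)"
  if as: "as \<in> A.fr A M" and bs: "bs \<in> B.fr B N" for as bs
 proof -
  have la: "length as = length as0" "set as \<subseteq> A" and lb: "length bs = length bs0" "set bs \<subseteq> B" using as bs qa qb by (auto simp: frames_def)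
  have "D (map i1 as @ map i2 bs) = D (map i1 as0 @ map i2 bs) \<otimes> vol K V1 A M as"
   using A.alt_compare[OF sM as0(1) f1[OF lb], of "vol K V1 A M" as] A.vol_spec(1)[OF sM gA] qa as0(2) la by simp
  also have "D (map i1 as0 @ map i2 bs) = t \<otimes> vol K V2 B N bs"
   using B.alt_compare[OF sN bs0(1) f2, of "vol K V2 B N" bs] B.vol_spec(1)[OF sN gB] qb bs0(2) lb by (simp add: t_def)
  finally show ?thesis using tc A.vol_closed[OF sM gA as] B.vol_closed[OF sN gB bs] by (simp add: A.R.m_ac)
 qed
 ultimately show ?thesis using tc unfolding D_def by blast
qed

end

context direct_sum_lattices
begin

text \<open>The factor in \<open>vol_ds_exists\<close>.\<close>

definition tt where "tt A B M N = (SOME t. t \<in> carrier K \<and> t \<noteq> \<zero> \<and> (\<forall>as\<in>A.fr A M. \<forall>bs\<in>B.fr B N.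
  vol K V (ds A B) (ds M N) (map i1 as @ map i2 bs) = t \<otimes> (vol K V1 A M as \<otimes> vol K V2 B N bs)))"

lemma tt:
 assumes l: "A.lat M" "A.lat A" "M \<subseteq> A" "B.lat N" "B.lat B" "N \<subseteq> B"
 shows tt_closed: "tt A B M N \<in> carrier K" and tt_nz: "tt A B M N \<noteq> \<zero>"
  and vol_ds: "!!as bs. as \<in> A.fr A M ==> bs \<in> B.fr B N ==>
   vol K V (ds A B) (ds M N) (map i1 as @ map i2 bs) = tt A B M N \<otimes> (vol K V1 A M as \<otimes> vol K V2 B N bs)"
 using someI_ex[OF vol_ds_exists[OF l], folded tt_def] by auto

text \<open>Compares the flag coefficients of a direct sum with those of the summands. In the sum the blocks
occur in the order \<open>M0/M, N0/N, A/M0, B/N0\<close>, in the summands in the order \<open>M0/M, A/M0, N0/N, B/N0\<close>; exchanging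
the two middle blocks gives the sign.\<close>

lemma tt_th:
 assumes l1: "A.lat M" "A.lat M0" "A.lat A" "M \<subseteq> M0" "M0 \<subseteq> A" and l2: "B.lat N" "B.lat N0" "B.lat B" "N \<subseteq> N0" "N0 \<subseteq> B"
 shows "W.th (ds A B) (ds M0 N0) (ds M N) \<otimes> (tt M0 N0 M N \<otimes> tt A B M0 N0) =
  A.sg (qdim K V2 N0 N * qdim K V1 A M0) \<otimes> (tt A B M N \<otimes> (A.th A M0 M \<otimes> B.th B N0 N))"
proof -
 have MA: "M \<subseteq> A" and NB: "N \<subseteq> B" using l1 l2 by auto
 obtain n1 where n1: "n1 \<in> A.fr M0 M" "A.vl M0 M n1 = \<one>" using A.lat_basis[OF l1(1,2,4)] .
 obtain a1 where a1: "a1 \<in> A.fr A M0" "A.vl A M0 a1 = \<one>" using A.lat_basis[OF l1(2,3,5)] .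
 obtain n2 where n2: "n2 \<in> B.fr N0 N" "B.vl N0 N n2 = \<one>" using B.lat_basis[OF l2(1,2,4)] .
 obtain a2 where a2: "a2 \<in> B.fr B N0" "B.vl B N0 a2 = \<one>" using B.lat_basis[OF l2(2,3,5)] .
 have L: "W.lat (ds M N)" "W.lat (ds M0 N0)" "W.lat (ds A B)" "ds M N \<subseteq> ds M0 N0" "ds M0 N0 \<subseteq> ds A B"
  using lat_ds l1 l2 ds_mono by auto
 have L6: "ds M N \<subseteq> ds A B" using L by blast
 note fn = frames_ds[OF l1(1,2,4) l2(1,2,4) n1(1) n2(1)] and fa = frames_ds[OF l1(2,3,5) l2(2,3,5) a1(1) a2(1)]
 note t1 = tt_closed[OF l1(1,2,4) l2(1,2,4)] and t2 = tt_closed[OF l1(2,3,5) l2(2,3,5)] and t3 = tt_closed[OF l1(1,3) MA l2(1,3) NB]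
 note h1 = A.th_closed[OF l1] and h2 = B.th_closed[OF l2] and h = W.th_closed[OF L]
 have 1: "vol K V (ds A B) (ds M N) ((map i1 n1 @ map i2 n2) @ (map i1 a1 @ map i2 a2)) =
   W.th (ds A B) (ds M0 N0) (ds M N) \<otimes> (tt M0 N0 M N \<otimes> tt A B M0 N0)"
  unfolding W.vol_th[OF L fn fa] vol_ds[OF l1(1,2,4) l2(1,2,4) n1(1) n2(1)] vol_ds[OF l1(2,3,5) l2(2,3,5) a1(1) a2(1)] n1(2) n2(2) a1(2) a2(2)
  using t1 t2 by simp
 have D: "W.altf (ds A B) (ds M N) (qdim K V (ds A B) (ds M N)) (vol K V (ds A B) (ds M N))"
  by (rule W.vol_spec(1)[OF W.lat_sub[OF L(1)] W.lat_fgen[OF L(1,3) L6]])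
 have len: "length n2 = qdim K V2 N0 N" "length a1 = qdim K V1 A M0" using n2 a1 by (auto simp: frames_def)
 have fr: "(map i1 n1 @ map i2 n2) @ (map i1 a1 @ map i2 a2) \<in> W.fr (ds A B) (ds M N)" by (rule W.frames_append[OF L fn fa])
 then have st: "set (map i1 n1) \<subseteq> ds A B" "set (map i2 n2) \<subseteq> ds A B" "set (map i1 a1) \<subseteq> ds A B" "set (map i2 a2) \<subseteq> ds A B"
  and ln: "length (map i1 n1) + length (map i1 a1) + length (map i2 n2) + length (map i2 a2) = qdim K V (ds A B) (ds M N)"
  by (auto simp: frames_def)
 have f1: "n1 @ a1 \<in> A.fr A M" by (rule A.frames_append[OF l1 n1(1) a1(1)])
 have f2: "n2 @ a2 \<in> B.fr B N" by (rule B.frames_append[OF l2 n2(1) a2(1)])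
 have e: "map i1 n1 @ map i1 a1 @ map i2 n2 @ map i2 a2 = map i1 (n1 @ a1) @ map i2 (n2 @ a2)" by simp
 have 2: "vol K V (ds A B) (ds M N) (map i1 n1 @ map i2 n2 @ map i1 a1 @ map i2 a2) =
   A.sg (qdim K V2 N0 N * qdim K V1 A M0) \<otimes> (tt A B M N \<otimes> (A.th A M0 M \<otimes> B.th B N0 N))"
  unfolding W.alt_block_swap[OF D W.lat_sub[OF L(3)] ln st(1,3,2,4)] e vol_ds[OF l1(1,3) MA l2(1,3) NB f1 f2]
   A.vol_th[OF l1 n1(1) a1(1)] B.vol_th[OF l2 n2(1) a2(1)] n1(2) n2(2) a1(2) a2(2)
  using h1 h2 len by (simp add: A.sg_nat_pow mult.commute)
 show ?thesis using 1 2 by simp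
qed

text \<open>The product of two line elements. It is defined by its coordinate on one lattice \<open>M0 \<oplus> N0\<close>; on another
lattice of the form \<open>M \<oplus> N\<close> the signs of \<open>tt_th\<close> for source and target enter, which are accounted for by the sign
in the statement.\<close>

lemma line_product:
 assumes l: "A.lat A1" "A.lat B1" "B.lat A2" "B.lat B2" and s1: "\<sigma>1 \<in> A.rl A1 B1" and s2: "\<sigma>2 \<in> B.rl A2 B2"
 shows "\<exists>\<sigma>\<in>W.rl (ds A1 A2) (ds B1 B2). \<forall>M\<in>A.minor A1 B1. \<forall>N\<in>B.minor A2 B2.
  W.kap (ds A1 A2) (ds B1 B2) \<sigma> (ds M N) \<otimes> tt B1 B2 M N =
  A.sg (qdim K V2 A2 N * (qdim K V1 A1 M + qdim K V1 B1 M)) \<otimes> (tt A1 A2 M N \<otimes> (A.kap A1 B1 \<sigma>1 M \<otimes> B.kap A2 B2 \<sigma>2 N))"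
proof -
 define T1 T2 where "T1 = A1 \<inter> B1" and "T2 = A2 \<inter> B2"
 have T: "A.lat T1" "B.lat T2" "T1 \<subseteq> A1" "T1 \<subseteq> B1" "T2 \<subseteq> A2" "T2 \<subseteq> B2"
  using A.lat_Int B.lat_Int l by (auto simp: T1_def T2_def)
 have Tm: "T1 \<in> A.minor A1 B1" "T2 \<in> B.minor A2 B2" using T by (auto simp: A.minor_iff B.minor_iff)
 have L: "W.lat (ds A1 A2)" "W.lat (ds B1 B2)" "W.lat (ds T1 T2)" using lat_ds l T by auto
 have LT: "ds T1 T2 \<in> W.minor (ds A1 A2) (ds B1 B2)" using L T ds_mono by (auto simp: W.minor_iff)
 define k10 k20 where "k10 = A.kap A1 B1 \<sigma>1 T1" and "k20 = B.kap A2 B2 \<sigma>2 T2"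
 have k0: "k10 \<in> carrier K" "k20 \<in> carrier K"
  unfolding k10_def k20_def using A.kap_closed[OF l(1,2) s1 Tm(1)] B.kap_closed[OF l(3,4) s2 Tm(2)] by auto
 define tA0 tB0 where "tA0 = tt A1 A2 T1 T2" and "tB0 = tt B1 B2 T1 T2"
 have t0: "tA0 \<in> carrier K" "tB0 \<in> carrier K" "tB0 \<noteq> \<zero>" unfolding tA0_def tB0_def
  using tt_closed[OF T(1) l(1) T(3) T(2) l(3) T(5)] tt_closed[OF T(1) l(2) T(4) T(2) l(4) T(6)] tt_nz[OF T(1) l(2) T(4) T(2) l(4) T(6)] by auto
 define s0 where "s0 = A.sg (qdim K V2 A2 T2 * (qdim K V1 A1 T1 + qdim K V1 B1 T1))"
 have s0: "s0 \<in> carrier K" by (simp add: s0_def)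
 define c0 where "c0 = s0 \<otimes> (tA0 \<otimes> (k10 \<otimes> k20)) \<otimes> inv tB0"
 have c0: "c0 \<in> carrier K" "c0 \<otimes> tB0 = s0 \<otimes> (tA0 \<otimes> (k10 \<otimes> k20))"
  unfolding c0_def using s0 t0 k0 A.invK[OF t0(2,3)] by (auto simp: A.R.m_assoc)
 obtain \<sigma> where \<sigma>: "\<sigma> \<in> W.rl (ds A1 A2) (ds B1 B2)" "W.kap (ds A1 A2) (ds B1 B2) \<sigma> (ds T1 T2) = c0"
  using W.rl_exists[OF L(1,2) LT c0(1)] by auto
 have "W.kap (ds A1 A2) (ds B1 B2) \<sigma> (ds M N) \<otimes> tt B1 B2 M N =
  A.sg (qdim K V2 A2 N * (qdim K V1 A1 M + qdim K V1 B1 M)) \<otimes> (tt A1 A2 M N \<otimes> (A.kap A1 B1 \<sigma>1 M \<otimes> B.kap A2 B2 \<sigma>2 N))"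
  if M: "M \<in> A.minor A1 B1" and N: "N \<in> B.minor A2 B2" for M N
 proof -
  have m: "A.lat M" "M \<subseteq> A1" "M \<subseteq> B1" "M \<subseteq> T1" using M by (auto simp: A.minor_iff T1_def)
  have n: "B.lat N" "N \<subseteq> A2" "N \<subseteq> B2" "N \<subseteq> T2" using N by (auto simp: B.minor_iff T2_def)
  have LM: "W.lat (ds M N)" "ds M N \<subseteq> ds T1 T2" using lat_ds m n ds_mono by auto
  have LMm: "ds M N \<in> W.minor (ds A1 A2) (ds B1 B2)" using LM m n ds_mono by (auto simp: W.minor_iff)
  have TA: "ds T1 T2 \<subseteq> ds A1 A2" "ds T1 T2 \<subseteq> ds B1 B2" using ds_mono T by auto
  define \<kappa> where "\<kappa> = W.kap (ds A1 A2) (ds B1 B2) \<sigma> (ds M N)"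
  define k1 k2 where "k1 = A.kap A1 B1 \<sigma>1 M" and "k2 = B.kap A2 B2 \<sigma>2 N"
  define tA tB u where "tA = tt A1 A2 M N" and "tB = tt B1 B2 M N" and "u = tt T1 T2 M N"
  define hA hB where "hA = W.th (ds A1 A2) (ds T1 T2) (ds M N)" and "hB = W.th (ds B1 B2) (ds T1 T2) (ds M N)"
  define a1 a2 b1 b2 where "a1 = A.th A1 T1 M" and "a2 = B.th A2 T2 N" and "b1 = A.th B1 T1 M" and "b2 = B.th B2 T2 N"
  define sA sB where "sA = A.sg (qdim K V2 T2 N * qdim K V1 A1 T1)" and "sB = A.sg (qdim K V2 T2 N * qdim K V1 B1 T1)"
  have ck: "\<kappa> \<in> carrier K" "k1 \<in> carrier K" "k2 \<in> carrier K" unfolding \<kappa>_def k1_def k2_def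
   using W.kap_closed[OF L(1,2) \<sigma>(1) LMm] A.kap_closed[OF l(1,2) s1 M] B.kap_closed[OF l(3,4) s2 N] by auto
  have ct: "tA \<in> carrier K" "tB \<in> carrier K" "u \<in> carrier K" unfolding tA_def tB_def u_def
   using tt_closed[OF m(1) l(1) m(2) n(1) l(3) n(2)] tt_closed[OF m(1) l(2) m(3) n(1) l(4) n(3)] tt_closed[OF m(1) T(1) m(4) n(1) T(2) n(4)] by auto
  have ch: "hA \<in> carrier K" "hB \<in> carrier K" unfolding hA_def hB_def
   using W.th_closed[OF LM(1) L(3,1) LM(2) TA(1)] W.th_closed[OF LM(1) L(3,2) LM(2) TA(2)] by auto
  have ca: "a1 \<in> carrier K" "a2 \<in> carrier K" "b1 \<in> carrier K" "b2 \<in> carrier K" "b1 \<noteq> \<zero>" "b2 \<noteq> \<zero>"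
   unfolding a1_def a2_def b1_def b2_def
   using A.th_closed[OF m(1) T(1) l(1) m(4) T(3)] B.th_closed[OF n(1) T(2) l(3) n(4) T(5)]
    A.th_closed[OF m(1) T(1) l(2) m(4) T(4)] B.th_closed[OF n(1) T(2) l(4) n(4) T(6)]
    A.th_nz[OF m(1) T(1) l(2) m(4) T(4)] B.th_nz[OF n(1) T(2) l(4) n(4) T(6)] by auto
  have cs: "sA \<in> carrier K" "sB \<in> carrier K" "sB \<otimes> sB = \<one>" "sB \<noteq> \<zero>" unfolding sA_def sB_def by (auto simp: A.sg_sq A.sg_nonzero)
  have rA: "hA \<otimes> (u \<otimes> tA0) = sA \<otimes> (tA \<otimes> (a1 \<otimes> a2))"
   unfolding hA_def u_def tA0_def sA_def tA_def a1_def a2_def by (rule tt_th[OF m(1) T(1) l(1) m(4) T(3) n(1) T(2) l(3) n(4) T(5)])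
  have rB: "hB \<otimes> (u \<otimes> tB0) = sB \<otimes> (tB \<otimes> (b1 \<otimes> b2))"
   unfolding hB_def u_def tB0_def sB_def tB_def b1_def b2_def by (rule tt_th[OF m(1) T(1) l(2) m(4) T(4) n(1) T(2) l(4) n(4) T(6)])
  have r: "\<kappa> \<otimes> hB = c0 \<otimes> hA" unfolding \<kappa>_def hA_def hB_def using W.kap_cons[OF L(1,2) \<sigma>(1) LT LM] \<sigma>(2) by simp
  have r1: "k1 \<otimes> b1 = k10 \<otimes> a1" unfolding k1_def b1_def k10_def a1_def by (rule A.kap_cons[OF l(1,2) s1 Tm(1) m(1,4)])
  have r2: "k2 \<otimes> b2 = k20 \<otimes> a2" unfolding k2_def b2_def k20_def a2_def by (rule B.kap_cons[OF l(3,4) s2 Tm(2) n(1,4)])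
  have "(\<kappa> \<otimes> tB) \<otimes> (sB \<otimes> (b1 \<otimes> b2)) = \<kappa> \<otimes> (sB \<otimes> (tB \<otimes> (b1 \<otimes> b2)))" using ck(1) ct(2) cs(1,2) ca(1-4) by (simp add: A.R.m_ac)
  also have "\<dots> = (\<kappa> \<otimes> hB) \<otimes> (u \<otimes> tB0)" unfolding rB[symmetric] using ck ch ct t0 by (simp add: A.R.m_assoc)
  also have "\<dots> = hA \<otimes> u \<otimes> (c0 \<otimes> tB0)" unfolding r using c0(1) ch ct t0 by (simp add: A.R.m_ac)
  also have "\<dots> = s0 \<otimes> ((hA \<otimes> (u \<otimes> tA0)) \<otimes> (k10 \<otimes> k20))" unfolding c0(2) using s0 k0 t0(1,2) ch ct by (simp add: A.R.m_ac)
  also have "\<dots> = (s0 \<otimes> sA \<otimes> tA) \<otimes> ((k10 \<otimes> a1) \<otimes> (k20 \<otimes> a2))" unfolding rA using s0 k0 cs(1,2) ct ca(1-4) by (simp add: A.R.m_ac)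
  also have "\<dots> = (s0 \<otimes> sA \<otimes> tA) \<otimes> (k1 \<otimes> k2) \<otimes> \<one> \<otimes> (b1 \<otimes> b2)"
   unfolding r1[symmetric] r2[symmetric] using s0 ck cs(1,2) ct ca(1-4) by (simp add: A.R.m_ac)
  also have "\<dots> = (s0 \<otimes> sA \<otimes> sB \<otimes> (tA \<otimes> (k1 \<otimes> k2))) \<otimes> (sB \<otimes> (b1 \<otimes> b2))"
   unfolding cs(3)[symmetric] using s0 ck cs(1,2) ct ca(1-4) by (simp add: A.R.m_ac)
  finally have "\<kappa> \<otimes> tB = s0 \<otimes> sA \<otimes> sB \<otimes> (tA \<otimes> (k1 \<otimes> k2))"
   using A.mult_cancel[of "\<kappa> \<otimes> tB" "s0 \<otimes> sA \<otimes> sB \<otimes> (tA \<otimes> (k1 \<otimes> k2))" "sB \<otimes> (b1 \<otimes> b2)"]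
    s0 ck cs ct ca A.integral_iff by simp
  moreover have "s0 \<otimes> sA \<otimes> sB = A.sg (qdim K V2 A2 N * (qdim K V1 A1 M + qdim K V1 B1 M))"
   unfolding s0_def sA_def sB_def A.sg_mult
    B.lat_qdim[OF n(1) T(2) l(3) n(4) T(5)] A.lat_qdim[OF m(1) T(1) l(1) m(4) T(3)] A.lat_qdim[OF m(1) T(1) l(2) m(4) T(4)]
   unfolding A.sg_def by (simp add: algebra_simps)
  ultimately show ?thesis unfolding \<kappa>_def tA_def tB_def k1_def k2_def by simp
 qed
 with \<sigma>(1) show ?thesis by blast
qed

lemma bf_ds:
 assumes l: "A.lat M" "A.lat A" "M \<subseteq> A" "B.lat N" "B.lat B" "N \<subseteq> B" and f: "as \<in> A.bf A M" "bs \<in> B.bf B N"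
 shows "map i1 as @ map i2 bs \<in> W.bf (ds A B) (ds M N)"
proof -
 have a: "as \<in> A.fr A M" "bs \<in> B.fr B N" using f by (auto simp: A.bf_def B.bf_def)
 have "vol K V (ds A B) (ds M N) (map i1 as @ map i2 bs) \<noteq> \<zero>"
  using vol_ds[OF l a] tt_closed[OF l] tt_nz[OF l] A.bfD[OF l(1-3) f(1)] B.bfD[OF l(4-6) f(2)] A.integral_iff by auto
 then show ?thesis using frames_ds[OF l a] by (simp add: W.bf_def)
qed

definition is_sum where
 "is_sum S S1 S2 \<longleftrightarrow> (\<forall>x\<in>carrier V1. \<forall>y\<in>carrier V2. S (i1 x \<oplus>\<^bsub>V\<^esub> i2 y) = i1 (S1 x) \<oplus>\<^bsub>V\<^esub> i2 (S2 y))"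

end

context direct_sum_lattices
begin

context
 fixes S S1 S2
 assumes S: "S \<in> W.GL" and S1: "S1 \<in> A.GL" and S2: "S2 \<in> B.GL" and sum: "is_sum S S1 S2"
begin

section \<open>Multiplicativity of the signed symbol\<close>

lemma sum_apply: "x \<in> carrier V1 ==> y \<in> carrier V2 ==> S (i1 x \<oplus>\<^bsub>V\<^esub> i2 y) = i1 (S1 x) \<oplus>\<^bsub>V\<^esub> i2 (S2 y)"
 using sum by (simp add: is_sum_def)

lemma sum_i1: "x \<in> carrier V1 ==> S (i1 x) = i1 (S1 x)"
proof -
 assume x: "x \<in> carrier V1"
 have "S2 \<zero>\<^bsub>V2\<^esub> = \<zero>\<^bsub>V2\<^esub>" by (rule lin_inj.f_zero[OF B.GL_D(4)[OF S2]])
 moreover have "S1 x \<in> carrier V1" by (rule lin_inj.f_closed[OF A.GL_D(4)[OF S1] x])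
 ultimately show ?thesis using sum_apply[OF x, of "\<zero>\<^bsub>V2\<^esub>"] i1_eq[OF x] i1_eq[of "S1 x"] by simp
qed

lemma sum_i2: "y \<in> carrier V2 ==> S (i2 y) = i2 (S2 y)"
proof -
 assume y: "y \<in> carrier V2"
 have "S1 \<zero>\<^bsub>V1\<^esub> = \<zero>\<^bsub>V1\<^esub>" by (rule lin_inj.f_zero[OF A.GL_D(4)[OF S1]])
 moreover have "S2 y \<in> carrier V2" by (rule lin_inj.f_closed[OF B.GL_D(4)[OF S2] y])
 ultimately show ?thesis using sum_apply[of "\<zero>\<^bsub>V1\<^esub>" y] y i2_eq[OF y] i2_eq[of "S2 y"] by simp
qed

lemma sum_image: "Y \<subseteq> carrier V1 ==> Z \<subseteq> carrier V2 ==> S ` ds Y Z = ds (S1 ` Y) (S2 ` Z)"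
proof -
 assume c: "Y \<subseteq> carrier V1" "Z \<subseteq> carrier V2"
 have e: "S (i1 x \<oplus>\<^bsub>V\<^esub> i2 y) = i1 (S1 x) \<oplus>\<^bsub>V\<^esub> i2 (S2 y)" if "x \<in> Y" "y \<in> Z" for x y
  using that c by (intro sum_apply) auto
 show ?thesis
 proof
  show "S ` ds Y Z \<subseteq> ds (S1 ` Y) (S2 ` Z)"
  proof
   fix v assume "v \<in> S ` ds Y Z"
   then obtain x y where xy: "x \<in> Y" "y \<in> Z" "v = S (i1 x \<oplus>\<^bsub>V\<^esub> i2 y)" unfolding ds_def by blast
   show "v \<in> ds (S1 ` Y) (S2 ` Z)" unfolding xy(3) e[OF xy(1,2)] ds_def using xy(1,2) by blast
  qed
  show "ds (S1 ` Y) (S2 ` Z) \<subseteq> S ` ds Y Z"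
  proof
   fix v assume "v \<in> ds (S1 ` Y) (S2 ` Z)"
   then obtain x y where xy: "x \<in> Y" "y \<in> Z" "v = i1 (S1 x) \<oplus>\<^bsub>V\<^esub> i2 (S2 y)" unfolding ds_def by blast
   show "v \<in> S ` ds Y Z" unfolding xy(3) e[OF xy(1,2), symmetric] using xy(1,2) by (intro imageI) (auto simp: ds_def)
  qed
 qed
qed

lemma sum_map: "set xs \<subseteq> carrier V1 ==> set ys \<subseteq> carrier V2 ==>
  map S (map i1 xs @ map i2 ys) = map i1 (map S1 xs) @ map i2 (map S2 ys)"
 using sum_i1 sum_i2 by (auto simp: subset_iff)

lemma sum_P: "S ` P = ds (S1 ` P1) (S2 ` P2)"
 unfolding P_ds by (rule sum_image[OF A.Pc B.Pc])

text \<open>The product of lifts of \<open>S1\<close> and \<open>S2\<close> is a lift of \<open>S\<close>. Its values in concatenated bases are free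
of the auxiliary factors \<open>tt\<close>, and only the sign remains.\<close>

lemma lift_product:
 assumes x: "x \<in> carrier A.G" "snd x = S1" and y: "y \<in> carrier B.G" "snd y = S2"
 shows "\<exists>z. z \<in> carrier W.G \<and> snd z = S \<and>
  (\<forall>M N p1 q1 p2 q2. A.lat M --> M \<subseteq> P1 --> M \<subseteq> S1 ` P1 --> B.lat N --> N \<subseteq> P2 --> N \<subseteq> S2 ` P2 -->
   p1 \<in> A.bf P1 M --> q1 \<in> A.bf (S1 ` P1) M --> p2 \<in> B.bf P2 N --> q2 \<in> B.bf (S2 ` P2) N -->
   W.gv z (ds M N) (map i1 p1 @ map i2 p2) (map i1 q1 @ map i2 q2) =
    A.sg (length p2 * (length p1 + length q1)) \<otimes> (A.gv x M p1 q1 \<otimes> B.gv y N p2 q2))"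
proof -
 note X1 = A.G_D[OF x(1), unfolded x(2)] and Y1 = B.G_D[OF y(1), unfolded y(2)]
 obtain \<sigma> where \<sigma>: "\<sigma> \<in> W.rl (ds P1 P2) (ds (S1 ` P1) (S2 ` P2))"
  and k: "!!M N. M \<in> A.minor P1 (S1 ` P1) ==> N \<in> B.minor P2 (S2 ` P2) ==>
   W.kap (ds P1 P2) (ds (S1 ` P1) (S2 ` P2)) \<sigma> (ds M N) \<otimes> tt (S1 ` P1) (S2 ` P2) M N =
   A.sg (qdim K V2 P2 N * (qdim K V1 P1 M + qdim K V1 (S1 ` P1) M)) \<otimes>
    (tt P1 P2 M N \<otimes> (A.kap P1 (S1 ` P1) (fst x) M \<otimes> B.kap P2 (S2 ` P2) (fst y) N))"
  using line_product[OF A.lat_P X1(4) B.lat_P Y1(4) X1(2) Y1(2)] by blast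
 have im: "S ` P = ds (S1 ` P1) (S2 ` P2)" by (rule sum_P)
 have \<sigma>': "\<sigma> \<in> W.rl P (S ` P)" using \<sigma> unfolding im P_ds[symmetric] .
 have v: "W.val P (S ` P) \<sigma> (ds M N) (map i1 p1 @ map i2 p2) (map i1 q1 @ map i2 q2) =
    A.sg (length p2 * (length p1 + length q1)) \<otimes> (A.gv x M p1 q1 \<otimes> B.gv y N p2 q2)"
  if m: "A.lat M" "M \<subseteq> P1" "M \<subseteq> S1 ` P1" "B.lat N" "N \<subseteq> P2" "N \<subseteq> S2 ` P2"
   and f: "p1 \<in> A.bf P1 M" "q1 \<in> A.bf (S1 ` P1) M" "p2 \<in> B.bf P2 N" "q2 \<in> B.bf (S2 ` P2) N" for M N p1 q1 p2 q2
 proof -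
  have Mm: "M \<in> A.minor P1 (S1 ` P1)" "N \<in> B.minor P2 (S2 ` P2)" using m by (auto simp: A.minor_iff B.minor_iff)
  have fr: "p1 \<in> A.fr P1 M" "q1 \<in> A.fr (S1 ` P1) M" "p2 \<in> B.fr P2 N" "q2 \<in> B.fr (S2 ` P2) N"
   using f by (auto simp: A.bf_def B.bf_def)
  have lD: "W.lat (ds M N)" "ds M N \<subseteq> ds P1 P2" "ds M N \<subseteq> ds (S1 ` P1) (S2 ` P2)" using lat_ds m ds_mono by auto
  have lPS: "W.lat (ds P1 P2)" "W.lat (ds (S1 ` P1) (S2 ` P2))" using lat_ds A.lat_P B.lat_P X1(4) Y1(4) by auto
  define \<kappa> where "\<kappa> = W.kap (ds P1 P2) (ds (S1 ` P1) (S2 ` P2)) \<sigma> (ds M N)"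
  define tA tB where "tA = tt P1 P2 M N" and "tB = tt (S1 ` P1) (S2 ` P2) M N"
  define k1 k2 where "k1 = A.kap P1 (S1 ` P1) (fst x) M" and "k2 = B.kap P2 (S2 ` P2) (fst y) N"
  define s where "s = A.sg (length p2 * (length p1 + length q1))"
  define vp1 vq1 vp2 vq2 where "vp1 = A.vl P1 M p1" and "vq1 = A.vl (S1 ` P1) M q1" and "vp2 = B.vl P2 N p2" and "vq2 = B.vl (S2 ` P2) N q2"
  have c: "tA \<in> carrier K" "tA \<noteq> \<zero>" "tB \<in> carrier K" "k1 \<in> carrier K" "k2 \<in> carrier K" "\<kappa> \<in> carrier K" "s \<in> carrier K"
   unfolding tA_def tB_def k1_def k2_def \<kappa>_def s_def
   using tt_closed[OF m(1) A.lat_P m(2) m(4) B.lat_P m(5)] tt_nz[OF m(1) A.lat_P m(2) m(4) B.lat_P m(5)]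
    tt_closed[OF m(1) X1(4) m(3) m(4) Y1(4) m(6)] A.kap_closed[OF A.lat_P X1(4) X1(2) Mm(1)] B.kap_closed[OF B.lat_P Y1(4) Y1(2) Mm(2)]
    W.kap_closed[OF lPS \<sigma>] lD by (auto simp: W.minor_iff)
  have cv: "vp1 \<in> carrier K" "vp1 \<noteq> \<zero>" "vq1 \<in> carrier K" "vp2 \<in> carrier K" "vp2 \<noteq> \<zero>" "vq2 \<in> carrier K"
   unfolding vp1_def vq1_def vp2_def vq2_def
   using A.bfD[OF m(1) A.lat_P m(2) f(1)] A.bfD[OF m(1) X1(4) m(3) f(2)] B.bfD[OF m(4) B.lat_P m(5) f(3)] B.bfD[OF m(4) Y1(4) m(6) f(4)] by auto
  note i = A.invK[OF c(1,2)] A.invK[OF cv(1,2)] A.invK[OF cv(4,5)]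
  have ic: "inv tA \<in> carrier K" "inv vp1 \<in> carrier K" "inv vp2 \<in> carrier K" "tA \<otimes> inv tA = \<one>" using i by auto
  have kk: "\<kappa> \<otimes> tB = s \<otimes> (tA \<otimes> (k1 \<otimes> k2))"
   unfolding \<kappa>_def tB_def s_def tA_def k1_def k2_def using k[OF Mm] f
   by (simp add: A.bf_length B.bf_length)
  have "W.val P (S ` P) \<sigma> (ds M N) (map i1 p1 @ map i2 p2) (map i1 q1 @ map i2 q2) =
    \<kappa> \<otimes> (tB \<otimes> (vq1 \<otimes> vq2)) \<otimes> inv (tA \<otimes> (vp1 \<otimes> vp2))"
   unfolding W.val_def im unfolding P_ds vol_ds[OF m(1) A.lat_P m(2) m(4) B.lat_P m(5) fr(1,3)] vol_ds[OF m(1) X1(4) m(3) m(4) Y1(4) m(6) fr(2,4)]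
   by (simp add: \<kappa>_def tA_def tB_def vp1_def vp2_def vq1_def vq2_def)
  also have "inv (tA \<otimes> (vp1 \<otimes> vp2)) = inv tA \<otimes> (inv vp1 \<otimes> inv vp2)"
   using A.inv_mult_K[of tA "vp1 \<otimes> vp2"] A.inv_mult_K[of vp1 vp2] c cv A.integral_iff by simp
  also have "\<kappa> \<otimes> (tB \<otimes> (vq1 \<otimes> vq2)) \<otimes> (inv tA \<otimes> (inv vp1 \<otimes> inv vp2)) =
   (\<kappa> \<otimes> tB) \<otimes> ((vq1 \<otimes> vq2) \<otimes> (inv tA \<otimes> (inv vp1 \<otimes> inv vp2)))"
   using c cv ic by (simp add: A.R.m_assoc)
  also have "\<dots> = s \<otimes> ((k1 \<otimes> vq1 \<otimes> inv vp1) \<otimes> (k2 \<otimes> vq2 \<otimes> inv vp2)) \<otimes> (tA \<otimes> inv tA)"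
   unfolding kk using c(1,3-7) cv(1,3,4,6) ic(1-3) by (simp add: A.R.m_ac)
  also have "\<dots> = s \<otimes> ((k1 \<otimes> vq1 \<otimes> inv vp1) \<otimes> (k2 \<otimes> vq2 \<otimes> inv vp2))"
   unfolding ic(4) using c cv ic by simp
  finally show ?thesis unfolding A.gv_def B.gv_def A.val_def B.val_def x(2) y(2) s_def k1_def k2_def vp1_def vq1_def vp2_def vq2_def .
 qed
 define M N where "M = P1 \<inter> S1 ` P1" and "N = P2 \<inter> S2 ` P2"
 have m: "A.lat M" "M \<subseteq> P1" "M \<subseteq> S1 ` P1" "B.lat N" "N \<subseteq> P2" "N \<subseteq> S2 ` P2"
  using A.lat_Int A.lat_P X1(4) B.lat_Int B.lat_P Y1(4) by (auto simp: M_def N_def)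
 obtain p1 where p1: "p1 \<in> A.bf P1 M" using A.bf_exists[OF m(1) A.lat_P m(2)] by (rule exE)
 obtain q1 where q1: "q1 \<in> A.bf (S1 ` P1) M" using A.bf_exists[OF m(1) X1(4) m(3)] by (rule exE)
 obtain p2 where p2: "p2 \<in> B.bf P2 N" using B.bf_exists[OF m(4) B.lat_P m(5)] by (rule exE)
 obtain q2 where q2: "q2 \<in> B.bf (S2 ` P2) N" using B.bf_exists[OF m(4) Y1(4) m(6)] by (rule exE)
 have nz: "W.val P (S ` P) \<sigma> (ds M N) (map i1 p1 @ map i2 p2) (map i1 q1 @ map i2 q2) \<noteq> \<zero>"
  unfolding v[OF m p1 q1 p2 q2]
  using A.gv_nonzero[OF x(1) m(1,2) _ p1, of q1] B.gv_nonzero[OF y(1) m(4,5) _ p2, of q2] q1 q2 m x(2) y(2)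
   A.sg_nonzero A.integral_iff by simp
 have lD: "ds M N \<in> W.minor P (S ` P)"
  unfolding W.minor_iff im
  using lat_ds[OF m(1,4)] ds_mono[OF m(2,5)] ds_mono[OF m(3,6)] unfolding P_ds[symmetric] by simp
 have fp: "map i1 p1 @ map i2 p2 \<in> W.bf P (ds M N)" unfolding P_ds by (rule bf_ds[OF m(1) A.lat_P m(2) m(4) B.lat_P m(5) p1 p2])
 have fq: "map i1 q1 @ map i2 q2 \<in> W.bf (S ` P) (ds M N)" unfolding im by (rule bf_ds[OF m(1) X1(4) m(3,4) Y1(4) m(6) q1 q2])
 have "\<sigma> \<noteq> line_zero K V P P (S ` P)"
  using W.val_zero_iff[OF W.lat_P W.GL_lat(1)[OF S] \<sigma>' lD fp fq] nz by blast
 then have z: "(\<sigma>, S) \<in> carrier W.G" using S \<sigma>' by (simp add: W.G_iff)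
 have gz: "W.gv (\<sigma>, S) = W.val P (S ` P) \<sigma>" by (intro ext) (simp add: W.gv_def)
 show ?thesis
  by (intro exI[of _ "(\<sigma>, S)"] conjI allI impI z) (simp, unfold gz, rule v)
qed

end

text \<open>Apply \<open>comm_frames\<close> in both summands and concatenate the bases. The lattice obtained in this way is small
enough for \<open>comm_ratio\<close> in the sum, and the four signs from \<open>lift_product\<close> combine to the cross term of the
winding numbers.\<close>

theorem signed_symbol_direct_sum:
 assumes S: "S \<in> W.GL" "S1 \<in> A.GL" "S2 \<in> B.GL" "is_sum S S1 S2"
  and T: "T \<in> W.GL" "T1 \<in> A.GL" "T2 \<in> B.GL" "is_sum T T1 T2"
  and comm: "compose (carrier V) S T = compose (carrier V) T S"
  and comm1: "compose (carrier V1) S1 T1 = compose (carrier V1) T1 S1"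
  and comm2: "compose (carrier V2) S2 T2 = compose (carrier V2) T2 S2"
 shows "signed_symbol K V P S T = signed_symbol K V1 P1 S1 T1 \<otimes> signed_symbol K V2 P2 S2 T2"
proof -
 obtain x1 where x1: "x1 \<in> carrier A.G" "snd x1 = S1" using A.G_lift[OF S(2)] by auto
 obtain x2 where x2: "x2 \<in> carrier B.G" "snd x2 = S2" using B.G_lift[OF S(3)] by auto
 obtain y1 where y1: "y1 \<in> carrier A.G" "snd y1 = T1" using A.G_lift[OF T(2)] by auto
 obtain y2 where y2: "y2 \<in> carrier B.G" "snd y2 = T2" using B.G_lift[OF T(3)] by auto
 obtain x where x: "x \<in> carrier W.G" "snd x = S"
  and gx: "\<forall>M N p1 q1 p2 q2. A.lat M --> M \<subseteq> P1 --> M \<subseteq> S1 ` P1 --> B.lat N --> N \<subseteq> P2 --> N \<subseteq> S2 ` P2 -->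
   p1 \<in> A.bf P1 M --> q1 \<in> A.bf (S1 ` P1) M --> p2 \<in> B.bf P2 N --> q2 \<in> B.bf (S2 ` P2) N -->
   W.gv x (ds M N) (map i1 p1 @ map i2 p2) (map i1 q1 @ map i2 q2) =
    A.sg (length p2 * (length p1 + length q1)) \<otimes> (A.gv x1 M p1 q1 \<otimes> B.gv x2 N p2 q2)"
  using lift_product[OF S x1 x2] by (elim exE conjE)
 obtain y where y: "y \<in> carrier W.G" "snd y = T"
  and gy: "\<forall>M N p1 q1 p2 q2. A.lat M --> M \<subseteq> P1 --> M \<subseteq> T1 ` P1 --> B.lat N --> N \<subseteq> P2 --> N \<subseteq> T2 ` P2 -->
   p1 \<in> A.bf P1 M --> q1 \<in> A.bf (T1 ` P1) M --> p2 \<in> B.bf P2 N --> q2 \<in> B.bf (T2 ` P2) N -->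
   W.gv y (ds M N) (map i1 p1 @ map i2 p2) (map i1 q1 @ map i2 q2) =
    A.sg (length p2 * (length p1 + length q1)) \<otimes> (A.gv y1 M p1 q1 \<otimes> B.gv y2 N p2 q2)"
  using lift_product[OF T y1 y2] by (elim exE conjE)
 obtain M M' a1 b1 c1 d1 e1 where M: "A.lat M" "A.lat M'" "S1 ` M = T1 ` M'" "M \<subseteq> P1" "M \<subseteq> T1 ` P1" "M' \<subseteq> P1" "M' \<subseteq> S1 ` P1" "S1 ` M \<subseteq> P1"
  and f1: "a1 \<in> A.bf P1 (S1 ` M)" "b1 \<in> A.bf P1 M" "d1 \<in> A.bf (T1 ` P1) M" "c1 \<in> A.bf P1 M'" "e1 \<in> A.bf (S1 ` P1) M'" "map T1 e1 = map S1 d1"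
  and r1: "A.gv x1 (S1 ` M) a1 (map S1 b1) \<otimes> A.gv y1 M b1 d1 =
   commutator_symbol K V1 P1 S1 T1 \<otimes> (A.gv y1 (S1 ` M) a1 (map T1 c1) \<otimes> A.gv x1 M' c1 e1)"
  and w1: "winding K V1 P1 S1 = int (length a1) - int (length b1)" "winding K V1 P1 T1 = int (length a1) - int (length c1)"
  "winding K V1 P1 T1 = int (length b1) - int (length d1)" "winding K V1 P1 S1 = int (length c1) - int (length d1)"
  by (rule A.comm_frames[OF x1(1) y1(1) x1(2) y1(2) comm1])
 obtain N N' a2 b2 c2 d2 e2 where N: "B.lat N" "B.lat N'" "S2 ` N = T2 ` N'" "N \<subseteq> P2" "N \<subseteq> T2 ` P2" "N' \<subseteq> P2" "N' \<subseteq> S2 ` P2" "S2 ` N \<subseteq> P2"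
  and f2: "a2 \<in> B.bf P2 (S2 ` N)" "b2 \<in> B.bf P2 N" "d2 \<in> B.bf (T2 ` P2) N" "c2 \<in> B.bf P2 N'" "e2 \<in> B.bf (S2 ` P2) N'" "map T2 e2 = map S2 d2"
  and r2: "B.gv x2 (S2 ` N) a2 (map S2 b2) \<otimes> B.gv y2 N b2 d2 =
   commutator_symbol K V2 P2 S2 T2 \<otimes> (B.gv y2 (S2 ` N) a2 (map T2 c2) \<otimes> B.gv x2 N' c2 e2)"
  and w2: "winding K V2 P2 S2 = int (length a2) - int (length b2)" "winding K V2 P2 T2 = int (length a2) - int (length c2)"
  "winding K V2 P2 T2 = int (length b2) - int (length d2)" "winding K V2 P2 S2 = int (length c2) - int (length d2)"
  by (rule B.comm_frames[OF x2(1) y2(1) x2(2) y2(2) comm2])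
 define \<sigma>1 \<sigma>2 where "\<sigma>1 = commutator_symbol K V1 P1 S1 T1" and "\<sigma>2 = commutator_symbol K V2 P2 S2 T2"
 have \<sigma>: "\<sigma>1 \<in> carrier K" "\<sigma>1 \<noteq> \<zero>" "\<sigma>2 \<in> carrier K" "\<sigma>2 \<noteq> \<zero>"
  unfolding \<sigma>1_def \<sigma>2_def
  using A.comm_symbol(1,2)[OF x1(1) y1(1)] B.comm_symbol(1,2)[OF x2(1) y2(1)] x1(2) y1(2) x2(2) y2(2) comm1 comm2 by auto
 note XA = A.G_D[OF x1(1), unfolded x1(2)] and YA = A.G_D[OF y1(1), unfolded y1(2)]
  and XB = B.G_D[OF x2(1), unfolded x2(2)] and YB = B.G_D[OF y2(1), unfolded y2(2)]
 let ?L = "ds (S1 ` M) (S2 ` N)"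
 have SM: "A.lat (S1 ` M)" "B.lat (S2 ` N)" using A.lat_image[OF S(2) M(1)] B.lat_image[OF S(3) N(1)] by auto
 have sub1: "S1 ` M \<subseteq> S1 ` P1" "S2 ` N \<subseteq> S2 ` P2" "S1 ` M \<subseteq> T1 ` P1" "S2 ` N \<subseteq> T2 ` P2"
  "S1 ` M \<subseteq> S1 ` T1 ` P1" "S2 ` N \<subseteq> S2 ` T2 ` P2"
  using image_mono[OF M(4), of S1] image_mono[OF N(4), of S2] image_mono[OF M(6), of T1] image_mono[OF N(6), of T2]
   image_mono[OF M(5), of S1] image_mono[OF N(5), of S2] M(3) N(3) by simp_all
 note cM = A.carrier_lat[OF M(1)] A.carrier_lat[OF M(2)] and cN = B.carrier_lat[OF N(1)] B.carrier_lat[OF N(2)]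
 have imS: "S ` ds M N = ?L" by (rule sum_image[OF S cM(1) cN(1)])
 have imT: "T ` ds M' N' = ?L" unfolding M(3) N(3) by (rule sum_image[OF T cM(2) cN(2)])
 have SP: "S ` P = ds (S1 ` P1) (S2 ` P2)" and TP: "T ` P = ds (T1 ` P1) (T2 ` P2)" using sum_P[OF S] sum_P[OF T] by auto
 have STP: "S ` T ` P = ds (S1 ` T1 ` P1) (S2 ` T2 ` P2)"
  unfolding TP by (rule sum_image[OF S A.carrier_lat[OF YA(4)] B.carrier_lat[OF YB(4)]])
 have Sb: "map S1 b1 \<in> A.bf (S1 ` P1) (S1 ` M)" "map S2 b2 \<in> B.bf (S2 ` P2) (S2 ` N)"
  using A.bf_image[OF S(2) M(1) A.lat_P M(4) f1(2)] B.bf_image[OF S(3) N(1) B.lat_P N(4) f2(2)] by auto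
 have Tc: "map T1 c1 \<in> A.bf (T1 ` P1) (S1 ` M)" "map T2 c2 \<in> B.bf (T2 ` P2) (S2 ` N)"
  unfolding M(3) N(3) using A.bf_image[OF T(2) M(2) A.lat_P M(6) f1(4)] B.bf_image[OF T(3) N(2) B.lat_P N(6) f2(4)] by auto
 have Sd: "map S1 d1 \<in> A.bf (S1 ` T1 ` P1) (S1 ` M)" "map S2 d2 \<in> B.bf (S2 ` T2 ` P2) (S2 ` N)"
  using A.bf_image[OF S(2) M(1) YA(4) M(5) f1(3)] B.bf_image[OF S(3) N(1) YB(4) N(5) f2(3)] by auto
 define a b c d e where "a = map i1 a1 @ map i2 a2" and "b = map i1 b1 @ map i2 b2" and "c = map i1 c1 @ map i2 c2"
  and "d = map i1 d1 @ map i2 d2" and "e = map i1 e1 @ map i2 e2"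
 have mS: "map S b = map i1 (map S1 b1) @ map i2 (map S2 b2)" "map S d = map i1 (map S1 d1) @ map i2 (map S2 d2)"
  unfolding b_def d_def using A.bf_set[OF A.lat_P f1(2)] B.bf_set[OF B.lat_P f2(2)] A.bf_set[OF YA(4) f1(3)] B.bf_set[OF YB(4) f2(3)]
  by (auto simp only: sum_map[OF S])
 have mT: "map T c = map i1 (map T1 c1) @ map i2 (map T2 c2)" "map T e = map i1 (map T1 e1) @ map i2 (map T2 e2)"
  unfolding c_def e_def using A.bf_set[OF A.lat_P f1(4)] B.bf_set[OF B.lat_P f2(4)] A.bf_set[OF XA(4) f1(5)] B.bf_set[OF XB(4) f2(5)]
  by (auto simp only: sum_map[OF T])
 have Te: "map T e = map S d" unfolding mT mS f1(6) f2(6) ..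
 have F6: "map S d \<in> W.bf (S ` T ` P) (?L)"
  unfolding mS(2) STP
  by (rule bf_ds[OF SM(1) A.lat_image[OF S(2) YA(4)] sub1(5) SM(2) B.lat_image[OF S(3) YB(4)] sub1(6) Sd])
 have F5: "a \<in> W.bf P (?L)" "b \<in> W.bf P (ds M N)" "c \<in> W.bf P (ds M' N')"
  "d \<in> W.bf (T ` P) (ds M N)" "e \<in> W.bf (S ` P) (ds M' N')"
  unfolding a_def b_def c_def e_def SP TP d_def unfolding P_ds
  by (rule bf_ds A.lat_P B.lat_P M N SM f1 f2 XA(4) XB(4) YA(4) YB(4))+
 note F = F5 F6
 have L: "W.lat (ds M N)" "W.lat (ds M' N')" "W.lat (?L)" using lat_ds M N SM by auto
 have LP8: "?L \<subseteq> S ` T ` P" unfolding STP by (rule ds_mono[OF sub1(5,6)])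
 have LP7: "ds M N \<subseteq> P" "ds M N \<subseteq> T ` P" "ds M' N' \<subseteq> P" "ds M' N' \<subseteq> S ` P" "?L \<subseteq> P"
   "?L \<subseteq> S ` P" "?L \<subseteq> T ` P"
  unfolding SP TP unfolding P_ds by (rule ds_mono M N sub1)+
 note LP = LP7 LP8
 have g1: "W.gv (x \<otimes>\<^bsub>W.G\<^esub> y) (?L) a (map S d) = W.gv x (?L) a (map S b) \<otimes> W.gv y (ds M N) b d"
  using W.gv_mult(1)[OF x(1) y(1) L(1) LP(1), of a b d] LP F unfolding x(2) y(2) imS by simp
 have g2: "W.gv (y \<otimes>\<^bsub>W.G\<^esub> x) (?L) a (map S d) = W.gv y (?L) a (map T c) \<otimes> W.gv x (ds M' N') c e"
  using W.gv_mult(1)[OF y(1) x(1) L(2) LP(3), of a c e] LP F unfolding x(2) y(2) imT Te by simp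
 define X0 X1 Y0 Y1 Z0 Z1 W0 W1 where "X0 = A.gv x1 (S1 ` M) a1 (map S1 b1)" and "X1 = B.gv x2 (S2 ` N) a2 (map S2 b2)"
  and "Y0 = A.gv y1 M b1 d1" and "Y1 = B.gv y2 N b2 d2" and "Z0 = A.gv y1 (S1 ` M) a1 (map T1 c1)" and "Z1 = B.gv y2 (S2 ` N) a2 (map T2 c2)"
  and "W0 = A.gv x1 M' c1 e1" and "W1 = B.gv x2 N' c2 e2"
 have le: "length e1 = length d1" "length e2 = length d2"
  using arg_cong[OF f1(6), of length] arg_cong[OF f2(6), of length] by simp_all
 define na1 nb1 nc1 nd1 na2 nb2 nc2 nd2 where n: "na1 = length a1" "nb1 = length b1" "nc1 = length c1" "nd1 = length d1"
  "na2 = length a2" "nb2 = length b2" "nc2 = length c2" "nd2 = length d2"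
 have hX: "W.gv x (?L) a (map S b) = A.sg (na2 * (na1 + nb1)) \<otimes> (X0 \<otimes> X1)"
  using gx[rule_format, OF SM(1) M(8) sub1(1) SM(2) N(8) sub1(2) f1(1) Sb(1) f2(1) Sb(2)]
  unfolding mS(1) a_def X0_def X1_def n by simp
 have hY: "W.gv y (ds M N) b d = A.sg (nb2 * (nb1 + nd1)) \<otimes> (Y0 \<otimes> Y1)"
  using gy[rule_format, OF M(1,4,5) N(1,4,5) f1(2,3) f2(2,3)]
  unfolding b_def d_def Y0_def Y1_def n by simp
 have hZ: "W.gv y (?L) a (map T c) = A.sg (na2 * (na1 + nc1)) \<otimes> (Z0 \<otimes> Z1)"
  using gy[rule_format, OF SM(1) M(8) sub1(3) SM(2) N(8) sub1(4) f1(1) Tc(1) f2(1) Tc(2)]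
  unfolding mT(1) a_def Z0_def Z1_def n by simp
 have hW: "W.gv x (ds M' N') c e = A.sg (nc2 * (nc1 + nd1)) \<otimes> (W0 \<otimes> W1)"
  using gx[rule_format, OF M(2,6,7) N(2,6,7) f1(4,5) f2(4,5)]
  unfolding c_def e_def W0_def W1_def n le by simp
 have cl: "X0 \<in> carrier K" "X1 \<in> carrier K" "Y0 \<in> carrier K" "Y1 \<in> carrier K"
  "Z0 \<in> carrier K" "Z1 \<in> carrier K" "W0 \<in> carrier K" "W1 \<in> carrier K"
  unfolding X0_def X1_def Y0_def Y1_def Z0_def Z1_def W0_def W1_def
  using A.gv_nonzero[OF x1(1) SM(1) M(8) _ f1(1), of "map S1 b1"] B.gv_nonzero[OF x2(1) SM(2) N(8) _ f2(1), of "map S2 b2"]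
   A.gv_nonzero[OF y1(1) M(1,4) _ f1(2), of d1] B.gv_nonzero[OF y2(1) N(1,4) _ f2(2), of d2]
   A.gv_nonzero[OF y1(1) SM(1) M(8) _ f1(1), of "map T1 c1"] B.gv_nonzero[OF y2(1) SM(2) N(8) _ f2(1), of "map T2 c2"]
   A.gv_nonzero[OF x1(1) M(2,6) _ f1(4), of e1] B.gv_nonzero[OF x2(1) N(2,6) _ f2(4), of e2]
   sub1 Sb Tc M(5,7) N(5,7) f1(3,5) f2(3,5) by (simp_all only: x1(2) x2(2) y1(2) y2(2) simp_thms)
 define s where "s = A.sg (na2 * (na1 + nb1)) \<otimes> A.sg (nb2 * (nb1 + nd1)) \<otimes> A.sg (na2 * (na1 + nc1)) \<otimes> A.sg (nc2 * (nc1 + nd1))"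
 define s1 s2 s3 s4 where s_: "s1 = A.sg (na2 * (na1 + nb1))" "s2 = A.sg (nb2 * (nb1 + nd1))" "s3 = A.sg (na2 * (na1 + nc1))" "s4 = A.sg (nc2 * (nc1 + nd1))"
 have sc: "s1 \<in> carrier K" "s2 \<in> carrier K" "s3 \<in> carrier K" "s4 \<in> carrier K" "s3 \<otimes> s3 = \<one>" "s4 \<otimes> s4 = \<one>" by (simp_all add: s_ A.sg_sq)
 have s: "s = s1 \<otimes> s2 \<otimes> s3 \<otimes> s4" by (simp only: s_def s_)
 have snz: "s \<in> carrier K" "s \<noteq> \<zero>" unfolding s_def using A.sg_nonzero A.integral_iff by simp_all
 have r: "X0 \<otimes> Y0 = \<sigma>1 \<otimes> (Z0 \<otimes> W0)" "X1 \<otimes> Y1 = \<sigma>2 \<otimes> (Z1 \<otimes> W1)"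
  using r1 r2 by (simp_all only: X0_def X1_def Y0_def Y1_def Z0_def Z1_def W0_def W1_def \<sigma>1_def \<sigma>2_def)
 have "(s1 \<otimes> (X0 \<otimes> X1)) \<otimes> (s2 \<otimes> (Y0 \<otimes> Y1)) = s1 \<otimes> s2 \<otimes> ((X0 \<otimes> Y0) \<otimes> (X1 \<otimes> Y1))"
  using cl sc(1-4) by (simp add: A.R.m_ac)
 \<comment> \<open>the squares of \<open>s3\<close> and \<open>s4\<close> are \<open>1\<close>; they supply the signs of the other product\<close>
 also have "\<dots> = s1 \<otimes> s2 \<otimes> ((\<sigma>1 \<otimes> (Z0 \<otimes> W0)) \<otimes> (\<sigma>2 \<otimes> (Z1 \<otimes> W1))) \<otimes> (s3 \<otimes> s3) \<otimes> (s4 \<otimes> s4)"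
  unfolding r sc(5,6) using cl sc(1-4) \<sigma>(1,3) by simp
 also have "\<dots> = (s1 \<otimes> s2 \<otimes> s3 \<otimes> s4 \<otimes> (\<sigma>1 \<otimes> \<sigma>2)) \<otimes> ((s3 \<otimes> (Z0 \<otimes> Z1)) \<otimes> (s4 \<otimes> (W0 \<otimes> W1)))"
  using cl sc(1-4) \<sigma>(1,3) by (simp add: A.R.m_ac)
 finally have ratio: "(s1 \<otimes> (X0 \<otimes> X1)) \<otimes> (s2 \<otimes> (Y0 \<otimes> Y1)) =
  (s \<otimes> (\<sigma>1 \<otimes> \<sigma>2)) \<otimes> ((s3 \<otimes> (Z0 \<otimes> Z1)) \<otimes> (s4 \<otimes> (W0 \<otimes> W1)))" unfolding s .
 have gg: "W.gv (x \<otimes>\<^bsub>W.G\<^esub> y) (?L) a (map S d) =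
   (s \<otimes> (\<sigma>1 \<otimes> \<sigma>2)) \<otimes> W.gv (y \<otimes>\<^bsub>W.G\<^esub> x) (?L) a (map S d)"
  unfolding g1 g2 hX hY hZ hW s_[symmetric] by (rule ratio)
 have co: "commutator_symbol K V P S T = s \<otimes> (\<sigma>1 \<otimes> \<sigma>2)"
 proof -
  have "commutator_symbol K V P (snd x) (snd y) = s \<otimes> (\<sigma>1 \<otimes> \<sigma>2)"
  proof (rule W.comm_ratio[OF x(1) y(1) _ L(3) LP(5) _ F(1) _ _ _ gg])
   show "s \<otimes> (\<sigma>1 \<otimes> \<sigma>2) \<noteq> \<zero>" using snz \<sigma> A.integral_iff by simp
  qed (use comm LP(8) F(6) snz \<sigma> in \<open>simp_all add: x(2) y(2)\<close>)
  then show ?thesis by (simp add: x(2) y(2))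
 qed
 have lSb: "length b = qdim K V (S ` P) (?L)"
  using W.qdim_image[OF S(1) L(1) W.lat_P LP(1)] W.bf_length[OF F(2)] unfolding imS by simp
 have lTc: "length c = qdim K V (T ` P) (?L)"
  using W.qdim_image[OF T(1) L(2) W.lat_P LP(3)] W.bf_length[OF F(3)] unfolding imT by simp
 have la: "length a = qdim K V P (?L)" by (rule W.bf_length[OF F(1)])
 have w: "winding K V P S = int (na1 + na2) - int (nb1 + nb2)" "winding K V P T = int (na1 + na2) - int (nc1 + nc2)"
  using W.winding_eq[OF S(1) L(3) LP(5,6)] W.winding_eq[OF T(1) L(3) LP(5,7)] lSb lTc la
  unfolding a_def b_def c_def n by simp_all
 have w': "winding K V1 P1 S1 = int na1 - int nb1" "winding K V1 P1 T1 = int na1 - int nc1"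
  "winding K V2 P2 S2 = int na2 - int nb2" "winding K V2 P2 T2 = int na2 - int nc2"
  using w1(1,2) w2(1,2) by (simp_all add: n)
 have "na1 + nd1 = nb1 + nc1" "na2 + nd2 = nb2 + nc2" using w1 w2 unfolding n by linarith+
 then have "even (na1 + nd1) = even (nb1 + nc1)" "even (na2 + nd2) = even (nb2 + nc2)" by simp_all
 then have par: "even nd1 = (even na1 = (even nb1 = even nc1))" unfolding even_add by blast
 \<comment> \<open>signs as functions of parities, so that the comparison of exponents becomes propositional\<close>
 define pm where "pm b = (if b then \<one> else \<ominus> \<one>)" for b :: bool
 have pm: "pm a \<otimes> pm b = pm (a = b)" "pm a \<in> carrier K" for a b by (auto simp: pm_def A.R.l_minus)
 have pms: "A.sg n = pm (even n)" "(\<ominus> \<one>) [^] (k :: int) = pm (even k)" for n k by (simp_all add: pm_def A.sg_def A.sg_int_pow)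
 have ev: "even (int m - int n) = (even m = even n)" for m n :: nat by (simp add: even_diff)
 define u where "u k = pm (even k)" for k :: int
 have "u (winding K V P S * winding K V P T) \<otimes> s = u (winding K V1 P1 S1 * winding K V1 P1 T1) \<otimes> u (winding K V2 P2 S2 * winding K V2 P2 T2)"
  unfolding s_def pms u_def pm w w' even_mult_iff ev even_add par
  by (rule arg_cong[where f = pm]) blast
 moreover have "u k \<in> carrier K" for k by (simp add: u_def pm)
 ultimately show ?thesis
  unfolding signed_symbol_def co pms(2) \<sigma>1_def[symmetric] \<sigma>2_def[symmetric] u_def[symmetric]
  using snz(1) \<sigma>(1,3) by (metis (no_types, lifting) A.R.m_assoc A.R.m_closed A.R.m_lcomm)
qed

end

section \<open>The local fields as vector spaces\<close>

subsection \<open>Total rings of fractions\<close>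

text \<open>Operations defined through all representatives are well defined if the result is constant.\<close>

lemma the_elem_const:
 assumes "Q a s b t" "!!a s b t. Q a s b t ==> g a s b t = x"
 shows "the_elem {g a s b t |a s b t. Q a s b t} = x"
proof -
 have "{g a s b t |a s b t. Q a s b t} = {x}" using assms by blast
 then show ?thesis by simp
qed

context
 fixes R :: "'a ring" (structure)
 assumes R: "cring R"
begin

abbreviation Reg where "Reg \<equiv> regular_elems R"
abbreviation frac where "frac \<equiv> fraction R"

interpretation cring R by (rule R)

lemma regular_closed: "s \<in> Reg ==> s \<in> carrier R" by (simp add: regular_elems_def)

lemma regular_one: "\<one> \<in> Reg" by (simp add: regular_elems_def)

lemma regularD: "s \<in> Reg ==> a \<in> carrier R ==> a \<otimes> s = \<zero> ==> a = \<zero>"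
 by (simp add: regular_elems_def)

lemma regular_mult: "s \<in> Reg ==> t \<in> Reg ==> s \<otimes> t \<in> Reg"
proof -
 assume s: "s \<in> Reg" and t: "t \<in> Reg"
 note c = regular_closed[OF s] regular_closed[OF t]
 have "a = \<zero>" if a: "a \<in> carrier R" "a \<otimes> (s \<otimes> t) = \<zero>" for a
  by (rule regularD[OF s a(1)], rule regularD[OF t]) (use a c in \<open>simp_all add: m_assoc\<close>)
 then show ?thesis unfolding regular_elems_def using c by simp
qed

lemma regular_cancel: "s \<in> Reg ==> a \<in> carrier R ==> b \<in> carrier R ==> a \<otimes> s = b \<otimes> s ==> a = b"
proof -
 assume s: "s \<in> Reg" and a: "a \<in> carrier R" "b \<in> carrier R" and e: "a \<otimes> s = b \<otimes> s"
 have sc: "s \<in> carrier R" by (rule regular_closed[OF s])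
 have "(a \<ominus> b) \<otimes> s = \<zero>" using a sc e by (simp add: a_minus_def l_distr l_minus r_neg)
 then have "a \<ominus> b = \<zero>" by (rule regularD[OF s minus_closed[OF a]])
 then show ?thesis using a by simp
qed

text \<open>Transitivity of the cross-multiplication relation uses that denominators may be cancelled.\<close>

lemma fraction_eq_iff:
 assumes a: "a \<in> carrier R" "s \<in> Reg" and b: "b \<in> carrier R" "t \<in> Reg"
 shows "frac a s = frac b t \<longleftrightarrow> a \<otimes> t = b \<otimes> s"
proof
 assume "frac a s = frac b t"
 moreover have "(b, t) \<in> frac b t" using b by (simp add: fraction_def)
 ultimately have "(b, t) \<in> frac a s" by simp
 then show "a \<otimes> t = b \<otimes> s" by (simp add: fraction_def)
next
 have trans: "a \<otimes> u = c \<otimes> s" if h: "a \<otimes> t = b \<otimes> s" "b \<otimes> u = c \<otimes> t" "a \<in> carrier R" "b \<in> carrier R" "c \<in> carrier R"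
  "s \<in> Reg" "t \<in> Reg" "u \<in> Reg" for a b c s t u
 proof -
  note r = h(3-5) h(6-8)[THEN regular_closed]
  have "(a \<otimes> u) \<otimes> t = (a \<otimes> t) \<otimes> u" using r by (simp add: m_ac)
  also have "\<dots> = (b \<otimes> u) \<otimes> s" unfolding h(1) using r by (simp add: m_ac)
  also have "\<dots> = (c \<otimes> s) \<otimes> t" unfolding h(2) using r by (simp add: m_ac)
  finally show ?thesis using r by - (rule regular_cancel[OF h(7)], auto)
 qed
 assume e: "a \<otimes> t = b \<otimes> s"
 show "frac a s = frac b t"
 proof (rule Set.set_eqI)
  fix p :: "'a \<times> 'a"
  obtain c u where p: "p = (c, u)" by (cases p)
  have "a \<otimes> u = c \<otimes> s \<longleftrightarrow> b \<otimes> u = c \<otimes> t" if "c \<in> carrier R" "u \<in> Reg"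
   using trans[OF e[symmetric] _ b(1) a(1) that(1) b(2) a(2) that(2)] trans[OF e _ a(1) b(1) that(1) a(2) b(2) that(2)] by (rule iffI)
  then show "p \<in> frac a s \<longleftrightarrow> p \<in> frac b t" unfolding p fraction_def by (simp cong: conj_cong)
 qed
qed

lemma frac_mult:
 assumes a: "a \<in> carrier R" "s \<in> Reg" and b: "b \<in> carrier R" "t \<in> Reg"
 shows "frac a s \<otimes>\<^bsub>Frac R\<^esub> frac b t = frac (a \<otimes> b) (s \<otimes> t)"
proof -
 note r = a(1) b(1) a(2)[THEN regular_closed] b(2)[THEN regular_closed]
 have eq: "frac (a' \<otimes> b') (s' \<otimes> t') = frac (a \<otimes> b) (s \<otimes> t)"
  if "(a', s') \<in> frac a s" "(b', t') \<in> frac b t" for a' b' s' t'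
 proof -
  have h: "a' \<in> carrier R" "s' \<in> Reg" "a \<otimes> s' = a' \<otimes> s" "b' \<in> carrier R" "t' \<in> Reg" "b \<otimes> t' = b' \<otimes> t"
   using that by (auto simp: fraction_def)
  note r' = h(1,4) h(2)[THEN regular_closed] h(5)[THEN regular_closed]
  have "(a' \<otimes> b') \<otimes> (s \<otimes> t) = (a' \<otimes> s) \<otimes> (b' \<otimes> t)" using r r' by (simp add: m_ac)
  also have "\<dots> = (a \<otimes> b) \<otimes> (s' \<otimes> t')" unfolding h(3)[symmetric] h(6)[symmetric] using r r' by (simp add: m_ac)
  finally show ?thesis using r r' h a b by (subst fraction_eq_iff) (auto intro: regular_mult)
 qed
 have m: "(a, s) \<in> frac a s \<and> (b, t) \<in> frac b t" using a b by (simp add: fraction_def)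
 show ?thesis unfolding Frac_def monoid.simps ring_record_simps
  by (rule the_elem_const[where Q = "\<lambda>a' s' b' t'. (a', s') \<in> frac a s \<and> (b', t') \<in> frac b t", OF m])
   (elim conjE, rule eq)
qed

lemma frac_add:
 assumes a: "a \<in> carrier R" "s \<in> Reg" and b: "b \<in> carrier R" "t \<in> Reg"
 shows "frac a s \<oplus>\<^bsub>Frac R\<^esub> frac b t = frac (a \<otimes> t \<oplus> b \<otimes> s) (s \<otimes> t)"
proof -
 note r = a(1) b(1) a(2)[THEN regular_closed] b(2)[THEN regular_closed]
 have eq: "frac (a' \<otimes> t' \<oplus> b' \<otimes> s') (s' \<otimes> t') = frac (a \<otimes> t \<oplus> b \<otimes> s) (s \<otimes> t)"
  if "(a', s') \<in> frac a s" "(b', t') \<in> frac b t" for a' b' s' t'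
 proof -
  have h: "a' \<in> carrier R" "s' \<in> Reg" "a \<otimes> s' = a' \<otimes> s" "b' \<in> carrier R" "t' \<in> Reg" "b \<otimes> t' = b' \<otimes> t"
   using that by (auto simp: fraction_def)
  note r' = h(1,4) h(2)[THEN regular_closed] h(5)[THEN regular_closed]
  have "(a' \<otimes> t' \<oplus> b' \<otimes> s') \<otimes> (s \<otimes> t) = (a' \<otimes> s) \<otimes> (t' \<otimes> t) \<oplus> (b' \<otimes> t) \<otimes> (s' \<otimes> s)" using r r' by (simp add: m_ac l_distr r_distr)
  also have "\<dots> = (a \<otimes> t \<oplus> b \<otimes> s) \<otimes> (s' \<otimes> t')" unfolding h(3)[symmetric] h(6)[symmetric] using r r' by (simp add: m_ac l_distr r_distr)
  finally show ?thesis using r r' h a b by (subst fraction_eq_iff) (auto intro: regular_mult)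
 qed
 have m: "(a, s) \<in> frac a s \<and> (b, t) \<in> frac b t" using a b by (simp add: fraction_def)
 show ?thesis unfolding Frac_def monoid.simps ring_record_simps
  by (rule the_elem_const[where Q = "\<lambda>a' s' b' t'. (a', s') \<in> frac a s \<and> (b', t') \<in> frac b t", OF m])
   (elim conjE, rule eq)
qed

lemma frac_carrier: "x \<in> carrier (Frac R) \<longleftrightarrow> (\<exists>a s. a \<in> carrier R \<and> s \<in> Reg \<and> x = frac a s)"
 by (auto simp: Frac_def)

lemma fraction_in_Frac: "a \<in> carrier R ==> s \<in> Reg ==> frac a s \<in> carrier (Frac R)"
 by (auto simp: Frac_def)

lemma frac_one: "\<one>\<^bsub>Frac R\<^esub> = frac \<one> \<one>" and frac_zero: "\<zero>\<^bsub>Frac R\<^esub> = frac \<zero> \<one>"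
 by (simp_all add: Frac_def)

lemma Frac_cring: "cring (Frac R)"
proof (rule cringI)
 note [simp] = frac_mult frac_add fraction_in_Frac fraction_eq_iff regular_mult regular_one regular_closed frac_one frac_zero
 show "abelian_group (Frac R)"
 proof (rule abelian_groupI)
  fix x y assume "x \<in> carrier (Frac R)" "y \<in> carrier (Frac R)"
  then obtain a s b t where r: "a \<in> carrier R" "s \<in> Reg" "b \<in> carrier R" "t \<in> Reg"
   and e: "x = frac a s" "y = frac b t" unfolding frac_carrier by (elim exE conjE)
  show "x \<oplus>\<^bsub>Frac R\<^esub> y \<in> carrier (Frac R)" using r by (simp add: e)
  show "x \<oplus>\<^bsub>Frac R\<^esub> y = y \<oplus>\<^bsub>Frac R\<^esub> x" using r by (simp add: e m_ac a_ac l_distr)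
  fix z assume "z \<in> carrier (Frac R)"
  then obtain c u where r': "c \<in> carrier R" "u \<in> Reg" and e': "z = frac c u"
   unfolding frac_carrier by (elim exE conjE)
  show "x \<oplus>\<^bsub>Frac R\<^esub> y \<oplus>\<^bsub>Frac R\<^esub> z = x \<oplus>\<^bsub>Frac R\<^esub> (y \<oplus>\<^bsub>Frac R\<^esub> z)" using r r'
   by (simp add: e e' m_ac a_ac l_distr r_distr)
 next
  fix x assume "x \<in> carrier (Frac R)"
  then obtain a s where r: "a \<in> carrier R" "s \<in> Reg" and e: "x = frac a s"
   unfolding frac_carrier by (elim exE conjE)
  show "\<zero>\<^bsub>Frac R\<^esub> \<oplus>\<^bsub>Frac R\<^esub> x = x" using r by (simp add: e)
  show "\<exists>y\<in>carrier (Frac R). y \<oplus>\<^bsub>Frac R\<^esub> x = \<zero>\<^bsub>Frac R\<^esub>"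
   by (rule bexI[of _ "frac (\<ominus> a) s"]) (use r in \<open>simp_all add: e l_minus l_neg\<close>)
 qed simp
 show "comm_monoid (Frac R)"
 proof (rule comm_monoidI)
  fix x y assume "x \<in> carrier (Frac R)" "y \<in> carrier (Frac R)"
  then obtain a s b t where r: "a \<in> carrier R" "s \<in> Reg" "b \<in> carrier R" "t \<in> Reg"
   and e: "x = frac a s" "y = frac b t" unfolding frac_carrier by (elim exE conjE)
  show "x \<otimes>\<^bsub>Frac R\<^esub> y \<in> carrier (Frac R)" using r by (simp add: e)
  show "x \<otimes>\<^bsub>Frac R\<^esub> y = y \<otimes>\<^bsub>Frac R\<^esub> x" using r by (simp add: e m_ac)
  fix z assume "z \<in> carrier (Frac R)"
  then obtain c u where r': "c \<in> carrier R" "u \<in> Reg" and e': "z = frac c u"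
   unfolding frac_carrier by (elim exE conjE)
  show "x \<otimes>\<^bsub>Frac R\<^esub> y \<otimes>\<^bsub>Frac R\<^esub> z = x \<otimes>\<^bsub>Frac R\<^esub> (y \<otimes>\<^bsub>Frac R\<^esub> z)" using r r'
   by (simp add: e e' m_ac)
 next
  fix x assume "x \<in> carrier (Frac R)"
  then obtain a s where r: "a \<in> carrier R" "s \<in> Reg" and e: "x = frac a s"
   unfolding frac_carrier by (elim exE conjE)
  show "\<one>\<^bsub>Frac R\<^esub> \<otimes>\<^bsub>Frac R\<^esub> x = x" using r by (simp add: e)
 qed simp
 fix x y z assume "x \<in> carrier (Frac R)" "y \<in> carrier (Frac R)" "z \<in> carrier (Frac R)"
 then obtain a s b t c u where r: "a \<in> carrier R" "s \<in> Reg" "b \<in> carrier R" "t \<in> Reg"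
   "c \<in> carrier R" "u \<in> Reg"
  and e: "x = frac a s" "y = frac b t" "z = frac c u" unfolding frac_carrier by (elim exE conjE)
 show "(x \<oplus>\<^bsub>Frac R\<^esub> y) \<otimes>\<^bsub>Frac R\<^esub> z = x \<otimes>\<^bsub>Frac R\<^esub> z \<oplus>\<^bsub>Frac R\<^esub> y \<otimes>\<^bsub>Frac R\<^esub> z"
  using r by (simp add: e m_ac a_ac l_distr r_distr)
qed

lemma fraction_hom: "(\<lambda>a. frac a \<one>) \<in> ring_hom R (Frac R)"
 by (rule ring_hom_memI) (simp_all add: frac_mult frac_add fraction_in_Frac regular_one frac_one)

end

subsection \<open>Completions of local rings\<close>

context
 fixes R :: "'a ring" (structure)
 assumes loc: "local_ring R"
begin

abbreviation Mp where "Mp \<equiv> max_power R"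
abbreviation CR where "CR \<equiv> completion R"

interpretation cring R using loc by (simp add: local_ring_def)

lemma max_ideal_ideal: "ideal (max_ideal R) R"
proof -
 have "\<exists>!m. maximalideal m R" using loc by (simp add: local_ring_def)
 then have "maximalideal (max_ideal R) R" unfolding max_ideal_def by (rule theI')
 then show ?thesis by (rule maximalideal.axioms(1))
qed

lemma max_power_Suc: "Mp (Suc n) = Mp n \<cdot>\<^bsub>R\<^esub> max_ideal R"
 by (simp add: max_power_def ideals_set_def)

lemma max_power_ideal: "ideal (Mp n) R"
proof (induction n)
 case 0
 then show ?case by (simp add: max_power_def ideals_set_def oneideal)
next
 case (Suc n)
 then show ?case unfolding max_power_Suc by (rule ideal_prod_is_ideal[OF _ max_ideal_ideal])
qed

lemma max_power_decreasing: "Mp (Suc n) \<subseteq> Mp n"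
 unfolding max_power_Suc using ideal_prod_inter[OF max_power_ideal max_ideal_ideal] by blast

lemma quot_carrier: "X' \<in> carrier (R Quot Mp n) \<longleftrightarrow> (\<exists>r\<in>carrier R. X' = Mp n +> r)"
 by (auto simp: FactRing_def A_RCOSETS_def')

lemma coset_mono: "Mp (Suc n) +> r \<subseteq> Mp n +> r"
 using max_power_decreasing[of n] by (auto simp: a_r_coset_def')

text \<open>Consecutive components of a compatible sequence have a common representative: one of the smaller
coset.\<close>

lemma completion_carrier:
 "a \<in> carrier (CR) \<longleftrightarrow>
  (\<forall>n. \<exists>r\<in>carrier R. a n = Mp n +> r \<and> a (Suc n) = Mp (Suc n) +> r)"
proof
 assume a: "a \<in> carrier (CR)"
 show "\<forall>n. \<exists>r\<in>carrier R. a n = Mp n +> r \<and> a (Suc n) = Mp (Suc n) +> r"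
 proof
  fix n
  have c: "a n \<in> carrier (R Quot Mp n)" "a (Suc n) \<in> carrier (R Quot Mp (Suc n))" "a (Suc n) \<subseteq> a n"
   using a by (auto simp: completion_def)
  obtain r where r: "r \<in> carrier R" "a (Suc n) = Mp (Suc n) +> r" using c(2) quot_carrier by blast
  obtain s where s: "s \<in> carrier R" "a n = Mp n +> s" using c(1) quot_carrier by blast
  interpret J: ideal "Mp n" R by (rule max_power_ideal)
  interpret J': ideal "Mp (Suc n)" R by (rule max_power_ideal)
  have "r \<in> a n" using J'.a_rcos_self[OF r(1)] r(2) c(3) by auto
  then have "a n = Mp n +> r" unfolding s(2) by (rule J.a_repr_independence'[OF _ s(1)])
  then show "\<exists>r\<in>carrier R. a n = Mp n +> r \<and> a (Suc n) = Mp (Suc n) +> r" using r by blast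
 qed
next
 assume "\<forall>n. \<exists>r\<in>carrier R. a n = Mp n +> r \<and> a (Suc n) = Mp (Suc n) +> r"
 then have "a n \<in> carrier (R Quot Mp n) \<and> a (Suc n) \<subseteq> a n" for n
  using coset_mono quot_carrier by metis
 then show "a \<in> carrier (CR)" by (simp add: completion_def)
qed

lemma completion_ops:
 assumes "r \<in> carrier R" "s \<in> carrier R"
 shows "(Mp n +> r) \<oplus>\<^bsub>R Quot Mp n\<^esub> (Mp n +> s) = Mp n +> (r \<oplus> s)"
  "(Mp n +> r) \<otimes>\<^bsub>R Quot Mp n\<^esub> (Mp n +> s) = Mp n +> (r \<otimes> s)"
proof -
 interpret J: ideal "Mp n" R by (rule max_power_ideal)
 show "(Mp n +> r) \<oplus>\<^bsub>R Quot Mp n\<^esub> (Mp n +> s) = Mp n +> (r \<oplus> s)"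
  using assms by (simp add: FactRing_def J.a_rcos_sum)
 show "(Mp n +> r) \<otimes>\<^bsub>R Quot Mp n\<^esub> (Mp n +> s) = Mp n +> (r \<otimes> s)"
  using assms by (simp add: FactRing_def J.rcoset_mult_add)
qed

lemma to_completion_closed: "r \<in> carrier R ==> to_completion R r \<in> carrier (CR)"
 unfolding completion_carrier to_completion_def by blast

lemma completion_closed:
 assumes a: "a \<in> carrier (CR)" and b: "b \<in> carrier (CR)"
 shows "a \<oplus>\<^bsub>CR\<^esub> b \<in> carrier (CR)" "a \<otimes>\<^bsub>CR\<^esub> b \<in> carrier (CR)"
proof -
 have "\<exists>r\<in>carrier R. \<exists>s\<in>carrier R. a n = Mp n +> r \<and> a (Suc n) = Mp (Suc n) +> r \<and>
   b n = Mp n +> s \<and> b (Suc n) = Mp (Suc n) +> s" for n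
  using a b unfolding completion_carrier by blast
 note rs = this
 have ops: "(a \<oplus>\<^bsub>CR\<^esub> b) n = a n \<oplus>\<^bsub>R Quot Mp n\<^esub> b n"
  "(a \<otimes>\<^bsub>CR\<^esub> b) n = a n \<otimes>\<^bsub>R Quot Mp n\<^esub> b n" for n by (simp_all add: completion_def)
 show "a \<oplus>\<^bsub>CR\<^esub> b \<in> carrier (CR)" unfolding completion_carrier ops
 proof
  fix n
  obtain r s where r: "r \<in> carrier R" "s \<in> carrier R"
   "a n = Mp n +> r" "a (Suc n) = Mp (Suc n) +> r" "b n = Mp n +> s" "b (Suc n) = Mp (Suc n) +> s"
   using rs[of n] by (elim bexE conjE)
  show "\<exists>r\<in>carrier R. a n \<oplus>\<^bsub>R Quot Mp n\<^esub> b n = Mp n +> r \<and>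
    a (Suc n) \<oplus>\<^bsub>R Quot Mp (Suc n)\<^esub> b (Suc n) = Mp (Suc n) +> r"
   by (rule bexI[of _ "r \<oplus> s"]) (use r completion_ops(1)[OF r(1,2)] in simp_all)
 qed
 show "a \<otimes>\<^bsub>CR\<^esub> b \<in> carrier (CR)" unfolding completion_carrier ops
 proof
  fix n
  obtain r s where r: "r \<in> carrier R" "s \<in> carrier R"
   "a n = Mp n +> r" "a (Suc n) = Mp (Suc n) +> r" "b n = Mp n +> s" "b (Suc n) = Mp (Suc n) +> s"
   using rs[of n] by (elim bexE conjE)
  show "\<exists>r\<in>carrier R. a n \<otimes>\<^bsub>R Quot Mp n\<^esub> b n = Mp n +> r \<and>
    a (Suc n) \<otimes>\<^bsub>R Quot Mp (Suc n)\<^esub> b (Suc n) = Mp (Suc n) +> r"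
   by (rule bexI[of _ "r \<otimes> s"]) (use r completion_ops(2)[OF r(1,2)] in simp_all)
 qed
qed

lemma completion_one: "\<one>\<^bsub>CR\<^esub> = to_completion R \<one>"
 by (simp add: completion_def to_completion_def FactRing_def)

lemma completion_zero: "\<zero>\<^bsub>CR\<^esub> = to_completion R \<zero>"
proof -
 have "Mp n +> \<zero> = Mp n" for n
  by (rule a_coset_add_zero[OF additive_subgroup.a_subset[OF ideal.axioms(1)[OF max_power_ideal]]])
 then show ?thesis by (simp add: completion_def to_completion_def FactRing_def)
qed

lemma to_completion_hom: "to_completion R \<in> ring_hom R (CR)"
proof (rule ring_hom_memI)
 fix r s assume r: "r \<in> carrier R" "s \<in> carrier R"
 show "to_completion R (r \<otimes> s) = to_completion R r \<otimes>\<^bsub>CR\<^esub> to_completion R s"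
  "to_completion R (r \<oplus> s) = to_completion R r \<oplus>\<^bsub>CR\<^esub> to_completion R s"
  using completion_ops[OF r] by (simp_all add: to_completion_def completion_def)
qed (simp_all add: to_completion_closed completion_one)

text \<open>All laws hold componentwise in the quotient rings. For negatives, multiply by the image of \<open>-1\<close>,
which is compatible because products of compatible sequences are.\<close>

lemma completion_cring: "cring (CR)"
proof -
 have Q: "cring (R Quot Mp n)" for n by (rule ideal.quotient_is_cring[OF max_power_ideal cring_axioms])
 have c: "a n \<in> carrier (R Quot Mp n)" if "a \<in> carrier (CR)" for a n
  using that by (simp add: completion_def)
 have ops: "(a \<oplus>\<^bsub>CR\<^esub> b) n = a n \<oplus>\<^bsub>R Quot Mp n\<^esub> b n" "(a \<otimes>\<^bsub>CR\<^esub> b) n = a n \<otimes>\<^bsub>R Quot Mp n\<^esub> b n"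
  "\<one>\<^bsub>CR\<^esub> n = \<one>\<^bsub>R Quot Mp n\<^esub>" "\<zero>\<^bsub>CR\<^esub> n = \<zero>\<^bsub>R Quot Mp n\<^esub>" for a b n
  by (simp_all add: completion_def)
 have one: "\<one>\<^bsub>CR\<^esub> \<in> carrier (CR)" and zero: "\<zero>\<^bsub>CR\<^esub> \<in> carrier (CR)"
  unfolding completion_one completion_zero by (simp_all add: to_completion_closed)
 let ?m = "to_completion R (\<ominus> \<one>)"
 have m: "?m \<in> carrier (CR)" by (simp add: to_completion_closed)
 have m1: "?m \<oplus>\<^bsub>CR\<^esub> \<one>\<^bsub>CR\<^esub> = \<zero>\<^bsub>CR\<^esub>"
  unfolding completion_one completion_zero using ring_hom_add[OF to_completion_hom, of "\<ominus> \<one>" \<one>] by (simp add: l_neg)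
 have distr: "(a \<oplus>\<^bsub>CR\<^esub> b) \<otimes>\<^bsub>CR\<^esub> d = a \<otimes>\<^bsub>CR\<^esub> d \<oplus>\<^bsub>CR\<^esub> b \<otimes>\<^bsub>CR\<^esub> d"
  if "a \<in> carrier (CR)" "b \<in> carrier (CR)" "d \<in> carrier (CR)" for a b d
  by (rule ext, unfold ops, rule cring.cring_simprules(13)[OF Q c c c]) (fact that)+
 have lone: "\<one>\<^bsub>CR\<^esub> \<otimes>\<^bsub>CR\<^esub> a = a" if "a \<in> carrier (CR)" for a
  by (rule ext, unfold ops, rule cring.cring_simprules(12)[OF Q c]) (fact that)
 have lzero: "\<zero>\<^bsub>CR\<^esub> \<otimes>\<^bsub>CR\<^esub> a = \<zero>\<^bsub>CR\<^esub>" if "a \<in> carrier (CR)" for a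
  by (rule ext, unfold ops) (rule cring.cring_simprules(26)[OF Q c[OF that]])
 show ?thesis
 proof (rule cringI)
  show "abelian_group (CR)"
  proof (rule abelian_groupI)
   fix a assume a: "a \<in> carrier (CR)"
   show "\<exists>b\<in>carrier (CR). b \<oplus>\<^bsub>CR\<^esub> a = \<zero>\<^bsub>CR\<^esub>"
   proof (rule bexI[OF _ completion_closed(2)[OF m a]])
    have "?m \<otimes>\<^bsub>CR\<^esub> a \<oplus>\<^bsub>CR\<^esub> a = (?m \<oplus>\<^bsub>CR\<^esub> \<one>\<^bsub>CR\<^esub>) \<otimes>\<^bsub>CR\<^esub> a"
     unfolding distr[OF m one a] lone[OF a] ..
    also have "\<dots> = \<zero>\<^bsub>CR\<^esub>" unfolding m1 by (rule lzero[OF a])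
    finally show "?m \<otimes>\<^bsub>CR\<^esub> a \<oplus>\<^bsub>CR\<^esub> a = \<zero>\<^bsub>CR\<^esub>" .
   qed
  next
   fix a b d assume h: "a \<in> carrier (CR)" "b \<in> carrier (CR)" "d \<in> carrier (CR)"
   show "a \<oplus>\<^bsub>CR\<^esub> b \<oplus>\<^bsub>CR\<^esub> d = a \<oplus>\<^bsub>CR\<^esub> (b \<oplus>\<^bsub>CR\<^esub> d)"
    by (rule ext, unfold ops, rule cring.cring_simprules(7)[OF Q c c c]) (fact h)+
  next
   fix a b assume h: "a \<in> carrier (CR)" "b \<in> carrier (CR)"
   show "a \<oplus>\<^bsub>CR\<^esub> b \<in> carrier (CR)" by (rule completion_closed(1)[OF h])
   show "a \<oplus>\<^bsub>CR\<^esub> b = b \<oplus>\<^bsub>CR\<^esub> a"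
    by (rule ext, unfold ops, rule cring.cring_simprules(10)[OF Q c c]) (fact h)+
  next
   fix a assume h: "a \<in> carrier (CR)"
   show "\<zero>\<^bsub>CR\<^esub> \<oplus>\<^bsub>CR\<^esub> a = a"
    by (rule ext, unfold ops, rule cring.cring_simprules(8)[OF Q c]) (fact h)
  qed (rule zero)
  show "comm_monoid (CR)"
  proof (rule comm_monoidI)
   fix a b d assume h: "a \<in> carrier (CR)" "b \<in> carrier (CR)" "d \<in> carrier (CR)"
   show "a \<otimes>\<^bsub>CR\<^esub> b \<otimes>\<^bsub>CR\<^esub> d = a \<otimes>\<^bsub>CR\<^esub> (b \<otimes>\<^bsub>CR\<^esub> d)"
    by (rule ext, unfold ops, rule cring.cring_simprules(11)[OF Q c c c]) (fact h)+
  next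
   fix a b assume h: "a \<in> carrier (CR)" "b \<in> carrier (CR)"
   show "a \<otimes>\<^bsub>CR\<^esub> b \<in> carrier (CR)" by (rule completion_closed(2)[OF h])
   show "a \<otimes>\<^bsub>CR\<^esub> b = b \<otimes>\<^bsub>CR\<^esub> a"
    by (rule ext, unfold ops, rule cring.cring_simprules(14)[OF Q c c]) (fact h)+
  qed (fact one lone)+
 qed (rule distr)
qed

end

subsection \<open>Germs\<close>

context ringed_space_over
begin

lemma open_pts: "openin (spc C) (pts C)" by simp

lemma germ_eqI:
 assumes U: "openin (spc C) U" "s \<in> carrier (sect C U)" and V: "openin (spc C) V" "t \<in> carrier (sect C V)"
  and W: "openin (spc C) W" "x \<in> W" "W \<subseteq> U \<inter> V" "restr C U W s = restr C V W t"
 shows "germ C x U s \<subseteq> germ C x V t"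
proof
 fix p assume "p \<in> germ C x U s"
 then obtain V' t' W' where p: "p = (V', t')" "openin (spc C) V'" "x \<in> V'" "t' \<in> carrier (sect C V')"
  "openin (spc C) W'" "x \<in> W'" "W' \<subseteq> U \<inter> V'" "restr C U W' s = restr C V' W' t'"
  unfolding germ_def by blast
 have o: "openin (spc C) (W \<inter> W')" using W p by blast
 have "restr C V (W \<inter> W') t = restr C W (W \<inter> W') (restr C V W t)"
  using restr_restr[OF V(1) W(1) o, of t] W(3) V(2) by auto
 also have "\<dots> = restr C U (W \<inter> W') s" unfolding W(4)[symmetric] using restr_restr[OF U(1) W(1) o, of s] W(3) U(2) by auto
 also have "\<dots> = restr C W' (W \<inter> W') (restr C U W' s)" using restr_restr[OF U(1) p(5) o, of s] p(7) U(2) by auto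
 also have "\<dots> = restr C V' (W \<inter> W') t'" unfolding p(8) using restr_restr[OF p(2,5) o, of t'] p(4,7) by auto
 finally show "p \<in> germ C x V t" unfolding p(1) germ_def using p o W by (intro CollectI case_prodI conjI exI[of _ "W \<inter> W'"]) auto
qed

lemma germ_eq:
 assumes U: "openin (spc C) U" "s \<in> carrier (sect C U)" and V: "openin (spc C) V" "t \<in> carrier (sect C V)"
  and W: "openin (spc C) W" "x \<in> W" "W \<subseteq> U \<inter> V" "restr C U W s = restr C V W t"
 shows "germ C x U s = germ C x V t"
 using germ_eqI[OF U V W] germ_eqI[OF V U W(1,2)] W(3,4) by auto

text \<open>The ring operations of a stalk are defined through all representatives; a binary operation
 on sections that commutes with restriction induces a well-defined one on germs.\<close>

lemma germ_op:
 assumes x: "x \<in> pts C" and s: "s \<in> carrier (sect C (pts C))" "t \<in> carrier (sect C (pts C))"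
  and opc: "!!U a b. openin (spc C) U ==> a \<in> carrier (sect C U) ==> b \<in> carrier (sect C U) ==> op U a b \<in> carrier (sect C U)"
  and opr: "!!U V a b. openin (spc C) U ==> openin (spc C) V ==> V \<subseteq> U ==> a \<in> carrier (sect C U) ==> b \<in> carrier (sect C U) ==>
   restr C U V (op U a b) = op V (restr C U V a) (restr C U V b)"
 shows "the_elem {germ C x (U \<inter> V) (op (U \<inter> V) (restr C U (U \<inter> V) s') (restr C V (U \<inter> V) t')) |U s' V t'.
   (U, s') \<in> germ C x (pts C) s \<and> (V, t') \<in> germ C x (pts C) t} = germ C x (pts C) (op (pts C) s t)"
proof -
 have mem: "(pts C, a) \<in> germ C x (pts C) a" if "a \<in> carrier (sect C (pts C))" for a
  unfolding germ_def using x that open_pts by (intro CollectI case_prodI conjI exI[of _ "pts C"]) auto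
 have rc: "restr C U V a \<in> carrier (sect C V)" if "openin (spc C) U" "openin (spc C) V" "V \<subseteq> U" "a \<in> carrier (sect C U)" for U V a
  by (rule ring_hom_closed[OF restr_hom[OF that(1-3)] that(4)])
 have eq: "germ C x (U \<inter> V) (op (U \<inter> V) (restr C U (U \<inter> V) s') (restr C V (U \<inter> V) t')) = germ C x (pts C) (op (pts C) s t)"
  if h: "(U, s') \<in> germ C x (pts C) s" "(V, t') \<in> germ C x (pts C) t" for U V s' t'
 proof -
  obtain W1 where 1: "openin (spc C) U" "x \<in> U" "s' \<in> carrier (sect C U)" "openin (spc C) W1" "x \<in> W1" "W1 \<subseteq> pts C \<inter> U"
   "restr C (pts C) W1 s = restr C U W1 s'" using h(1) unfolding germ_def by blast
  obtain W2 where 2: "openin (spc C) V" "x \<in> V" "t' \<in> carrier (sect C V)" "openin (spc C) W2" "x \<in> W2" "W2 \<subseteq> pts C \<inter> V"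
   "restr C (pts C) W2 t = restr C V W2 t'" using h(2) unfolding germ_def by blast
  define W where "W = W1 \<inter> W2"
  have W: "openin (spc C) W" "x \<in> W" "W \<subseteq> U \<inter> V" "W \<subseteq> W1" "W \<subseteq> W2" "W \<subseteq> pts C" unfolding W_def using 1 2 by auto
  have UV: "openin (spc C) (U \<inter> V)" "U \<inter> V \<subseteq> U" "U \<inter> V \<subseteq> V" using 1 2 by auto
  have s1: "restr C U W s' = restr C (pts C) W s"
   using restr_restr[OF 1(1) 1(4) W(1), of s'] restr_restr[OF open_pts 1(4) W(1), of s] 1 W s by auto
  have t1: "restr C V W t' = restr C (pts C) W t"
   using restr_restr[OF 2(1) 2(4) W(1), of t'] restr_restr[OF open_pts 2(4) W(1), of t] 2 W s by auto
  have s2: "restr C (U \<inter> V) W (restr C U (U \<inter> V) s') = restr C U W s'" by (rule restr_restr[OF 1(1) UV(1) W(1,3) UV(2) 1(3)])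
  have t2: "restr C (U \<inter> V) W (restr C V (U \<inter> V) t') = restr C V W t'" by (rule restr_restr[OF 2(1) UV(1) W(1,3) UV(3) 2(3)])
  have c: "restr C U (U \<inter> V) s' \<in> carrier (sect C (U \<inter> V))" "restr C V (U \<inter> V) t' \<in> carrier (sect C (U \<inter> V))"
   using rc[OF 1(1) UV(1,2) 1(3)] rc[OF 2(1) UV(1,3) 2(3)] by auto
  show ?thesis
  proof (rule germ_eq[OF UV(1) opc[OF UV(1) c] open_pts opc[OF open_pts s] W(1,2)])
   show "W \<subseteq> U \<inter> V \<inter> pts C" using W by auto
   show "restr C (U \<inter> V) W (op (U \<inter> V) (restr C U (U \<inter> V) s') (restr C V (U \<inter> V) t')) = restr C (pts C) W (op (pts C) s t)"
    unfolding opr[OF UV(1) W(1,3) c] opr[OF open_pts W(1,6) s] s2 t2 s1 t1 ..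
  qed
 qed
 have "{germ C x (U \<inter> V) (op (U \<inter> V) (restr C U (U \<inter> V) s') (restr C V (U \<inter> V) t')) |U s' V t'.
   (U, s') \<in> germ C x (pts C) s \<and> (V, t') \<in> germ C x (pts C) t} = {germ C x (pts C) (op (pts C) s t)}"
  using eq mem[OF s(1)] mem[OF s(2)] by blast
 then show ?thesis by simp
qed

lemma germ_hom: "x \<in> pts C ==> germ C x (pts C) \<in> ring_hom (sect C (pts C)) (stalk C x)"
proof -
 assume x: "x \<in> pts C"
 have r: "ring (sect C U)" if "openin (spc C) U" for U using sect_cring[OF that] by (rule cring.axioms(1))
 show ?thesis
 proof (rule ring_hom_memI)
  fix s t assume s: "s \<in> carrier (sect C (pts C))" "t \<in> carrier (sect C (pts C))"
  show "germ C x (pts C) (s \<otimes>\<^bsub>sect C (pts C)\<^esub> t) = germ C x (pts C) s \<otimes>\<^bsub>stalk C x\<^esub> germ C x (pts C) t"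
   using germ_op[OF x s, of "\<lambda>U. monoid.mult (sect C U)"] ring.ring_simprules(5)[OF r] ring_hom_mult[OF restr_hom]
   by (simp add: stalk_def)
  show "germ C x (pts C) (s \<oplus>\<^bsub>sect C (pts C)\<^esub> t) = germ C x (pts C) s \<oplus>\<^bsub>stalk C x\<^esub> germ C x (pts C) t"
   using germ_op[OF x s, of "\<lambda>U. add (sect C U)"] ring.ring_simprules(1)[OF r] ring_hom_add[OF restr_hom]
   by (simp add: stalk_def)
 qed (use x in \<open>auto simp: stalk_def\<close>)
qed

lemma str_germ_hom: "x \<in> pts C ==> str_germ C x \<in> ring_hom K (stalk C x)"
 using ring_hom_trans[OF str_hom germ_hom] by (simp add: str_germ_def comp_def ring_hom_def Pi_iff)

end

subsection \<open>Algebras as vector spaces\<close>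

lemma kspace_of_hom:
 fixes K :: "'k ring" and L :: "'l ring"
 assumes K: "field K" and L: "cring L" and h: "h \<in> ring_hom K L"
 shows "kspace K \<lparr>carrier = carrier L, monoid.mult = monoid.mult L, one = one L, ring.zero = ring.zero L, add = add L,
   smult = \<lambda>c f. h c \<otimes>\<^bsub>L\<^esub> f\<rparr>" (is "kspace K ?V")
proof -
 interpret K: field K by (rule K)
 interpret L: cring L by (rule L)
 have "Module.module K ?V"
 proof (rule Module.moduleI[OF K.cring_axioms])
  show "abelian_group ?V"
   by (rule abelian_groupI) (use L.add.l_inv_ex in \<open>simp_all add: L.a_ac\<close>)
 qed (use ring_hom_closed[OF h] ring_hom_add[OF h] ring_hom_mult[OF h] ring_hom_one[OF h] in \<open>simp_all add: L.l_distr L.r_distr L.m_assoc\<close>)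
 then show ?thesis using K by (simp add: kspace_def vectorspace_def)
qed

text \<open>The scalars act through \<open>K \<rightarrow> O\<^sub>x \<rightarrow> A\<^sub>x \<rightarrow> K\<^sub>x\<close>, a composition of ring homomorphisms.\<close>

lemma local_lattice:
 fixes K :: "'k ring" and C :: "('k, 'p, 'a) rspace"
 assumes K: "field K" and C: "scheme_over K C" and x: "x \<in> pts C"
 shows "lattice_kspace K (local_field C x) (local_ints C x)"
proof -
 interpret C: scheme_over K C by (rule C)
 define A where "A = complete_stalk C x"
 have loc: "local_ring (stalk C x)" by (rule C.stalk_local[OF x])
 have A: "cring A" unfolding A_def complete_stalk_def by (rule completion_cring[OF loc])
 interpret A: cring A by (rule A)
 interpret L: cring "Frac A" by (rule Frac_cring[OF A])
 define g where "g c = to_completion (stalk C x) (str_germ C x c)" for c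
 have g: "g \<in> ring_hom K A"
  using ring_hom_trans[OF C.str_germ_hom[OF x] to_completion_hom[OF loc]]
  by (simp add: g_def[abs_def] A_def complete_stalk_def comp_def)
 have \<iota>: "(\<lambda>a. fraction A a \<one>\<^bsub>A\<^esub>) \<in> ring_hom A (Frac A)" by (rule fraction_hom[OF A])
 have h: "(\<lambda>c. fraction A (g c) \<one>\<^bsub>A\<^esub>) \<in> ring_hom K (Frac A)" using ring_hom_trans[OF g \<iota>] by (simp add: comp_def)
 have V: "local_field C x = \<lparr>carrier = carrier (Frac A), monoid.mult = monoid.mult (Frac A), one = one (Frac A),
   ring.zero = ring.zero (Frac A), add = add (Frac A), smult = \<lambda>c f. fraction A (g c) \<one>\<^bsub>A\<^esub> \<otimes>\<^bsub>Frac A\<^esub> f\<rparr>"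
  by (simp add: local_field_def Let_def A_def g_def)
 have P: "local_ints C x = (\<lambda>a. fraction A a \<one>\<^bsub>A\<^esub>) ` carrier A" by (simp add: local_ints_def Let_def A_def)
 interpret kspace K "local_field C x" unfolding V by (rule kspace_of_hom[OF K L.cring_axioms h])
 have "submodule K (local_ints C x) (local_field C x)"
  unfolding sub_iff
 proof (intro conjI ballI)
  show "local_ints C x \<subseteq> carrier (local_field C x)" unfolding P V using ring_hom_closed[OF \<iota>] by auto
  show "\<zero>\<^bsub>local_field C x\<^esub> \<in> local_ints C x" unfolding P V by (simp add: frac_zero[OF A])
  fix v w assume "v \<in> local_ints C x" "w \<in> local_ints C x"
  then show "v \<oplus>\<^bsub>local_field C x\<^esub> w \<in> local_ints C x" unfolding P V by (auto simp: ring_hom_add[OF \<iota>, symmetric])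
 next
  fix c v assume c: "c \<in> carrier K" and "v \<in> local_ints C x"
  then show "c \<odot>\<^bsub>local_field C x\<^esub> v \<in> local_ints C x" unfolding P V using ring_hom_closed[OF g c]
   by (auto simp: ring_hom_mult[OF \<iota>, symmetric])
 qed
 then show ?thesis using kspace_axioms by (simp add: lattice_kspace_def lattice_kspace_axioms_def)
qed

section \<open>Restricted products of lattices\<close>

locale lattice_family =
 fixes K :: "'k ring" (structure) and I :: "'i set" and V :: "'i => ('k, 'v) module" and A :: "'i => 'v set"
 assumes K: "field K" and lattice: "i \<in> I ==> lattice_kspace K (V i) (A i)"
begin

sublocale K: field K by (rule K)

abbreviation RP where "RP J \<equiv> restricted_product J V A"
abbreviation IP where "IP J \<equiv> (\<Pi>\<^sub>E i\<in>J. A i)"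

lemma at:
 assumes i: "i \<in> I"
 shows "v \<in> A i ==> v \<in> carrier (V i)" "\<zero>\<^bsub>V i\<^esub> \<in> A i" "v \<in> A i ==> w \<in> A i ==> v \<oplus>\<^bsub>V i\<^esub> w \<in> A i"
  "c \<in> carrier K ==> v \<in> A i ==> c \<odot>\<^bsub>V i\<^esub> v \<in> A i" "\<zero>\<^bsub>V i\<^esub> \<in> carrier (V i)"
  "v \<in> carrier (V i) ==> w \<in> carrier (V i) ==> v \<oplus>\<^bsub>V i\<^esub> w \<in> carrier (V i)"
  "c \<in> carrier K ==> v \<in> carrier (V i) ==> c \<odot>\<^bsub>V i\<^esub> v \<in> carrier (V i)"
proof -
 interpret lattice_kspace K "V i" "A i" by (rule lattice[OF i])
 note s = subD[OF P]
 show "v \<in> A i ==> v \<in> carrier (V i)" "\<zero>\<^bsub>V i\<^esub> \<in> A i" "v \<in> A i ==> w \<in> A i ==> v \<oplus>\<^bsub>V i\<^esub> w \<in> A i"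
  "c \<in> carrier K ==> v \<in> A i ==> c \<odot>\<^bsub>V i\<^esub> v \<in> A i" by (fact s)+
 show "\<zero>\<^bsub>V i\<^esub> \<in> carrier (V i)" "v \<in> carrier (V i) ==> w \<in> carrier (V i) ==> v \<oplus>\<^bsub>V i\<^esub> w \<in> carrier (V i)"
  "c \<in> carrier K ==> v \<in> carrier (V i) ==> c \<odot>\<^bsub>V i\<^esub> v \<in> carrier (V i)" by simp_all
qed

lemma laws:
 assumes i: "i \<in> I" and u: "u \<in> carrier (V i)"
 shows "v \<in> carrier (V i) ==> w \<in> carrier (V i) ==> u \<oplus>\<^bsub>V i\<^esub> v \<oplus>\<^bsub>V i\<^esub> w = u \<oplus>\<^bsub>V i\<^esub> (v \<oplus>\<^bsub>V i\<^esub> w)"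
  "v \<in> carrier (V i) ==> u \<oplus>\<^bsub>V i\<^esub> v = v \<oplus>\<^bsub>V i\<^esub> u"
  "\<zero>\<^bsub>V i\<^esub> \<oplus>\<^bsub>V i\<^esub> u = u" "u \<oplus>\<^bsub>V i\<^esub> \<zero>\<^bsub>V i\<^esub> = u"
  "(\<ominus> \<one>) \<odot>\<^bsub>V i\<^esub> u \<oplus>\<^bsub>V i\<^esub> u = \<zero>\<^bsub>V i\<^esub>"
  "a \<in> carrier K ==> b \<in> carrier K ==> (a \<oplus> b) \<odot>\<^bsub>V i\<^esub> u = a \<odot>\<^bsub>V i\<^esub> u \<oplus>\<^bsub>V i\<^esub> b \<odot>\<^bsub>V i\<^esub> u"
  "a \<in> carrier K ==> v \<in> carrier (V i) ==> a \<odot>\<^bsub>V i\<^esub> (u \<oplus>\<^bsub>V i\<^esub> v) = a \<odot>\<^bsub>V i\<^esub> u \<oplus>\<^bsub>V i\<^esub> a \<odot>\<^bsub>V i\<^esub> v"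
  "a \<in> carrier K ==> b \<in> carrier K ==> (a \<otimes> b) \<odot>\<^bsub>V i\<^esub> u = a \<odot>\<^bsub>V i\<^esub> (b \<odot>\<^bsub>V i\<^esub> u)"
  "\<one> \<odot>\<^bsub>V i\<^esub> u = u" "a \<in> carrier K ==> a \<odot>\<^bsub>V i\<^esub> \<zero>\<^bsub>V i\<^esub> = \<zero>\<^bsub>V i\<^esub>"
proof -
 interpret lattice_kspace K "V i" "A i" by (rule lattice[OF i])
 show "v \<in> carrier (V i) ==> w \<in> carrier (V i) ==> u \<oplus>\<^bsub>V i\<^esub> v \<oplus>\<^bsub>V i\<^esub> w = u \<oplus>\<^bsub>V i\<^esub> (v \<oplus>\<^bsub>V i\<^esub> w)"
  using u by (rule M.a_assoc)
 show "v \<in> carrier (V i) ==> u \<oplus>\<^bsub>V i\<^esub> v = v \<oplus>\<^bsub>V i\<^esub> u" using u by (rule M.a_comm)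
 show "\<zero>\<^bsub>V i\<^esub> \<oplus>\<^bsub>V i\<^esub> u = u" "u \<oplus>\<^bsub>V i\<^esub> \<zero>\<^bsub>V i\<^esub> = u" using u by simp_all
 show "a \<in> carrier K ==> b \<in> carrier K ==> (a \<oplus> b) \<odot>\<^bsub>V i\<^esub> u = a \<odot>\<^bsub>V i\<^esub> u \<oplus>\<^bsub>V i\<^esub> b \<odot>\<^bsub>V i\<^esub> u" for a b
  using u by (simp add: smult_l_distr)
 from this[of "\<ominus> \<one>" \<one>] show "(\<ominus> \<one>) \<odot>\<^bsub>V i\<^esub> u \<oplus>\<^bsub>V i\<^esub> u = \<zero>\<^bsub>V i\<^esub>" using u by (simp add: K.l_neg)
 show "a \<in> carrier K ==> v \<in> carrier (V i) ==> a \<odot>\<^bsub>V i\<^esub> (u \<oplus>\<^bsub>V i\<^esub> v) = a \<odot>\<^bsub>V i\<^esub> u \<oplus>\<^bsub>V i\<^esub> a \<odot>\<^bsub>V i\<^esub> v"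
  using u by (simp add: smult_r_distr)
 show "a \<in> carrier K ==> b \<in> carrier K ==> (a \<otimes> b) \<odot>\<^bsub>V i\<^esub> u = a \<odot>\<^bsub>V i\<^esub> (b \<odot>\<^bsub>V i\<^esub> u)"
  using u by (simp add: smult_assoc1)
 show "\<one> \<odot>\<^bsub>V i\<^esub> u = u" "a \<in> carrier K ==> a \<odot>\<^bsub>V i\<^esub> \<zero>\<^bsub>V i\<^esub> = \<zero>\<^bsub>V i\<^esub>" using u by simp_all
qed

lemma RP_iff: "f \<in> carrier (RP J) \<longleftrightarrow> f \<in> (\<Pi>\<^sub>E i\<in>J. carrier (V i)) \<and> finite {i \<in> J. f i \<notin> A i}"
 by (simp add: restricted_product_def)

lemma RP_ops: "\<zero>\<^bsub>RP J\<^esub> = (\<lambda>i\<in>J. \<zero>\<^bsub>V i\<^esub>)" "f \<oplus>\<^bsub>RP J\<^esub> g = (\<lambda>i\<in>J. f i \<oplus>\<^bsub>V i\<^esub> g i)" "c \<odot>\<^bsub>RP J\<^esub> f = (\<lambda>i\<in>J. c \<odot>\<^bsub>V i\<^esub> f i)"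
 by (simp_all add: restricted_product_def)

lemma RP_at: "f \<in> carrier (RP J) ==> i \<in> J ==> f i \<in> carrier (V i)"
 by (auto simp: RP_iff)

lemma RP_finite: "f \<in> carrier (RP J) ==> finite {i \<in> J. f i \<notin> A i}"
 by (simp add: RP_iff)

lemma RP_memI:
 assumes "!!i. i \<in> J ==> g i \<in> carrier (V i)" "finite F" "!!i. i \<in> J ==> i \<notin> F ==> g i \<in> A i"
 shows "(\<lambda>i\<in>J. g i) \<in> carrier (RP J)"
proof -
 have "{i \<in> J. (\<lambda>i\<in>J. g i) i \<notin> A i} \<subseteq> F" using assms(3) by auto
 then have "finite {i \<in> J. (\<lambda>i\<in>J. g i) i \<notin> A i}" using assms(2) by (rule finite_subset)
 then show ?thesis using assms(1) by (simp add: RP_iff)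
qed

lemma RP_restrict: "f \<in> carrier (RP J) ==> (\<lambda>i\<in>J. f i) = f"
 unfolding RP_iff by (rule PiE_restrict) (erule conjunct1)

lemma RP_zero: "J \<subseteq> I ==> \<zero>\<^bsub>RP J\<^esub> \<in> carrier (RP J)"
 unfolding RP_ops by (rule RP_memI[where F = "{}"]) (auto simp: at)

lemma RP_add: "J \<subseteq> I ==> f \<in> carrier (RP J) ==> g \<in> carrier (RP J) ==> f \<oplus>\<^bsub>RP J\<^esub> g \<in> carrier (RP J)"
proof -
 assume J: "J \<subseteq> I" and f: "f \<in> carrier (RP J)" "g \<in> carrier (RP J)"
 show ?thesis unfolding RP_ops
 proof (rule RP_memI)
  show "finite ({i \<in> J. f i \<notin> A i} \<union> {i \<in> J. g i \<notin> A i})" using f[THEN RP_finite] by simp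
  fix i assume i: "i \<in> J"
  then have iI: "i \<in> I" using J by auto
  show "f i \<oplus>\<^bsub>V i\<^esub> g i \<in> carrier (V i)" by (rule at(6)[OF iI RP_at[OF f(1) i] RP_at[OF f(2) i]])
  assume "i \<notin> {i \<in> J. f i \<notin> A i} \<union> {i \<in> J. g i \<notin> A i}"
  then show "f i \<oplus>\<^bsub>V i\<^esub> g i \<in> A i" using i by (intro at(3)[OF iI]) auto
 qed
qed

lemma RP_smult: "J \<subseteq> I ==> c \<in> carrier K ==> f \<in> carrier (RP J) ==> c \<odot>\<^bsub>RP J\<^esub> f \<in> carrier (RP J)"
proof -
 assume J: "J \<subseteq> I" and c: "c \<in> carrier K" and f: "f \<in> carrier (RP J)"
 show ?thesis unfolding RP_ops
 proof (rule RP_memI[OF _ RP_finite[OF f]])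
  fix i assume i: "i \<in> J"
  then have iI: "i \<in> I" using J by auto
  show "c \<odot>\<^bsub>V i\<^esub> f i \<in> carrier (V i)" by (rule at(7)[OF iI c RP_at[OF f i]])
  assume "i \<notin> {i \<in> J. f i \<notin> A i}"
  then show "c \<odot>\<^bsub>V i\<^esub> f i \<in> A i" using i by (intro at(4)[OF iI c]) auto
 qed
qed

lemma RP_kspace: "J \<subseteq> I ==> kspace K (RP J)"
proof -
 assume J: "J \<subseteq> I"
 note c = RP_zero[OF J] RP_add[OF J] RP_smult[OF J]
 have I: "i \<in> I" if "i \<in> J" for i using that J by auto
 have ab: "abelian_group (RP J)"
 proof (rule abelian_groupI)
  fix f g h assume f: "f \<in> carrier (RP J)" "g \<in> carrier (RP J)" "h \<in> carrier (RP J)"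
  show "f \<oplus>\<^bsub>RP J\<^esub> g \<oplus>\<^bsub>RP J\<^esub> h = f \<oplus>\<^bsub>RP J\<^esub> (g \<oplus>\<^bsub>RP J\<^esub> h)"
   unfolding RP_ops by (rule restrict_ext) (simp add: laws(1)[OF I RP_at[OF f(1)] RP_at[OF f(2)] RP_at[OF f(3)]])
 next
  fix f g assume f: "f \<in> carrier (RP J)" "g \<in> carrier (RP J)"
  show "f \<oplus>\<^bsub>RP J\<^esub> g = g \<oplus>\<^bsub>RP J\<^esub> f"
   unfolding RP_ops by (rule restrict_ext) (rule laws(2)[OF I RP_at[OF f(1)] RP_at[OF f(2)]])
 next
  fix f assume f: "f \<in> carrier (RP J)"
  have "\<zero>\<^bsub>RP J\<^esub> \<oplus>\<^bsub>RP J\<^esub> f = (\<lambda>i\<in>J. f i)"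
   unfolding RP_ops by (rule restrict_ext) (simp add: laws(3)[OF I RP_at[OF f]])
  then show "\<zero>\<^bsub>RP J\<^esub> \<oplus>\<^bsub>RP J\<^esub> f = f" unfolding RP_restrict[OF f] .
  show "\<exists>g\<in>carrier (RP J). g \<oplus>\<^bsub>RP J\<^esub> f = \<zero>\<^bsub>RP J\<^esub>"
  proof (rule bexI)
   show "(\<ominus> \<one>) \<odot>\<^bsub>RP J\<^esub> f \<in> carrier (RP J)" using f by (intro c) simp_all
   show "(\<ominus> \<one>) \<odot>\<^bsub>RP J\<^esub> f \<oplus>\<^bsub>RP J\<^esub> f = \<zero>\<^bsub>RP J\<^esub>"
    unfolding RP_ops by (rule restrict_ext) (simp add: laws(5)[OF I RP_at[OF f]])
  qed
 qed (use c in simp_all)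
 have "Module.module K (RP J)"
 proof (rule Module.moduleI[OF K.cring_axioms ab])
  fix a f assume a: "a \<in> carrier K" and f: "f \<in> carrier (RP J)"
  show "a \<odot>\<^bsub>RP J\<^esub> f \<in> carrier (RP J)" by (rule c(3)[OF a f])
 next
  fix a b f assume a: "a \<in> carrier K" "b \<in> carrier K" and f: "f \<in> carrier (RP J)"
  show "(a \<oplus> b) \<odot>\<^bsub>RP J\<^esub> f = a \<odot>\<^bsub>RP J\<^esub> f \<oplus>\<^bsub>RP J\<^esub> b \<odot>\<^bsub>RP J\<^esub> f"
   unfolding RP_ops by (rule restrict_ext) (simp add: laws(6)[OF I RP_at[OF f] a])
  show "(a \<otimes> b) \<odot>\<^bsub>RP J\<^esub> f = a \<odot>\<^bsub>RP J\<^esub> (b \<odot>\<^bsub>RP J\<^esub> f)"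
   unfolding RP_ops by (rule restrict_ext) (simp add: laws(8)[OF I RP_at[OF f] a])
 next
  fix a f g assume a: "a \<in> carrier K" and f: "f \<in> carrier (RP J)" "g \<in> carrier (RP J)"
  show "a \<odot>\<^bsub>RP J\<^esub> (f \<oplus>\<^bsub>RP J\<^esub> g) = a \<odot>\<^bsub>RP J\<^esub> f \<oplus>\<^bsub>RP J\<^esub> a \<odot>\<^bsub>RP J\<^esub> g"
   unfolding RP_ops by (rule restrict_ext) (simp add: laws(7)[OF I RP_at[OF f(1)] a RP_at[OF f(2)]])
 next
  fix f assume f: "f \<in> carrier (RP J)"
  have "\<one> \<odot>\<^bsub>RP J\<^esub> f = (\<lambda>i\<in>J. f i)"
   unfolding RP_ops by (rule restrict_ext) (simp add: laws(9)[OF I RP_at[OF f]])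
  then show "\<one> \<odot>\<^bsub>RP J\<^esub> f = f" unfolding RP_restrict[OF f] .
 qed
 then show ?thesis using K by (simp add: kspace_def vectorspace_def)
qed

lemma prod_sub_RP: "J \<subseteq> I ==> (!!i. i \<in> J ==> B i \<subseteq> carrier (V i)) ==> finite F ==> (!!i. i \<in> J ==> i \<notin> F ==> B i \<subseteq> A i) ==>
  (\<Pi>\<^sub>E i\<in>J. B i) \<subseteq> carrier (RP J)"
proof
 fix f assume h: "J \<subseteq> I" "!!i. i \<in> J ==> B i \<subseteq> carrier (V i)" "finite F" "!!i. i \<in> J ==> i \<notin> F ==> B i \<subseteq> A i"
  and f: "f \<in> (\<Pi>\<^sub>E i\<in>J. B i)"
 have fi: "f i \<in> B i" if "i \<in> J" for i using f that by auto
 have "(\<lambda>i\<in>J. f i) \<in> carrier (RP J)" by (rule RP_memI[OF _ h(3)]) (use fi h(2,4) in blast)+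
 then show "f \<in> carrier (RP J)" using f by (simp add: PiE_restrict)
qed

lemma RP_lattice: "J \<subseteq> I ==> lattice_kspace K (RP J) (IP J)"
proof -
 assume J: "J \<subseteq> I"
 interpret kspace K "RP J" by (rule RP_kspace[OF J])
 have I: "i \<in> I" if "i \<in> J" for i using that J by auto
 have "sub (IP J)" unfolding sub_iff
 proof (intro conjI ballI)
  show "IP J \<subseteq> carrier (RP J)" by (rule prod_sub_RP[where F = "{}"]) (use J at(1) in auto)
  show "\<zero>\<^bsub>RP J\<^esub> \<in> IP J" unfolding RP_ops using I at(2) by simp
  fix f g assume fg: "f \<in> IP J" "g \<in> IP J"
  have f: "f i \<in> A i" "g i \<in> A i" if "i \<in> J" for i using fg that by auto
  show "f \<oplus>\<^bsub>RP J\<^esub> g \<in> IP J" unfolding RP_ops restrict_PiE_iff using I f at(3) by blast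
 next
  fix c f assume c: "c \<in> carrier K" and "f \<in> IP J"
  then have f: "f i \<in> A i" if "i \<in> J" for i using that by auto
  show "c \<odot>\<^bsub>RP J\<^esub> f \<in> IP J" unfolding RP_ops restrict_PiE_iff using I f at(4)[OF _ c] by blast
 qed
 then show ?thesis using kspace_axioms by (simp add: lattice_kspace_def lattice_kspace_axioms_def)
qed

text \<open>For \<open>x \<in> J\<close> the restricted product over \<open>J\<close> is the direct sum of \<open>V x\<close> and of the restricted product over
\<open>J - {x}\<close>. Here \<open>at_point\<close> and \<open>off_point\<close> are the two inclusions, and \<open>glue\<close> is the sum of their values.\<close>

definition at_point where "at_point J x v = (\<lambda>i\<in>J. if i = x then v else \<zero>\<^bsub>V i\<^esub>)"
definition off_point where "off_point J x f = (\<lambda>i\<in>J. if i = x then \<zero>\<^bsub>V i\<^esub> else f i)"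
definition glue where "glue J x v f = (\<lambda>i\<in>J. if i = x then v else f i)"

context
 fixes J :: "'i set" and x :: 'i
 assumes J: "J \<subseteq> I" and x: "x \<in> J"
begin

lemma glue_closed: "v \<in> carrier (V x) ==> f \<in> carrier (RP (J - {x})) ==> glue J x v f \<in> carrier (RP J)"
 unfolding glue_def
proof (rule RP_memI)
 assume v: "v \<in> carrier (V x)" and f: "f \<in> carrier (RP (J - {x}))"
 show "finite (insert x {i \<in> J - {x}. f i \<notin> A i})" by (rule finite.insertI[OF RP_finite[OF f]])
 show "(if i = x then v else f i) \<in> carrier (V i)" if "i \<in> J" for i using v RP_at[OF f, of i] that by simp
 show "(if i = x then v else f i) \<in> A i" if "i \<in> J" "i \<notin> insert x {i \<in> J - {x}. f i \<notin> A i}" for i using that by auto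
qed

lemma at_point_closed: "v \<in> carrier (V x) ==> at_point J x v \<in> carrier (RP J)"
 unfolding at_point_def by (rule RP_memI[where F = "{x}"]) (use J at(2,5) in auto)

lemma off_point_closed: "f \<in> carrier (RP (J - {x})) ==> off_point J x f \<in> carrier (RP J)"
 unfolding off_point_def
proof (rule RP_memI)
 assume f: "f \<in> carrier (RP (J - {x}))"
 show "finite (insert x {i \<in> J - {x}. f i \<notin> A i})" by (rule finite.insertI[OF RP_finite[OF f]])
 show "(if i = x then \<zero>\<^bsub>V i\<^esub> else f i) \<in> carrier (V i)" if "i \<in> J" for i
  using at(5)[OF subsetD[OF J that]] RP_at[OF f, of i] that by (cases "i = x") simp_all
 show "(if i = x then \<zero>\<^bsub>V i\<^esub> else f i) \<in> A i" if "i \<in> J" "i \<notin> insert x {i \<in> J - {x}. f i \<notin> A i}" for i using that by auto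
qed

lemma glue_sum: "v \<in> carrier (V x) ==> f \<in> carrier (RP (J - {x})) ==> at_point J x v \<oplus>\<^bsub>RP J\<^esub> off_point J x f = glue J x v f"
 unfolding RP_ops at_point_def off_point_def glue_def
proof (rule restrict_ext)
 fix i assume v: "v \<in> carrier (V x)" and f: "f \<in> carrier (RP (J - {x}))" and i: "i \<in> J"
 have iI: "i \<in> I" using i J by auto
 show "(\<lambda>i\<in>J. if i = x then v else \<zero>\<^bsub>V i\<^esub>) i \<oplus>\<^bsub>V i\<^esub> (\<lambda>i\<in>J. if i = x then \<zero>\<^bsub>V i\<^esub> else f i) i = (if i = x then v else f i)"
  using i v laws(4)[OF iI, of v] laws(3)[OF iI, of "f i"] RP_at[OF f, of i] by auto
qed

lemma glue_inject:
 assumes f: "f \<in> carrier (RP (J - {x}))" "f' \<in> carrier (RP (J - {x}))" and e: "glue J x v f = glue J x v' f'"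
 shows "v = v' \<and> f = f'"
proof
 show "v = v'" using fun_cong[OF e, of x] x by (simp add: glue_def)
 have "f i = f' i" if "i \<in> J - {x}" for i using fun_cong[OF e, of i] that by (simp add: glue_def)
 then have "(\<lambda>i\<in>J - {x}. f i) = (\<lambda>i\<in>J - {x}. f' i)" by (rule restrict_ext)
 then show "f = f'" unfolding RP_restrict[OF f(1)] RP_restrict[OF f(2)] .
qed

lemma glue_split: "f \<in> (\<Pi>\<^sub>E i\<in>J. B i) ==> f = glue J x (f x) (\<lambda>i\<in>J - {x}. f i)"
proof -
 assume f: "f \<in> (\<Pi>\<^sub>E i\<in>J. B i)"
 have "(\<lambda>i\<in>J. f i) = glue J x (f x) (\<lambda>i\<in>J - {x}. f i)" unfolding glue_def by (rule restrict_ext) auto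
 then show ?thesis using f by (simp add: PiE_restrict)
qed

lemma prod_glue: "(\<Pi>\<^sub>E i\<in>J. B i) = {glue J x v f |v f. v \<in> B x \<and> f \<in> (\<Pi>\<^sub>E i\<in>J - {x}. B i)}"
proof
 show "(\<Pi>\<^sub>E i\<in>J. B i) \<subseteq> {glue J x v f |v f. v \<in> B x \<and> f \<in> (\<Pi>\<^sub>E i\<in>J - {x}. B i)}"
 proof
  fix f assume f: "f \<in> (\<Pi>\<^sub>E i\<in>J. B i)"
  then have "f x \<in> B x" "(\<lambda>i\<in>J - {x}. f i) \<in> (\<Pi>\<^sub>E i\<in>J - {x}. B i)" using x by auto
  then show "f \<in> {glue J x v f |v f. v \<in> B x \<and> f \<in> (\<Pi>\<^sub>E i\<in>J - {x}. B i)}"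
   using glue_split[OF f] by (intro CollectI exI conjI)
 qed
 show "{glue J x v f |v f. v \<in> B x \<and> f \<in> (\<Pi>\<^sub>E i\<in>J - {x}. B i)} \<subseteq> (\<Pi>\<^sub>E i\<in>J. B i)"
 proof
  fix g assume "g \<in> {glue J x v f |v f. v \<in> B x \<and> f \<in> (\<Pi>\<^sub>E i\<in>J - {x}. B i)}"
  then obtain v f where g: "g = glue J x v f" "v \<in> B x" "f \<in> (\<Pi>\<^sub>E i\<in>J - {x}. B i)" by (elim CollectE exE conjE)
  have "f i \<in> B i" if "i \<in> J" "i \<noteq> x" for i using g(3) that by auto
  then show "g \<in> (\<Pi>\<^sub>E i\<in>J. B i)" unfolding g(1) glue_def restrict_PiE_iff using g(2) by simp
 qed
qed

lemma prod_ds: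
 assumes B: "B x \<subseteq> carrier (V x)" "(\<Pi>\<^sub>E i\<in>J - {x}. B i) \<subseteq> carrier (RP (J - {x}))"
 shows "{at_point J x v \<oplus>\<^bsub>RP J\<^esub> off_point J x f |v f. v \<in> B x \<and> f \<in> (\<Pi>\<^sub>E i\<in>J - {x}. B i)} = (\<Pi>\<^sub>E i\<in>J. B i)"
 unfolding prod_glue[of B]
proof (rule Collect_cong, intro iff_exI)
 fix g v f
 show "(g = at_point J x v \<oplus>\<^bsub>RP J\<^esub> off_point J x f \<and> v \<in> B x \<and> f \<in> (\<Pi>\<^sub>E i\<in>J - {x}. B i)) =
   (g = glue J x v f \<and> v \<in> B x \<and> f \<in> (\<Pi>\<^sub>E i\<in>J - {x}. B i))"
 proof (cases "v \<in> B x \<and> f \<in> (\<Pi>\<^sub>E i\<in>J - {x}. B i)")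
  case True
  then have "at_point J x v \<oplus>\<^bsub>RP J\<^esub> off_point J x f = glue J x v f" using B by (intro glue_sum) (rule subsetD, assumption, erule conjunct1 conjunct2)+
  then show ?thesis by (simp only:)
 next
  case False
  then show ?thesis by (simp only: simp_thms)
 qed
qed

lemma split_at: "direct_sum_lattices K (V x) (A x) (RP (J - {x})) (IP (J - {x})) (RP J) (IP J) (at_point J x) (off_point J x)"
proof -
 have xI: "x \<in> I" using x J by auto
 have J': "J - {x} \<subseteq> I" using J by auto
 interpret A: lattice_kspace K "V x" "A x" by (rule lattice[OF xI])
 interpret B: lattice_kspace K "RP (J - {x})" "IP (J - {x})" by (rule RP_lattice[OF J'])
 interpret W: lattice_kspace K "RP J" "IP J" by (rule RP_lattice[OF J])
 have I: "i \<in> I" if "i \<in> J" for i using that J by auto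
 have P: "IP (J - {x}) \<subseteq> carrier (RP (J - {x}))" by (rule prod_sub_RP[where F = "{}"]) (use J' at(1) in auto)
 have zz: "\<zero>\<^bsub>V i\<^esub> \<oplus>\<^bsub>V i\<^esub> \<zero>\<^bsub>V i\<^esub> = \<zero>\<^bsub>V i\<^esub>" if "i \<in> J" for i by (rule laws(3)[OF I[OF that] at(5)[OF I[OF that]]])
 have cz: "c \<odot>\<^bsub>V i\<^esub> \<zero>\<^bsub>V i\<^esub> = \<zero>\<^bsub>V i\<^esub>" if "i \<in> J" "c \<in> carrier K" for i c
  by (rule laws(10)[OF I[OF that(1)] at(5)[OF I[OF that(1)]] that(2)])
 have h1: "at_point J x \<in> module_hom K (V x) (RP J)"
  unfolding module_hom_def
 proof (intro CollectI conjI allI impI)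
  show "at_point J x \<in> carrier (V x) \<rightarrow> carrier (RP J)" using at_point_closed by auto
  fix v w assume vw: "v \<in> carrier (V x) \<and> w \<in> carrier (V x)"
  show "at_point J x (v \<oplus>\<^bsub>V x\<^esub> w) = at_point J x v \<oplus>\<^bsub>RP J\<^esub> at_point J x w"
   unfolding RP_ops at_point_def by (rule restrict_ext) (simp add: zz)
 next
  fix c v assume c: "c \<in> carrier K \<and> v \<in> carrier (V x)"
  show "at_point J x (c \<odot>\<^bsub>V x\<^esub> v) = c \<odot>\<^bsub>RP J\<^esub> at_point J x v"
   unfolding RP_ops at_point_def by (rule restrict_ext) (simp add: cz c)
 qed
 have j1: "inj_on (at_point J x) (carrier (V x))"
 proof (rule inj_onI)
  fix v w assume "at_point J x v = at_point J x w"
  from fun_cong[OF this, of x] show "v = w" using x by (simp add: at_point_def)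
 qed
 have h2: "off_point J x \<in> module_hom K (RP (J - {x})) (RP J)"
  unfolding module_hom_def
 proof (intro CollectI conjI allI impI)
  show "off_point J x \<in> carrier (RP (J - {x})) \<rightarrow> carrier (RP J)" using off_point_closed by auto
  fix f g assume "f \<in> carrier (RP (J - {x})) \<and> g \<in> carrier (RP (J - {x}))"
  show "off_point J x (f \<oplus>\<^bsub>RP (J - {x})\<^esub> g) = off_point J x f \<oplus>\<^bsub>RP J\<^esub> off_point J x g"
   unfolding RP_ops off_point_def by (rule restrict_ext) (simp add: zz)
 next
  fix c f assume c: "c \<in> carrier K \<and> f \<in> carrier (RP (J - {x}))"
  show "off_point J x (c \<odot>\<^bsub>RP (J - {x})\<^esub> f) = c \<odot>\<^bsub>RP J\<^esub> off_point J x f"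
   unfolding RP_ops off_point_def by (rule restrict_ext) (simp add: cz c)
 qed
 have j2: "inj_on (off_point J x) (carrier (RP (J - {x})))"
 proof (rule inj_onI)
  fix f g assume f: "f \<in> carrier (RP (J - {x}))" "g \<in> carrier (RP (J - {x}))" and e: "off_point J x f = off_point J x g"
  have "f i = g i" if "i \<in> J - {x}" for i using fun_cong[OF e, of i] that by (simp add: off_point_def)
  then have "(\<lambda>i\<in>J - {x}. f i) = (\<lambda>i\<in>J - {x}. g i)" by (rule restrict_ext)
  then show "f = g" unfolding RP_restrict[OF f(1)] RP_restrict[OF f(2)] .
 qed
 have I1: "lin_inj K (V x) (RP J) (at_point J x)"
  by (rule lin_inj.intro[OF A.kspace_axioms W.kspace_axioms lin_inj_axioms.intro[OF h1 j1]])
 have I2: "lin_inj K (RP (J - {x})) (RP J) (off_point J x)"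
  by (rule lin_inj.intro[OF B.kspace_axioms W.kspace_axioms lin_inj_axioms.intro[OF h2 j2]])
 show ?thesis
 proof (rule direct_sum_lattices.intro[OF A.lattice_kspace_axioms B.lattice_kspace_axioms W.lattice_kspace_axioms I1 I2],
   rule direct_sum_lattices_axioms.intro)
  fix f assume f: "f \<in> carrier (RP J)"
  then have fP: "f \<in> (\<Pi>\<^sub>E i\<in>J. carrier (V i))" by (simp add: RP_iff)
  have g: "(\<lambda>i\<in>J - {x}. f i) \<in> carrier (RP (J - {x}))"
   by (rule RP_memI[OF _ RP_finite[OF f]]) (use RP_at[OF f] in auto)
  have "f = at_point J x (f x) \<oplus>\<^bsub>RP J\<^esub> off_point J x (\<lambda>i\<in>J - {x}. f i)"
   unfolding glue_sum[OF RP_at[OF f x] g] by (rule glue_split[OF fP])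
  then show "\<exists>v\<in>carrier (V x). \<exists>g\<in>carrier (RP (J - {x})). f = at_point J x v \<oplus>\<^bsub>RP J\<^esub> off_point J x g"
   by (rule bexI[OF bexI[OF _ g] RP_at[OF f x]])
 next
  fix v v' f f' assume h: "v \<in> carrier (V x)" "v' \<in> carrier (V x)" "f \<in> carrier (RP (J - {x}))" "f' \<in> carrier (RP (J - {x}))"
   "at_point J x v \<oplus>\<^bsub>RP J\<^esub> off_point J x f = at_point J x v' \<oplus>\<^bsub>RP J\<^esub> off_point J x f'"
  show "v = v' \<and> f = f'"
   by (rule glue_inject[OF h(3,4)]) (use h(5)[unfolded glue_sum[OF h(1,3)] glue_sum[OF h(2,4)]] in simp)
 next
  show "IP J = {at_point J x v \<oplus>\<^bsub>RP J\<^esub> off_point J x f |v f. v \<in> A x \<and> f \<in> IP (J - {x})}"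
   by (rule prod_ds[symmetric, OF _ P]) (use at(1)[OF xI] in auto)
 qed
qed

end

text \<open>Induction on the exceptional set, splitting off one index at a time; the direct sum of lattices is a
lattice by \<open>lat_ds\<close>.\<close>

lemma prod_lat:
 assumes "finite F"
 shows "J \<subseteq> I ==> F \<subseteq> J ==> \<forall>i\<in>J. lattice_kspace.lat K (V i) (A i) (B i) ==> \<forall>i\<in>J - F. B i = A i ==>
  lattice_kspace.lat K (RP J) (IP J) (\<Pi>\<^sub>E i\<in>J. B i)"
 using assms
proof (induction F arbitrary: J rule: finite_induct)
 case empty
 then have "(\<Pi>\<^sub>E i\<in>J. B i) = IP J" by (intro PiE_cong) simp
 then show ?case using lattice_kspace.lat_P[OF RP_lattice[OF empty(1)]] by simp
next
 case (insert x F)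
 have x: "x \<in> J" and J': "J - {x} \<subseteq> I" using insert.prems by auto
 interpret D: direct_sum_lattices K "V x" "A x" "RP (J - {x})" "IP (J - {x})" "RP J" "IP J" "at_point J x" "off_point J x"
  by (rule split_at[OF insert.prems(1) x])
 have 1: "D.A.lat (B x)" using insert.prems(3) x by blast
 have 2: "D.B.lat (\<Pi>\<^sub>E i\<in>J - {x}. B i)" by (rule insert.IH[OF J']) (use insert.hyps insert.prems in auto)
 have "D.W.lat (D.ds (B x) (\<Pi>\<^sub>E i\<in>J - {x}. B i))" by (rule D.lat_ds[OF 1 2])
 then show ?case unfolding D.ds_def prod_ds[OF insert.prems(1) x D.A.carrier_lat[OF 1] D.B.carrier_lat[OF 2]] .
qed

subsection \<open>Products of automorphisms\<close>

definition prodmap where "prodmap J S = (\<lambda>f\<in>carrier (RP J). \<lambda>i\<in>J. S i (f i))"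

abbreviation Gls where "Gls i \<equiv> carrier (Gl K (V i) (A i))"

lemma Gls_at:
 assumes i: "i \<in> I" and S: "S \<in> Gls i"
 shows "v \<in> carrier (V i) ==> S v \<in> carrier (V i)"
  "v \<in> carrier (V i) ==> w \<in> carrier (V i) ==> S (v \<oplus>\<^bsub>V i\<^esub> w) = S v \<oplus>\<^bsub>V i\<^esub> S w"
  "c \<in> carrier K ==> v \<in> carrier (V i) ==> S (c \<odot>\<^bsub>V i\<^esub> v) = c \<odot>\<^bsub>V i\<^esub> S v"
proof -
 interpret lattice_kspace K "V i" "A i" by (rule lattice[OF i])
 interpret S: lin_inj K "V i" "V i" S by (rule GL_D(4)[OF S])
 show "v \<in> carrier (V i) ==> S v \<in> carrier (V i)"
  "v \<in> carrier (V i) ==> w \<in> carrier (V i) ==> S (v \<oplus>\<^bsub>V i\<^esub> w) = S v \<oplus>\<^bsub>V i\<^esub> S w"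
  "c \<in> carrier K ==> v \<in> carrier (V i) ==> S (c \<odot>\<^bsub>V i\<^esub> v) = c \<odot>\<^bsub>V i\<^esub> S v"
  by (fact S.f_closed S.f_add S.f_smult)+
qed

context
 fixes J :: "'i set" and S :: "'i => 'v => 'v"
 assumes J: "J \<subseteq> I" and S0: "\<forall>i\<in>J. S i \<in> Gls i" and bad: "finite {i \<in> J. S i ` A i \<noteq> A i}"
begin

lemma prodmap_closed: "f \<in> carrier (RP J) ==> prodmap J S f \<in> carrier (RP J)"
proof -
 assume f: "f \<in> carrier (RP J)"
 have "(\<lambda>i\<in>J. S i (f i)) \<in> carrier (RP J)"
 proof (rule RP_memI)
  show "finite ({i \<in> J. f i \<notin> A i} \<union> {i \<in> J. S i ` A i \<noteq> A i})" using RP_finite[OF f] bad by simp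
  fix i assume i: "i \<in> J"
  then show "S i (f i) \<in> carrier (V i)" using Gls_at(1)[OF _ S0[rule_format] RP_at[OF f]] J by blast
  assume "i \<notin> {i \<in> J. f i \<notin> A i} \<union> {i \<in> J. S i ` A i \<noteq> A i}"
  then have "f i \<in> A i" "S i ` A i = A i" using i by auto
  then show "S i (f i) \<in> A i" using imageI[of "f i" "A i" "S i"] by simp
 qed
 then show ?thesis using f by (simp add: prodmap_def)
qed

lemma prodmap_image:
 assumes B: "(\<Pi>\<^sub>E i\<in>J. B i) \<subseteq> carrier (RP J)"
 shows "prodmap J S ` (\<Pi>\<^sub>E i\<in>J. B i) = (\<Pi>\<^sub>E i\<in>J. S i ` B i)"
proof
 show "prodmap J S ` (\<Pi>\<^sub>E i\<in>J. B i) \<subseteq> (\<Pi>\<^sub>E i\<in>J. S i ` B i)"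
 proof (rule image_subsetI)
  fix f assume f: "f \<in> (\<Pi>\<^sub>E i\<in>J. B i)"
  then have fi: "f i \<in> B i" if "i \<in> J" for i using that by auto
  show "prodmap J S f \<in> (\<Pi>\<^sub>E i\<in>J. S i ` B i)" using subsetD[OF B f] fi by (simp add: prodmap_def)
 qed
 show "(\<Pi>\<^sub>E i\<in>J. S i ` B i) \<subseteq> prodmap J S ` (\<Pi>\<^sub>E i\<in>J. B i)"
 proof
  fix g assume g: "g \<in> (\<Pi>\<^sub>E i\<in>J. S i ` B i)"
  define f where "f = (\<lambda>i\<in>J. inv_into (B i) (S i) (g i))"
  have gi: "g i \<in> S i ` B i" if "i \<in> J" for i using g that by auto
  have f: "f \<in> (\<Pi>\<^sub>E i\<in>J. B i)" unfolding f_def restrict_PiE_iff using inv_into_into[OF gi] by blast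
  have "prodmap J S f = (\<lambda>i\<in>J. S i (f i))" using subsetD[OF B f] by (simp add: prodmap_def)
  also have "\<dots> = (\<lambda>i\<in>J. g i)" by (rule restrict_ext) (simp add: f_def f_inv_into_f[OF gi])
  also have "\<dots> = g" using g by (simp add: PiE_restrict)
  finally show "g \<in> prodmap J S ` (\<Pi>\<^sub>E i\<in>J. B i)" using f by (metis imageI)
 qed
qed

end

text \<open>The inverse is the product of the inverses, and these have the same exceptional indices. The images
of the integral adeles under both maps are lattices by \<open>prod_lat\<close>.\<close>

lemma prodmap_GL:
 assumes J: "J \<subseteq> I" and S0: "\<forall>i\<in>J. S i \<in> Gls i" and bad: "finite {i \<in> J. S i ` A i \<noteq> A i}"
 shows "prodmap J S \<in> carrier (Gl K (RP J) (IP J))"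
proof -
 interpret W: lattice_kspace K "RP J" "IP J" by (rule RP_lattice[OF J])
 have I: "i \<in> I" if "i \<in> J" for i using that J by auto
 note S = S0[rule_format] and L = lattice[OF I]
 define S' where "S' i = lattice_kspace.ginv (V i) (S i)" for i
 have S': "S' i \<in> Gls i" if "i \<in> J" for i unfolding S'_def by (rule lattice_kspace.ginv(1)[OF L[OF that] S[OF that]])
 then have S'0: "\<forall>i\<in>J. S' i \<in> Gls i" by blast
 have im: "S' i ` S i ` B = B" "S i ` S' i ` B = B" if "i \<in> J" "B \<subseteq> carrier (V i)" for i B
  unfolding S'_def using lattice_kspace.ginv(3,4)[OF L[OF that(1)] S[OF that(1)] that(2)] by auto
 have Ac: "A i \<subseteq> carrier (V i)" if "i \<in> J" for i using at(1)[OF I[OF that]] by auto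
 have "{i \<in> J. S' i ` A i \<noteq> A i} \<subseteq> {i \<in> J. S i ` A i \<noteq> A i}"
 proof
  fix i assume i: "i \<in> {i \<in> J. S' i ` A i \<noteq> A i}"
  then have "S i ` A i \<noteq> A i" using im(1)[of i "A i"] Ac[of i] by (metis (mono_tags, lifting) mem_Collect_eq)
  then show "i \<in> {i \<in> J. S i ` A i \<noteq> A i}" using i by simp
 qed
 then have bad': "finite {i \<in> J. S' i ` A i \<noteq> A i}" using bad by (rule finite_subset)
 have inv: "S' i (S i v) = v" "S i (S' i v) = v" if "i \<in> J" "v \<in> carrier (V i)" for i v
  using im[OF that(1), of "{v}"] that(2) by simp_all
 note c = prodmap_closed[OF J S0 bad] and c' = prodmap_closed[OF J S'0 bad']
 have ap: "prodmap J S f = (\<lambda>i\<in>J. S i (f i))" if "f \<in> carrier (RP J)" for S f using that by (simp add: prodmap_def)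
 have i1: "prodmap J S' (prodmap J S f) = f" if f: "f \<in> carrier (RP J)" for f
 proof -
  have "prodmap J S' (prodmap J S f) = (\<lambda>i\<in>J. f i)"
   unfolding ap[OF c[OF f]] unfolding ap[OF f] by (rule restrict_ext) (simp add: inv RP_at[OF f])
  then show ?thesis unfolding RP_restrict[OF f] .
 qed
 have i2: "prodmap J S (prodmap J S' f) = f" if f: "f \<in> carrier (RP J)" for f
 proof -
  have "prodmap J S (prodmap J S' f) = (\<lambda>i\<in>J. f i)"
   unfolding ap[OF c'[OF f]] unfolding ap[OF f] by (rule restrict_ext) (simp add: inv RP_at[OF f])
  then show ?thesis unfolding RP_restrict[OF f] .
 qed
 have "bij_betw (prodmap J S) (carrier (RP J)) (carrier (RP J))"
  by (rule bij_betw_byWitness[where f' = "prodmap J S'"]) (use c c' i1 i2 in auto)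
 then have b: "prodmap J S \<in> Bij (carrier (RP J))" by (simp add: Bij_def prodmap_def)
 have h: "prodmap J S \<in> module_hom K (RP J) (RP J)"
  unfolding module_hom_def
 proof (intro CollectI conjI allI impI)
  show "prodmap J S \<in> carrier (RP J) \<rightarrow> carrier (RP J)" using c by auto
  fix f g assume "f \<in> carrier (RP J) \<and> g \<in> carrier (RP J)"
  then have f: "f \<in> carrier (RP J)" "g \<in> carrier (RP J)" by auto
  show "prodmap J S (f \<oplus>\<^bsub>RP J\<^esub> g) = prodmap J S f \<oplus>\<^bsub>RP J\<^esub> prodmap J S g"
   unfolding ap[OF f(1)] ap[OF f(2)] ap[OF RP_add[OF J f]] unfolding RP_ops
   by (rule restrict_ext) (simp add: Gls_at(2)[OF I S] RP_at[OF f(1)] RP_at[OF f(2)])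
 next
  fix a f assume "a \<in> carrier K \<and> f \<in> carrier (RP J)"
  then have f: "a \<in> carrier K" "f \<in> carrier (RP J)" by auto
  show "prodmap J S (a \<odot>\<^bsub>RP J\<^esub> f) = a \<odot>\<^bsub>RP J\<^esub> prodmap J S f"
   unfolding ap[OF f(2)] ap[OF RP_smult[OF J f]] unfolding RP_ops
   by (rule restrict_ext) (simp add: Gls_at(3)[OF I S] f(1) RP_at[OF f(2)])
 qed
 have IPc: "IP J \<subseteq> carrier (RP J)" by (rule prod_sub_RP[where F = "{}"]) (use J Ac in auto)
 have l1: "W.lat (prodmap J S ` IP J)" unfolding prodmap_image[OF J S0 bad IPc]
  by (rule prod_lat[OF bad J]) (use lattice_kspace.GL_lat(1)[OF L S] in auto)
 have l2: "W.lat (\<Pi>\<^sub>E i\<in>J. S' i ` A i)"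
  by (rule prod_lat[OF bad' J]) (use lattice_kspace.GL_lat(1)[OF L S'] in auto)
 have "prodmap J S ` (\<Pi>\<^sub>E i\<in>J. S' i ` A i) = (\<Pi>\<^sub>E i\<in>J. S i ` S' i ` A i)"
  by (rule prodmap_image[OF J S0 bad W.carrier_lat[OF l2]])
 also have "\<dots> = IP J" by (rule PiE_cong) (simp add: im(2) Ac)
 finally show ?thesis by (rule W.GL_I[OF b h l1 l2])
qed

lemma prodmap_sum:
 assumes J: "J \<subseteq> I" and x: "x \<in> J" and S0: "\<forall>i\<in>J. S i \<in> Gls i" and bad: "finite {i \<in> J. S i ` A i \<noteq> A i}"
  and v: "v \<in> carrier (V x)" and f: "f \<in> carrier (RP (J - {x}))"
 shows "prodmap J S (at_point J x v \<oplus>\<^bsub>RP J\<^esub> off_point J x f) = at_point J x (S x v) \<oplus>\<^bsub>RP J\<^esub> off_point J x (prodmap (J - {x}) S f)"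
proof -
 note S = S0[rule_format]
 have "{i \<in> J - {x}. S i ` A i \<noteq> A i} \<subseteq> {i \<in> J. S i ` A i \<noteq> A i}" by auto
 then have b: "finite {i \<in> J - {x}. S i ` A i \<noteq> A i}" using bad by (rule finite_subset)
 have J': "J - {x} \<subseteq> I" and xI: "x \<in> I" using J x by auto
 have p: "prodmap (J - {x}) S f \<in> carrier (RP (J - {x}))" by (rule prodmap_closed[OF J' _ b f]) (use S0 in auto)
 show ?thesis
  unfolding glue_sum[OF J x v f] glue_sum[OF J x Gls_at(1)[OF xI S[OF x] v] p]
  using f glue_closed[OF J x v f] by (auto simp: prodmap_def glue_def intro!: restrict_ext)
qed

lemma prodmap_commute:
 assumes J: "J \<subseteq> I" and S0: "\<forall>i\<in>J. S i \<in> Gls i" and T0: "\<forall>i\<in>J. T i \<in> Gls i"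
  and bS: "finite {i \<in> J. S i ` A i \<noteq> A i}" and bT: "finite {i \<in> J. T i ` A i \<noteq> A i}"
  and comm0: "\<forall>i\<in>J. compose (carrier (V i)) (S i) (T i) = compose (carrier (V i)) (T i) (S i)"
 shows "compose (carrier (RP J)) (prodmap J S) (prodmap J T) = compose (carrier (RP J)) (prodmap J T) (prodmap J S)"
 unfolding compose_def
proof (rule restrict_ext)
 fix f assume f: "f \<in> carrier (RP J)"
 have ap: "prodmap J S f = (\<lambda>i\<in>J. S i (f i))" if "f \<in> carrier (RP J)" for S f using that by (simp add: prodmap_def)
 have c: "S i (T i (f i)) = T i (S i (f i))" if i: "i \<in> J" for i
  using fun_cong[OF comm0[rule_format, OF i], of "f i"] RP_at[OF f i] by (simp add: compose_def)
 show "prodmap J S (prodmap J T f) = prodmap J T (prodmap J S f)"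
  unfolding ap[OF prodmap_closed[OF J T0 bT f]] ap[OF prodmap_closed[OF J S0 bS f]] unfolding ap[OF f]
  by (rule restrict_ext) (simp add: c)
qed

text \<open>Induction on the exceptional set, by multiplicativity of the signed symbol and its triviality for
stable lattices.\<close>

theorem signed_symbol_prodmap:
 assumes "finite F"
 shows "J \<subseteq> I ==> F \<subseteq> J ==> \<forall>i\<in>J. S i \<in> Gls i ==> \<forall>i\<in>J. T i \<in> Gls i ==>
  \<forall>i\<in>J. compose (carrier (V i)) (S i) (T i) = compose (carrier (V i)) (T i) (S i) ==>
  \<forall>i\<in>J - F. S i ` A i = A i \<and> T i ` A i = A i ==>
  signed_symbol K (RP J) (IP J) (prodmap J S) (prodmap J T) = (\<Otimes>i\<in>F. signed_symbol K (V i) (A i) (S i) (T i))"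
 using assms
proof (induction F arbitrary: J rule: finite_induct)
 case empty
 note J = empty(1) and S = empty(3) and T = empty(4) and comm = empty(5) and st = empty(6)
 have "{i \<in> J. S i ` A i \<noteq> A i} = {}" "{i \<in> J. T i ` A i \<noteq> A i} = {}" using st by auto
 then have b: "finite {i \<in> J. S i ` A i \<noteq> A i}" "finite {i \<in> J. T i ` A i \<noteq> A i}" by (metis finite.emptyI)+
 interpret W: lattice_kspace K "RP J" "IP J" by (rule RP_lattice[OF J])
 have "(\<Pi>\<^sub>E i\<in>J. S i ` A i) = IP J" "(\<Pi>\<^sub>E i\<in>J. T i ` A i) = IP J" by (rule PiE_cong, simp add: st)+
 then have im: "prodmap J S ` IP J = IP J" "prodmap J T ` IP J = IP J"
  using prodmap_image[OF J S b(1) W.Pc] prodmap_image[OF J T b(2) W.Pc] by simp_all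
 show ?case
  using W.signed_symbol_stable[OF prodmap_GL[OF J S b(1)] prodmap_GL[OF J T b(2)] prodmap_commute[OF J S T b comm] im] by simp
next
 case (insert x F)
 note J = insert.prems(1) and S = insert.prems(3) and T = insert.prems(4) and comm = insert.prems(5) and st = insert.prems(6)
 have x: "x \<in> J" and J': "J - {x} \<subseteq> I" and F: "F \<subseteq> J - {x}" and xI: "x \<in> I" using insert.prems(1,2) insert.hyps by auto
 have "{i \<in> J. S i ` A i \<noteq> A i} \<subseteq> insert x F" "{i \<in> J. T i ` A i \<noteq> A i} \<subseteq> insert x F" using st by auto
 then have b: "finite {i \<in> J. S i ` A i \<noteq> A i}" "finite {i \<in> J. T i ` A i \<noteq> A i}"
  using insert.hyps(1) by (auto elim: finite_subset)
 have "{i \<in> J - {x}. S i ` A i \<noteq> A i} \<subseteq> F" "{i \<in> J - {x}. T i ` A i \<noteq> A i} \<subseteq> F" using st by auto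
 then have b': "finite {i \<in> J - {x}. S i ` A i \<noteq> A i}" "finite {i \<in> J - {x}. T i ` A i \<noteq> A i}"
  using insert.hyps(1) by (auto elim: finite_subset)
 have S': "\<forall>i\<in>J - {x}. S i \<in> Gls i" and T': "\<forall>i\<in>J - {x}. T i \<in> Gls i"
  and comm': "\<forall>i\<in>J - {x}. compose (carrier (V i)) (S i) (T i) = compose (carrier (V i)) (T i) (S i)"
  using S T comm by auto
 interpret D: direct_sum_lattices K "V x" "A x" "RP (J - {x})" "IP (J - {x})" "RP J" "IP J" "at_point J x" "off_point J x"
  by (rule split_at[OF J x])
 have sums: "D.is_sum (prodmap J S) (S x) (prodmap (J - {x}) S)" "D.is_sum (prodmap J T) (T x) (prodmap (J - {x}) T)"
  unfolding D.is_sum_def using prodmap_sum[OF J x S b(1)] prodmap_sum[OF J x T b(2)] by blast+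
 have "signed_symbol K (RP J) (IP J) (prodmap J S) (prodmap J T) =
   signed_symbol K (V x) (A x) (S x) (T x) \<otimes> signed_symbol K (RP (J - {x})) (IP (J - {x})) (prodmap (J - {x}) S) (prodmap (J - {x}) T)"
  by (rule D.signed_symbol_direct_sum[OF prodmap_GL[OF J S b(1)] S[rule_format, OF x] prodmap_GL[OF J' S' b'(1)] sums(1)
     prodmap_GL[OF J T b(2)] T[rule_format, OF x] prodmap_GL[OF J' T' b'(2)] sums(2)
     prodmap_commute[OF J S T b comm] comm[rule_format, OF x] prodmap_commute[OF J' S' T' b' comm']])
 also have "signed_symbol K (RP (J - {x})) (IP (J - {x})) (prodmap (J - {x}) S) (prodmap (J - {x}) T) =
   (\<Otimes>i\<in>F. signed_symbol K (V i) (A i) (S i) (T i))"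
  by (rule insert.IH[OF J' F S' T' comm']) (use st in auto)
 also have "signed_symbol K (V x) (A x) (S x) (T x) \<otimes> (\<Otimes>i\<in>F. signed_symbol K (V i) (A i) (S i) (T i)) =
   (\<Otimes>i\<in>insert x F. signed_symbol K (V i) (A i) (S i) (T i))"
 proof (rule K.finprod_insert[symmetric, OF insert.hyps])
  have c: "signed_symbol K (V i) (A i) (S i) (T i) \<in> carrier K" if i: "i \<in> insert x F" for i
  proof -
   have i: "i \<in> J" "i \<in> I" using i insert.prems(1,2) by auto
   show ?thesis by (rule lattice_kspace.signed_symbol_closed[OF lattice[OF i(2)] bspec[OF S i(1)] bspec[OF T i(1)] bspec[OF comm i(1)]])
  qed
  then show "(\<lambda>i. signed_symbol K (V i) (A i) (S i) (T i)) \<in> F \<rightarrow> carrier K" "signed_symbol K (V x) (A x) (S x) (T x) \<in> carrier K" by auto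
 qed
 finally show ?case .
qed

text \<open>Choose in every \<open>A i\<close> a witness against \<open>S i A i \<subseteq> A i\<close>, if there is one. The witnesses form an integral
element, and its image lies in the restricted product; so witnesses exist only for finitely many \<open>i\<close>. For the
opposite inclusion argue in the same way with a preimage.\<close>

lemma prodmap_bad_finite:
 assumes b: "bij_betw (prodmap I S) (carrier (RP I)) (carrier (RP I))"
 shows "finite {i \<in> I. S i ` A i \<noteq> A i}"
proof -
 have IPc: "IP I \<subseteq> carrier (RP I)" by (rule prod_sub_RP[where F = "{}"]) (use at(1) in auto)
 \<comment> \<open>any element of \<open>A i\<close> will do where no witness exists\<close>
 define p where "p i = (SOME v. v \<in> A i \<and> (S i ` A i \<subseteq> A i \<or> S i v \<notin> A i))" for i
 have p: "p i \<in> A i \<and> (S i ` A i \<subseteq> A i \<or> S i (p i) \<notin> A i)" if i: "i \<in> I" for i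
 proof -
  have "\<exists>v. v \<in> A i \<and> (S i ` A i \<subseteq> A i \<or> S i v \<notin> A i)" using at(2)[OF i] by blast
  then show ?thesis unfolding p_def by (rule someI_ex)
 qed
 have pP: "(\<lambda>i\<in>I. p i) \<in> carrier (RP I)" by (rule subsetD[OF IPc]) (simp add: p)
 have "prodmap I S (\<lambda>i\<in>I. p i) \<in> carrier (RP I)" using b pP by (auto simp: bij_betw_def)
 then have "finite {i \<in> I. prodmap I S (\<lambda>i\<in>I. p i) i \<notin> A i}" by (rule RP_finite)
 moreover have "{i \<in> I. \<not> S i ` A i \<subseteq> A i} \<subseteq> {i \<in> I. prodmap I S (\<lambda>i\<in>I. p i) i \<notin> A i}"
  using p pP by (auto simp: prodmap_def)
 ultimately have 1: "finite {i \<in> I. \<not> S i ` A i \<subseteq> A i}" by (rule finite_subset[rotated])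
 define q where "q i = (SOME v. v \<in> A i \<and> (A i \<subseteq> S i ` A i \<or> v \<notin> S i ` A i))" for i
 have q: "q i \<in> A i \<and> (A i \<subseteq> S i ` A i \<or> q i \<notin> S i ` A i)" if i: "i \<in> I" for i
 proof -
  have "\<exists>v. v \<in> A i \<and> (A i \<subseteq> S i ` A i \<or> v \<notin> S i ` A i)" using at(2)[OF i] by blast
  then show ?thesis unfolding q_def by (rule someI_ex)
 qed
 have qP: "(\<lambda>i\<in>I. q i) \<in> carrier (RP I)" by (rule subsetD[OF IPc]) (simp add: q)
 have "(\<lambda>i\<in>I. q i) \<in> prodmap I S ` carrier (RP I)" using b qP by (simp add: bij_betw_def)
 then obtain g where g: "g \<in> carrier (RP I)" "(\<lambda>i\<in>I. q i) = prodmap I S g" by (elim imageE)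
 have "q i = S i (g i)" if "i \<in> I" for i using fun_cong[OF g(2), of i] g(1) that by (simp add: prodmap_def)
 then have "{i \<in> I. \<not> A i \<subseteq> S i ` A i} \<subseteq> {i \<in> I. g i \<notin> A i}" using q by auto
 then have 2: "finite {i \<in> I. \<not> A i \<subseteq> S i ` A i}" using RP_finite[OF g(1)] by (rule finite_subset)
 have "{i \<in> I. S i ` A i \<noteq> A i} \<subseteq> {i \<in> I. \<not> S i ` A i \<subseteq> A i} \<union> {i \<in> I. \<not> A i \<subseteq> S i ` A i}" by auto
 then show ?thesis using 1 2 by (meson finite_UnI finite_subset)
qed

text \<open>Test the commutation on elements supported at one index.\<close>

lemma prodmap_commute_at:
 assumes S: "\<forall>i\<in>I. S i \<in> Gls i" and T: "\<forall>i\<in>I. T i \<in> Gls i"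
  and bS: "finite {i \<in> I. S i ` A i \<noteq> A i}" and bT: "finite {i \<in> I. T i ` A i \<noteq> A i}"
  and comm: "compose (carrier (RP I)) (prodmap I S) (prodmap I T) = compose (carrier (RP I)) (prodmap I T) (prodmap I S)"
  and x: "x \<in> I"
 shows "compose (carrier (V x)) (S x) (T x) = compose (carrier (V x)) (T x) (S x)"
 unfolding compose_def
proof (rule restrict_ext)
 fix v assume v: "v \<in> carrier (V x)"
 let ?f = "at_point I x v"
 have f: "?f \<in> carrier (RP I)" by (rule at_point_closed[OF subset_refl x v])
 have fx: "?f x = v" using x by (simp add: at_point_def)
 have ap: "prodmap I S f x = S x (f x)" if "f \<in> carrier (RP I)" for S f using that x by (simp add: prodmap_def)
 have "prodmap I S (prodmap I T ?f) = prodmap I T (prodmap I S ?f)"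
  using fun_cong[OF comm, of ?f] f by (simp add: compose_def)
 from fun_cong[OF this, of x] show "S x (T x v) = T x (S x v)"
  unfolding ap[OF prodmap_closed[OF subset_refl T bT f]] ap[OF prodmap_closed[OF subset_refl S bS f]] ap[OF f] fx .
qed

end

section \<open>Commutators of adelic automorphisms\<close>

theorem theorem3p12:
  fixes K :: "'k ring"
    and C :: "('k, 'p, 'a) rspace"
    and S T :: "('p, 'a) local_maps"
  assumes "perfect_field K"
    and "proper_nonsingular_curve K C"
    and "alg_closed_in_function_field K C"
    and "\<And>x. x \<in> closed_points C \<Longrightarrow> S x \<in> carrier (Gl K (local_field C x) (local_ints C x))"
    and "\<And>x. x \<in> closed_points C \<Longrightarrow> T x \<in> carrier (Gl K (local_field C x) (local_ints C x))"
    and "adelic_prod C S \<in> Gl0 K (adeles C) (integral_adeles C)"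
    and "adelic_prod C T \<in> Gl0 K (adeles C) (integral_adeles C)"
    and "adelic_prod C S \<otimes>\<^bsub>Gl K (adeles C) (integral_adeles C)\<^esub> adelic_prod C T =
         adelic_prod C T \<otimes>\<^bsub>Gl K (adeles C) (integral_adeles C)\<^esub> adelic_prod C S"
  shows "finite {x \<in> closed_points C. local_symbol K C S T x \<noteq> \<one>\<^bsub>K\<^esub>} \<and>
         finite {x \<in> closed_points C. local_factor K C S T x \<noteq> \<one>\<^bsub>K\<^esub>} \<and>
         commutator_symbol K (adeles C) (integral_adeles C) (adelic_prod C S) (adelic_prod C T) =
           (\<Otimes>\<^bsub>K\<^esub>x\<in>{x \<in> closed_points C. local_factor K C S T x \<noteq> \<one>\<^bsub>K\<^esub>}. local_factor K C S T x)"
proof -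
 define I where "I = closed_points C"
 have K: "field K" using assms(1) by (simp add: perfect_field_def)
 have C: "scheme_over K C" using assms(2) by (simp add: proper_nonsingular_curve_def)
 interpret lattice_family K I "local_field C" "local_ints C"
  by (rule lattice_family.intro[OF K], rule local_lattice[OF K C]) (simp add: I_def closed_points_def)
 have ad: "adeles C = RP I" "integral_adeles C = IP I" "!!S. adelic_prod C S = prodmap I S"
  by (simp_all add: adeles_def integral_adeles_def adelic_prod_def prodmap_def I_def)
 have S: "\<forall>i\<in>I. S i \<in> Gls i" and T: "\<forall>i\<in>I. T i \<in> Gls i" using assms(4,5) by (simp_all add: I_def)
 interpret W: lattice_kspace K "RP I" "IP I" by (rule RP_lattice[OF subset_refl])
 have GL: "prodmap I S \<in> W.GL" "prodmap I T \<in> W.GL" and w: "winding K (RP I) (IP I) (prodmap I S) = 0" "winding K (RP I) (IP I) (prodmap I T) = 0"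
  using assms(6,7) unfolding ad by (simp_all add: Gl0_def)
 have comm: "compose (carrier (RP I)) (prodmap I S) (prodmap I T) = compose (carrier (RP I)) (prodmap I T) (prodmap I S)"
  using assms(8) unfolding ad W.GL_mult[OF GL] W.GL_mult[OF GL(2,1)] .
 have b: "finite {i \<in> I. S i ` local_ints C i \<noteq> local_ints C i}" "finite {i \<in> I. T i ` local_ints C i \<noteq> local_ints C i}"
  using prodmap_bad_finite[OF W.GL_D(3)[OF GL(1)]] prodmap_bad_finite[OF W.GL_D(3)[OF GL(2)]] by simp_all
 have lc: "\<forall>i\<in>I. compose (carrier (local_field C i)) (S i) (T i) = compose (carrier (local_field C i)) (T i) (S i)"
  using prodmap_commute_at[OF S T b comm] by (rule ballI)
 define F where "F = {i \<in> I. S i ` local_ints C i \<noteq> local_ints C i} \<union> {i \<in> I. T i ` local_ints C i \<noteq> local_ints C i}"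
 have F: "finite F" "F \<subseteq> I" using b by (auto simp: F_def)
 have st: "S i ` local_ints C i = local_ints C i \<and> T i ` local_ints C i = local_ints C i" if "i \<in> I - F" for i
  using that by (auto simp: F_def)
 then have st': "\<forall>i\<in>I - F. S i ` local_ints C i = local_ints C i \<and> T i ` local_ints C i = local_ints C i" by blast
 have lf: "local_factor K C S T i = signed_symbol K (local_field C i) (local_ints C i) (S i) (T i)" for i
  by (simp add: local_factor_def signed_symbol_def local_winding_def local_symbol_def)
 have lf1: "local_factor K C S T i = \<one>\<^bsub>K\<^esub>" "local_symbol K C S T i = \<one>\<^bsub>K\<^esub>" if i: "i \<in> I - F" for i
 proof -
  have iI: "i \<in> I" using i by auto
  show "local_factor K C S T i = \<one>\<^bsub>K\<^esub>" unfolding lf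
   by (rule lattice_kspace.signed_symbol_stable[OF lattice[OF iI] bspec[OF S iI] bspec[OF T iI] bspec[OF lc iI]]) (use st[OF i] in auto)
  show "local_symbol K C S T i = \<one>\<^bsub>K\<^esub>" unfolding local_symbol_def
   by (rule lattice_kspace.symbol_stable[OF lattice[OF iI] bspec[OF S iI] bspec[OF T iI] bspec[OF lc iI]]) (use st[OF i] in auto)
 qed
 have lfc: "local_factor K C S T i \<in> carrier K" if iI: "i \<in> I" for i
  unfolding lf by (rule lattice_kspace.signed_symbol_closed[OF lattice[OF iI] bspec[OF S iI] bspec[OF T iI] bspec[OF lc iI]])
 have sub: "{x \<in> I. local_symbol K C S T x \<noteq> \<one>\<^bsub>K\<^esub>} \<subseteq> F" "{x \<in> I. local_factor K C S T x \<noteq> \<one>\<^bsub>K\<^esub>} \<subseteq> F" using lf1 by auto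
 have "commutator_symbol K (RP I) (IP I) (prodmap I S) (prodmap I T) = signed_symbol K (RP I) (IP I) (prodmap I S) (prodmap I T)"
  unfolding signed_symbol_def w using W.symbol_closed[OF GL comm] by simp
 also have "\<dots> = (\<Otimes>\<^bsub>K\<^esub>i\<in>F. local_factor K C S T i)"
  unfolding lf by (rule signed_symbol_prodmap[OF F(1) subset_refl F(2) S T lc st'])
 also have "\<dots> = (\<Otimes>\<^bsub>K\<^esub>x\<in>{x \<in> I. local_factor K C S T x \<noteq> \<one>\<^bsub>K\<^esub>}. local_factor K C S T x)"
  by (rule K.finprod_mono_neutral_cong_right[OF F(1) sub(2)]) (use F(2) lfc in auto)
 finally show ?thesis unfolding ad I_def[symmetric] using sub[THEN finite_subset, OF F(1)] by simp
qed

end
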